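(* Let $K$ be any field. Let $A$ be a unital $K$-algebra which is Morita equivalent to a Leavitt path algebra $L_K(E)$ of a finite graph $E$. Then $A$ is isomorphic, as a $K$-algebra, to a Leavitt path algebra $L_K(G)$ of some finite graph $G$.
   Context: A (directed) graph $E=(E^0,E^1,s,r)$ consists of disjoint sets $E^0$ (vertices) and $E^1$ (edges) and maps $s,r:E^1\to E^0$. It is finite if $E^0$ and $E^1$ are finite; the vertex set is nonempty. A vertex $v$ is a sink if $s^{-1}(v)=\emptyset$; in a finite graph, a vertex is regular if it is not a sink. The Leavitt path algebra $L_K(E)$ is the $K$-algebra generated by $E^0\cup E^1\cup\{e^*\mid e\in E^1\}$ subject to, for all $v,w\in E^0$ and $e,f\in E^1$: (1) $vw=\delta_{v,w}w$; (2) $s(e)e=e=er(e)$ and $r(e)e^*=e^*=e^*s(e)$; (3) $e^*f=\delta_{e,f}r(e)$; (4) $v=\sum_{e\in s^{-1}(v)}ee^*$ for every regular vertex $v$. For finite $E$ it is unital with identity $\sum_{v\in E^0}v$. Morita equivalence of unital $K$-algebras $A$ and $B$ means that there is a $K$-linear equivalence between their categories of left modules; equivalently, there are a positive integer $n$ and a full idempotent $f\in M_n(B)$ (i.e. $M_n(B)=M_n(B)fM_n(B)$) with $A\cong fM_n(B)f$ as $K$-algebras. *)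

theory Defs
  imports "Graph_Theory.Digraph" "HOL-Algebra.QuotRing" "HOL-Algebra.Module"
begin

section \<open>Unital associative algebras over a commutative ring\<close>

text \<open>The library locale \<^locale>\<open>algebra\<close> is confined to commutative algebras.\<close>

locale unital_algebra = module K A + A: ring A for K (structure) and A (structure) +
  assumes smult_mult_left:
    "\<lbrakk>a \<in> carrier K; x \<in> carrier A; y \<in> carrier A\<rbrakk>
      \<Longrightarrow> (a \<odot>\<^bsub>A\<^esub> x) \<otimes>\<^bsub>A\<^esub> y = a \<odot>\<^bsub>A\<^esub> (x \<otimes>\<^bsub>A\<^esub> y)"
    and smult_mult_right:
    "\<lbrakk>a \<in> carrier K; x \<in> carrier A; y \<in> carrier A\<rbrakk>
      \<Longrightarrow> x \<otimes>\<^bsub>A\<^esub> (a \<odot>\<^bsub>A\<^esub> y) = a \<odot>\<^bsub>A\<^esub> (x \<otimes>\<^bsub>A\<^esub> y)"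

definition alg_iso :: "[('k, 'r) ring_scheme, ('k, 'a, 'm) module_scheme, ('k, 'b, 'n) module_scheme]
    \<Rightarrow> ('a \<Rightarrow> 'b) set"
  where "alg_iso K A B =
    {\<phi> \<in> ring_iso A B. \<forall>a\<in>carrier K. \<forall>x\<in>carrier A. \<phi> (a \<odot>\<^bsub>A\<^esub> x) = a \<odot>\<^bsub>B\<^esub> \<phi> x}"

definition is_alg_iso :: "[('k, 'r) ring_scheme, ('k, 'a, 'm) module_scheme, ('k, 'b, 'n) module_scheme]
    \<Rightarrow> bool"
  where "is_alg_iso K A B \<longleftrightarrow> alg_iso K A B \<noteq> {}"


section \<open>Matrix algebras, corners and Morita equivalence\<close>

definition matrix_algebra :: "[nat, ('k, 'b, 'n) module_scheme] \<Rightarrow> ('k, nat \<times> nat \<Rightarrow> 'b) module"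
  where "matrix_algebra n B =
    \<lparr>carrier = {..<n} \<times> {..<n} \<rightarrow>\<^sub>E carrier B,
     mult = (\<lambda>M N. restrict (\<lambda>(i, j). \<Oplus>\<^bsub>B\<^esub>k\<in>{..<n}. M (i, k) \<otimes>\<^bsub>B\<^esub> N (k, j)) ({..<n} \<times> {..<n})),
     one = restrict (\<lambda>(i, j). if i = j then \<one>\<^bsub>B\<^esub> else \<zero>\<^bsub>B\<^esub>) ({..<n} \<times> {..<n}),
     zero = (\<lambda>_\<in>{..<n} \<times> {..<n}. \<zero>\<^bsub>B\<^esub>),
     add = (\<lambda>M N. \<lambda>p\<in>{..<n} \<times> {..<n}. M p \<oplus>\<^bsub>B\<^esub> N p),
     smult = (\<lambda>a M. \<lambda>p\<in>{..<n} \<times> {..<n}. a \<odot>\<^bsub>B\<^esub> M p)\<rparr>"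

definition full_idempotent :: "[('a, 'r) ring_scheme, 'a] \<Rightarrow> bool"
  where "full_idempotent R f \<longleftrightarrow>
    f \<in> carrier R \<and> f \<otimes>\<^bsub>R\<^esub> f = f \<and>
    carrier R = {\<Oplus>\<^bsub>R\<^esub>i\<in>{..<m}. x i \<otimes>\<^bsub>R\<^esub> f \<otimes>\<^bsub>R\<^esub> y i | (m::nat) x y.
      x \<in> {..<m} \<rightarrow> carrier R \<and> y \<in> {..<m} \<rightarrow> carrier R}"

definition corner :: "[('k, 'a, 'm) module_scheme, 'a] \<Rightarrow> ('k, 'a, 'm) module_scheme"
  where "corner R f =
    R\<lparr>carrier := {f \<otimes>\<^bsub>R\<^esub> x \<otimes>\<^bsub>R\<^esub> f | x. x \<in> carrier R}, one := f\<rparr>"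

text \<open>
  Categories of all left modules cannot be quantified over within one HOL type, so Morita
  equivalence of unital \<open>K\<close>-algebras is defined by \<open>A \<cong> f M\<^sub>n(B) f\<close> for a full idempotent \<open>f\<close>.
\<close>

definition morita_equivalent ::
    "[('k, 'r) ring_scheme, ('k, 'a, 'm) module_scheme, ('k, 'b, 'n) module_scheme] \<Rightarrow> bool"
  where "morita_equivalent K A B \<longleftrightarrow>
    (\<exists>n>0. \<exists>f. full_idempotent (matrix_algebra n B) f \<and>
      is_alg_iso K A (corner (matrix_algebra n B) f))"


section \<open>Free algebras\<close>

text \<open>
  \<open>free_algebra K X\<close> is the free unital \<open>K\<close>-algebra on \<open>X\<close>: finitely supported
  coefficient functions on the words over \<open>X\<close>, with the convolution product.
\<close>

definition free_algebra :: "[('k, 'r) ring_scheme, 'x set] \<Rightarrow> ('k, 'x list \<Rightarrow> 'k) module"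
  where "free_algebra K X =
    \<lparr>carrier = {p. range p \<subseteq> carrier K \<and> {w. p w \<noteq> \<zero>\<^bsub>K\<^esub>} \<subseteq> lists X \<and> finite {w. p w \<noteq> \<zero>\<^bsub>K\<^esub>}},
     mult = (\<lambda>p q w. \<Oplus>\<^bsub>K\<^esub>i\<in>{..length w}. p (take i w) \<otimes>\<^bsub>K\<^esub> q (drop i w)),
     one = (\<lambda>w. if w = [] then \<one>\<^bsub>K\<^esub> else \<zero>\<^bsub>K\<^esub>),
     zero = (\<lambda>_. \<zero>\<^bsub>K\<^esub>),
     add = (\<lambda>p q w. p w \<oplus>\<^bsub>K\<^esub> q w),
     smult = (\<lambda>a p w. a \<otimes>\<^bsub>K\<^esub> p w)\<rparr>"

definition word :: "[('k, 'r) ring_scheme, 'x list] \<Rightarrow> 'x list \<Rightarrow> 'k"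
  where "word K u = (\<lambda>w. if w = u then \<one>\<^bsub>K\<^esub> else \<zero>\<^bsub>K\<^esub>)"


section \<open>Leavitt path algebras\<close>

text \<open>
  A graph \<open>E = (E\<^sup>0, E\<^sup>1, s, r)\<close> is a digraph with \<open>E\<^sup>0 = verts E\<close>, \<open>E\<^sup>1 = arcs E\<close>, \<open>s = tail E\<close>,
  \<open>r = head E\<close>; \<^locale>\<open>fin_digraph\<close> allows loops and parallel arcs, and also the null graph.
\<close>

definition finite_graph :: "('v, 'e) pre_digraph \<Rightarrow> bool"
  where "finite_graph E \<longleftrightarrow> fin_digraph E \<and> verts E \<noteq> {}"

datatype ('v, 'e) generator = Vertex 'v | Edge 'e | Ghost 'e

definition generators :: "('v, 'e) pre_digraph \<Rightarrow> ('v, 'e) generator set"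
  where "generators E = Vertex ` verts E \<union> Edge ` arcs E \<union> Ghost ` arcs E"

definition path_relators ::
    "[('k, 'r) ring_scheme, ('v, 'e) pre_digraph] \<Rightarrow> (('v, 'e) generator list \<Rightarrow> 'k) set"
  where "path_relators K E = (let F = free_algebra K (generators E) in
      {word K [Vertex v, Vertex w] \<ominus>\<^bsub>F\<^esub> (if v = w then word K [Vertex w] else \<zero>\<^bsub>F\<^esub>)
        | v w. v \<in> verts E \<and> w \<in> verts E}
    \<union> {word K [Vertex (tail E e), Edge e] \<ominus>\<^bsub>F\<^esub> word K [Edge e] | e. e \<in> arcs E}
    \<union> {word K [Edge e, Vertex (head E e)] \<ominus>\<^bsub>F\<^esub> word K [Edge e] | e. e \<in> arcs E}
    \<union> {word K [Vertex (head E e), Ghost e] \<ominus>\<^bsub>F\<^esub> word K [Ghost e] | e. e \<in> arcs E}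
    \<union> {word K [Ghost e, Vertex (tail E e)] \<ominus>\<^bsub>F\<^esub> word K [Ghost e] | e. e \<in> arcs E}
    \<union> {word K [Ghost e, Edge f] \<ominus>\<^bsub>F\<^esub> (if e = f then word K [Vertex (head E e)] else \<zero>\<^bsub>F\<^esub>)
        | e f. e \<in> arcs E \<and> f \<in> arcs E}
    \<union> {word K [Vertex v] \<ominus>\<^bsub>F\<^esub> (\<Oplus>\<^bsub>F\<^esub>e\<in>out_arcs E v. word K [Edge e, Ghost e])
        | v. v \<in> verts E \<and> out_arcs E v \<noteq> {}})"

text \<open>
  \<open>L\<^sub>K(E)\<close> is presented as an algebra without a prescribed identity, so it is \<open>F\<^sub>+/I\<close>, where \<open>F\<^sub>+\<close>
  consists of the elements of the free unital algebra \<open>F\<close> with vanishing coefficient at the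
  empty word, and \<open>I\<close> is the ideal generated by the relators; as \<open>I \<subseteq> F\<^sub>+\<close>
  and \<open>F = K1 + F\<^sub>+\<close>, generating the ideal in \<open>F\<close> or in \<open>F\<^sub>+\<close> gives the same \<open>I\<close>. The field
  \<^const>\<open>one\<close> is the class of the sum of all vertices, which is the identity for finite \<open>E\<close>
  (and is meaningful only in that case).
\<close>

definition leavitt_path_algebra ::
    "[('k, 'r) ring_scheme, ('v, 'e) pre_digraph] \<Rightarrow> ('k, (('v, 'e) generator list \<Rightarrow> 'k) set) module"
  where "leavitt_path_algebra K E =
    (let F = free_algebra K (generators E); I = Idl\<^bsub>F\<^esub> (path_relators K E) in
    \<lparr>carrier = {I +>\<^bsub>F\<^esub> p | p. p \<in> carrier F \<and> p [] = \<zero>\<^bsub>K\<^esub>},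
     mult = mult (F Quot I),
     one = I +>\<^bsub>F\<^esub> (\<Oplus>\<^bsub>F\<^esub>v\<in>verts E. word K [Vertex v]),
     zero = zero (F Quot I),
     add = add (F Quot I),
     smult = (\<lambda>a C. \<Union>p\<in>C. I +>\<^bsub>F\<^esub> (a \<odot>\<^bsub>F\<^esub> p))\<rparr>)"

end

theory Submission
  imports Defs "Graph_Theory.Arc_Walk" "HOL-Library.Sublist" "HOL-Library.Countable_Set"
begin

text \<open>
  The proof works inside one fixed algebra, in which graphs are
  represented by elements: a system for \<open>E\<close> in \<open>A\<close> is a family of elements of \<open>A\<close> that satisfies
  the defining relations of the Leavitt path algebra, whose paths are linearly independent, and
  whose products \<open>\<mu>\<nu>\<^sup>*\<close> span every \<open>p\<^sub>u A p\<^sub>w\<close>. By \<open>leavitt_system_corner_iso\<close> a system identifies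
  \<open>L\<^sub>K(E)\<close> with the corner of \<open>A\<close> at the sum of its vertices. So it is enough to find, inside
  \<open>M\<^sub>n(L\<^sub>K(E))\<close>, a system for some finite graph whose vertices add up to the given full
  idempotent \<open>f\<close>.

  The link between idempotents and graphs is a frame of \<open>f\<close>: elements \<open>x\<^sub>k\<close>, \<open>y\<^sub>k\<close> with
  \<open>y\<^sub>k x\<^sub>l = \<delta>\<^sub>k\<^sub>l p\<^bsub>\<nu> k\<^esub>\<close> and \<open>\<Sum>x\<^sub>k y\<^sub>k = f\<close>, that is, an explicit isomorphism of the right ideal \<open>f A\<close>
  with a direct sum of the ideals \<open>p\<^bsub>\<nu> k\<^esub> A\<close>. Three facts carry the proof.

  Every idempotent has a frame (\<open>frame_of_idempotent\<close>). Here \<open>f A\<close> is generated by finitely many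
  linear combinations of paths, because any element becomes such a combination after right
  multiplication by long paths. Order the paths compatibly with multiplication on the right.
  If the leading path of one generator is an initial segment of the leading path of another
  one, subtract a multiple of the former from the latter and lower the leading path. When no leading
  path is an initial segment of another, the generators are independent, and this forces the
  relations of a frame.

  If every vertex occurs in a frame of \<open>f\<close>, then \<open>f\<close> is the sum of the vertices of another graph
  (\<open>system_of_full_frame\<close>): for every further occurrence of a vertex \<open>v\<close> attach a new vertex with
  a single edge to \<open>v\<close>.

  Any nonempty frame can be made to have this property by changing the graph
  (\<open>reduce_to_full_frame\<close>). A summand at a regular vertex may be replaced by summands at the ends of
  its edges. A regular vertex without loop is removed from the frame in this way, and then from
  the graph, the paths of length two through it becoming edges. Once all regular vertices have loops,
  the replacement only enlarges the set of vertices that occur, so in a frame with as many vertices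
  as possible this set is closed under following edges, and the graph may be restricted to it.

  The first system, in the Leavitt path algebra itself, requires that distinct paths are linearly
  independent there. This is read off from a representation on a function space
  (\<open>canonical_system\<close>). In the matrix algebra the upper left corner carries the same graph, and
  the identity matrix has a frame in which every vertex occurs (\<open>matrix_system\<close>); the second
  fact then makes the sum of the vertices equal to the identity, as the first fact requires.
  Fullness of \<open>f\<close> ensures \<open>f \<noteq> 0\<close>, so that its frame is nonempty.
\<close>

section \<open>Finite sums\<close>

context abelian_monoid begin

lemma finsum_Sigma:
  assumes "finite I" and "\<And>i. i \<in> I \<Longrightarrow> finite (B i)"
    and "\<And>i j. i \<in> I \<Longrightarrow> j \<in> B i \<Longrightarrow> f (i, j) \<in> carrier G"
  shows "(\<Oplus>p\<in>Sigma I B. f p) = (\<Oplus>i\<in>I. \<Oplus>j\<in>B i. f (i, j))"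
proof -
  have "(\<Oplus>p\<in>Sigma I B. f p) = (\<Oplus>p\<in>(\<Union>i\<in>I. Pair i ` B i). f p)"
    by (rule arg_cong[where f = "finsum G f"]) auto
  also have "\<dots> = (\<Oplus>i\<in>I. \<Oplus>p\<in>Pair i ` B i. f p)"
    using assms by (intro add.finprod_UN_disjoint) (auto simp: pairwise_def disjnt_def)
  also have "\<dots> = (\<Oplus>i\<in>I. \<Oplus>j\<in>B i. f (i, j))"
  proof (rule finsum_cong')
    fix i assume i: "i \<in> I"
    then have "f \<in> Pair i ` B i \<rightarrow> carrier G" using assms by auto
    then show "(\<Oplus>p\<in>Pair i ` B i. f p) = (\<Oplus>j\<in>B i. f (i, j))"
      by (subst finsum_reindex) (auto simp: inj_on_def)
  qed (use assms in \<open>auto intro!: finsum_closed\<close>)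
  finally show ?thesis .
qed

lemma finsum_swap:
  assumes "finite I" "finite J" and "\<And>i j. i \<in> I \<Longrightarrow> j \<in> J \<Longrightarrow> f i j \<in> carrier G"
  shows "(\<Oplus>i\<in>I. \<Oplus>j\<in>J. f i j) = (\<Oplus>j\<in>J. \<Oplus>i\<in>I. f i j)"
proof -
  have "(\<Oplus>i\<in>I. \<Oplus>j\<in>J. f i j) = (\<Oplus>p\<in>I \<times> J. case p of (i, j) \<Rightarrow> f i j)"
    using assms by (subst finsum_Sigma) auto
  also have "I \<times> J = prod.swap ` (J \<times> I)"
    by auto
  also have "(\<Oplus>p\<in>prod.swap ` (J \<times> I). case p of (i, j) \<Rightarrow> f i j)
      = (\<Oplus>p\<in>J \<times> I. case p of (j, i) \<Rightarrow> f i j)"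
    using assms by (subst finsum_reindex) (auto simp: prod.swap_def case_prod_unfold intro!: finsum_cong')
  also have "\<dots> = (\<Oplus>j\<in>J. \<Oplus>i\<in>I. f i j)"
    using assms by (subst finsum_Sigma) auto
  finally show ?thesis .
qed

lemma finsum_only:
  assumes "finite A" "i \<in> A" "f i \<in> carrier G"
    and "\<And>j. j \<in> A \<Longrightarrow> j \<noteq> i \<Longrightarrow> f j = \<zero>"
  shows "(\<Oplus>j\<in>A. f j) = f i"
proof -
  have "(\<Oplus>j\<in>{i}. f j) = (\<Oplus>j\<in>A. f j)"
    using assms by (intro add.finprod_mono_neutral_cong_left) (auto simp: Pi_def, metis assms(3,4) zero_closed)
  then show ?thesis using assms by simp
qed

lemma finsum_neutral:
  assumes "\<And>j. j \<in> A \<Longrightarrow> f j = \<zero>"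
  shows "(\<Oplus>j\<in>A. f j) = \<zero>"
  using assms by (rule add.finprod_one_eqI)

lemma finsum_closed':
  assumes "\<And>i. i \<in> A \<Longrightarrow> f i \<in> carrier G"
  shows "(\<Oplus>i\<in>A. f i) \<in> carrier G"
  using assms by (intro finsum_closed) auto

end

section \<open>Linear spans and linear independence in algebras\<close>

lemma (in module) finsum_smult_rdistr:
  assumes "finite I" "\<And>i. i \<in> I \<Longrightarrow> c i \<in> carrier R" "x \<in> carrier M"
  shows "(\<Oplus>i\<in>I. c i) \<odot>\<^bsub>M\<^esub> x = (\<Oplus>\<^bsub>M\<^esub>i\<in>I. c i \<odot>\<^bsub>M\<^esub> x)"
  using assms
proof (induct I)
  case (insert i I)
  then have "c \<in> I \<rightarrow> carrier R" by auto
  then show ?case using insert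
    by (simp add: Pi_def smult_l_distr)
qed auto

context unital_algebra begin

inductive_set lin :: "'c set \<Rightarrow> 'c set" for S where
  lin_zero: "\<zero>\<^bsub>A\<^esub> \<in> lin S"
| lin_step: "\<lbrakk>c \<in> carrier K; s \<in> S; x \<in> lin S\<rbrakk> \<Longrightarrow> c \<odot>\<^bsub>A\<^esub> s \<oplus>\<^bsub>A\<^esub> x \<in> lin S"

lemma lin_closed:
  assumes "S \<subseteq> carrier A" "x \<in> lin S"
  shows "x \<in> carrier A"
  using assms(2,1) by induct auto

lemma lin_add:
  assumes "S \<subseteq> carrier A" "x \<in> lin S" "y \<in> lin S"
  shows "x \<oplus>\<^bsub>A\<^esub> y \<in> lin S"
  using assms(2)
proof induct
  case lin_zero
  then show ?case using assms lin_closed by simp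
next
  case (lin_step c s x)
  then have "c \<odot>\<^bsub>A\<^esub> s \<oplus>\<^bsub>A\<^esub> (x \<oplus>\<^bsub>A\<^esub> y) \<in> lin S" by (intro lin.lin_step)
  moreover have "s \<in> carrier A" "x \<in> carrier A" "y \<in> carrier A"
    using lin_step assms lin_closed by auto
  ultimately show ?case using lin_step by (simp add: M.a_assoc)
qed

lemma lin_base: "S \<subseteq> carrier A \<Longrightarrow> s \<in> S \<Longrightarrow> s \<in> lin S"
  using lin_step[of \<one> s S "\<zero>\<^bsub>A\<^esub>"] lin_zero by auto

text \<open>Every inclusion of spans below is obtained by checking generators along a linear map.\<close>

lemma lin_map:
  assumes S: "S \<subseteq> carrier A" and S': "S' \<subseteq> carrier A"
    and x: "x \<in> lin S"
    and zero: "h \<zero>\<^bsub>A\<^esub> = \<zero>\<^bsub>A\<^esub>"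
    and add: "\<And>u v. u \<in> carrier A \<Longrightarrow> v \<in> carrier A \<Longrightarrow> h (u \<oplus>\<^bsub>A\<^esub> v) = h u \<oplus>\<^bsub>A\<^esub> h v"
    and smult: "\<And>c u. c \<in> carrier K \<Longrightarrow> u \<in> carrier A \<Longrightarrow> h (c \<odot>\<^bsub>A\<^esub> u) = c \<odot>\<^bsub>A\<^esub> h u"
    and gen: "\<And>s. s \<in> S \<Longrightarrow> h s \<in> lin S'"
  shows "h x \<in> lin S'"
proof -
  have sm: "c \<odot>\<^bsub>A\<^esub> y \<in> lin S'" if "c \<in> carrier K" "y \<in> lin S'" for c y
    using that(2)
  proof induct
    case lin_zero
    then show ?case using that by (simp add: lin.lin_zero)
  next
    case (lin_step d s y)
    then have "(c \<otimes> d) \<odot>\<^bsub>A\<^esub> s \<oplus>\<^bsub>A\<^esub> c \<odot>\<^bsub>A\<^esub> y \<in> lin S'"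
      using that by (intro lin.lin_step) auto
    moreover have "s \<in> carrier A" "y \<in> carrier A" using lin_step S' lin_closed by auto
    ultimately show ?case using lin_step that by (simp add: smult_r_distr smult_assoc1)
  qed
  show ?thesis using x
  proof induct
    case lin_zero
    then show ?case by (simp add: zero lin.lin_zero)
  next
    case (lin_step c s x)
    then have "h (c \<odot>\<^bsub>A\<^esub> s \<oplus>\<^bsub>A\<^esub> x) = c \<odot>\<^bsub>A\<^esub> h s \<oplus>\<^bsub>A\<^esub> h x"
      using S lin_closed by (simp add: add smult subsetD)
    then show ?case using lin_step sm gen S' by (simp add: lin_add)
  qed
qed

lemma lin_smult:
  assumes "S \<subseteq> carrier A" "c \<in> carrier K" "x \<in> lin S"
  shows "c \<odot>\<^bsub>A\<^esub> x \<in> lin S"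
proof (rule lin_map[OF assms(1,1,3)])
  fix s assume "s \<in> S"
  then have "c \<odot>\<^bsub>A\<^esub> s \<oplus>\<^bsub>A\<^esub> \<zero>\<^bsub>A\<^esub> \<in> lin S" using assms lin_zero lin_step by blast
  then show "c \<odot>\<^bsub>A\<^esub> s \<in> lin S" using \<open>s \<in> S\<close> assms by auto
next
  fix c' u assume "c' \<in> carrier K" "u \<in> carrier A"
  then show "c \<odot>\<^bsub>A\<^esub> (c' \<odot>\<^bsub>A\<^esub> u) = c' \<odot>\<^bsub>A\<^esub> (c \<odot>\<^bsub>A\<^esub> u)"
    using assms by (simp add: smult_assoc1[symmetric] m_comm)
qed (use assms in \<open>auto simp: smult_r_distr\<close>)

lemma lin_finsum:
  assumes "S \<subseteq> carrier A" "finite I" "\<And>i. i \<in> I \<Longrightarrow> x i \<in> lin S"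
  shows "(\<Oplus>\<^bsub>A\<^esub>i\<in>I. x i) \<in> lin S"
  using assms(2,3)
proof (induct I)
  case (insert i I)
  then have "x \<in> I \<rightarrow> carrier A" "x i \<in> carrier A" using assms lin_closed by auto
  then show ?case using insert assms(1) by (simp add: lin_add)
qed (simp add: lin_zero)

lemma lin_sandwich:
  assumes "S \<subseteq> carrier A" "S' \<subseteq> carrier A" "b \<in> carrier A" "c \<in> carrier A" "x \<in> lin S"
    and "\<And>s. s \<in> S \<Longrightarrow> b \<otimes>\<^bsub>A\<^esub> s \<otimes>\<^bsub>A\<^esub> c \<in> lin S'"
  shows "b \<otimes>\<^bsub>A\<^esub> x \<otimes>\<^bsub>A\<^esub> c \<in> lin S'"
  using assms(5,6)
  by (intro lin_map[OF assms(1,2), of x "\<lambda>x. b \<otimes>\<^bsub>A\<^esub> x \<otimes>\<^bsub>A\<^esub> c"])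
    (use assms in \<open>auto simp: A.r_distr A.l_distr smult_mult_left smult_mult_right\<close>)

lemma lin_mult_right:
  assumes "S \<subseteq> carrier A" "S' \<subseteq> carrier A" "c \<in> carrier A" "x \<in> lin S"
    and "\<And>s. s \<in> S \<Longrightarrow> s \<otimes>\<^bsub>A\<^esub> c \<in> lin S'"
  shows "x \<otimes>\<^bsub>A\<^esub> c \<in> lin S'"
  using assms(4,5)
  by (intro lin_map[OF assms(1,2), of x "\<lambda>x. x \<otimes>\<^bsub>A\<^esub> c"])
    (use assms in \<open>auto simp: A.l_distr smult_mult_left\<close>)

lemma lin_mult_left:
  assumes "S \<subseteq> carrier A" "S' \<subseteq> carrier A" "c \<in> carrier A" "x \<in> lin S"
    and "\<And>s. s \<in> S \<Longrightarrow> c \<otimes>\<^bsub>A\<^esub> s \<in> lin S'"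
  shows "c \<otimes>\<^bsub>A\<^esub> x \<in> lin S'"
  using assms(4,5)
  by (intro lin_map[OF assms(1,2), of x "\<lambda>x. c \<otimes>\<^bsub>A\<^esub> x"])
    (use assms in \<open>auto simp: A.r_distr smult_mult_right\<close>)

lemma lin_mono:
  assumes "S \<subseteq> carrier A" "S' \<subseteq> carrier A" "x \<in> lin S" "\<And>s. s \<in> S \<Longrightarrow> s \<in> lin S'"
  shows "x \<in> lin S'"
  using lin_map[OF assms(1-3), of "\<lambda>x. x"] assms(4) by auto

lemma lin_finite_sum:
  assumes "x \<in> lin S" "S \<subseteq> carrier A"
  shows "\<exists>(n::nat) c s. (\<forall>i<n. c i \<in> carrier K \<and> s i \<in> S) \<and> x = (\<Oplus>\<^bsub>A\<^esub>i\<in>{..<n}. c i \<odot>\<^bsub>A\<^esub> s i)"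
  using assms(1)
proof induct
  case lin_zero
  then show ?case by (intro exI[of _ 0]) auto
next
  case (lin_step d t x)
  then obtain n :: nat and c s where h: "\<And>i. i < n \<Longrightarrow> c i \<in> carrier K \<and> s i \<in> S"
    and x: "x = (\<Oplus>\<^bsub>A\<^esub>i\<in>{..<n}. c i \<odot>\<^bsub>A\<^esub> s i)" by blast
  let ?c = "c(n := d)" and ?s = "s(n := t)"
  have cl: "c i \<odot>\<^bsub>A\<^esub> s i \<in> carrier A" if "i < n" for i using h[OF that] assms(2) by auto
  have eq: "(\<Oplus>\<^bsub>A\<^esub>i\<in>{..<n}. ?c i \<odot>\<^bsub>A\<^esub> ?s i) = (\<Oplus>\<^bsub>A\<^esub>i\<in>{..<n}. c i \<odot>\<^bsub>A\<^esub> s i)"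
    using cl by (intro M.finsum_cong') auto
  have "(\<Oplus>\<^bsub>A\<^esub>i\<in>{..<Suc n}. ?c i \<odot>\<^bsub>A\<^esub> ?s i) = d \<odot>\<^bsub>A\<^esub> t \<oplus>\<^bsub>A\<^esub> (\<Oplus>\<^bsub>A\<^esub>i\<in>{..<n}. ?c i \<odot>\<^bsub>A\<^esub> ?s i)"
    using cl lin_step assms(2) by (simp add: lessThan_Suc Pi_def subsetD)
  then show ?case using h lin_step unfolding eq x
    by (intro exI[of _ "Suc n"] exI[of _ ?c] exI[of _ ?s]) (auto simp: less_Suc_eq)
qed

text \<open>Independence of a family rather than of a set, so that no injectivity has to be known
  beforehand.\<close>

definition lin_indep :: "('i \<Rightarrow> 'c) \<Rightarrow> 'i set \<Rightarrow> bool" where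
  "lin_indep \<phi> S \<longleftrightarrow> (\<forall>T c. finite T \<and> T \<subseteq> S \<and> c \<in> T \<rightarrow> carrier K \<and>
     (\<Oplus>\<^bsub>A\<^esub>i\<in>T. c i \<odot>\<^bsub>A\<^esub> \<phi> i) = \<zero>\<^bsub>A\<^esub> \<longrightarrow> (\<forall>i\<in>T. c i = \<zero>))"

text \<open>A form suited to sums of products of paths: different products may give the same path, and
  only the coefficient of a path that occurs a single time is read off.\<close>

lemma lin_indep_isolated:
  assumes "lin_indep \<phi> S" and \<phi>: "\<And>i. i \<in> S \<Longrightarrow> \<phi> i \<in> carrier A"
    and I: "finite I" "\<And>i. i \<in> I \<Longrightarrow> c i \<in> carrier K" "\<And>i. i \<in> I \<Longrightarrow> \<theta> i \<in> S"
    and sum: "(\<Oplus>\<^bsub>A\<^esub>i\<in>I. c i \<odot>\<^bsub>A\<^esub> \<phi> (\<theta> i)) = \<zero>\<^bsub>A\<^esub>"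
    and i0: "i0 \<in> I" "\<And>i. i \<in> I \<Longrightarrow> \<theta> i = \<theta> i0 \<Longrightarrow> i = i0"
  shows "c i0 = \<zero>"
proof -
  define B where "B j = {i \<in> I. \<theta> i = j}" for j
  define d where "d j = (\<Oplus>i\<in>B j. c i)" for j
  have B: "finite (B j)" "B j \<subseteq> I" for j using I by (auto simp: B_def)
  have d: "d j \<in> carrier K" for j unfolding d_def using I B(2)[of j] by (intro R.finsum_closed) auto
  have "(\<Oplus>\<^bsub>A\<^esub>i\<in>I. c i \<odot>\<^bsub>A\<^esub> \<phi> (\<theta> i)) = (\<Oplus>\<^bsub>A\<^esub>i\<in>\<Union>(B ` (\<theta> ` I)). c i \<odot>\<^bsub>A\<^esub> \<phi> (\<theta> i))"
    by (rule arg_cong[where f = "finsum A _"]) (auto simp: B_def)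
  also have "\<dots> = (\<Oplus>\<^bsub>A\<^esub>j\<in>\<theta> ` I. \<Oplus>\<^bsub>A\<^esub>i\<in>B j. c i \<odot>\<^bsub>A\<^esub> \<phi> (\<theta> i))"
    using I \<phi> B by (intro M.add.finprod_UN_disjoint) (auto simp: pairwise_def disjnt_def B_def)
  also have "\<dots> = (\<Oplus>\<^bsub>A\<^esub>j\<in>\<theta> ` I. d j \<odot>\<^bsub>A\<^esub> \<phi> j)"
  proof (rule M.finsum_cong')
    fix j assume "j \<in> \<theta> ` I"
    then have "\<phi> j \<in> carrier A" using I \<phi> by auto
    then show "(\<Oplus>\<^bsub>A\<^esub>i\<in>B j. c i \<odot>\<^bsub>A\<^esub> \<phi> (\<theta> i)) = d j \<odot>\<^bsub>A\<^esub> \<phi> j"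
      unfolding d_def using I B
      by (subst finsum_smult_rdistr) (auto simp: B_def intro!: M.finsum_cong')
  qed (use I d \<phi> in auto)
  finally have "(\<Oplus>\<^bsub>A\<^esub>j\<in>\<theta> ` I. d j \<odot>\<^bsub>A\<^esub> \<phi> j) = \<zero>\<^bsub>A\<^esub>" using sum by simp
  moreover have "finite (\<theta> ` I)" "\<theta> ` I \<subseteq> S" "d \<in> \<theta> ` I \<rightarrow> carrier K"
    using I d by auto
  ultimately have "d (\<theta> i0) = \<zero>"
    using assms(1) i0(1) unfolding lin_indep_def by blast
  moreover have "B (\<theta> i0) = {i0}" using i0 by (auto simp: B_def)
  ultimately show ?thesis using I i0 by (simp add: d_def)
qed

end

section \<open>The free algebra and its universal property\<close>

context cring begin

definition conv :: "('x list \<Rightarrow> 'a) \<Rightarrow> ('x list \<Rightarrow> 'a) \<Rightarrow> 'x list \<Rightarrow> 'a" where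
  "conv p q = (\<lambda>w. \<Oplus>i\<in>{..length w}. p (take i w) \<otimes> q (drop i w))"

lemma conv_closed:
  assumes "range p \<subseteq> carrier R" "range q \<subseteq> carrier R"
  shows "conv p q w \<in> carrier R"
proof -
  have "p u \<in> carrier R" "q u \<in> carrier R" for u using assms by auto
  then show ?thesis unfolding conv_def by (intro finsum_closed) auto
qed

lemma conv_range:
  "range p \<subseteq> carrier R \<Longrightarrow> range q \<subseteq> carrier R \<Longrightarrow> range (conv p q) \<subseteq> carrier R"
  using conv_closed[of p q] by auto

lemma conv_Nil:
  assumes "range p \<subseteq> carrier R" "range q \<subseteq> carrier R"
  shows "conv p q [] = p [] \<otimes> q []"
proof -
  have "p [] \<in> carrier R" "q [] \<in> carrier R" using assms by auto
  then show ?thesis by (simp add: conv_def)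
qed

text \<open>Recursion on the first letter turns associativity of the convolution product into an induction,
  with no manipulation of double sums over splittings of a word.\<close>

lemma conv_Cons:
  assumes "range p \<subseteq> carrier R" "range q \<subseteq> carrier R"
  shows "conv p q (x # w) = p [] \<otimes> q (x # w) \<oplus> conv (\<lambda>u. p (x # u)) q w"
proof -
  have *: "p u \<in> carrier R" "q u \<in> carrier R" for u using assms by auto
  have "(\<Oplus>i\<in>{..length w}. p (x # take i w) \<otimes> q (drop i w)) \<in> carrier R"
    using * by (intro finsum_closed) auto
  then show ?thesis
    unfolding conv_def using * by (simp add: finsum_Suc2 Pi_def a_comm del: finsum_Suc)
qed

lemma conv_add_left:
  assumes "range p \<subseteq> carrier R" "range q \<subseteq> carrier R" "range r \<subseteq> carrier R"
  shows "conv (\<lambda>w. p w \<oplus> q w) r w = conv p r w \<oplus> conv q r w"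
proof -
  have *: "p u \<in> carrier R" "q u \<in> carrier R" "r u \<in> carrier R" for u using assms by auto
  have "conv (\<lambda>w. p w \<oplus> q w) r w
      = (\<Oplus>i\<in>{..length w}. p (take i w) \<otimes> r (drop i w) \<oplus> q (take i w) \<otimes> r (drop i w))"
    unfolding conv_def using * by (intro finsum_cong') (auto simp: l_distr)
  also have "\<dots> = conv p r w \<oplus> conv q r w"
    unfolding conv_def using * by (intro finsum_addf) auto
  finally show ?thesis .
qed

lemma conv_add_right:
  assumes "range p \<subseteq> carrier R" "range q \<subseteq> carrier R" "range r \<subseteq> carrier R"
  shows "conv r (\<lambda>w. p w \<oplus> q w) w = conv r p w \<oplus> conv r q w"
proof -
  have *: "p u \<in> carrier R" "q u \<in> carrier R" "r u \<in> carrier R" for u using assms by auto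
  have "conv r (\<lambda>w. p w \<oplus> q w) w
      = (\<Oplus>i\<in>{..length w}. r (take i w) \<otimes> p (drop i w) \<oplus> r (take i w) \<otimes> q (drop i w))"
    unfolding conv_def using * by (intro finsum_cong') (auto simp: r_distr)
  also have "\<dots> = conv r p w \<oplus> conv r q w"
    unfolding conv_def using * by (intro finsum_addf) auto
  finally show ?thesis .
qed

lemma conv_smult_left:
  assumes "range p \<subseteq> carrier R" "range q \<subseteq> carrier R" "a \<in> carrier R"
  shows "conv (\<lambda>w. a \<otimes> p w) q w = a \<otimes> conv p q w"
proof -
  have *: "p u \<in> carrier R" "q u \<in> carrier R" for u using assms by auto
  have "conv (\<lambda>w. a \<otimes> p w) q w = (\<Oplus>i\<in>{..length w}. a \<otimes> (p (take i w) \<otimes> q (drop i w)))"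
    unfolding conv_def using * assms by (intro finsum_cong') (auto simp: m_assoc)
  also have "\<dots> = a \<otimes> conv p q w"
    unfolding conv_def using * assms by (intro finsum_rdistr[symmetric]) auto
  finally show ?thesis .
qed

lemma conv_smult_right:
  assumes "range p \<subseteq> carrier R" "range q \<subseteq> carrier R" "a \<in> carrier R"
  shows "conv p (\<lambda>w. a \<otimes> q w) w = a \<otimes> conv p q w"
proof -
  have *: "p u \<in> carrier R" "q u \<in> carrier R" for u using assms by auto
  have "conv p (\<lambda>w. a \<otimes> q w) w = (\<Oplus>i\<in>{..length w}. a \<otimes> (p (take i w) \<otimes> q (drop i w)))"
    unfolding conv_def using * assms by (intro finsum_cong') (auto simp: m_lcomm)
  also have "\<dots> = a \<otimes> conv p q w"
    unfolding conv_def using * assms by (intro finsum_rdistr[symmetric]) auto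
  finally show ?thesis .
qed

lemma conv_assoc:
  assumes "range p \<subseteq> carrier R" "range q \<subseteq> carrier R" "range r \<subseteq> carrier R"
  shows "conv (conv p q) r w = conv p (conv q r) w"
  using assms(1)
proof (induct w arbitrary: p)
  case Nil
  have cl: "p [] \<in> carrier R" "q [] \<in> carrier R" "r [] \<in> carrier R" using Nil assms by auto
  have "range (conv p q) \<subseteq> carrier R" "range (conv q r) \<subseteq> carrier R"
    by (rule conv_range[OF Nil.prems assms(2)] conv_range[OF assms(2,3)])+
  then show ?case using Nil assms cl by (simp add: conv_Nil m_assoc)
next
  case (Cons x w)
  let ?px = "\<lambda>u. p (x # u)" and ?qx = "\<lambda>u. q (x # u)"
  have px: "range ?px \<subseteq> carrier R" "range ?qx \<subseteq> carrier R" using Cons assms by auto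
  have pq: "range (conv p q) \<subseteq> carrier R" "range (conv q r) \<subseteq> carrier R"
    "range (conv ?px q) \<subseteq> carrier R" "range (conv ?qx r) \<subseteq> carrier R"
    by (rule conv_range[OF Cons.prems assms(2)] conv_range[OF assms(2,3)]
        conv_range[OF px(1) assms(2)] conv_range[OF px(2) assms(3)])+
  have cl: "p u \<in> carrier R" "q u \<in> carrier R" "r u \<in> carrier R"
    "conv p q u \<in> carrier R" "conv q r u \<in> carrier R" "conv ?px q u \<in> carrier R"
    "conv ?qx r u \<in> carrier R" "conv (conv ?px q) r u \<in> carrier R"
    for u
    using Cons.prems assms(2,3) pq conv_closed[OF pq(3) assms(3)] by (auto simp: image_subset_iff)
  have sm: "range (\<lambda>u. p [] \<otimes> ?qx u) \<subseteq> carrier R" using cl by auto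
  have "conv (conv p q) r (x # w)
      = conv p q [] \<otimes> r (x # w) \<oplus> conv (\<lambda>u. conv p q (x # u)) r w"
    using pq assms by (simp add: conv_Cons)
  also have "(\<lambda>u. conv p q (x # u)) = (\<lambda>u. p [] \<otimes> ?qx u \<oplus> conv ?px q u)"
    using Cons assms by (simp add: conv_Cons)
  also have "conv (\<lambda>u. p [] \<otimes> ?qx u \<oplus> conv ?px q u) r w
      = p [] \<otimes> conv ?qx r w \<oplus> conv (conv ?px q) r w"
    using sm pq px assms cl by (simp add: conv_add_left conv_smult_left)
  also have "conv (conv ?px q) r w = conv ?px (conv q r) w"
    using px(1) by (rule Cons.hyps)
  also have "conv p q [] \<otimes> r (x # w) \<oplus> (p [] \<otimes> conv ?qx r w \<oplus> conv ?px (conv q r) w)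
      = p [] \<otimes> (q [] \<otimes> r (x # w) \<oplus> conv ?qx r w) \<oplus> conv ?px (conv q r) w"
    using Cons assms cl px pq
    by (simp add: conv_Nil m_assoc r_distr a_assoc conv_closed)
  also have "\<dots> = p [] \<otimes> conv q r (x # w) \<oplus> conv ?px (conv q r) w"
    using assms by (simp add: conv_Cons)
  also have "\<dots> = conv p (conv q r) (x # w)"
    using Cons pq by (simp add: conv_Cons)
  finally show ?case .
qed

lemma conv_word:
  fixes u :: "'x list"
  assumes "range q \<subseteq> carrier R"
  shows "conv (word R u) q (u @ w) = q w" and "conv (word R u) q w' = \<zero> \<or> (\<exists>w. w' = u @ w)"
proof -
  have wr: "range (word R v) \<subseteq> carrier R" for v :: "'x list" by (auto simp: word_def)
  have z: "conv (\<lambda>_. \<zero>) q w = \<zero>" for w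
    using assms unfolding conv_def by (intro add.finprod_one_eqI) (simp add: image_subset_iff)
  have tl: "(\<lambda>v. word R (y # u) (x # v)) = (if x = y then word R u else (\<lambda>_. \<zero>))" for x y u
    by (auto simp: word_def)
  have nil: "(\<lambda>v. word R [] (x # v)) = (\<lambda>_. \<zero>)" for x :: 'x
    by (auto simp: word_def)
  have w1: "word R (y # u) [] = \<zero>" "word R [] [] = \<one>" for y :: 'x and u by (auto simp: word_def)
  have cl: "q v \<in> carrier R" for v using assms by auto
  show "conv (word R u) q (u @ w) = q w"
  proof (induct u)
    case Nil
    then show ?case using assms wr z cl
      by (cases w) (simp_all add: conv_Nil conv_Cons nil w1)
  next
    case (Cons y u)
    then show ?case using assms wr z cl by (simp add: conv_Cons tl w1)
  qed
  show "conv (word R u) q w' = \<zero> \<or> (\<exists>w. w' = u @ w)"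
  proof (induct u arbitrary: w')
    case (Cons y u)
    show ?case
    proof (cases w')
      case (Cons x v)
      then show ?thesis using Cons.hyps[of v] assms wr z cl by (auto simp: conv_Cons tl w1)
    qed (use assms wr cl in \<open>simp add: conv_Nil w1\<close>)
  qed auto
qed

abbreviation supp :: "('i \<Rightarrow> 'a) \<Rightarrow> 'i set" where
  "supp p \<equiv> {w. p w \<noteq> \<zero>}"

lemma free_carrier_iff:
  "p \<in> carrier (free_algebra R X) \<longleftrightarrow> range p \<subseteq> carrier R \<and> supp p \<subseteq> lists X \<and> finite (supp p)"
  by (simp add: free_algebra_def)

lemma word_range: "range (word R u) \<subseteq> carrier R"
  by (auto simp: word_def)

lemma free_coeff: "p \<in> carrier (free_algebra R X) \<Longrightarrow> p w \<in> carrier R"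
  by (auto simp: free_carrier_iff)

lemma free_supp:
  assumes "p \<in> carrier (free_algebra R X)"
  shows "finite (supp p)" "supp p \<subseteq> lists X"
  using assms by (auto simp: free_carrier_iff)

lemma free_sel:
  "x \<otimes>\<^bsub>free_algebra R X\<^esub> y = conv x y"
  "\<one>\<^bsub>free_algebra R X\<^esub> = word R []"
  "\<zero>\<^bsub>free_algebra R X\<^esub> = (\<lambda>_. \<zero>)"
  "x \<oplus>\<^bsub>free_algebra R X\<^esub> y = (\<lambda>w. x w \<oplus> y w)"
  "a \<odot>\<^bsub>free_algebra R X\<^esub> x = (\<lambda>w. a \<otimes> x w)"
  by (simp_all add: free_algebra_def conv_def word_def fun_eq_iff)

lemma free_algebra_unital_algebra: "unital_algebra R (free_algebra R X)"
proof -
  let ?F = "free_algebra R X"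
  have cl: "p w \<in> carrier R" if "p \<in> carrier ?F" for p w
    using that by (auto simp: free_carrier_iff)
  have rg: "range p \<subseteq> carrier R" if "p \<in> carrier ?F" for p
    using that by (auto simp: free_carrier_iff)
  have add: "x \<oplus>\<^bsub>?F\<^esub> y \<in> carrier ?F" if "x \<in> carrier ?F" "y \<in> carrier ?F" for x y
  proof -
    have "supp (\<lambda>w. x w \<oplus> y w) \<subseteq> supp x \<union> supp y" using that by auto
    moreover have "finite (supp x \<union> supp y)" "supp x \<union> supp y \<subseteq> lists X"
      using that by (auto simp: free_carrier_iff)
    ultimately show ?thesis using cl[OF that(1)] cl[OF that(2)] unfolding free_carrier_iff free_sel
      by (meson a_closed finite_subset image_subsetI subset_trans)
  qed
  have sm: "a \<odot>\<^bsub>?F\<^esub> x \<in> carrier ?F" if "a \<in> carrier R" "x \<in> carrier ?F" for a x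
  proof -
    have "supp (\<lambda>w. a \<otimes> x w) \<subseteq> supp x" using that by auto
    then show ?thesis using that cl[OF that(2)] unfolding free_carrier_iff free_sel
      by (meson m_closed finite_subset image_subsetI subset_trans)
  qed
  have mult: "x \<otimes>\<^bsub>?F\<^esub> y \<in> carrier ?F" if "x \<in> carrier ?F" "y \<in> carrier ?F" for x y
  proof -
    have "supp (conv x y) \<subseteq> (\<lambda>(u, v). u @ v) ` (supp x \<times> supp y)"
    proof
      fix w assume "w \<in> supp (conv x y)"
      then have "\<not> (\<forall>i\<in>{..length w}. x (take i w) \<otimes> y (drop i w) = \<zero>)"
        unfolding conv_def using add.finprod_one_eqI by fastforce
      then obtain i where "x (take i w) \<otimes> y (drop i w) \<noteq> \<zero>" by blast
      then have "x (take i w) \<noteq> \<zero>" "y (drop i w) \<noteq> \<zero>"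
        using cl[OF that(1)] cl[OF that(2)] by auto
      then show "w \<in> (\<lambda>(u, v). u @ v) ` (supp x \<times> supp y)"
        by (intro image_eqI[of _ _ "(take i w, drop i w)"]) auto
    qed
    moreover have "finite ((\<lambda>(u, v). u @ v) ` (supp x \<times> supp y))"
      "(\<lambda>(u, v). u @ v) ` (supp x \<times> supp y) \<subseteq> lists X"
      using that by (fastforce simp: free_carrier_iff)+
    ultimately have "finite (supp (conv x y)) \<and> supp (conv x y) \<subseteq> lists X"
      using finite_subset by (meson subset_trans)
    moreover have "range (conv x y) \<subseteq> carrier R"
      using rg[OF that(1)] rg[OF that(2)] by (rule conv_range)
    ultimately show ?thesis unfolding free_carrier_iff free_sel by simp
  qed
  have word: "word R [] \<in> carrier ?F" by (auto simp: free_carrier_iff word_def)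
  have zero: "\<zero>\<^bsub>?F\<^esub> \<in> carrier ?F" by (auto simp: free_carrier_iff free_sel)
  have grp: "abelian_group ?F"
  proof (rule abelian_groupI)
    fix x y z assume "x \<in> carrier ?F" "y \<in> carrier ?F" "z \<in> carrier ?F"
    then have "x w \<in> carrier R" "y w \<in> carrier R" "z w \<in> carrier R" for w by (auto intro!: cl)
    then show "x \<oplus>\<^bsub>?F\<^esub> y \<oplus>\<^bsub>?F\<^esub> z = x \<oplus>\<^bsub>?F\<^esub> (y \<oplus>\<^bsub>?F\<^esub> z)"
      by (simp add: free_sel a_assoc)
  next
    fix x y assume "x \<in> carrier ?F" "y \<in> carrier ?F"
    then have "x w \<in> carrier R" "y w \<in> carrier R" for w by (auto intro!: cl)
    then show "x \<oplus>\<^bsub>?F\<^esub> y = y \<oplus>\<^bsub>?F\<^esub> x"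
      by (simp add: free_sel a_comm)
  next
    fix x assume x: "x \<in> carrier ?F"
    have "supp (\<lambda>w. \<ominus> x w) = supp x"
      using cl[OF x] by (metis (no_types, lifting) minus_minus minus_zero)
    then have "(\<lambda>w. \<ominus> x w) \<in> carrier ?F"
      using x cl[OF x] by (auto simp: free_carrier_iff)
    then show "\<exists>y\<in>carrier ?F. y \<oplus>\<^bsub>?F\<^esub> x = \<zero>\<^bsub>?F\<^esub>"
      using cl[OF x] by (intro bexI) (auto simp: free_sel l_neg)
  qed (use add zero cl in \<open>auto simp: free_sel\<close>)
  have one_l: "conv (word R []) x w = x w" if "x \<in> carrier ?F" for x w
    using conv_word(1)[OF rg[OF that], of "[]" w] by simp
  have one_r: "conv x (word R []) w = x w" if "x \<in> carrier ?F" for x w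
    using rg[OF that]
  proof (induct w arbitrary: x)
    case Nil
    then have "x [] \<in> carrier R" by auto
    then show ?case using Nil by (simp add: conv_Nil word_range) (simp add: word_def)
  next
    case (Cons y w)
    have "range (\<lambda>u. x (y # u)) \<subseteq> carrier R" using Cons.prems by auto
    then have "conv (\<lambda>u. x (y # u)) (word R []) w = x (y # w)" by (rule Cons.hyps)
    moreover have "x [] \<in> carrier R" "x (y # w) \<in> carrier R" using Cons.prems by auto
    ultimately show ?case using Cons.prems by (simp add: conv_Cons word_range) (simp add: word_def)
  qed
  have ring: "ring ?F"
  proof (rule ringI[OF grp])
    show "monoid ?F"
      using mult word one_l one_r rg
      by (intro monoidI) (auto simp: free_sel conv_assoc intro!: ext)
  qed (use rg in \<open>auto simp: free_sel conv_add_left conv_add_right intro!: ext\<close>)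
  have "module R ?F"
    using sm cl by (intro moduleI is_cring grp) (auto simp: free_sel l_distr r_distr m_assoc intro!: ext)
  then show ?thesis
    using ring rg by (intro unital_algebra.intro)
      (auto simp: unital_algebra_axioms_def free_sel conv_smult_left conv_smult_right intro!: ext)
qed

lemma word_closed: "u \<in> lists X \<Longrightarrow> word R u \<in> carrier (free_algebra R X)"
  by (auto simp: free_carrier_iff word_def)

lemma word_mult: "conv (word R u) (word R v) = word R (u @ v)"
proof
  fix w
  have r: "range (word R v) \<subseteq> carrier R" by (auto simp: word_def)
  show "conv (word R u) (word R v) w = word R (u @ v) w"
  proof (cases "\<exists>w'. w = u @ w'")
    case True
    then obtain w' where w: "w = u @ w'" by blast
    show ?thesis unfolding w conv_word(1)[OF r] by (simp add: word_def)
  next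
    case False
    then show ?thesis using conv_word(2)[OF r, of u w] by (auto simp: word_def)
  qed
qed

lemma free_algebra_induct [consumes 1, case_names zero add]:
  assumes "p \<in> carrier (free_algebra R X)"
    and "P (\<lambda>_. \<zero>)"
    and "\<And>a u p. \<lbrakk>a \<in> carrier R; u \<in> lists X; p u = \<zero>; p \<in> carrier (free_algebra R X); P p\<rbrakk>
      \<Longrightarrow> P (a \<odot>\<^bsub>free_algebra R X\<^esub> word R u \<oplus>\<^bsub>free_algebra R X\<^esub> p)"
  shows "P p"
proof -
  have "finite (supp p)" using assms(1) by (simp add: free_carrier_iff)
  then show ?thesis using assms(1)
  proof (induct "supp p" arbitrary: p rule: finite_induct)
    case empty
    then have "p = (\<lambda>_. \<zero>)" by auto
    then show ?case using assms(2) by simp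
  next
    case (insert u S)
    let ?q = "p(u := \<zero>)"
    have S: "S = supp ?q" using insert by auto
    have "supp ?q \<subseteq> supp p" by auto
    then have q: "?q \<in> carrier (free_algebra R X)"
      using insert by (auto simp: free_carrier_iff intro: finite_subset)
    have p: "p u \<in> carrier R" "u \<in> lists X" "\<And>w. p w \<in> carrier R"
      using insert by (auto simp: free_carrier_iff)
    have "p = p u \<odot>\<^bsub>free_algebra R X\<^esub> word R u \<oplus>\<^bsub>free_algebra R X\<^esub> ?q"
      using p by (auto simp: free_sel word_def fun_eq_iff)
    then show ?case using assms(3)[OF p(1,2) _ q insert(3)[OF S q]] by simp
  qed
qed

end

context unital_algebra begin

definition wprod :: "('x \<Rightarrow> 'c) \<Rightarrow> 'x list \<Rightarrow> 'c" where
  "wprod g w = foldr (\<lambda>x a. g x \<otimes>\<^bsub>A\<^esub> a) w \<one>\<^bsub>A\<^esub>"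

definition ev :: "('x \<Rightarrow> 'c) \<Rightarrow> ('x list \<Rightarrow> 'a) \<Rightarrow> 'c" where
  "ev g p = (\<Oplus>\<^bsub>A\<^esub>w\<in>supp p. p w \<odot>\<^bsub>A\<^esub> wprod g w)"

lemma wprod_simps [simp]:
  "wprod g [] = \<one>\<^bsub>A\<^esub>" "wprod g (x # w) = g x \<otimes>\<^bsub>A\<^esub> wprod g w"
  by (simp_all add: wprod_def)

context
  fixes g :: "'x \<Rightarrow> 'c" and X :: "'x set"
  assumes g: "g \<in> X \<rightarrow> carrier A"
begin

abbreviation (input) "FX \<equiv> free_algebra K X"

interpretation F: unital_algebra K FX
  by (rule free_algebra_unital_algebra)

lemma gen_closed: "x \<in> X \<Longrightarrow> g x \<in> carrier A"
  using g by auto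

lemma wprod_closed: "w \<in> lists X \<Longrightarrow> wprod g w \<in> carrier A"
  by (induct w) (simp_all add: gen_closed)

lemma wprod_append:
  "u \<in> lists X \<Longrightarrow> v \<in> lists X \<Longrightarrow> wprod g (u @ v) = wprod g u \<otimes>\<^bsub>A\<^esub> wprod g v"
  by (induct u) (simp_all add: gen_closed wprod_closed A.m_assoc)

lemma wprod_supp: "p \<in> carrier FX \<Longrightarrow> p w \<noteq> \<zero> \<Longrightarrow> wprod g w \<in> carrier A"
  using free_supp(2) by (intro wprod_closed) blast

lemma ev_superset:
  assumes "p \<in> carrier FX" "finite S" "supp p \<subseteq> S" "S \<subseteq> lists X"
  shows "ev g p = (\<Oplus>\<^bsub>A\<^esub>w\<in>S. p w \<odot>\<^bsub>A\<^esub> wprod g w)"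
proof -
  have "p w \<odot>\<^bsub>A\<^esub> wprod g w \<in> carrier A" "wprod g w \<in> carrier A" if "w \<in> S" for w
    using wprod_closed[of w] that assms(4) free_coeff[OF assms(1)] by blast+
  then show ?thesis unfolding ev_def using assms
    by (intro M.add.finprod_mono_neutral_cong_left) auto
qed

lemma ev_closed:
  assumes "p \<in> carrier FX"
  shows "ev g p \<in> carrier A"
  unfolding ev_def using wprod_supp[OF assms] free_coeff[OF assms] free_supp[OF assms]
  by (intro M.finsum_closed') auto

lemma ev_add:
  assumes "p \<in> carrier FX" "q \<in> carrier FX"
  shows "ev g (p \<oplus>\<^bsub>FX\<^esub> q) = ev g p \<oplus>\<^bsub>A\<^esub> ev g q"
proof -
  let ?S = "supp p \<union> supp q"
  have S: "finite ?S" "?S \<subseteq> lists X" using assms by (auto simp: free_carrier_iff)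
  have cl: "p w \<in> carrier K" "q w \<in> carrier K" for w using assms by (auto simp: free_carrier_iff)
  have "ev g (p \<oplus>\<^bsub>FX\<^esub> q) = (\<Oplus>\<^bsub>A\<^esub>w\<in>?S. (p w \<oplus> q w) \<odot>\<^bsub>A\<^esub> wprod g w)"
    using assms S cl by (subst ev_superset[of _ ?S]) (auto simp: free_sel intro: F.M.a_closed[unfolded free_sel])
  also have "\<dots> = (\<Oplus>\<^bsub>A\<^esub>w\<in>?S. p w \<odot>\<^bsub>A\<^esub> wprod g w \<oplus>\<^bsub>A\<^esub> q w \<odot>\<^bsub>A\<^esub> wprod g w)"
    using S cl wprod_supp[OF assms(1)] wprod_supp[OF assms(2)] by (intro M.finsum_cong') (auto simp: smult_l_distr)
  also have "\<dots> = (\<Oplus>\<^bsub>A\<^esub>w\<in>?S. p w \<odot>\<^bsub>A\<^esub> wprod g w) \<oplus>\<^bsub>A\<^esub> (\<Oplus>\<^bsub>A\<^esub>w\<in>?S. q w \<odot>\<^bsub>A\<^esub> wprod g w)"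
    using S cl wprod_supp[OF assms(1)] wprod_supp[OF assms(2)] by (intro M.finsum_addf) auto
  also have "\<dots> = ev g p \<oplus>\<^bsub>A\<^esub> ev g q"
    using assms S by (subst (1 2) ev_superset[of _ ?S]) auto
  finally show ?thesis .
qed

lemma ev_smult:
  assumes "p \<in> carrier FX" "a \<in> carrier K"
  shows "ev g (a \<odot>\<^bsub>FX\<^esub> p) = a \<odot>\<^bsub>A\<^esub> ev g p"
proof -
  have S: "finite (supp p)" "supp p \<subseteq> lists X" using assms by (auto simp: free_carrier_iff)
  have cl: "p w \<in> carrier K" for w using assms by (auto simp: free_carrier_iff)
  have "ev g (a \<odot>\<^bsub>FX\<^esub> p) = (\<Oplus>\<^bsub>A\<^esub>w\<in>supp p. (a \<otimes> p w) \<odot>\<^bsub>A\<^esub> wprod g w)"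
    using assms S cl by (subst ev_superset[of _ "supp p"]) (auto simp: free_sel intro: F.smult_closed[unfolded free_sel])
  also have "\<dots> = (\<Oplus>\<^bsub>A\<^esub>w\<in>supp p. a \<odot>\<^bsub>A\<^esub> (p w \<odot>\<^bsub>A\<^esub> wprod g w))"
    using S cl wprod_supp[OF assms(1)] assms by (intro M.finsum_cong') (auto simp: smult_assoc1)
  also have "\<dots> = a \<odot>\<^bsub>A\<^esub> ev g p"
    unfolding ev_def using S cl wprod_supp[OF assms(1)] assms by (intro finsum_smult_ldistr[symmetric]) auto
  finally show ?thesis .
qed

lemma ev_zero: "ev g (\<lambda>_. \<zero>) = \<zero>\<^bsub>A\<^esub>"
  by (simp add: ev_def)

lemma ev_word: "u \<in> lists X \<Longrightarrow> ev g (word K u) = wprod g u"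
  using wprod_closed[of u] word_closed[of u X] by (subst ev_superset[of _ "{u}"]) (auto simp: word_def)

lemma ev_finsum:
  assumes "finite I" "\<And>i. i \<in> I \<Longrightarrow> p i \<in> carrier FX"
  shows "ev g (\<Oplus>\<^bsub>FX\<^esub>i\<in>I. p i) = (\<Oplus>\<^bsub>A\<^esub>i\<in>I. ev g (p i))"
  using assms
proof (induct I)
  case empty
  then show ?case by (simp add: ev_zero[unfolded free_sel(3)[symmetric]] free_sel(3))
next
  case (insert i I)
  then have "p \<in> I \<rightarrow> carrier FX" "(\<lambda>i. ev g (p i)) \<in> I \<rightarrow> carrier A" by (auto simp: ev_closed)
  then show ?case using insert by (simp add: ev_add ev_closed)
qed

lemma ev_mult:
  assumes "p \<in> carrier FX" "q \<in> carrier FX"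
  shows "ev g (p \<otimes>\<^bsub>FX\<^esub> q) = ev g p \<otimes>\<^bsub>A\<^esub> ev g q"
proof -
  have w: "ev g (word K u \<otimes>\<^bsub>FX\<^esub> q) = wprod g u \<otimes>\<^bsub>A\<^esub> ev g q" if u: "u \<in> lists X" for u
    using assms(2)
  proof (induct q rule: free_algebra_induct)
    case zero
    have "word K u \<otimes>\<^bsub>FX\<^esub> (\<lambda>_. \<zero>) = (\<lambda>_. \<zero>)"
      using F.A.r_null[OF word_closed[OF u]] by (simp add: free_sel)
    then show ?case using u by (simp add: ev_zero wprod_closed)
  next
    case (add a v p)
    have uv: "word K u \<otimes>\<^bsub>FX\<^esub> word K v = word K (u @ v)" by (simp add: free_sel word_mult)
    have cl: "word K u \<in> carrier FX" "word K v \<in> carrier FX" "u @ v \<in> lists X"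
      using add u by (auto intro!: word_closed)
    then have "word K u \<otimes>\<^bsub>FX\<^esub> (a \<odot>\<^bsub>FX\<^esub> word K v \<oplus>\<^bsub>FX\<^esub> p)
        = a \<odot>\<^bsub>FX\<^esub> word K (u @ v) \<oplus>\<^bsub>FX\<^esub> word K u \<otimes>\<^bsub>FX\<^esub> p"
      using add uv by (simp add: F.A.r_distr F.smult_mult_right)
    then show ?case using add u cl
      by (simp add: ev_add ev_smult ev_word wprod_append A.r_distr smult_mult_right ev_closed
          wprod_closed word_closed)
  qed
  show ?thesis using assms(1)
  proof (induct p rule: free_algebra_induct)
    case zero
    have "(\<lambda>_. \<zero>) \<otimes>\<^bsub>FX\<^esub> q = (\<lambda>_. \<zero>)"
      using F.A.l_null[OF assms(2)] by (simp add: free_sel)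
    then show ?case using assms by (simp add: ev_zero ev_closed)
  next
    case (add a v p)
    have "word K v \<in> carrier FX" using add by (auto intro!: word_closed)
    then show ?case using add assms(2)
      by (simp add: F.A.l_distr F.smult_mult_left ev_add ev_smult w ev_word A.l_distr
          smult_mult_left ev_closed wprod_closed)
  qed
qed

lemma ev_one: "ev g \<one>\<^bsub>FX\<^esub> = \<one>\<^bsub>A\<^esub>"
  using ev_word[of "[]"] by (simp add: free_sel)

lemma ev_minus:
  assumes "p \<in> carrier FX" "q \<in> carrier FX"
  shows "ev g (p \<ominus>\<^bsub>FX\<^esub> q) = ev g p \<ominus>\<^bsub>A\<^esub> ev g q"
proof -
  have "ev g (p \<ominus>\<^bsub>FX\<^esub> q) \<oplus>\<^bsub>A\<^esub> ev g q = ev g (p \<ominus>\<^bsub>FX\<^esub> q \<oplus>\<^bsub>FX\<^esub> q)"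
    using assms by (simp add: ev_add)
  also have "p \<ominus>\<^bsub>FX\<^esub> q \<oplus>\<^bsub>FX\<^esub> q = p"
    using assms by (simp add: a_minus_def F.M.a_assoc F.M.l_neg)
  finally show ?thesis
    using assms by (metis M.add.inv_solve_right a_minus_def F.M.minus_closed ev_closed)
qed

text \<open>Together with the preceding rules this is the universal property of the free algebra modulo
  relations.\<close>

lemma ev_ideal:
  assumes "S \<subseteq> carrier FX" "\<And>s. s \<in> S \<Longrightarrow> ev g s = \<zero>\<^bsub>A\<^esub>" and p: "p \<in> Idl\<^bsub>FX\<^esub> S"
  shows "ev g p = \<zero>\<^bsub>A\<^esub>"
proof -
  have hom: "ev g \<in> ring_hom FX A"
    by (rule ring_hom_memI) (auto simp: ev_closed ev_mult ev_add ev_one)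
  interpret H: ring_hom_ring FX A "ev g"
    by (rule ring_hom_ringI2[OF F.A.ring_axioms A.ring_axioms hom])
  have "s \<in> a_kernel FX A (ev g)" if "s \<in> S" for s
    using assms(1) assms(2)[OF that] that unfolding a_kernel_def' by blast
  then have "Idl\<^bsub>FX\<^esub> S \<subseteq> a_kernel FX A (ev g)"
    by (intro F.A.genideal_minimal H.kernel_is_ideal) blast
  then show ?thesis using p unfolding a_kernel_def' by blast
qed

end

end

section \<open>Leavitt families\<close>

text \<open>A representation of the relations in an arbitrary algebra; the vertices need not add up to its
  identity.\<close>

locale leavitt_family = K: field K + unital_algebra K A + fin_digraph E
  for A :: "('k, 'a, 'm) module_scheme" (structure) and K :: "('k, 'r) ring_scheme" (structure)
    and E :: "('v, 'e) pre_digraph" +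
  fixes g :: "('v, 'e) generator \<Rightarrow> 'a"
  assumes g_closed: "x \<in> generators E \<Longrightarrow> g x \<in> carrier A"
    and vertex_vertex: "\<lbrakk>v \<in> verts E; w \<in> verts E\<rbrakk>
      \<Longrightarrow> g (Vertex v) \<otimes> g (Vertex w) = (if v = w then g (Vertex w) else \<zero>)"
    and tail_edge: "e \<in> arcs E \<Longrightarrow> g (Vertex (tail E e)) \<otimes> g (Edge e) = g (Edge e)"
    and edge_head: "e \<in> arcs E \<Longrightarrow> g (Edge e) \<otimes> g (Vertex (head E e)) = g (Edge e)"
    and head_ghost: "e \<in> arcs E \<Longrightarrow> g (Vertex (head E e)) \<otimes> g (Ghost e) = g (Ghost e)"
    and ghost_tail: "e \<in> arcs E \<Longrightarrow> g (Ghost e) \<otimes> g (Vertex (tail E e)) = g (Ghost e)"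
    and ghost_edge: "\<lbrakk>e \<in> arcs E; f \<in> arcs E\<rbrakk>
      \<Longrightarrow> g (Ghost e) \<otimes> g (Edge f) = (if e = f then g (Vertex (head E e)) else \<zero>)"
    and cuntz_krieger: "\<lbrakk>v \<in> verts E; out_arcs E v \<noteq> {}\<rbrakk>
      \<Longrightarrow> g (Vertex v) = (\<Oplus>e\<in>out_arcs E v. g (Edge e) \<otimes> g (Ghost e))"
begin

abbreviation "P v \<equiv> g (Vertex v)"
abbreviation "S e \<equiv> g (Edge e)"
abbreviation "T e \<equiv> g (Ghost e)"

lemma P_closed [simp]: "v \<in> verts E \<Longrightarrow> P v \<in> carrier A"
  and S_closed [simp]: "e \<in> arcs E \<Longrightarrow> S e \<in> carrier A"
  and T_closed [simp]: "e \<in> arcs E \<Longrightarrow> T e \<in> carrier A"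
  by (auto intro!: g_closed simp: generators_def)

lemma vertex_idem [simp]: "v \<in> verts E \<Longrightarrow> P v \<otimes> P v = P v"
  by (simp add: vertex_vertex)

lemma left_absorb:
  assumes "p \<otimes> x = x" "p \<in> carrier A" "x \<in> carrier A" "y \<in> carrier A"
  shows "p \<otimes> (x \<otimes> y) = x \<otimes> y"
  using assms by (simp add: A.m_assoc[symmetric])

lemma right_absorb:
  assumes "x \<otimes> p = x" "p \<in> carrier A" "x \<in> carrier A" "y \<in> carrier A"
  shows "(y \<otimes> x) \<otimes> p = y \<otimes> x"
  using assms by (simp add: A.m_assoc)

text \<open>The start vertex is a separate argument because the empty walk stands for a vertex.\<close>

primrec pth :: "'v \<Rightarrow> 'e list \<Rightarrow> 'a" where
  "pth v [] = P v"
| "pth v (e # \<mu>) = S e \<otimes> pth (head E e) \<mu>"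

primrec gst :: "'v \<Rightarrow> 'e list \<Rightarrow> 'a" where
  "gst v [] = P v"
| "gst v (e # \<mu>) = gst (head E e) \<mu> \<otimes> T e"

lemma pth_closed: "awalk v \<mu> w \<Longrightarrow> pth v \<mu> \<in> carrier A"
  by (induct \<mu> arbitrary: v) (auto simp: awalk_Nil_iff awalk_Cons_iff)

lemma gst_closed: "awalk v \<mu> w \<Longrightarrow> gst v \<mu> \<in> carrier A"
  by (induct \<mu> arbitrary: v) (auto simp: awalk_Nil_iff awalk_Cons_iff)

lemma pth_left: "awalk v \<mu> w \<Longrightarrow> P v \<otimes> pth v \<mu> = pth v \<mu>"
  by (cases \<mu>) (auto simp: awalk_Nil_iff awalk_Cons_iff intro!: left_absorb tail_edge pth_closed)

lemma pth_right: "awalk v \<mu> w \<Longrightarrow> pth v \<mu> \<otimes> P w = pth v \<mu>"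
proof (induct \<mu> arbitrary: v)
  case (Cons e \<mu>)
  then have "awalk (head E e) \<mu> w" "e \<in> arcs E" "w \<in> verts E"
    by (auto simp: awalk_Cons_iff dest: awalk_last_in_verts)
  then show ?case using Cons(1)[of "head E e"] by (simp add: A.m_assoc pth_closed)
qed (auto simp: awalk_Nil_iff)

lemma gst_right: "awalk v \<mu> w \<Longrightarrow> gst v \<mu> \<otimes> P v = gst v \<mu>"
  by (cases \<mu>) (auto simp: awalk_Nil_iff awalk_Cons_iff intro!: right_absorb ghost_tail gst_closed)

lemma gst_left: "awalk v \<mu> w \<Longrightarrow> P w \<otimes> gst v \<mu> = gst v \<mu>"
proof (induct \<mu> arbitrary: v)
  case (Cons e \<mu>)
  then have "awalk (head E e) \<mu> w" "e \<in> arcs E" "w \<in> verts E"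
    by (auto simp: awalk_Cons_iff dest: awalk_last_in_verts)
  then show ?case using Cons(1)[of "head E e"] by (simp add: A.m_assoc[symmetric] gst_closed)
qed (auto simp: awalk_Nil_iff)

lemma pth_append:
  "\<lbrakk>awalk v \<mu> w; awalk w \<nu> z\<rbrakk> \<Longrightarrow> pth v (\<mu> @ \<nu>) = pth v \<mu> \<otimes> pth w \<nu>"
proof (induct \<mu> arbitrary: v)
  case (Cons e \<mu>)
  then have "awalk (head E e) \<mu> w" "e \<in> arcs E" by (auto simp: awalk_Cons_iff)
  then show ?case using Cons by (simp add: A.m_assoc pth_closed)
qed (auto simp: awalk_Nil_iff pth_left)

lemma gst_append:
  "\<lbrakk>awalk v \<mu> w; awalk w \<nu> z\<rbrakk> \<Longrightarrow> gst v (\<mu> @ \<nu>) = gst w \<nu> \<otimes> gst v \<mu>"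
proof (induct \<mu> arbitrary: v)
  case (Cons e \<mu>)
  then have "awalk (head E e) \<mu> w" "e \<in> arcs E" by (auto simp: awalk_Cons_iff)
  then show ?case using Cons by (simp add: A.m_assoc gst_closed)
qed (auto simp: awalk_Nil_iff gst_right)

lemma ghost_edge_mult:
  assumes "e \<in> arcs E" "f \<in> arcs E" "x \<in> carrier A" "y \<in> carrier A"
  shows "(x \<otimes> T e) \<otimes> (S f \<otimes> y) = (if e = f then x \<otimes> (P (head E e) \<otimes> y) else \<zero>)"
proof -
  have "(x \<otimes> T e) \<otimes> (S f \<otimes> y) = x \<otimes> ((T e \<otimes> S f) \<otimes> y)"
    using assms by (simp add: A.m_assoc)
  then show ?thesis using assms by (simp add: ghost_edge)
qed

lemma gst_pth_append:
  "\<lbrakk>awalk v \<mu> w; awalk w \<nu> z\<rbrakk> \<Longrightarrow> gst v \<mu> \<otimes> pth v (\<mu> @ \<nu>) = pth w \<nu>"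
proof (induct \<mu> arbitrary: v)
  case (Cons e \<mu>)
  then have *: "awalk (head E e) \<mu> w" "e \<in> arcs E" "awalk (head E e) (\<mu> @ \<nu>) z"
    by (auto simp: awalk_Cons_iff intro: awalk_appendI)
  then show ?case using Cons(1)[OF *(1) Cons.prems(2)]
    by (simp add: ghost_edge_mult gst_closed pth_closed pth_left)
qed (auto simp: awalk_Nil_iff pth_left)

lemma gst_pth: "awalk v \<mu> w \<Longrightarrow> gst v \<mu> \<otimes> pth v \<mu> = P w"
  using gst_pth_append[of v \<mu> w "[]" w] by (auto simp: awalk_Nil_iff dest: awalk_last_in_verts)

lemma gst_pth_zero:
  "\<lbrakk>awalk v \<mu> w; awalk u \<nu> z; v \<noteq> u \<or> \<not> prefix \<mu> \<nu> \<and> \<not> prefix \<nu> \<mu>\<rbrakk> \<Longrightarrow> gst v \<mu> \<otimes> pth u \<nu> = \<zero>"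
proof (induct \<mu> arbitrary: v u \<nu>)
  case Nil
  then have "v \<noteq> u" "v \<in> verts E" "u \<in> verts E"
    by (auto simp: awalk_Nil_iff dest: awalk_hd_in_verts)
  then have "P v \<otimes> (P u \<otimes> pth u \<nu>) = \<zero>"
    using Nil by (simp add: A.m_assoc[symmetric] vertex_vertex pth_closed)
  then show ?case using Nil by (simp add: pth_left)
next
  case (Cons e \<mu>)
  then have e: "awalk (head E e) \<mu> w" "e \<in> arcs E" "v = tail E e" by (auto simp: awalk_Cons_iff)
  show ?case
  proof (cases \<nu>)
    case Nil
    then have u: "u \<noteq> v" "u \<in> verts E" "v \<in> verts E" "u = z" using Cons by (auto simp: awalk_Nil_iff dest: awalk_hd_in_verts)
    have "gst v (e # \<mu>) = gst v (e # \<mu>) \<otimes> P v" using gst_right[OF Cons.prems(1)] by simp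
    then have "gst v (e # \<mu>) \<otimes> P u = gst v (e # \<mu>) \<otimes> (P v \<otimes> P u)"
      using gst_closed[OF Cons.prems(1)] u by (metis A.m_assoc P_closed)
    then show ?thesis using gst_closed[OF Cons.prems(1)] u Nil by (simp add: vertex_vertex)
  next
    case (Cons f \<nu>')
    then have f: "awalk (head E f) \<nu>' z" "f \<in> arcs E" "u = tail E f" using Cons.prems by (auto simp: awalk_Cons_iff)
    have "gst (head E e) \<mu> \<otimes> pth (head E e) \<nu>' = \<zero>" if "e = f"
      using Cons.prems Cons Cons.hyps[OF e(1), of "head E e" \<nu>'] e f that by auto
    then show ?thesis using Cons e f by (simp add: ghost_edge_mult gst_closed pth_closed pth_left)
  qed
qed

text \<open>The two forms in which the Cuntz-Krieger relation is used: any element that ends at a regular vertex is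
  recovered from its products with the outgoing edges, and is therefore zero if all these
  products are.\<close>

lemma expand_right:
  assumes "a \<in> carrier A" "w \<in> verts E" "out_arcs E w \<noteq> {}"
  shows "a \<otimes> P w = (\<Oplus>e\<in>out_arcs E w. (a \<otimes> S e) \<otimes> T e)"
proof -
  have "a \<otimes> P w = (\<Oplus>e\<in>out_arcs E w. a \<otimes> (S e \<otimes> T e))"
    using assms by (subst cuntz_krieger) (auto intro!: A.finsum_rdistr)
  also have "\<dots> = (\<Oplus>e\<in>out_arcs E w. (a \<otimes> S e) \<otimes> T e)"
    using assms by (intro M.finsum_cong') (auto simp: A.m_assoc)
  finally show ?thesis .
qed

lemma cancel_edges:
  assumes "a \<in> carrier A" "w \<in> verts E" "out_arcs E w \<noteq> {}" "a \<otimes> P w = a"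
    and "\<And>e. e \<in> out_arcs E w \<Longrightarrow> a \<otimes> S e = \<zero>"
  shows "a = \<zero>"
proof -
  have "a = (\<Oplus>e\<in>out_arcs E w. (a \<otimes> S e) \<otimes> T e)"
    using expand_right[OF assms(1-3)] assms(4) by simp
  also have "\<dots> = \<zero>" using assms by (intro M.finsum_neutral) auto
  finally show ?thesis .
qed

text \<open>The sum of the vertices is the identity of the subalgebra that the family generates.\<close>

definition unit :: 'a where "unit = (\<Oplus>v\<in>verts E. P v)"

lemma unit_closed [simp]: "unit \<in> carrier A"
  unfolding unit_def by (intro M.finsum_closed) auto

lemma vertex_unit: assumes "v \<in> verts E" shows "P v \<otimes> unit = P v"
proof -
  have "P v \<otimes> unit = (\<Oplus>w\<in>verts E. P v \<otimes> P w)"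
    unfolding unit_def using assms by (intro A.finsum_rdistr) auto
  also have "\<dots> = P v \<otimes> P v"
    using assms by (intro M.finsum_only) (auto simp: vertex_vertex)
  finally show ?thesis using assms by simp
qed

lemma unit_vertex: assumes "v \<in> verts E" shows "unit \<otimes> P v = P v"
proof -
  have "unit \<otimes> P v = (\<Oplus>w\<in>verts E. P w \<otimes> P v)"
    unfolding unit_def using assms by (intro A.finsum_ldistr) auto
  also have "\<dots> = P v \<otimes> P v"
    using assms by (intro M.finsum_only) (auto simp: vertex_vertex)
  finally show ?thesis using assms by simp
qed

lemma unit_idem: "unit \<otimes> unit = unit"
proof -
  have "unit \<otimes> unit = (\<Oplus>w\<in>verts E. unit \<otimes> P w)"
    by (subst (2) unit_def) (auto intro!: A.finsum_rdistr)
  also have "\<dots> = unit"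
    by (subst (2) unit_def) (auto intro!: M.finsum_cong' simp: unit_vertex)
  finally show ?thesis .
qed

lemma gen_unit: "x \<in> generators E \<Longrightarrow> g x \<otimes> unit = g x"
  and unit_gen: "x \<in> generators E \<Longrightarrow> unit \<otimes> g x = g x"
proof -
  assume x: "x \<in> generators E"
  show "g x \<otimes> unit = g x"
  proof (cases x)
    case (Edge e)
    then have e: "e \<in> arcs E" using x by (auto simp: generators_def)
    have "S e \<otimes> unit = S e \<otimes> (P (head E e) \<otimes> unit)"
      using e by (simp add: A.m_assoc[symmetric] edge_head)
    then show ?thesis using e Edge by (simp add: vertex_unit edge_head)
  next
    case (Ghost e)
    then have e: "e \<in> arcs E" using x by (auto simp: generators_def)
    have "T e \<otimes> unit = T e \<otimes> (P (tail E e) \<otimes> unit)"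
      using e by (simp add: A.m_assoc[symmetric] ghost_tail)
    then show ?thesis using e Ghost by (simp add: vertex_unit ghost_tail)
  qed (use x in \<open>auto simp: generators_def vertex_unit\<close>)
  show "unit \<otimes> g x = g x"
  proof (cases x)
    case (Edge e)
    then have e: "e \<in> arcs E" using x by (auto simp: generators_def)
    have "unit \<otimes> S e = (unit \<otimes> P (tail E e)) \<otimes> S e"
      using e by (simp add: A.m_assoc tail_edge)
    then show ?thesis using e Edge by (simp add: unit_vertex tail_edge)
  next
    case (Ghost e)
    then have e: "e \<in> arcs E" using x by (auto simp: generators_def)
    have "unit \<otimes> T e = (unit \<otimes> P (head E e)) \<otimes> T e"
      using e by (simp add: A.m_assoc head_ghost)
    then show ?thesis using e Ghost by (simp add: unit_vertex head_ghost)
  qed (use x in \<open>auto simp: generators_def unit_vertex\<close>)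
qed

lemma corner_decomp:
  assumes "a \<in> carrier A" "unit \<otimes> a = a"
  shows "a = (\<Oplus>u\<in>verts E. P u \<otimes> a)"
  using assms A.finsum_ldistr[of "verts E" a P] by (simp add: unit_def)

lemma corner_decomp_right:
  assumes "a \<in> carrier A" "a \<otimes> unit = a"
  shows "a = (\<Oplus>u\<in>verts E. a \<otimes> P u)"
  using assms A.finsum_rdistr[of "verts E" a P] by (simp add: unit_def)

subsection \<open>Elements that become polynomial in the edges after right multiplication by long paths\<close>

definition monomials :: "'v set \<Rightarrow> 'v \<Rightarrow> 'a set" where
  "monomials U w = {pth u \<mu> |u \<mu>. u \<in> U \<and> awalk u \<mu> w}"

definition polynomials :: "'v set \<Rightarrow> 'v \<Rightarrow> 'a set" where
  "polynomials U w = lin (monomials U w)"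

definition path_pairs :: "'v set \<Rightarrow> 'v \<Rightarrow> 'a set" where
  "path_pairs U w = {pth u \<mu> \<otimes> gst w \<nu> |u \<mu> \<nu> z. u \<in> U \<and> awalk u \<mu> z \<and> awalk w \<nu> z}"

text \<open>An element \<open>a = a p\<^sub>w\<close> is tame if \<open>a \<gamma>\<close> is a linear
  combination of paths for every walk \<open>\<gamma>\<close> from \<open>w\<close> that has
  length \<open>m\<close> or stops at a sink before. Statements about tame elements are reduced
  to polynomials by induction on \<open>m\<close> and \<open>cancel_edges\<close>; this is the
  way in which ghost edges are dealt with throughout.\<close>

primrec tame :: "nat \<Rightarrow> 'v set \<Rightarrow> 'v \<Rightarrow> 'a set" where
  "tame 0 U w = polynomials U w"
| "tame (Suc m) U w = (if out_arcs E w = {} then polynomials U w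
     else {a \<in> carrier A. a \<otimes> P w = a \<and> (\<forall>e\<in>out_arcs E w. a \<otimes> S e \<in> tame m U (head E e))})"

lemma monomials_closed: "monomials U w \<subseteq> carrier A"
  by (auto simp: monomials_def pth_closed)

lemma polynomials_closed: "a \<in> polynomials U w \<Longrightarrow> a \<in> carrier A"
  unfolding polynomials_def using lin_closed[OF monomials_closed] .

lemma path_pairs_closed: "path_pairs U w \<subseteq> carrier A"
  by (auto simp: path_pairs_def pth_closed gst_closed)

lemma polynomials_right:
  assumes "a \<in> polynomials U w" "w \<in> verts E"
  shows "a \<otimes> P w = a"
proof -
  have "s \<otimes> P w = s" if "s \<in> monomials U w" for s
    using that by (auto simp: monomials_def pth_right)
  with assms(1)[unfolded polynomials_def] show ?thesis
  proof (induct rule: lin.induct)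
    case (lin_step c s x)
    moreover have "s \<in> carrier A" "x \<in> carrier A"
      using lin_step monomials_closed lin_closed[OF monomials_closed] by blast+
    ultimately show ?case using assms(2) by (simp add: A.l_distr smult_mult_left)
  qed (use assms in auto)
qed

lemma polynomials_edge:
  assumes "a \<in> polynomials U w" "e \<in> out_arcs E w"
  shows "a \<otimes> S e \<in> polynomials U (head E e)"
  unfolding polynomials_def
proof (rule lin_mult_right[OF monomials_closed monomials_closed _ assms(1)[unfolded polynomials_def]])
  fix s assume "s \<in> monomials U w"
  then obtain u \<mu> where s: "s = pth u \<mu>" "u \<in> U" "awalk u \<mu> w" by (auto simp: monomials_def)
  have e: "awalk w [e] (head E e)" using assms by (auto simp: awalk_Cons_iff awalk_Nil_iff)
  have "pth u (\<mu> @ [e]) \<in> monomials U (head E e)"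
    unfolding monomials_def using s e awalk_appendI by blast
  moreover have "pth u (\<mu> @ [e]) = s \<otimes> S e"
    using s e assms by (simp add: pth_append edge_head)
  ultimately show "s \<otimes> S e \<in> lin (monomials U (head E e))"
    using lin_base monomials_closed by metis
qed (use assms in auto)

lemma tame_closed: "w \<in> verts E \<Longrightarrow> a \<in> tame m U w \<Longrightarrow> a \<in> carrier A \<and> a \<otimes> P w = a"
  by (cases m) (auto simp: polynomials_closed polynomials_right split: if_splits)

lemma polynomials_tame: "w \<in> verts E \<Longrightarrow> a \<in> polynomials U w \<Longrightarrow> a \<in> tame m U w"
proof (induct m arbitrary: a w)
  case (Suc m)
  have "a \<otimes> S e \<in> tame m U (head E e)" if "e \<in> out_arcs E w" for e
    using that Suc by (auto intro!: Suc(1) polynomials_edge)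
  then show ?case using Suc by (auto simp: polynomials_closed polynomials_right)
qed auto

lemma tame_Suc: "w \<in> verts E \<Longrightarrow> a \<in> tame m U w \<Longrightarrow> a \<in> tame (Suc m) U w"
proof (induct m arbitrary: a w)
  case 0
  then show ?case using polynomials_tame[of w a U "Suc 0"] by simp
next
  case (Suc m)
  show ?case
  proof (cases "out_arcs E w = {}")
    case False
    have "a \<otimes> S e \<in> tame (Suc m) U (head E e)" if "e \<in> out_arcs E w" for e
      using that Suc.prems False by (intro Suc.hyps) auto
    then show ?thesis using False tame_closed[OF Suc.prems]
      by (subst tame.simps) (simp del: tame.simps)
  qed (use Suc in simp)
qed

lemma tame_mono: "w \<in> verts E \<Longrightarrow> a \<in> tame m U w \<Longrightarrow> m \<le> n \<Longrightarrow> a \<in> tame n U w"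
  by (rule dec_induct[of m n "\<lambda>n. a \<in> tame n U w"]) (auto intro: tame_Suc simp del: tame.simps)

lemma tame_zero: "w \<in> verts E \<Longrightarrow> \<zero> \<in> tame m U w"
  by (rule polynomials_tame) (auto simp: polynomials_def lin_zero)

lemma tame_add: "w \<in> verts E \<Longrightarrow> a \<in> tame m U w \<Longrightarrow> b \<in> tame m U w \<Longrightarrow> a \<oplus> b \<in> tame m U w"
proof (induct m arbitrary: a b w)
  case 0
  then show ?case by (simp add: polynomials_def lin_add monomials_closed)
next
  case (Suc m)
  show ?case
  proof (cases "out_arcs E w = {}")
    case True
    then show ?thesis using Suc by (simp add: polynomials_def lin_add monomials_closed)
  next
    case False
    have ab: "a \<in> carrier A" "b \<in> carrier A" "a \<otimes> P w = a" "b \<otimes> P w = b"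
      using tame_closed Suc.prems by blast+
    have "(a \<oplus> b) \<otimes> S e \<in> tame m U (head E e)" if "e \<in> out_arcs E w" for e
      using that Suc.prems False ab by (auto simp: A.l_distr intro!: Suc.hyps)
    then show ?thesis using False Suc ab by (auto simp: A.l_distr)
  qed
qed

lemma tame_smult: "w \<in> verts E \<Longrightarrow> a \<in> tame m U w \<Longrightarrow> c \<in> carrier K \<Longrightarrow> c \<odot> a \<in> tame m U w"
proof (induct m arbitrary: a w)
  case 0
  then show ?case by (simp add: polynomials_def lin_smult monomials_closed)
next
  case (Suc m)
  show ?case
  proof (cases "out_arcs E w = {}")
    case True
    then show ?thesis using Suc by (simp add: polynomials_def lin_smult monomials_closed)
  next
    case False
    have ab: "a \<in> carrier A" "a \<otimes> P w = a"
      using tame_closed Suc.prems by blast+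
    have "(c \<odot> a) \<otimes> S e \<in> tame m U (head E e)" if "e \<in> out_arcs E w" for e
      using that Suc.prems False ab by (auto simp: smult_mult_left intro!: Suc.hyps)
    then show ?thesis using False Suc ab by (auto simp: smult_mult_left)
  qed
qed

text \<open>Each edge multiplied on the right either cancels the first ghost edge or gives zero.\<close>

lemma path_pair_tame:
  "\<lbrakk>u \<in> U; awalk u \<mu> z; awalk w \<nu> z\<rbrakk> \<Longrightarrow> pth u \<mu> \<otimes> gst w \<nu> \<in> tame (length \<nu>) U w"
proof (induct \<nu> arbitrary: w)
  case Nil
  then have "pth u \<mu> \<in> monomials U w" "w = z" by (auto simp: monomials_def awalk_Nil_iff)
  then show ?case using Nil
    by (simp add: polynomials_def pth_right lin_base monomials_closed)
next
  case (Cons f \<nu>)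
  then have f: "f \<in> arcs E" "w = tail E f" "awalk (head E f) \<nu> z"
    by (auto simp: awalk_Cons_iff)
  have cl: "pth u \<mu> \<in> carrier A" "gst (head E f) \<nu> \<in> carrier A"
    using Cons f pth_closed gst_closed by blast+
  let ?a = "pth u \<mu> \<otimes> gst w (f # \<nu>)"
  have "?a \<otimes> S e \<in> tame (length \<nu>) U (head E e)" if e: "e \<in> out_arcs E w" for e
  proof -
    have "?a \<otimes> S e = pth u \<mu> \<otimes> (gst (head E f) \<nu> \<otimes> (T f \<otimes> S e))"
      using cl f e by (simp add: A.m_assoc)
    also have "\<dots> = (if e = f then pth u \<mu> \<otimes> gst (head E f) \<nu> else \<zero>)"
      using cl f e gst_right[OF f(3)] by (auto simp: ghost_edge)
    finally show ?thesis using Cons.hyps[OF Cons.prems(1,2) f(3)] e by (auto simp: tame_zero)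
  qed
  moreover have "f \<in> out_arcs E w" using f by auto
  moreover have "?a \<otimes> P w = ?a"
    using cl f gst_right[OF Cons.prems(3)] gst_closed[OF Cons.prems(3)] by (simp add: A.m_assoc)
  ultimately show ?case using cl f gst_closed[OF Cons.prems(3)] by auto
qed

lemma span_tame:
  assumes "a \<in> lin (path_pairs U w)" "w \<in> verts E"
  shows "\<exists>m. a \<in> tame m U w"
  using assms(1)
proof induct
  case lin_zero
  then show ?case using tame_zero assms by blast
next
  case (lin_step c s x)
  then obtain m where x: "x \<in> tame m U w" by blast
  obtain u \<mu> \<nu> z where s: "s = pth u \<mu> \<otimes> gst w \<nu>" "u \<in> U" "awalk u \<mu> z" "awalk w \<nu> z"
    using lin_step by (auto simp: path_pairs_def)
  define n where "n = length \<nu>"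
  have "s \<in> tame n U w" unfolding s(1) n_def using s(2-4) by (rule path_pair_tame)
  with x
  have "s \<in> tame (max m n) U w" "x \<in> tame (max m n) U w"
    using assms tame_mono by (meson max.cobounded1 max.cobounded2)+
  then show ?case using lin_step assms tame_add tame_smult by metis
qed

end

section \<open>Corners\<close>

context unital_algebra begin

lemma corner_sel:
  "x \<otimes>\<^bsub>corner A f\<^esub> y = x \<otimes>\<^bsub>A\<^esub> y" "x \<oplus>\<^bsub>corner A f\<^esub> y = x \<oplus>\<^bsub>A\<^esub> y"
  "\<zero>\<^bsub>corner A f\<^esub> = \<zero>\<^bsub>A\<^esub>" "\<one>\<^bsub>corner A f\<^esub> = f" "c \<odot>\<^bsub>corner A f\<^esub> x = c \<odot>\<^bsub>A\<^esub> x"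
  by (simp_all add: corner_def)

context
  fixes f assumes f: "f \<in> carrier A" "f \<otimes>\<^bsub>A\<^esub> f = f"
begin

lemma corner_carrier:
  "x \<in> carrier (corner A f) \<longleftrightarrow> x \<in> carrier A \<and> f \<otimes>\<^bsub>A\<^esub> x = x \<and> x \<otimes>\<^bsub>A\<^esub> f = x"
proof
  assume "x \<in> carrier (corner A f)"
  then obtain y where y: "y \<in> carrier A" "x = f \<otimes>\<^bsub>A\<^esub> y \<otimes>\<^bsub>A\<^esub> f" by (auto simp: corner_def)
  have "f \<otimes>\<^bsub>A\<^esub> x = (f \<otimes>\<^bsub>A\<^esub> f) \<otimes>\<^bsub>A\<^esub> y \<otimes>\<^bsub>A\<^esub> f"
    using y f(1) by (simp only: A.m_assoc A.m_closed)
  moreover have "x \<otimes>\<^bsub>A\<^esub> f = f \<otimes>\<^bsub>A\<^esub> y \<otimes>\<^bsub>A\<^esub> (f \<otimes>\<^bsub>A\<^esub> f)"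
    using y f(1) by (simp only: A.m_assoc A.m_closed)
  ultimately show "x \<in> carrier A \<and> f \<otimes>\<^bsub>A\<^esub> x = x \<and> x \<otimes>\<^bsub>A\<^esub> f = x"
    using y f by simp
next
  assume "x \<in> carrier A \<and> f \<otimes>\<^bsub>A\<^esub> x = x \<and> x \<otimes>\<^bsub>A\<^esub> f = x"
  then show "x \<in> carrier (corner A f)" unfolding corner_def by auto metis
qed

lemma corner_unital_algebra: "unital_algebra K (corner A f)"
proof -
  have mult: "x \<otimes>\<^bsub>A\<^esub> y \<in> carrier (corner A f)"
    if "x \<in> carrier (corner A f)" "y \<in> carrier (corner A f)" for x y
    using that f unfolding corner_carrier by (metis A.m_assoc A.m_closed)
  have add: "x \<oplus>\<^bsub>A\<^esub> y \<in> carrier (corner A f)"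
    if "x \<in> carrier (corner A f)" "y \<in> carrier (corner A f)" for x y
    using that f unfolding corner_carrier by (simp add: A.l_distr A.r_distr)
  have smult: "c \<odot>\<^bsub>A\<^esub> x \<in> carrier (corner A f)"
    if "c \<in> carrier K" "x \<in> carrier (corner A f)" for c x
    using that f unfolding corner_carrier by (simp add: smult_mult_left smult_mult_right)
  have neg: "\<ominus>\<^bsub>A\<^esub> x \<in> carrier (corner A f)" if "x \<in> carrier (corner A f)" for x
    using that f unfolding corner_carrier by (simp add: A.r_minus A.l_minus)
  have grp: "abelian_group (corner A f)"
  proof (rule abelian_groupI)
    fix x assume "x \<in> carrier (corner A f)"
    then show "\<exists>y\<in>carrier (corner A f). y \<oplus>\<^bsub>corner A f\<^esub> x = \<zero>\<^bsub>corner A f\<^esub>"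
      using neg[of x] by (intro bexI[of _ "\<ominus>\<^bsub>A\<^esub> x"]) (auto simp: corner_sel corner_carrier M.l_neg)
  qed (auto simp: corner_sel add, auto simp: corner_carrier f M.a_ac)
  have "module K (corner A f)"
    using smult by (intro moduleI is_cring grp)
      (auto simp: corner_sel, auto simp: corner_carrier smult_l_distr smult_r_distr smult_assoc1)
  moreover have "ring (corner A f)"
  proof (rule ringI[OF grp])
    show "monoid (corner A f)"
      using mult by (intro monoidI) (auto simp: corner_sel, auto simp: corner_carrier f A.m_assoc)
  qed (auto simp: corner_sel corner_carrier A.l_distr A.r_distr)
  ultimately show ?thesis
    by (intro unital_algebra.intro)
      (auto simp: unital_algebra_axioms_def corner_sel corner_carrier smult_mult_left smult_mult_right)
qed

lemma corner_finsum:
  assumes "finite I" "\<And>i. i \<in> I \<Longrightarrow> x i \<in> carrier (corner A f)"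
  shows "(\<Oplus>\<^bsub>corner A f\<^esub>i\<in>I. x i) = (\<Oplus>\<^bsub>A\<^esub>i\<in>I. x i)"
proof -
  interpret C: unital_algebra K "corner A f" by (rule corner_unital_algebra)
  show ?thesis using assms
  proof (induct I)
    case (insert i I)
    then have "x \<in> I \<rightarrow> carrier A" "x i \<in> carrier A" "x \<in> I \<rightarrow> carrier (corner A f)"
      by (auto simp: corner_carrier)
    then show ?case using insert by (simp add: corner_sel)
  qed (simp add: corner_sel)
qed

end

lemma corner_lin:
  assumes "f \<in> carrier A" "f \<otimes>\<^bsub>A\<^esub> f = f"
  shows "unital_algebra.lin K (corner A f) S = lin S"
proof -
  interpret C: unital_algebra K "corner A f" using assms by (rule corner_unital_algebra)
  have "x \<in> lin S" if "x \<in> C.lin S" for x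
    using that
  proof induct
    case (lin_step c s x)
    then show ?case using lin.lin_step[of c s S x] by (simp add: corner_sel)
  qed (simp add: corner_sel lin_zero)
  moreover have "x \<in> C.lin S" if "x \<in> lin S" for x
    using that
  proof induct
    case lin_zero
    then show ?case using C.lin_zero by (simp add: corner_sel)
  next
    case (lin_step c s x)
    then show ?case using C.lin_step[of c s S x] by (simp add: corner_sel)
  qed
  ultimately show ?thesis by blast
qed

end

section \<open>Faithful Leavitt families\<close>

context leavitt_family begin

text \<open>Polynomials are handled through their coefficient functions, since leading paths depend on the
  coefficients.\<close>

definition coeffs :: "'v set \<Rightarrow> 'v \<Rightarrow> ('v \<times> 'e list \<Rightarrow> 'k) set" where
  "coeffs U w = {c. range c \<subseteq> carrier K \<and> finite {i. c i \<noteq> \<zero>\<^bsub>K\<^esub>}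
     \<and> {i. c i \<noteq> \<zero>\<^bsub>K\<^esub>} \<subseteq> {(u, \<mu>). u \<in> U \<and> awalk u \<mu> w}}"

definition pev :: "('v \<times> 'e list \<Rightarrow> 'k) \<Rightarrow> 'a" where
  "pev c = (\<Oplus>i\<in>{i. c i \<noteq> \<zero>\<^bsub>K\<^esub>}. c i \<odot> pth (fst i) (snd i))"

lemma coeffs_closed: "c \<in> coeffs U w \<Longrightarrow> c i \<in> carrier K"
  by (auto simp: coeffs_def)

lemma coeffs_walk: "c \<in> coeffs U w \<Longrightarrow> c i \<noteq> \<zero>\<^bsub>K\<^esub> \<Longrightarrow> fst i \<in> U \<and> awalk (fst i) (snd i) w"
  by (auto simp: coeffs_def)

lemma coeffs_finite: "c \<in> coeffs U w \<Longrightarrow> finite {i. c i \<noteq> \<zero>\<^bsub>K\<^esub>}"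
  by (auto simp: coeffs_def)

lemma coeffs_term: "c \<in> coeffs U w \<Longrightarrow> c i \<noteq> \<zero>\<^bsub>K\<^esub> \<Longrightarrow> pth (fst i) (snd i) \<in> carrier A"
  using coeffs_walk pth_closed by blast

lemma pev_closed: "c \<in> coeffs U w \<Longrightarrow> pev c \<in> carrier A"
  unfolding pev_def using coeffs_closed coeffs_term by (intro M.finsum_closed') auto

lemma pev_superset:
  assumes "c \<in> coeffs U w" "finite X" "{i. c i \<noteq> \<zero>\<^bsub>K\<^esub>} \<subseteq> X"
    and "\<And>i. i \<in> X \<Longrightarrow> pth (fst i) (snd i) \<in> carrier A"
  shows "pev c = (\<Oplus>i\<in>X. c i \<odot> pth (fst i) (snd i))"
proof -
  have "c i \<odot> pth (fst i) (snd i) \<in> carrier A" if "i \<in> X" for i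
    using assms(4)[OF that] coeffs_closed[OF assms(1)] by auto
  then show ?thesis unfolding pev_def using assms
    by (intro M.add.finprod_mono_neutral_cong_left) auto
qed

lemma coeffs_add:
  assumes "c \<in> coeffs U w" "d \<in> coeffs U w"
  shows "(\<lambda>i. c i \<oplus>\<^bsub>K\<^esub> d i) \<in> coeffs U w"
proof -
  have cl: "c i \<in> carrier K" "d i \<in> carrier K" for i using assms coeffs_closed by blast+
  have sub: "{i. c i \<oplus>\<^bsub>K\<^esub> d i \<noteq> \<zero>\<^bsub>K\<^esub>} \<subseteq> {i. c i \<noteq> \<zero>\<^bsub>K\<^esub>} \<union> {i. d i \<noteq> \<zero>\<^bsub>K\<^esub>}"
    by auto
  have "finite {i. c i \<oplus>\<^bsub>K\<^esub> d i \<noteq> \<zero>\<^bsub>K\<^esub>}"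
    using sub coeffs_finite[OF assms(1)] coeffs_finite[OF assms(2)] by (auto intro: finite_subset)
  then show ?thesis
    using sub assms cl unfolding coeffs_def by blast
qed

lemma coeffs_smult:
  assumes "c \<in> coeffs U w" "a \<in> carrier K"
  shows "(\<lambda>i. a \<otimes>\<^bsub>K\<^esub> c i) \<in> coeffs U w"
proof -
  have cl: "c i \<in> carrier K" for i using assms coeffs_closed by blast
  have sub: "{i. a \<otimes>\<^bsub>K\<^esub> c i \<noteq> \<zero>\<^bsub>K\<^esub>} \<subseteq> {i. c i \<noteq> \<zero>\<^bsub>K\<^esub>}"
    using assms by auto
  then have "finite {i. a \<otimes>\<^bsub>K\<^esub> c i \<noteq> \<zero>\<^bsub>K\<^esub>}"
    using coeffs_finite[OF assms(1)] by (rule finite_subset)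
  then show ?thesis
    using sub assms cl unfolding coeffs_def by blast
qed

lemma pev_add:
  assumes "c \<in> coeffs U w" "d \<in> coeffs U w"
  shows "pev (\<lambda>i. c i \<oplus>\<^bsub>K\<^esub> d i) = pev c \<oplus> pev d"
proof -
  let ?S = "{i. c i \<noteq> \<zero>\<^bsub>K\<^esub>} \<union> {i. d i \<noteq> \<zero>\<^bsub>K\<^esub>}"
  have cl: "c i \<in> carrier K" "d i \<in> carrier K" for i using assms coeffs_closed by blast+
  have S: "finite ?S" using assms coeffs_finite by blast
  have t: "pth (fst i) (snd i) \<in> carrier A" if "i \<in> ?S" for i using that assms coeffs_term by blast
  have "pev (\<lambda>i. c i \<oplus>\<^bsub>K\<^esub> d i) = (\<Oplus>i\<in>?S. (c i \<oplus>\<^bsub>K\<^esub> d i) \<odot> pth (fst i) (snd i))"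
    by (rule pev_superset[OF coeffs_add[OF assms] S _ t]) auto
  also have "\<dots> = (\<Oplus>i\<in>?S. c i \<odot> pth (fst i) (snd i) \<oplus> d i \<odot> pth (fst i) (snd i))"
    using cl t by (intro M.finsum_cong' Pi_I) (simp_all add: smult_l_distr)
  also have "\<dots> = (\<Oplus>i\<in>?S. c i \<odot> pth (fst i) (snd i)) \<oplus> (\<Oplus>i\<in>?S. d i \<odot> pth (fst i) (snd i))"
    using cl t by (intro M.finsum_addf Pi_I) simp_all
  also have "\<dots> = pev c \<oplus> pev d"
    using pev_superset[OF assms(1) S _ t] pev_superset[OF assms(2) S _ t] by auto
  finally show ?thesis .
qed

lemma pev_smult:
  assumes "c \<in> coeffs U w" "a \<in> carrier K"
  shows "pev (\<lambda>i. a \<otimes>\<^bsub>K\<^esub> c i) = a \<odot> pev c"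
proof -
  let ?S = "{i. c i \<noteq> \<zero>\<^bsub>K\<^esub>}"
  have cl: "c i \<in> carrier K" for i using assms coeffs_closed by blast
  have S: "finite ?S" using assms coeffs_finite by blast
  have t: "pth (fst i) (snd i) \<in> carrier A" if "i \<in> ?S" for i using that assms coeffs_term by blast
  have "pev (\<lambda>i. a \<otimes>\<^bsub>K\<^esub> c i) = (\<Oplus>i\<in>?S. (a \<otimes>\<^bsub>K\<^esub> c i) \<odot> pth (fst i) (snd i))"
    using assms by (intro pev_superset[OF coeffs_smult[OF assms] S _ t]) auto
  also have "\<dots> = (\<Oplus>i\<in>?S. a \<odot> (c i \<odot> pth (fst i) (snd i)))"
    using cl t assms by (intro M.finsum_cong' Pi_I) (simp_all add: smult_assoc1)
  also have "\<dots> = a \<odot> pev c"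
    unfolding pev_def using cl t assms S by (intro finsum_smult_ldistr[symmetric] Pi_I) simp_all
  finally show ?thesis .
qed

lemma polynomial_coeffs:
  assumes "a \<in> polynomials U w"
  shows "\<exists>c\<in>coeffs U w. a = pev c"
  using assms unfolding polynomials_def
proof (induct rule: lin.induct)
  case lin_zero
  have "(\<lambda>_. \<zero>\<^bsub>K\<^esub>) \<in> coeffs U w" by (auto simp: coeffs_def)
  then show ?case by (auto simp: pev_def intro!: bexI[of _ "\<lambda>_. \<zero>\<^bsub>K\<^esub>"])
next
  case (lin_step a s x)
  then obtain c where c: "c \<in> coeffs U w" "x = pev c" by blast
  obtain u \<mu> where s: "s = pth u \<mu>" "u \<in> U" "awalk u \<mu> w"
    using lin_step by (auto simp: monomials_def)
  let ?d = "\<lambda>i. if i = (u, \<mu>) then a else \<zero>\<^bsub>K\<^esub>"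
  have d: "?d \<in> coeffs U w"
    using s lin_step by (auto simp: coeffs_def intro: finite_subset[of _ "{(u, \<mu>)}"])
  moreover have "pev ?d = a \<odot> s"
    using s lin_step pth_closed[OF s(3)] by (subst pev_superset[OF d, of "{(u, \<mu>)}"]) auto
  ultimately have "a \<odot> s \<oplus> x = pev (\<lambda>i. ?d i \<oplus>\<^bsub>K\<^esub> c i)" using c pev_add[OF d c(1)] by simp
  then show ?case using coeffs_add[OF d c(1)] by blast
qed

subsection \<open>Words in the generators span the same space as the path pairs\<close>

text \<open>Left multiplication by an edge prolongs the path; by a ghost edge it shortens the path, and if
  the path is empty it prolongs the second factor instead.\<close>

lemma path_pairs_edge:
  assumes "x \<in> generators E" "s \<in> path_pairs (verts E) w"
  shows "g x \<otimes> s \<in> lin (path_pairs (verts E) w)"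
proof -
  obtain u \<mu> \<nu> z where s: "s = pth u \<mu> \<otimes> gst w \<nu>" "u \<in> verts E" "awalk u \<mu> z" "awalk w \<nu> z"
    using assms by (auto simp: path_pairs_def)
  note base = lin_base[OF path_pairs_closed]
  have cl: "pth u \<mu> \<in> carrier A" "gst w \<nu> \<in> carrier A" using s pth_closed gst_closed by blast+
  have in_pairs: "pth u' \<mu>' \<otimes> gst w \<nu>' \<in> lin (path_pairs (verts E) w)"
    if "awalk u' \<mu>' z'" "awalk w \<nu>' z'" for u' \<mu>' \<nu>' z'
    using that by (intro base) (auto simp: path_pairs_def dest: awalk_hd_in_verts)
  have other: "P v \<otimes> pth u \<mu> = (if v = u then pth u \<mu> else \<zero>)" if "v \<in> verts E" for v
  proof -
    have "P v \<otimes> pth u \<mu> = (P v \<otimes> P u) \<otimes> pth u \<mu>"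
      using that s cl pth_left[OF s(3)] by (simp add: A.m_assoc)
    then show ?thesis using that s cl pth_left[OF s(3)] by (simp add: vertex_vertex)
  qed
  show ?thesis
  proof (cases x)
    case (Vertex v)
    then have "v \<in> verts E" using assms by (auto simp: generators_def)
    then have "g x \<otimes> s = (if v = u then s else \<zero>)"
      using Vertex s cl other by (simp add: A.m_assoc[symmetric])
    then show ?thesis using assms(2) base lin_zero by auto
  next
    case (Edge e)
    then have e: "e \<in> arcs E" using assms by (auto simp: generators_def)
    have eq: "S e \<otimes> pth u \<mu> = S e \<otimes> (P (head E e) \<otimes> pth u \<mu>)"
      using e cl by (simp add: A.m_assoc[symmetric] edge_head)
    have "S e \<otimes> pth u \<mu> = (if head E e = u then pth (tail E e) (e # \<mu>) else \<zero>)"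
    proof (cases "head E e = u")
      case False
      then show ?thesis using e other[of "head E e"] by (subst eq) simp
    qed simp
    moreover have "g x \<otimes> s = (S e \<otimes> pth u \<mu>) \<otimes> gst w \<nu>"
      using Edge s(1) cl e by (simp add: A.m_assoc)
    ultimately have "g x \<otimes> s = (if head E e = u then pth (tail E e) (e # \<mu>) \<otimes> gst w \<nu> else \<zero>)"
      using cl by (cases "head E e = u") (simp_all only: if_True if_False A.l_null refl)
    moreover have "awalk (tail E e) (e # \<mu>) z" if "head E e = u"
      using that s e by (auto simp: awalk_Cons_iff)
    ultimately show ?thesis using in_pairs[OF _ s(4)] lin_zero
      by (cases "head E e = u") (simp_all del: pth.simps)
  next
    case (Ghost e)
    then have e: "e \<in> arcs E" using assms by (auto simp: generators_def)
    show ?thesis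
    proof (cases \<mu>)
      case Nil
      then have u: "u = z" using s by (auto simp: awalk_Nil_iff)
      have "T e \<otimes> s = (T e \<otimes> P (tail E e)) \<otimes> (P u \<otimes> gst w \<nu>)"
        using Nil s e cl by (simp add: ghost_tail)
      also have "\<dots> = T e \<otimes> ((P (tail E e) \<otimes> P u) \<otimes> gst w \<nu>)"
        using s e cl by (simp add: A.m_assoc)
      finally have Ts: "T e \<otimes> s = (if tail E e = u then T e \<otimes> gst w \<nu> else \<zero>)"
        using s e cl u gst_left[OF s(4)] by (simp add: vertex_vertex)
      show ?thesis
      proof (cases "tail E e = u")
        case True
        have w: "awalk z [e] (head E e)" using True e u by (auto simp: awalk_Cons_iff awalk_Nil_iff)
        then have "gst w (\<nu> @ [e]) = T e \<otimes> gst w \<nu>"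
          using gst_append[OF s(4) w] e cl by (simp add: head_ghost)
        moreover have "awalk w (\<nu> @ [e]) (head E e)" using s w by (auto intro: awalk_appendI)
        moreover then have "P (head E e) \<otimes> gst w (\<nu> @ [e]) = gst w (\<nu> @ [e])" by (rule gst_left)
        moreover have "awalk (head E e) [] (head E e)" using e by (auto simp: awalk_Nil_iff)
        ultimately show ?thesis
          using in_pairs[of "head E e" "[]" "head E e" "\<nu> @ [e]"] Ts True Ghost by simp
      qed (use Ts Ghost lin_zero in simp)
    next
      case (Cons f \<mu>')
      then have f: "f \<in> arcs E" "u = tail E f" "awalk (head E f) \<mu>' z"
        using s by (auto simp: awalk_Cons_iff)
      have "T e \<otimes> s = (T e \<otimes> S f) \<otimes> (pth (head E f) \<mu>' \<otimes> gst w \<nu>)"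
        using Cons s e f cl pth_closed[OF f(3)] by (simp add: A.m_assoc)
      also have "\<dots> = (if e = f then pth (head E f) \<mu>' \<otimes> gst w \<nu> else \<zero>)"
        using e f cl pth_closed[OF f(3)] pth_left[OF f(3)]
        by (simp add: ghost_edge A.m_assoc[symmetric])
      finally show ?thesis using in_pairs[OF f(3) s(4)] Ghost lin_zero by auto
    qed
  qed
qed

lemma wprod_span:
  assumes "x \<in> lists (generators E)" "w \<in> verts E"
  shows "wprod g x \<otimes> P w \<in> lin (path_pairs (verts E) w)"
  using assms(1)
proof induct
  case Nil
  have "P w \<otimes> P w \<in> path_pairs (verts E) w"
    unfolding path_pairs_def using assms(2)
    by (intro CollectI exI[of _ w] exI[of _ "[]"]) (auto simp: awalk_Nil_iff)
  then show ?case using assms(2) lin_base[OF path_pairs_closed] by fastforce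
next
  case (Cons y x)
  have cl: "g y \<in> carrier A" "wprod g x \<in> carrier A"
    using Cons wprod_closed[of g "generators E" x] by (auto simp: g_closed)
  have "g y \<otimes> (wprod g x \<otimes> P w) \<in> lin (path_pairs (verts E) w)"
  proof (rule lin_mult_left[OF path_pairs_closed path_pairs_closed cl(1) Cons.hyps(3)])
    fix s assume "s \<in> path_pairs (verts E) w"
    then show "g y \<otimes> s \<in> lin (path_pairs (verts E) w)" by (rule path_pairs_edge[OF Cons.hyps(1)])
  qed
  then show ?case using cl assms by (simp add: A.m_assoc)
qed

lemma path_pairs_vertex:
  assumes "u \<in> verts E" "w \<in> verts E" "x \<in> lin (path_pairs (verts E) w)"
  shows "P u \<otimes> x \<in> lin (path_pairs {u} w)"
proof (rule lin_mult_left[OF path_pairs_closed path_pairs_closed _ assms(3)])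
  fix s assume "s \<in> path_pairs (verts E) w"
  then obtain u' \<mu> \<nu> z where s: "s = pth u' \<mu> \<otimes> gst w \<nu>" "u' \<in> verts E" "awalk u' \<mu> z" "awalk w \<nu> z"
    by (auto simp: path_pairs_def)
  have cl: "pth u' \<mu> \<in> carrier A" "gst w \<nu> \<in> carrier A" using s pth_closed gst_closed by blast+
  have "P u \<otimes> s = (P u \<otimes> P u') \<otimes> (pth u' \<mu> \<otimes> gst w \<nu>)"
    using s cl assms(1) pth_left[OF s(3)] by (simp add: A.m_assoc left_absorb)
  then have "P u \<otimes> s = (if u = u' then s else \<zero>)"
    using s cl assms(1) pth_left[OF s(3)] by (simp add: vertex_vertex left_absorb)
  moreover have "s \<in> path_pairs {u} w" if "u = u'" using s that by (auto simp: path_pairs_def)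
  ultimately show "P u \<otimes> s \<in> lin (path_pairs {u} w)"
    using lin_base[OF path_pairs_closed] lin_zero by auto
qed (use assms in auto)

end

text \<open>The vertices need not add up to the identity of \<open>A\<close>, so that a single algebra can
  carry systems for several graphs. The two conditions are what the uniqueness argument
  \<open>family_iso\<close> needs: independence for injectivity and spanning for surjectivity.\<close>

locale leavitt_system = leavitt_family A K E g
  for A :: "('k, 'a, 'm) module_scheme" (structure) and K :: "('k, 'r) ring_scheme" (structure)
    and E :: "('v, 'e) pre_digraph" and g :: "('v, 'e) generator \<Rightarrow> 'a" +
  assumes verts_nonempty: "verts E \<noteq> {}"
    and indep: "lin_indep (\<lambda>(v, \<mu>). pth v \<mu>) {(v, \<mu>). \<exists>w. awalk v \<mu> w}"
    and span: "\<lbrakk>u \<in> verts E; w \<in> verts E; a \<in> carrier A\<rbrakk>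
      \<Longrightarrow> P u \<otimes> a \<otimes> P w \<in> lin (path_pairs {u} w)"
begin

lemma pev_zero:
  assumes "c \<in> coeffs U w" "pev c = \<zero>"
  shows "c i = \<zero>\<^bsub>K\<^esub>"
proof (rule ccontr)
  assume "c i \<noteq> \<zero>\<^bsub>K\<^esub>"
  moreover have "finite {i. c i \<noteq> \<zero>\<^bsub>K\<^esub>} \<and> {i. c i \<noteq> \<zero>\<^bsub>K\<^esub>} \<subseteq> {(v, \<mu>). \<exists>w. awalk v \<mu> w} \<and>
      c \<in> {i. c i \<noteq> \<zero>\<^bsub>K\<^esub>} \<rightarrow> carrier K \<and>
      (\<Oplus>i\<in>{i. c i \<noteq> \<zero>\<^bsub>K\<^esub>}. c i \<odot> (case i of (v, \<mu>) \<Rightarrow> pth v \<mu>)) = \<zero>"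
    using assms by (auto simp: coeffs_def pev_def case_prod_unfold)
  then have "\<forall>i\<in>{i. c i \<noteq> \<zero>\<^bsub>K\<^esub>}. c i = \<zero>\<^bsub>K\<^esub>"
    using indep unfolding lin_indep_def by blast
  ultimately show False by blast
qed

lemma span_tame': "\<lbrakk>u \<in> verts E; w \<in> verts E; a \<in> carrier A\<rbrakk> \<Longrightarrow> \<exists>m. P u \<otimes> a \<otimes> P w \<in> tame m {u} w"
  using span span_tame by blast

end

locale leavitt_hom = Q: leavitt_family Q K E h + A: leavitt_family A K E g
  for Q :: "('k, 'q, 'n) module_scheme" and A :: "('k, 'a, 'm) module_scheme"
    and K :: "('k, 'r) ring_scheme" and E :: "('v, 'e) pre_digraph" and h g +
  fixes \<phi> :: "'q \<Rightarrow> 'a"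
  assumes hom_closed: "x \<in> carrier Q \<Longrightarrow> \<phi> x \<in> carrier A"
    and hom_mult: "\<lbrakk>x \<in> carrier Q; y \<in> carrier Q\<rbrakk> \<Longrightarrow> \<phi> (x \<otimes>\<^bsub>Q\<^esub> y) = \<phi> x \<otimes>\<^bsub>A\<^esub> \<phi> y"
    and hom_add: "\<lbrakk>x \<in> carrier Q; y \<in> carrier Q\<rbrakk> \<Longrightarrow> \<phi> (x \<oplus>\<^bsub>Q\<^esub> y) = \<phi> x \<oplus>\<^bsub>A\<^esub> \<phi> y"
    and hom_smult: "\<lbrakk>c \<in> carrier K; x \<in> carrier Q\<rbrakk> \<Longrightarrow> \<phi> (c \<odot>\<^bsub>Q\<^esub> x) = c \<odot>\<^bsub>A\<^esub> \<phi> x"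
    and hom_generator: "z \<in> generators E \<Longrightarrow> \<phi> (h z) = g z"
begin

lemma hom_zero: "\<phi> \<zero>\<^bsub>Q\<^esub> = \<zero>\<^bsub>A\<^esub>"
  using hom_smult[of "\<zero>\<^bsub>K\<^esub>" "\<zero>\<^bsub>Q\<^esub>"] hom_closed[of "\<zero>\<^bsub>Q\<^esub>"] by simp

lemma hom_finsum:
  assumes "finite I" "\<And>i. i \<in> I \<Longrightarrow> x i \<in> carrier Q"
  shows "\<phi> (\<Oplus>\<^bsub>Q\<^esub>i\<in>I. x i) = (\<Oplus>\<^bsub>A\<^esub>i\<in>I. \<phi> (x i))"
  using assms
proof (induct I)
  case (insert i I)
  then have "x \<in> I \<rightarrow> carrier Q" "(\<lambda>i. \<phi> (x i)) \<in> I \<rightarrow> carrier A" using hom_closed by auto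
  then show ?case using insert by (simp add: hom_closed hom_add)
qed (simp add: hom_zero)

lemma hom_vertex: "v \<in> verts E \<Longrightarrow> \<phi> (h (Vertex v)) = g (Vertex v)"
  using hom_generator by (auto simp: generators_def)

lemma hom_edge: "e \<in> arcs E \<Longrightarrow> \<phi> (h (Edge e)) = g (Edge e)"
  and hom_ghost: "e \<in> arcs E \<Longrightarrow> \<phi> (h (Ghost e)) = g (Ghost e)"
  using hom_generator by (auto simp: generators_def)

lemma hom_unit: "\<phi> Q.unit = A.unit"
  unfolding Q.unit_def A.unit_def by (subst hom_finsum) (auto simp: hom_vertex intro!: A.M.finsum_cong')

lemma hom_pth: "Q.awalk u \<mu> w \<Longrightarrow> \<phi> (Q.pth u \<mu>) = A.pth u \<mu>"
proof (induct \<mu> arbitrary: u)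
  case (Cons e \<mu>)
  then have *: "Q.awalk (head E e) \<mu> w" "e \<in> arcs E" by (auto simp: Q.awalk_Cons_iff)
  then show ?case using Cons(1) Q.pth_closed by (auto simp: hom_mult hom_edge)
qed (auto simp: Q.awalk_Nil_iff hom_vertex)

lemma hom_gst: "Q.awalk u \<mu> w \<Longrightarrow> \<phi> (Q.gst u \<mu>) = A.gst u \<mu>"
proof (induct \<mu> arbitrary: u)
  case (Cons e \<mu>)
  then have *: "Q.awalk (head E e) \<mu> w" "e \<in> arcs E" by (auto simp: Q.awalk_Cons_iff)
  then show ?case using Cons(1) Q.gst_closed by (auto simp: hom_mult hom_ghost)
qed (auto simp: Q.awalk_Nil_iff hom_vertex)

end

text \<open>On polynomials the homomorphism is injective because the paths in \<open>A\<close> are independent. It is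
  then injective on tame elements, because an element that is killed stays killed after right
  multiplication by edges, and an element with vanishing products with all edges vanishes.\<close>

lemma family_iso:
  assumes hom: "leavitt_hom Q A K E h g \<phi>"
    and spanQ: "\<And>u w a. \<lbrakk>u \<in> verts E; w \<in> verts E; a \<in> carrier Q\<rbrakk>
      \<Longrightarrow> h (Vertex u) \<otimes>\<^bsub>Q\<^esub> a \<otimes>\<^bsub>Q\<^esub> h (Vertex w)
        \<in> unital_algebra.lin K Q (leavitt_family.path_pairs Q E h {u} w)"
    and A: "leavitt_system A K E g"
  shows "\<phi> \<in> alg_iso K (corner Q (leavitt_family.unit Q E h)) (corner A (leavitt_family.unit A E g))"
proof -
  interpret leavitt_hom Q A K E h g \<phi> by (rule hom)
  interpret A: leavitt_system A K E g by (rule A)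
  let ?CQ = "corner Q Q.unit" and ?CA = "corner A A.unit"
  note \<phi> = hom_closed hom_mult hom_add hom_smult hom_generator
  note zero = hom_zero and sum = hom_finsum and gen = hom_vertex and gen' = hom_edge hom_ghost
    and unit = hom_unit and pth = hom_pth and gst = hom_gst
  have pev: "\<phi> (Q.pev c) = A.pev c" if "c \<in> Q.coeffs U w" for c U w
  proof -
    have i: "c i \<in> carrier K \<and> Q.pth (fst i) (snd i) \<in> carrier Q
        \<and> \<phi> (Q.pth (fst i) (snd i)) = A.pth (fst i) (snd i) \<and> A.pth (fst i) (snd i) \<in> carrier A"
      if "c i \<noteq> \<zero>\<^bsub>K\<^esub>" for i
      using that Q.coeffs_closed[OF \<open>c \<in> Q.coeffs U w\<close>] Q.coeffs_walk[OF \<open>c \<in> Q.coeffs U w\<close> that]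
        Q.pth_closed pth A.pth_closed by blast
    have "\<phi> (Q.pev c) = (\<Oplus>\<^bsub>A\<^esub>i\<in>{i. c i \<noteq> \<zero>\<^bsub>K\<^esub>}. \<phi> (c i \<odot>\<^bsub>Q\<^esub> Q.pth (fst i) (snd i)))"
      unfolding Q.pev_def using i by (intro sum Q.coeffs_finite[OF that]) simp
    also have "\<dots> = A.pev c"
      unfolding A.pev_def using i by (intro A.M.finsum_cong' Pi_I) (simp_all add: \<phi>(4))
    finally show ?thesis .
  qed
  have inj_tame: "a = \<zero>\<^bsub>Q\<^esub>" if "a \<in> Q.tame m U w" "w \<in> verts E" "\<phi> a = \<zero>\<^bsub>A\<^esub>" for a m U w
    using that
  proof (induct m arbitrary: a w)
    case 0
    then obtain c where c: "c \<in> Q.coeffs U w" "a = Q.pev c"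
      using Q.polynomial_coeffs[of a U w] by auto
    then have "c = (\<lambda>_. \<zero>\<^bsub>K\<^esub>)"
      using A.pev_zero[of c U w] pev[OF c(1)] 0 by auto
    then show ?case using c by (simp add: Q.pev_def)
  next
    case (Suc m)
    show ?case
    proof (cases "out_arcs E w = {}")
      case True
      then obtain c where c: "c \<in> Q.coeffs U w" "a = Q.pev c"
        using Q.polynomial_coeffs[of a U w] Suc.prems by auto
      then have "c = (\<lambda>_. \<zero>\<^bsub>K\<^esub>)"
        using A.pev_zero[of c U w] pev[OF c(1)] Suc.prems by auto
      then show ?thesis using c by (simp add: Q.pev_def)
    next
      case False
      have cl: "a \<in> carrier Q" "a \<otimes>\<^bsub>Q\<^esub> h (Vertex w) = a" using Q.tame_closed[OF Suc.prems(2,1)] by auto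
      have "a \<otimes>\<^bsub>Q\<^esub> h (Edge e) = \<zero>\<^bsub>Q\<^esub>" if "e \<in> out_arcs E w" for e
        using that Suc.prems False cl by (intro Suc.hyps[of _ "head E e"]) (auto simp: \<phi>(2) gen')
      then show ?thesis using cl Suc.prems False by (intro Q.cancel_edges[of a w])
    qed
  qed
  have inj0: "x = \<zero>\<^bsub>Q\<^esub>" if x: "x \<in> carrier ?CQ" "\<phi> x = \<zero>\<^bsub>A\<^esub>" for x
  proof -
    have cl: "x \<in> carrier Q" "Q.unit \<otimes>\<^bsub>Q\<^esub> x = x" "x \<otimes>\<^bsub>Q\<^esub> Q.unit = x"
      using x Q.corner_carrier[OF Q.unit_closed Q.unit_idem] by auto
    have uw: "h (Vertex u) \<otimes>\<^bsub>Q\<^esub> x \<otimes>\<^bsub>Q\<^esub> h (Vertex w) = \<zero>\<^bsub>Q\<^esub>" if uw: "u \<in> verts E" "w \<in> verts E" for u w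
    proof -
      obtain m where "h (Vertex u) \<otimes>\<^bsub>Q\<^esub> x \<otimes>\<^bsub>Q\<^esub> h (Vertex w) \<in> Q.tame m {u} w"
        using Q.span_tame[OF spanQ[OF uw cl(1)] uw(2)] by blast
      then show ?thesis
        using that cl x by (intro inj_tame[of _ m "{u}" w]) (auto simp: \<phi>(2) gen)
    qed
    have "h (Vertex u) \<otimes>\<^bsub>Q\<^esub> x = \<zero>\<^bsub>Q\<^esub>" if "u \<in> verts E" for u
    proof -
      have "h (Vertex u) \<otimes>\<^bsub>Q\<^esub> x = (\<Oplus>\<^bsub>Q\<^esub>w\<in>verts E. h (Vertex u) \<otimes>\<^bsub>Q\<^esub> x \<otimes>\<^bsub>Q\<^esub> h (Vertex w))"
        using that cl by (intro Q.corner_decomp_right) (auto simp: Q.A.m_assoc)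
      also have "\<dots> = \<zero>\<^bsub>Q\<^esub>" using uw that by (intro Q.M.finsum_neutral) auto
      finally show ?thesis .
    qed
    then have "(\<Oplus>\<^bsub>Q\<^esub>u\<in>verts E. h (Vertex u) \<otimes>\<^bsub>Q\<^esub> x) = \<zero>\<^bsub>Q\<^esub>"
      by (intro Q.M.finsum_neutral) auto
    then show ?thesis using Q.corner_decomp[OF cl(1,2)] by simp
  qed
  interpret CQ: unital_algebra K ?CQ by (rule Q.corner_unital_algebra[OF Q.unit_closed Q.unit_idem])
  interpret CA: unital_algebra K ?CA by (rule A.corner_unital_algebra[OF A.unit_closed A.unit_idem])
  note cQ = Q.corner_carrier[OF Q.unit_closed Q.unit_idem]
    and cA = A.corner_carrier[OF A.unit_closed A.unit_idem]
  have hom_corner: "\<phi> x \<in> carrier ?CA" if "x \<in> carrier ?CQ" for x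
  proof -
    have x: "x \<in> carrier Q" "Q.unit \<otimes>\<^bsub>Q\<^esub> x = x" "x \<otimes>\<^bsub>Q\<^esub> Q.unit = x" using that cQ by auto
    show ?thesis unfolding cA
      using \<phi>(2)[OF Q.unit_closed x(1)] \<phi>(2)[OF x(1) Q.unit_closed] x \<phi>(1) unit by simp
  qed
  have inj: "inj_on \<phi> (carrier ?CQ)"
  proof (rule inj_onI)
    fix x y assume xy: "x \<in> carrier ?CQ" "y \<in> carrier ?CQ" "\<phi> x = \<phi> y"
    let ?z = "x \<oplus>\<^bsub>Q\<^esub> (\<ominus>\<^bsub>K\<^esub> \<one>\<^bsub>K\<^esub>) \<odot>\<^bsub>Q\<^esub> y"
    have cl: "x \<in> carrier Q" "y \<in> carrier Q" using xy cQ by auto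
    have m1: "(\<ominus>\<^bsub>K\<^esub> \<one>\<^bsub>K\<^esub>) \<odot>\<^bsub>Q\<^esub> y = \<ominus>\<^bsub>Q\<^esub> y"
      using cl Q.smult_l_minus[of "\<one>\<^bsub>K\<^esub>" y] by simp
    have m2: "(\<ominus>\<^bsub>K\<^esub> \<one>\<^bsub>K\<^esub>) \<odot>\<^bsub>A\<^esub> \<phi> y = \<ominus>\<^bsub>A\<^esub> \<phi> y"
      using cl A.smult_l_minus[of "\<one>\<^bsub>K\<^esub>" "\<phi> y"] \<phi>(1) by simp
    have "?z \<in> carrier ?CQ"
      using CQ.M.a_closed[OF xy(1) CQ.smult_closed[OF _ xy(2), of "\<ominus>\<^bsub>K\<^esub> \<one>\<^bsub>K\<^esub>"]]
      by (simp add: Q.corner_sel)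
    moreover have "\<phi> ?z = \<zero>\<^bsub>A\<^esub>"
      using cl xy \<phi>(1) m2 by (simp add: \<phi>(3,4) A.M.r_neg)
    ultimately have "?z = \<zero>\<^bsub>Q\<^esub>" by (rule inj0)
    then have "x \<oplus>\<^bsub>Q\<^esub> \<ominus>\<^bsub>Q\<^esub> y = \<zero>\<^bsub>Q\<^esub>" using m1 by simp
    then show "x = y" using cl by (metis Q.M.minus_equality Q.M.minus_minus Q.M.a_inv_closed Q.M.add.inv_equality)
  qed
  have surj0: "a \<in> \<phi> ` carrier Q" if "a \<in> A.lin (A.path_pairs U w)" for a U w
    using that
  proof induct
    case lin_zero
    then show ?case using zero by (intro image_eqI[of _ _ "\<zero>\<^bsub>Q\<^esub>"]) auto
  next
    case (lin_step c s x)
    then obtain y where y: "y \<in> carrier Q" "x = \<phi> y" by blast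
    obtain u \<mu> \<nu> z where s: "s = A.pth u \<mu> \<otimes>\<^bsub>A\<^esub> A.gst w \<nu>" "Q.awalk u \<mu> z" "Q.awalk w \<nu> z"
      using lin_step by (auto simp: A.path_pairs_def)
    have cl: "Q.pth u \<mu> \<in> carrier Q" "Q.gst w \<nu> \<in> carrier Q"
      using s Q.pth_closed Q.gst_closed by blast+
    have "c \<odot>\<^bsub>A\<^esub> s \<oplus>\<^bsub>A\<^esub> x = \<phi> (c \<odot>\<^bsub>Q\<^esub> (Q.pth u \<mu> \<otimes>\<^bsub>Q\<^esub> Q.gst w \<nu>) \<oplus>\<^bsub>Q\<^esub> y)"
      using s cl y lin_step by (simp add: \<phi>(2,3,4) pth[OF s(2)] gst[OF s(3)])
    then show ?case using cl y lin_step by blast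
  qed
  have surj: "\<phi> ` carrier ?CQ = carrier ?CA"
  proof
    show "carrier ?CA \<subseteq> \<phi> ` carrier ?CQ"
    proof
      fix a assume "a \<in> carrier ?CA"
      then have a: "a \<in> carrier A" "A.unit \<otimes>\<^bsub>A\<^esub> a = a" "a \<otimes>\<^bsub>A\<^esub> A.unit = a" using cA by auto
      have "\<exists>x\<in>carrier Q. \<phi> x = g (Vertex u) \<otimes>\<^bsub>A\<^esub> a \<otimes>\<^bsub>A\<^esub> g (Vertex w)"
        if "u \<in> verts E" "w \<in> verts E" for u w
        using surj0[OF A.span[OF that a(1)]] by (metis imageE)
      then obtain x where x: "\<And>u w. \<lbrakk>u \<in> verts E; w \<in> verts E\<rbrakk> \<Longrightarrow> x u w \<in> carrier Q
          \<and> \<phi> (x u w) = g (Vertex u) \<otimes>\<^bsub>A\<^esub> a \<otimes>\<^bsub>A\<^esub> g (Vertex w)"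
        by metis
      define y where "y = (\<Oplus>\<^bsub>Q\<^esub>u\<in>verts E. \<Oplus>\<^bsub>Q\<^esub>w\<in>verts E. x u w)"
      have y: "y \<in> carrier Q" unfolding y_def using x by (intro Q.M.finsum_closed') auto
      have "\<phi> y = (\<Oplus>\<^bsub>A\<^esub>u\<in>verts E. \<Oplus>\<^bsub>A\<^esub>w\<in>verts E. \<phi> (x u w))"
        unfolding y_def using x \<phi>(1)
        by (subst sum) (auto intro!: Q.M.finsum_closed' A.M.finsum_closed' A.M.finsum_cong' sum)
      also have "\<dots> = (\<Oplus>\<^bsub>A\<^esub>u\<in>verts E. g (Vertex u) \<otimes>\<^bsub>A\<^esub> a)"
      proof (rule A.M.finsum_cong')
        fix u assume u: "u \<in> verts E"
        have "(\<Oplus>\<^bsub>A\<^esub>w\<in>verts E. \<phi> (x u w))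
            = (\<Oplus>\<^bsub>A\<^esub>w\<in>verts E. g (Vertex u) \<otimes>\<^bsub>A\<^esub> a \<otimes>\<^bsub>A\<^esub> g (Vertex w))"
          using x u a by (intro A.M.finsum_cong') auto
        also have "\<dots> = g (Vertex u) \<otimes>\<^bsub>A\<^esub> a"
          using u a by (intro A.corner_decomp_right[symmetric]) (auto simp: A.A.m_assoc)
        finally show "(\<Oplus>\<^bsub>A\<^esub>w\<in>verts E. \<phi> (x u w)) = g (Vertex u) \<otimes>\<^bsub>A\<^esub> a" .
      qed (use a in auto)
      also have "\<dots> = a" using A.corner_decomp[OF a(1,2)] by simp
      finally have "\<phi> y = a" .
      then have "\<phi> (Q.unit \<otimes>\<^bsub>Q\<^esub> y \<otimes>\<^bsub>Q\<^esub> Q.unit) = a" using y a unit by (simp add: \<phi>(2))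
      moreover have "Q.unit \<otimes>\<^bsub>Q\<^esub> y \<otimes>\<^bsub>Q\<^esub> Q.unit \<in> carrier ?CQ" using y by (auto simp: corner_def)
      ultimately show "a \<in> \<phi> ` carrier ?CQ" by blast
    qed
  qed (use hom_corner in blast)
  have "\<phi> \<in> ring_hom ?CQ ?CA"
    using hom_corner unit cQ by (intro ring_hom_memI) (auto simp: Q.corner_sel A.corner_sel \<phi>)
  then have "\<phi> \<in> ring_iso ?CQ ?CA"
    using inj surj by (auto simp: ring_iso_def bij_betw_def)
  then show ?thesis
    using cQ by (auto simp: alg_iso_def Q.corner_sel A.corner_sel \<phi>)
qed

section \<open>The Leavitt path algebra as a corner of the quotient of the free algebra\<close>

text \<open>The quotient of the free unital algebra by the same ideal. It has a universal property among all
  unital algebras, with families whose vertices do not add up to the identity; the Leavitt path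
  algebra is recovered as its corner at the sum of the vertices.\<close>

definition presented_algebra ::
    "[('k, 'r) ring_scheme, ('v, 'e) pre_digraph] \<Rightarrow> ('k, (('v, 'e) generator list \<Rightarrow> 'k) set) module"
  where "presented_algebra K E =
    (let F = free_algebra K (generators E); I = Idl\<^bsub>F\<^esub> (path_relators K E) in
    \<lparr>carrier = a_rcosets\<^bsub>F\<^esub> I, mult = mult (F Quot I), one = I +>\<^bsub>F\<^esub> \<one>\<^bsub>F\<^esub>,
     zero = zero (F Quot I), add = add (F Quot I),
     smult = (\<lambda>a C. \<Union>p\<in>C. I +>\<^bsub>F\<^esub> (a \<odot>\<^bsub>F\<^esub> p))\<rparr>)"

locale leavitt_presentation = K: field K + fin_digraph E
  for K :: "('k, 'r) ring_scheme" (structure) and E :: "('v, 'e) pre_digraph"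
begin

abbreviation "X \<equiv> generators E"
abbreviation "F \<equiv> free_algebra K X"
abbreviation "I \<equiv> Idl\<^bsub>F\<^esub> (path_relators K E)"
abbreviation "Q \<equiv> presented_algebra K E"

definition cls :: "(('v, 'e) generator list \<Rightarrow> 'k) \<Rightarrow> (('v, 'e) generator list \<Rightarrow> 'k) set"
  where "cls p = I +>\<^bsub>F\<^esub> p"

sublocale F: unital_algebra K F
  by (rule K.free_algebra_unital_algebra)

lemma words_closed [simp]:
  "v \<in> verts E \<Longrightarrow> word K [Vertex v] \<in> carrier F"
  "v \<in> verts E \<Longrightarrow> w \<in> verts E \<Longrightarrow> word K [Vertex v, Vertex w] \<in> carrier F"
  "e \<in> arcs E \<Longrightarrow> word K [Edge e] \<in> carrier F"
  "e \<in> arcs E \<Longrightarrow> word K [Ghost e] \<in> carrier F"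
  "e \<in> arcs E \<Longrightarrow> word K [Vertex (tail E e), Edge e] \<in> carrier F"
  "e \<in> arcs E \<Longrightarrow> word K [Edge e, Vertex (head E e)] \<in> carrier F"
  "e \<in> arcs E \<Longrightarrow> word K [Vertex (head E e), Ghost e] \<in> carrier F"
  "e \<in> arcs E \<Longrightarrow> word K [Ghost e, Vertex (tail E e)] \<in> carrier F"
  "e \<in> arcs E \<Longrightarrow> f \<in> arcs E \<Longrightarrow> word K [Ghost e, Edge f] \<in> carrier F"
  "e \<in> arcs E \<Longrightarrow> f \<in> arcs E \<Longrightarrow> word K [Edge e, Ghost f] \<in> carrier F"
  by (auto intro!: K.word_closed simp: generators_def)

lemma relators_closed: "path_relators K E \<subseteq> carrier F"
proof -
  have "(\<Oplus>\<^bsub>F\<^esub>e\<in>out_arcs E v. word K [Edge e, Ghost e]) \<in> carrier F" for v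
    by (intro F.M.finsum_closed') auto
  then show ?thesis
    unfolding path_relators_def Let_def
    by (intro Un_least subsetI) (auto intro!: F.M.minus_closed)
qed

lemma ideal_I: "ideal I F"
  by (rule F.A.genideal_ideal[OF relators_closed])

sublocale I: ideal I F
  by (rule ideal_I)

lemma cls_eq_iff: "p \<in> carrier F \<Longrightarrow> q \<in> carrier F \<Longrightarrow> cls p = cls q \<longleftrightarrow> p \<ominus>\<^bsub>F\<^esub> q \<in> I"
  unfolding cls_def using F.A.quotient_eq_iff_same_a_r_cos[OF ideal_I] by blast

lemma relator_cls:
  assumes "p \<ominus>\<^bsub>F\<^esub> q \<in> path_relators K E" "p \<in> carrier F" "q \<in> carrier F"
  shows "cls p = cls q"
  using assms F.A.genideal_self[OF relators_closed] by (auto simp: cls_eq_iff)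

lemma Q_carrier: "carrier Q = cls ` carrier F"
  by (auto simp: presented_algebra_def cls_def A_RCOSETS_def' Let_def)

lemma Q_sel:
  "p \<in> carrier F \<Longrightarrow> q \<in> carrier F \<Longrightarrow> cls p \<oplus>\<^bsub>Q\<^esub> cls q = cls (p \<oplus>\<^bsub>F\<^esub> q)"
  "p \<in> carrier F \<Longrightarrow> q \<in> carrier F \<Longrightarrow> cls p \<otimes>\<^bsub>Q\<^esub> cls q = cls (p \<otimes>\<^bsub>F\<^esub> q)"
  "\<one>\<^bsub>Q\<^esub> = cls \<one>\<^bsub>F\<^esub>"
  "\<zero>\<^bsub>Q\<^esub> = cls \<zero>\<^bsub>F\<^esub>"
  by (simp_all add: presented_algebra_def cls_def Let_def FactRing_def I.rcoset_mult_add I.a_rcos_sum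
      F.M.a_coset_add_zero I.a_subset)

lemma Q_smult:
  assumes "a \<in> carrier K" "p \<in> carrier F"
  shows "a \<odot>\<^bsub>Q\<^esub> cls p = cls (a \<odot>\<^bsub>F\<^esub> p)"
proof -
  have eq: "I +>\<^bsub>F\<^esub> (a \<odot>\<^bsub>F\<^esub> p') = cls (a \<odot>\<^bsub>F\<^esub> p)" if p': "p' \<in> cls p" for p'
  proof -
    obtain i where i: "i \<in> I" "p' = i \<oplus>\<^bsub>F\<^esub> p"
      using p' by (auto simp: cls_def a_r_coset_def r_coset_def)
    have iF: "i \<in> carrier F" using i I.Icarr by blast
    have "a \<odot>\<^bsub>F\<^esub> i = (a \<odot>\<^bsub>F\<^esub> \<one>\<^bsub>F\<^esub>) \<otimes>\<^bsub>F\<^esub> i"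
      using iF assms by (simp add: F.smult_mult_left)
    then have "a \<odot>\<^bsub>F\<^esub> i \<in> I" using i assms by (simp add: I.I_l_closed)
    moreover have "a \<odot>\<^bsub>F\<^esub> p' \<ominus>\<^bsub>F\<^esub> a \<odot>\<^bsub>F\<^esub> p = a \<odot>\<^bsub>F\<^esub> i"
      using i iF assms by (simp add: F.smult_r_distr a_minus_def F.M.a_assoc F.M.r_neg)
    ultimately show ?thesis
      using cls_eq_iff[of "a \<odot>\<^bsub>F\<^esub> p'" "a \<odot>\<^bsub>F\<^esub> p"] i iF assms by (simp add: cls_def)
  qed
  have "p \<in> cls p" using assms I.a_rcos_self by (simp add: cls_def)
  then show ?thesis
    using eq unfolding presented_algebra_def Let_def by auto
qed

lemma cls_carrier: "p \<in> carrier F \<Longrightarrow> cls p \<in> carrier Q"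
  by (simp add: Q_carrier)

lemma Q_unital_algebra: "unital_algebra K Q"
proof -
  have grp: "abelian_group Q"
  proof (rule abelian_groupI)
    fix x assume "x \<in> carrier Q"
    then obtain p where p: "p \<in> carrier F" "x = cls p" by (auto simp: Q_carrier)
    then show "\<exists>y\<in>carrier Q. y \<oplus>\<^bsub>Q\<^esub> x = \<zero>\<^bsub>Q\<^esub>"
      by (intro bexI[of _ "cls (\<ominus>\<^bsub>F\<^esub> p)"]) (auto simp: Q_sel F.M.l_neg cls_carrier)
  qed (auto simp: Q_carrier Q_sel F.M.a_ac)
  have "ring Q"
  proof (rule ringI[OF grp])
    show "monoid Q"
      by (intro monoidI) (auto simp: Q_carrier Q_sel F.A.m_assoc)
  qed (auto simp: Q_carrier Q_sel F.A.l_distr F.A.r_distr)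
  moreover have "module K Q"
    by (intro moduleI K.is_cring grp)
      (auto simp: Q_carrier Q_sel Q_smult F.smult_l_distr F.smult_r_distr F.smult_assoc1)
  ultimately show ?thesis
    by (intro unital_algebra.intro)
      (auto simp: unital_algebra_axioms_def Q_carrier Q_sel Q_smult F.smult_mult_left F.smult_mult_right)
qed

sublocale Q: unital_algebra K Q
  by (rule Q_unital_algebra)

definition canon :: "('v, 'e) generator \<Rightarrow> (('v, 'e) generator list \<Rightarrow> 'k) set" where
  "canon x = cls (word K [x])"

lemma canon_closed: "x \<in> X \<Longrightarrow> canon x \<in> carrier Q"
  unfolding canon_def by (intro cls_carrier K.word_closed) auto

lemma cls_word_append:
  "u \<in> lists X \<Longrightarrow> v \<in> lists X \<Longrightarrow> cls (word K u) \<otimes>\<^bsub>Q\<^esub> cls (word K v) = cls (word K (u @ v))"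
  using K.word_closed[of u X] K.word_closed[of v X] by (simp add: Q_sel K.free_sel K.word_mult)

lemma cls_word: "u \<in> lists X \<Longrightarrow> cls (word K u) = Q.wprod canon u"
proof (induct u)
  case (Cons x u)
  then show ?case using cls_word_append[of "[x]" u] by (simp add: canon_def)
qed (simp add: Q_sel K.free_sel)

lemma cls_finsum:
  assumes "finite J" "\<And>j. j \<in> J \<Longrightarrow> p j \<in> carrier F"
  shows "cls (\<Oplus>\<^bsub>F\<^esub>j\<in>J. p j) = (\<Oplus>\<^bsub>Q\<^esub>j\<in>J. cls (p j))"
  using assms
proof (induct J)
  case (insert j J)
  then have "p \<in> J \<rightarrow> carrier F" "(\<lambda>j. cls (p j)) \<in> J \<rightarrow> carrier Q" by (auto simp: cls_carrier)
  then show ?case using insert by (simp add: cls_carrier flip: Q_sel)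
qed (simp add: Q_sel)

lemma canon_mult: "x \<in> X \<Longrightarrow> y \<in> X \<Longrightarrow> canon x \<otimes>\<^bsub>Q\<^esub> canon y = cls (word K [x, y])"
  unfolding canon_def by (subst cls_word_append) auto

lemma canonical_family: "leavitt_family Q K E canon"
proof (unfold_locales)
  have X: "v \<in> verts E \<Longrightarrow> Vertex v \<in> X" "e \<in> arcs E \<Longrightarrow> Edge e \<in> X" "e \<in> arcs E \<Longrightarrow> Ghost e \<in> X" for v e
    by (auto simp: generators_def)
  note rel = path_relators_def[of K E, unfolded Let_def]
  { fix x assume "x \<in> X" then show "canon x \<in> carrier Q" by (rule canon_closed) }
  { fix v w assume vw: "v \<in> verts E" "w \<in> verts E"
    have "cls (word K [Vertex v, Vertex w]) = cls (if v = w then word K [Vertex w] else \<zero>\<^bsub>F\<^esub>)"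
      using vw by (intro relator_cls) (auto simp: rel)
    then show "canon (Vertex v) \<otimes>\<^bsub>Q\<^esub> canon (Vertex w) = (if v = w then canon (Vertex w) else \<zero>\<^bsub>Q\<^esub>)"
      using vw X by (simp add: canon_mult) (simp add: canon_def Q_sel) }
  { fix e assume e: "e \<in> arcs E"
    have "cls (word K [Vertex (tail E e), Edge e]) = cls (word K [Edge e])"
      using e by (intro relator_cls) (auto simp: rel)
    then show "canon (Vertex (tail E e)) \<otimes>\<^bsub>Q\<^esub> canon (Edge e) = canon (Edge e)"
      using e X by (simp add: canon_mult) (simp add: canon_def)
    have "cls (word K [Edge e, Vertex (head E e)]) = cls (word K [Edge e])"
      using e by (intro relator_cls) (auto simp: rel)
    then show "canon (Edge e) \<otimes>\<^bsub>Q\<^esub> canon (Vertex (head E e)) = canon (Edge e)"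
      using e X by (simp add: canon_mult) (simp add: canon_def)
    have "cls (word K [Vertex (head E e), Ghost e]) = cls (word K [Ghost e])"
      using e by (intro relator_cls) (auto simp: rel)
    then show "canon (Vertex (head E e)) \<otimes>\<^bsub>Q\<^esub> canon (Ghost e) = canon (Ghost e)"
      using e X by (simp add: canon_mult) (simp add: canon_def)
    have "cls (word K [Ghost e, Vertex (tail E e)]) = cls (word K [Ghost e])"
      using e by (intro relator_cls) (auto simp: rel)
    then show "canon (Ghost e) \<otimes>\<^bsub>Q\<^esub> canon (Vertex (tail E e)) = canon (Ghost e)"
      using e X by (simp add: canon_mult) (simp add: canon_def) }
  { fix e f assume e: "e \<in> arcs E" "f \<in> arcs E"
    have "cls (word K [Ghost e, Edge f]) = cls (if e = f then word K [Vertex (head E e)] else \<zero>\<^bsub>F\<^esub>)"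
      using e by (intro relator_cls) (auto simp: rel)
    then show "canon (Ghost e) \<otimes>\<^bsub>Q\<^esub> canon (Edge f) = (if e = f then canon (Vertex (head E e)) else \<zero>\<^bsub>Q\<^esub>)"
      using e X by (simp add: canon_mult) (simp add: canon_def Q_sel) }
  { fix v assume v: "v \<in> verts E" "out_arcs E v \<noteq> {}"
    have "cls (word K [Vertex v]) = cls (\<Oplus>\<^bsub>F\<^esub>e\<in>out_arcs E v. word K [Edge e, Ghost e])"
      using v by (intro relator_cls F.M.finsum_closed') (auto simp: rel)
    also have "\<dots> = (\<Oplus>\<^bsub>Q\<^esub>e\<in>out_arcs E v. cls (word K [Edge e, Ghost e]))"
      by (rule cls_finsum) auto
    also have "\<dots> = (\<Oplus>\<^bsub>Q\<^esub>e\<in>out_arcs E v. canon (Edge e) \<otimes>\<^bsub>Q\<^esub> canon (Ghost e))"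
      using X canon_closed by (intro Q.M.finsum_cong') (auto simp: canon_mult)
    finally show "canon (Vertex v) = (\<Oplus>\<^bsub>Q\<^esub>e\<in>out_arcs E v. canon (Edge e) \<otimes>\<^bsub>Q\<^esub> canon (Ghost e))"
      by (simp add: canon_def) }
qed

sublocale Q: leavitt_family Q K E canon
  by (rule canonical_family)

lemma Q_span:
  assumes "u \<in> verts E" "w \<in> verts E" "a \<in> carrier Q"
  shows "Q.P u \<otimes>\<^bsub>Q\<^esub> a \<otimes>\<^bsub>Q\<^esub> Q.P w \<in> Q.lin (Q.path_pairs {u} w)"
proof -
  obtain p where p: "p \<in> carrier F" "a = cls p" using assms Q_carrier by auto
  from p(1) have "cls p \<otimes>\<^bsub>Q\<^esub> Q.P w \<in> Q.lin (Q.path_pairs (verts E) w)"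
  proof (induct p rule: K.free_algebra_induct)
    case zero
    then show ?case using Q.lin_zero assms by (simp flip: Q_sel(4)[unfolded K.free_sel])
  next
    case (add a u p)
    have u: "word K u \<in> carrier F" using add(2) by (rule K.word_closed)
    have "cls (a \<odot>\<^bsub>F\<^esub> word K u \<oplus>\<^bsub>F\<^esub> p) \<otimes>\<^bsub>Q\<^esub> Q.P w
        = a \<odot>\<^bsub>Q\<^esub> (cls (word K u) \<otimes>\<^bsub>Q\<^esub> Q.P w) \<oplus>\<^bsub>Q\<^esub> cls p \<otimes>\<^bsub>Q\<^esub> Q.P w"
      using add u assms by (simp add: Q.A.l_distr Q.smult_mult_left cls_carrier flip: Q_sel(1) Q_smult)
    moreover have "cls (word K u) \<otimes>\<^bsub>Q\<^esub> Q.P w \<in> Q.lin (Q.path_pairs (verts E) w)"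
      using Q.wprod_span[of u w] add assms by (simp add: cls_word)
    ultimately show ?case using add
      by (simp add: Q.lin_add Q.lin_smult Q.path_pairs_closed)
  qed
  then have "Q.P u \<otimes>\<^bsub>Q\<^esub> (a \<otimes>\<^bsub>Q\<^esub> Q.P w) \<in> Q.lin (Q.path_pairs {u} w)"
    using p assms by (intro Q.path_pairs_vertex) auto
  then show ?thesis using assms by (simp add: Q.A.m_assoc)
qed

definition vertex_sum :: "('v, 'e) generator list \<Rightarrow> 'k" where
  "vertex_sum = (\<Oplus>\<^bsub>F\<^esub>v\<in>verts E. word K [Vertex v])"

lemma vertex_sum_closed: "vertex_sum \<in> carrier F"
  unfolding vertex_sum_def by (intro F.M.finsum_closed') auto

lemma cls_vertex_sum: "cls vertex_sum = Q.unit"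
  unfolding vertex_sum_def Q.unit_def by (subst cls_finsum) (auto simp: canon_def)

lemma vertex_sum_Nil: "vertex_sum [] = \<zero>"
proof -
  have "(\<Oplus>\<^bsub>F\<^esub>v\<in>V. word K [Vertex v]) [] = \<zero>" if "finite V" "V \<subseteq> verts E" for V
    using that
  proof (induct V)
    case (insert v V)
    then have "(\<lambda>v. word K [Vertex v]) \<in> V \<rightarrow> carrier F" by auto
    then show ?case using insert by (simp add: K.free_sel(4)) (simp add: word_def)
  qed (simp add: K.free_sel)
  then show ?thesis unfolding vertex_sum_def by simp
qed

lemma unit_absorbs_word:
  assumes "u \<in> lists X" "u \<noteq> []"
  shows "Q.unit \<otimes>\<^bsub>Q\<^esub> Q.wprod canon u = Q.wprod canon u" "Q.wprod canon u \<otimes>\<^bsub>Q\<^esub> Q.unit = Q.wprod canon u"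
proof -
  have g: "canon \<in> X \<rightarrow> carrier Q" using canon_closed by auto
  obtain x v where "u = x # v" using assms by (cases u) auto
  then show "Q.unit \<otimes>\<^bsub>Q\<^esub> Q.wprod canon u = Q.wprod canon u"
    using assms Q.wprod_closed[OF g] canon_closed
    by (simp add: Q.unit_gen flip: Q.A.m_assoc)
  obtain v' x' where u: "u = v' @ [x']" using assms by (cases u rule: rev_cases) auto
  then have "v' \<in> lists X" "x' \<in> X" using assms by auto
  then show "Q.wprod canon u \<otimes>\<^bsub>Q\<^esub> Q.unit = Q.wprod canon u"
    using u Q.wprod_closed[OF g] canon_closed
    by (simp add: Q.wprod_append[OF g] Q.gen_unit Q.A.m_assoc)
qed

lemma unit_absorbs:
  assumes "p \<in> carrier F" "p [] = \<zero>"
  shows "Q.unit \<otimes>\<^bsub>Q\<^esub> cls p = cls p" "cls p \<otimes>\<^bsub>Q\<^esub> Q.unit = cls p"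
proof -
  have "p [] = \<zero> \<longrightarrow> Q.unit \<otimes>\<^bsub>Q\<^esub> cls p = cls p \<and> cls p \<otimes>\<^bsub>Q\<^esub> Q.unit = cls p"
    using assms(1)
  proof (induct p rule: K.free_algebra_induct)
    case zero
    then show ?case by (simp flip: Q_sel(4)[unfolded K.free_sel])
  next
    case (add a u p)
    have u: "word K u \<in> carrier F" "cls (word K u) \<in> carrier Q" "cls p \<in> carrier Q"
      using K.word_closed[OF add(2)] add(4) cls_carrier by blast+
    have p0: "p [] \<in> carrier K" using add K.free_coeff by blast
    show ?case
    proof
      assume z: "(a \<odot>\<^bsub>F\<^esub> word K u \<oplus>\<^bsub>F\<^esub> p) [] = \<zero>"
      have eq: "cls (a \<odot>\<^bsub>F\<^esub> word K u \<oplus>\<^bsub>F\<^esub> p) = a \<odot>\<^bsub>Q\<^esub> cls (word K u) \<oplus>\<^bsub>Q\<^esub> cls p"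
        using add u by (simp flip: Q_sel Q_smult)
      show "Q.unit \<otimes>\<^bsub>Q\<^esub> cls (a \<odot>\<^bsub>F\<^esub> word K u \<oplus>\<^bsub>F\<^esub> p) = cls (a \<odot>\<^bsub>F\<^esub> word K u \<oplus>\<^bsub>F\<^esub> p) \<and>
        cls (a \<odot>\<^bsub>F\<^esub> word K u \<oplus>\<^bsub>F\<^esub> p) \<otimes>\<^bsub>Q\<^esub> Q.unit = cls (a \<odot>\<^bsub>F\<^esub> word K u \<oplus>\<^bsub>F\<^esub> p)"
      proof (cases "u = []")
        case True
        then have "p [] = \<zero>" using add by simp
        moreover have "a = \<zero>" using z True \<open>p [] = \<zero>\<close> add by (simp add: K.free_sel word_def)
        ultimately show ?thesis using add eq u by simp
      next
        case False
        then have "p [] = \<zero>" using z p0 add by (simp add: K.free_sel word_def)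
        then show ?thesis unfolding eq using add u unit_absorbs_word[OF add(2) False]
          by (simp add: cls_word Q.A.l_distr Q.A.r_distr Q.smult_mult_left Q.smult_mult_right)
      qed
    qed
  qed
  then show "Q.unit \<otimes>\<^bsub>Q\<^esub> cls p = cls p" "cls p \<otimes>\<^bsub>Q\<^esub> Q.unit = cls p" using assms by auto
qed

text \<open>A nonempty word begins and ends with a generator, hence with a vertex modulo the relators, so
  the sum of the vertices acts as identity on its class. Conversely, a multiple of this sum has
  no constant term.\<close>

lemma leavitt_path_algebra_corner: "leavitt_path_algebra K E = corner Q Q.unit"
proof -
  have "{cls p | p. p \<in> carrier F \<and> p [] = \<zero>} = {Q.unit \<otimes>\<^bsub>Q\<^esub> x \<otimes>\<^bsub>Q\<^esub> Q.unit | x. x \<in> carrier Q}"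
  proof (intro equalityI subsetI)
    fix x assume "x \<in> {cls p | p. p \<in> carrier F \<and> p [] = \<zero>}"
    then obtain p where p: "x = cls p" "p \<in> carrier F" "p [] = \<zero>" by blast
    then have "x = Q.unit \<otimes>\<^bsub>Q\<^esub> x \<otimes>\<^bsub>Q\<^esub> Q.unit" using unit_absorbs by simp
    then show "x \<in> {Q.unit \<otimes>\<^bsub>Q\<^esub> x \<otimes>\<^bsub>Q\<^esub> Q.unit | x. x \<in> carrier Q}" using p cls_carrier by blast
  next
    fix x assume "x \<in> {Q.unit \<otimes>\<^bsub>Q\<^esub> x \<otimes>\<^bsub>Q\<^esub> Q.unit | x. x \<in> carrier Q}"
    then obtain p where p: "p \<in> carrier F" "x = Q.unit \<otimes>\<^bsub>Q\<^esub> cls p \<otimes>\<^bsub>Q\<^esub> Q.unit"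
      using Q_carrier by auto
    let ?q = "vertex_sum \<otimes>\<^bsub>F\<^esub> p \<otimes>\<^bsub>F\<^esub> vertex_sum"
    have q: "?q \<in> carrier F" using p vertex_sum_closed by simp
    have rg: "range r \<subseteq> carrier K" if "r \<in> carrier F" for r using that by (simp add: K.free_carrier_iff)
    have "p [] \<in> carrier K" using p K.free_coeff by blast
    then have "?q [] = \<zero>"
      using p vertex_sum_closed rg
      by (simp add: K.free_sel K.conv_range K.conv_Nil vertex_sum_Nil)
    moreover have "x = cls ?q" using p vertex_sum_closed by (simp add: Q_sel flip: cls_vertex_sum)
    ultimately show "x \<in> {cls p | p. p \<in> carrier F \<and> p [] = \<zero>}" using q by blast
  qed
  moreover have "cls vertex_sum = Q.unit" by (rule cls_vertex_sum)
  ultimately show ?thesis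
    unfolding leavitt_path_algebra_def corner_def cls_def vertex_sum_def
    by (simp add: presented_algebra_def Let_def)
qed

lemma universal_property:
  assumes fam: "leavitt_family A K E g"
  shows "\<exists>\<phi>. leavitt_hom Q A K E canon g \<phi>"
proof -
  interpret A: leavitt_family A K E g by (rule fam)
  have gX: "g \<in> X \<rightarrow> carrier A" using A.g_closed by auto
  note evs = A.ev_minus[OF gX] A.ev_word[OF gX] A.ev_zero[OF gX] A.ev_finsum[OF gX]
  have X: "v \<in> verts E \<Longrightarrow> Vertex v \<in> X" "e \<in> arcs E \<Longrightarrow> Edge e \<in> X" "e \<in> arcs E \<Longrightarrow> Ghost e \<in> X" for v e
    by (auto simp: generators_def)
  have sub: "A.ev g (p \<ominus>\<^bsub>F\<^esub> q) = \<zero>\<^bsub>A\<^esub>" if "p \<in> carrier F" "q \<in> carrier F" "A.ev g p = A.ev g q" for p q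
    using that A.ev_closed[OF gX, of q] by (simp add: evs) (simp add: a_minus_def A.M.r_neg)
  have "A.ev g r = \<zero>\<^bsub>A\<^esub>" if "r \<in> path_relators K E" for r
    using that unfolding path_relators_def Let_def
  proof (elim UnE CollectE exE conjE)
    fix v w assume "r = word K [Vertex v, Vertex w] \<ominus>\<^bsub>F\<^esub> (if v = w then word K [Vertex w] else \<zero>\<^bsub>F\<^esub>)"
      "v \<in> verts E" "w \<in> verts E"
    then show ?thesis using X A.vertex_vertex
      by (simp only:) (rule sub, auto simp: evs, auto simp: evs K.free_sel(3))
  next
    fix e assume "r = word K [Vertex (tail E e), Edge e] \<ominus>\<^bsub>F\<^esub> word K [Edge e]" "e \<in> arcs E"
    then show ?thesis using X by (simp only:) (rule sub, auto simp: evs A.tail_edge)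
  next
    fix e assume "r = word K [Edge e, Vertex (head E e)] \<ominus>\<^bsub>F\<^esub> word K [Edge e]" "e \<in> arcs E"
    then show ?thesis using X by (simp only:) (rule sub, auto simp: evs A.edge_head)
  next
    fix e assume "r = word K [Vertex (head E e), Ghost e] \<ominus>\<^bsub>F\<^esub> word K [Ghost e]" "e \<in> arcs E"
    then show ?thesis using X by (simp only:) (rule sub, auto simp: evs A.head_ghost)
  next
    fix e assume "r = word K [Ghost e, Vertex (tail E e)] \<ominus>\<^bsub>F\<^esub> word K [Ghost e]" "e \<in> arcs E"
    then show ?thesis using X by (simp only:) (rule sub, auto simp: evs A.ghost_tail)
  next
    fix e f assume "r = word K [Ghost e, Edge f] \<ominus>\<^bsub>F\<^esub> (if e = f then word K [Vertex (head E e)] else \<zero>\<^bsub>F\<^esub>)"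
      "e \<in> arcs E" "f \<in> arcs E"
    then show ?thesis using X A.ghost_edge
      by (simp only:) (rule sub, auto simp: evs, auto simp: evs K.free_sel(3))
  next
    fix v assume r: "r = word K [Vertex v] \<ominus>\<^bsub>F\<^esub> (\<Oplus>\<^bsub>F\<^esub>e\<in>out_arcs E v. word K [Edge e, Ghost e])"
      and v: "v \<in> verts E" "out_arcs E v \<noteq> {}"
    have "A.ev g (\<Oplus>\<^bsub>F\<^esub>e\<in>out_arcs E v. word K [Edge e, Ghost e])
        = (\<Oplus>\<^bsub>A\<^esub>e\<in>out_arcs E v. A.ev g (word K [Edge e, Ghost e]))"
      by (intro A.ev_finsum[OF gX]) auto
    also have "\<dots> = (\<Oplus>\<^bsub>A\<^esub>e\<in>out_arcs E v. A.S e \<otimes>\<^bsub>A\<^esub> A.T e)"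
      using X by (intro A.M.finsum_cong') (auto simp: evs)
    finally show ?thesis unfolding r using v X A.cuntz_krieger[OF v]
      by (intro sub F.M.finsum_closed') (auto simp: evs)
  qed
  then have ker: "A.ev g p = \<zero>\<^bsub>A\<^esub>" if "p \<in> I" for p
    using that A.ev_ideal[OF gX relators_closed] by blast
  have wd: "A.ev g p = A.ev g q" if "p \<in> carrier F" "q \<in> carrier F" "cls p = cls q" for p q
  proof -
    have "A.ev g p \<ominus>\<^bsub>A\<^esub> A.ev g q = \<zero>\<^bsub>A\<^esub>"
      using ker[of "p \<ominus>\<^bsub>F\<^esub> q"] that by (simp add: cls_eq_iff evs)
    then have "\<ominus>\<^bsub>A\<^esub> (\<ominus>\<^bsub>A\<^esub> A.ev g q) = A.ev g p"
      using A.ev_closed[OF gX] that by (intro A.M.minus_equality) (auto simp: a_minus_def)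
    then show ?thesis using A.ev_closed[OF gX] that by simp
  qed
  define \<phi> where "\<phi> C = A.ev g (SOME p. p \<in> carrier F \<and> cls p = C)" for C
  have \<phi>: "\<phi> (cls p) = A.ev g p" if "p \<in> carrier F" for p
    unfolding \<phi>_def using that someI[of "\<lambda>q. q \<in> carrier F \<and> cls q = cls p" p] by (intro wd) auto
  have "leavitt_hom Q A K E canon g \<phi>"
  proof unfold_locales
    fix x assume "x \<in> X"
    then show "\<phi> (canon x) = g x"
      unfolding canon_def by (subst \<phi>) (auto intro!: K.word_closed simp: A.ev_word[OF gX] A.g_closed)
  qed (auto simp: Q_carrier Q_sel Q_smult \<phi> A.ev_closed[OF gX] A.ev_add[OF gX] A.ev_mult[OF gX] A.ev_smult[OF gX])
  then show ?thesis by blast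
qed

text \<open>The goal of all later constructions: a graph with a system realises the corner at the sum of its
  vertices.\<close>

theorem leavitt_system_corner_iso:
  assumes "leavitt_system A K E g"
  shows "\<exists>\<phi>. \<phi> \<in> alg_iso K (leavitt_path_algebra K E) (corner A (leavitt_family.unit A E g))"
proof -
  interpret A: leavitt_system A K E g by (rule assms)
  obtain \<phi> where "leavitt_hom Q A K E canon g \<phi>"
    using universal_property[OF A.leavitt_family_axioms] by blast
  then have "\<phi> \<in> alg_iso K (corner Q Q.unit) (corner A A.unit)"
    using Q_span assms by (rule family_iso)
  then show ?thesis unfolding leavitt_path_algebra_corner by blast
qed

end

section \<open>Linear operators on a function space\<close>

definition vectors :: "('k, 'r) ring_scheme \<Rightarrow> ('x \<Rightarrow> 'k) set" where
  "vectors K = {\<phi>. range \<phi> \<subseteq> carrier K}"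

definition operator_algebra :: "('k, 'r) ring_scheme \<Rightarrow> ('k, ('x \<Rightarrow> 'k) \<Rightarrow> 'x \<Rightarrow> 'k) module" where
  "operator_algebra K =
    \<lparr>carrier = {T \<in> vectors K \<rightarrow>\<^sub>E vectors K.
        (\<forall>\<phi>\<in>vectors K. \<forall>\<psi>\<in>vectors K. T (\<lambda>x. \<phi> x \<oplus>\<^bsub>K\<^esub> \<psi> x) = (\<lambda>x. T \<phi> x \<oplus>\<^bsub>K\<^esub> T \<psi> x))
      \<and> (\<forall>a\<in>carrier K. \<forall>\<phi>\<in>vectors K. T (\<lambda>x. a \<otimes>\<^bsub>K\<^esub> \<phi> x) = (\<lambda>x. a \<otimes>\<^bsub>K\<^esub> T \<phi> x))},
     mult = (\<lambda>S T. \<lambda>\<phi>\<in>vectors K. S (T \<phi>)),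
     one = (\<lambda>\<phi>\<in>vectors K. \<phi>),
     zero = (\<lambda>\<phi>\<in>vectors K. \<lambda>x. \<zero>\<^bsub>K\<^esub>),
     add = (\<lambda>S T. \<lambda>\<phi>\<in>vectors K. \<lambda>x. S \<phi> x \<oplus>\<^bsub>K\<^esub> T \<phi> x),
     smult = (\<lambda>a T. \<lambda>\<phi>\<in>vectors K. \<lambda>x. a \<otimes>\<^bsub>K\<^esub> T \<phi> x)\<rparr>"

text \<open>All functions are allowed as vectors, because composition with a partial map need not preserve
  finite supports.\<close>

definition pullback :: "('k, 'r) ring_scheme \<Rightarrow> ('x \<Rightarrow> 'x option) \<Rightarrow> ('x \<Rightarrow> 'k) \<Rightarrow> 'x \<Rightarrow> 'k" where
  "pullback K \<tau> = (\<lambda>\<phi>\<in>vectors K. \<lambda>x. case \<tau> x of None \<Rightarrow> \<zero>\<^bsub>K\<^esub> | Some y \<Rightarrow> \<phi> y)"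

context cring begin

abbreviation "Op \<equiv> operator_algebra R"

lemma vectors_app: "\<phi> \<in> vectors R \<Longrightarrow> \<phi> x \<in> carrier R"
  by (auto simp: vectors_def)

lemma vectorsI: "(\<And>x. \<phi> x \<in> carrier R) \<Longrightarrow> \<phi> \<in> vectors R"
  by (auto simp: vectors_def)

lemma Op_iff:
  "T \<in> carrier Op \<longleftrightarrow> T \<in> vectors R \<rightarrow>\<^sub>E vectors R
    \<and> (\<forall>\<phi>\<in>vectors R. \<forall>\<psi>\<in>vectors R. T (\<lambda>x. \<phi> x \<oplus> \<psi> x) = (\<lambda>x. T \<phi> x \<oplus> T \<psi> x))
    \<and> (\<forall>a\<in>carrier R. \<forall>\<phi>\<in>vectors R. T (\<lambda>x. a \<otimes> \<phi> x) = (\<lambda>x. a \<otimes> T \<phi> x))"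
  by (simp add: operator_algebra_def)

lemma Op_vectors: "T \<in> carrier Op \<Longrightarrow> \<phi> \<in> vectors R \<Longrightarrow> T \<phi> \<in> vectors R"
  unfolding Op_iff by (blast intro: PiE_mem)

lemma Op_app: "T \<in> carrier Op \<Longrightarrow> \<phi> \<in> vectors R \<Longrightarrow> T \<phi> x \<in> carrier R"
  by (rule vectors_app[OF Op_vectors])

lemma Op_sel:
  "\<phi> \<in> vectors R \<Longrightarrow> (S \<otimes>\<^bsub>Op\<^esub> T) \<phi> = S (T \<phi>)"
  "\<phi> \<in> vectors R \<Longrightarrow> \<one>\<^bsub>Op\<^esub> \<phi> = \<phi>"
  "\<phi> \<in> vectors R \<Longrightarrow> \<zero>\<^bsub>Op\<^esub> \<phi> = (\<lambda>x. \<zero>)"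
  "\<phi> \<in> vectors R \<Longrightarrow> (S \<oplus>\<^bsub>Op\<^esub> T) \<phi> = (\<lambda>x. S \<phi> x \<oplus> T \<phi> x)"
  "\<phi> \<in> vectors R \<Longrightarrow> (a \<odot>\<^bsub>Op\<^esub> T) \<phi> = (\<lambda>x. a \<otimes> T \<phi> x)"
  by (simp_all add: operator_algebra_def)

lemma Op_linear:
  assumes "T \<in> carrier Op"
  shows "\<phi> \<in> vectors R \<Longrightarrow> \<psi> \<in> vectors R \<Longrightarrow> T (\<lambda>x. \<phi> x \<oplus> \<psi> x) = (\<lambda>x. T \<phi> x \<oplus> T \<psi> x)"
    and "a \<in> carrier R \<Longrightarrow> \<phi> \<in> vectors R \<Longrightarrow> T (\<lambda>x. a \<otimes> \<phi> x) = (\<lambda>x. a \<otimes> T \<phi> x)"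
  using assms unfolding Op_iff by blast+

lemma OpI:
  assumes "T \<in> extensional (vectors R)"
    and "\<And>\<phi> x. \<phi> \<in> vectors R \<Longrightarrow> T \<phi> x \<in> carrier R"
    and "\<And>\<phi> \<psi> x. \<phi> \<in> vectors R \<Longrightarrow> \<psi> \<in> vectors R \<Longrightarrow> T (\<lambda>x. \<phi> x \<oplus> \<psi> x) x = T \<phi> x \<oplus> T \<psi> x"
    and "\<And>a \<phi> x. a \<in> carrier R \<Longrightarrow> \<phi> \<in> vectors R \<Longrightarrow> T (\<lambda>x. a \<otimes> \<phi> x) x = a \<otimes> T \<phi> x"
  shows "T \<in> carrier Op"
proof -
  have "T \<phi> \<in> vectors R" if "\<phi> \<in> vectors R" for \<phi>
    using assms(2)[OF that] by (rule vectorsI)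
  then show ?thesis
    using assms(1,3,4) unfolding Op_iff by (simp add: PiE_def fun_eq_iff)
qed

lemma Op_eqI:
  assumes "S \<in> carrier Op" "T \<in> carrier Op"
    and "\<And>\<phi> x. \<phi> \<in> vectors R \<Longrightarrow> S \<phi> x = T \<phi> x"
  shows "S = T"
proof (rule extensionalityI[of S "vectors R"])
  show "S \<in> extensional (vectors R)" "T \<in> extensional (vectors R)"
    using assms(1,2) unfolding Op_iff PiE_def by blast+
qed (use assms(3) in auto)

lemma Op_ext: "S \<otimes>\<^bsub>Op\<^esub> T \<in> extensional (vectors R)" "\<one>\<^bsub>Op\<^esub> \<in> extensional (vectors R)"
  "\<zero>\<^bsub>Op\<^esub> \<in> extensional (vectors R)" "S \<oplus>\<^bsub>Op\<^esub> T \<in> extensional (vectors R)"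
  "a \<odot>\<^bsub>Op\<^esub> T \<in> extensional (vectors R)"
  by (simp_all add: operator_algebra_def)

lemma vectors_add: "\<phi> \<in> vectors R \<Longrightarrow> \<psi> \<in> vectors R \<Longrightarrow> (\<lambda>x. \<phi> x \<oplus> \<psi> x) \<in> vectors R"
  and vectors_smult: "a \<in> carrier R \<Longrightarrow> \<phi> \<in> vectors R \<Longrightarrow> (\<lambda>x. a \<otimes> \<phi> x) \<in> vectors R"
  by (auto simp: vectors_def image_subset_iff)

lemmas Op_simps = Op_sel Op_linear Op_app Op_vectors vectors_add vectors_smult vectors_app

lemma Op_closed:
  "S \<in> carrier Op \<Longrightarrow> T \<in> carrier Op \<Longrightarrow> S \<otimes>\<^bsub>Op\<^esub> T \<in> carrier Op"
  "\<one>\<^bsub>Op\<^esub> \<in> carrier Op" "\<zero>\<^bsub>Op\<^esub> \<in> carrier Op"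
  "S \<in> carrier Op \<Longrightarrow> T \<in> carrier Op \<Longrightarrow> S \<oplus>\<^bsub>Op\<^esub> T \<in> carrier Op"
  "a \<in> carrier R \<Longrightarrow> T \<in> carrier Op \<Longrightarrow> a \<odot>\<^bsub>Op\<^esub> T \<in> carrier Op"
  by (rule OpI; simp add: Op_ext Op_simps r_distr m_lcomm a_ac)+

lemma operator_unital_algebra: "unital_algebra R Op"
proof -
  have grp: "abelian_group Op"
  proof (rule abelian_groupI)
    fix T assume T: "T \<in> carrier Op"
    have "(\<ominus> \<one>) \<odot>\<^bsub>Op\<^esub> T \<oplus>\<^bsub>Op\<^esub> T = \<zero>\<^bsub>Op\<^esub>"
      using T by (intro Op_eqI) (auto simp: Op_closed Op_simps l_minus l_neg)
    then show "\<exists>S\<in>carrier Op. S \<oplus>\<^bsub>Op\<^esub> T = \<zero>\<^bsub>Op\<^esub>"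
      using T Op_closed(5)[of "\<ominus> \<one>" T] by blast
  qed (auto simp: Op_closed Op_simps a_ac intro!: Op_eqI)
  have "ring Op"
  proof (rule ringI[OF grp])
    show "monoid Op"
      by (intro monoidI) (auto simp: Op_closed Op_simps intro!: Op_eqI)
  qed (auto simp: Op_closed Op_simps intro!: Op_eqI)
  moreover have "module R Op"
    by (intro moduleI is_cring grp)
      (auto simp: Op_closed Op_simps l_distr r_distr m_assoc intro!: Op_eqI)
  ultimately show ?thesis
    by (intro unital_algebra.intro)
      (auto simp: unital_algebra_axioms_def Op_closed Op_simps intro!: Op_eqI)
qed

lemma pullback_app: "\<phi> \<in> vectors R \<Longrightarrow> pullback R \<tau> \<phi> x = (case \<tau> x of None \<Rightarrow> \<zero> | Some y \<Rightarrow> \<phi> y)"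
  by (simp add: pullback_def)

lemma pullback_closed: "pullback R \<tau> \<in> carrier Op"
proof (rule OpI)
  show "pullback R \<tau> \<in> extensional (vectors R)" by (simp add: pullback_def)
qed (auto simp: pullback_app vectors_add vectors_smult vectors_app split: option.splits)

lemma pullback_mult: "pullback R \<tau> \<otimes>\<^bsub>Op\<^esub> pullback R \<sigma> = pullback R (\<sigma> \<circ>\<^sub>m \<tau>)"
  by (rule Op_eqI)
    (auto simp: Op_closed pullback_closed Op_sel pullback_app Op_vectors[OF pullback_closed] map_comp_def
      split: option.splits)

lemma pullback_empty: "pullback R Map.empty = \<zero>\<^bsub>Op\<^esub>"
  by (rule Op_eqI) (auto simp: Op_closed pullback_closed Op_sel pullback_app)

lemma Op_finsum_app:
  assumes "finite I" "\<And>i. i \<in> I \<Longrightarrow> T i \<in> carrier Op" "\<phi> \<in> vectors R"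
  shows "(\<Oplus>\<^bsub>Op\<^esub>i\<in>I. T i) \<phi> x = (\<Oplus>i\<in>I. T i \<phi> x)"
proof -
  interpret Op: unital_algebra R Op by (rule operator_unital_algebra)
  show ?thesis using assms(1,2)
  proof (induct I)
    case (insert i I)
    have "T j \<phi> x \<in> carrier R" if "j \<in> I" for j
      using that by (intro Op_app[OF insert(4)[of j] assms(3)]) simp
    then have "T \<in> I \<rightarrow> carrier Op" "(\<lambda>i. T i \<phi> x) \<in> I \<rightarrow> carrier R" using insert(4) by auto
    then show ?case using insert assms(3) by (simp add: Op_sel Op_app)
  qed (simp add: Op_sel assms(3))
qed

end

section \<open>Paths are linearly independent in the Leavitt path algebra\<close>

context leavitt_presentation begin

text \<open>The representation lives on functions on triples of a vertex, an integer and a natural number.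
  At every regular vertex \<open>v\<close> the natural numbers are identified with pairs of an edge that
  leaves \<open>v\<close> and a natural number, as the relations between edges and ghost edges require. An edge removes its own
  label from the natural number and lowers the integer by one. The integer records the length of a
  path, so that paths of different lengths are separated as well.\<close>

definition enc :: "'e \<Rightarrow> nat \<Rightarrow> nat" where
  "enc e j = to_nat_on (out_arcs E (tail E e) \<times> (UNIV :: nat set)) (e, j)"

lemma enc_bij:
  assumes "out_arcs E v \<noteq> {}"
  shows "bij_betw (to_nat_on (out_arcs E v \<times> (UNIV :: nat set))) (out_arcs E v \<times> (UNIV :: nat set)) UNIV"
proof (rule to_nat_on_infinite)
  show "countable (out_arcs E v \<times> (UNIV :: nat set))"
    by (intro countable_SIGMA countable_finite[of "out_arcs E v"] countableI_type) auto
  show "infinite (out_arcs E v \<times> (UNIV :: nat set))"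
    using finite_cartesian_productD2[of "out_arcs E v" "UNIV :: nat set"] assms by auto
qed

lemma enc_inj:
  assumes "e \<in> arcs E" "e' \<in> arcs E" "tail E e = tail E e'" "enc e j = enc e' j'"
  shows "e = e' \<and> j = j'"
proof -
  have "out_arcs E (tail E e) \<noteq> {}" using assms by auto
  then have "inj_on (to_nat_on (out_arcs E (tail E e) \<times> (UNIV :: nat set))) (out_arcs E (tail E e) \<times> UNIV)"
    using enc_bij by (auto simp: bij_betw_def)
  then have "(e, j) = (e', j')"
    by (rule inj_onD) (use assms in \<open>auto simp: enc_def\<close>)
  then show ?thesis by simp
qed

lemma enc_surj:
  assumes "out_arcs E v \<noteq> {}"
  shows "\<exists>e\<in>out_arcs E v. \<exists>j. enc e j = i"
proof -
  have "i \<in> to_nat_on (out_arcs E v \<times> (UNIV :: nat set)) ` (out_arcs E v \<times> UNIV)"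
    using enc_bij[OF assms] by (auto simp: bij_betw_def)
  then show ?thesis by (auto simp: enc_def)
qed

fun act :: "('v, 'e) generator \<Rightarrow> 'v \<times> int \<times> nat \<Rightarrow> ('v \<times> int \<times> nat) option" where
  "act (Vertex v) (u, k, i) = (if u = v then Some (u, k, i) else None)"
| "act (Ghost e) (u, k, i) = (if u = head E e then Some (tail E e, k + 1, enc e i) else None)"
| "act (Edge e) (u, k, i) = (if u = tail E e \<and> (\<exists>j. enc e j = i)
     then Some (head E e, k - 1, SOME j. enc e j = i) else None)"

lemma act_edge: "e \<in> arcs E \<Longrightarrow> act (Edge e) (tail E e, k, enc e j) = Some (head E e, k - 1, j)"
proof -
  assume e: "e \<in> arcs E"
  have "(SOME j'. enc e j' = enc e j) = j"
    by (rule some_equality) (use enc_inj[OF e e] in auto)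
  then show ?thesis by auto
qed

lemma act_edge_Some:
  assumes "e \<in> arcs E"
  shows "act (Edge e) (u, k, i) = Some (w, l, j) \<longleftrightarrow> u = tail E e \<and> i = enc e j \<and> w = head E e \<and> l = k - 1"
proof
  assume a: "act (Edge e) (u, k, i) = Some (w, l, j)"
  then obtain j' where "u = tail E e" "i = enc e j'" by (auto split: if_splits)
  then show "u = tail E e \<and> i = enc e j \<and> w = head E e \<and> l = k - 1"
    using a act_edge[OF assms, of k j'] by simp
qed (use act_edge[OF assms] in simp)

lemma act_edge_None:
  "act (Edge e) (u, k, i) = None \<longleftrightarrow> \<not> (u = tail E e \<and> (\<exists>j. i = enc e j))"
  by auto

definition rep :: "('v, 'e) generator \<Rightarrow> ('v \<times> int \<times> nat \<Rightarrow> 'k) \<Rightarrow> 'v \<times> int \<times> nat \<Rightarrow> 'k" where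
  "rep x = pullback K (act x)"

lemma rep_mult: "rep x \<otimes>\<^bsub>K.Op\<^esub> rep y = pullback K (act y \<circ>\<^sub>m act x)"
  by (simp add: rep_def K.pullback_mult)

lemma rep_family: "leavitt_family K.Op K E rep"
proof -
  interpret Op: unital_algebra K K.Op by (rule K.operator_unital_algebra)
  show ?thesis
  proof unfold_locales
    fix v w assume "v \<in> verts E" "w \<in> verts E"
    have "act (Vertex w) \<circ>\<^sub>m act (Vertex v) = (if v = w then act (Vertex w) else Map.empty)"
      by (auto simp: map_comp_def fun_eq_iff)
    then show "rep (Vertex v) \<otimes>\<^bsub>K.Op\<^esub> rep (Vertex w) = (if v = w then rep (Vertex w) else \<zero>\<^bsub>K.Op\<^esub>)"
      by (simp add: rep_mult K.pullback_empty) (simp add: rep_def)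
  next
    fix e assume e: "e \<in> arcs E"
    have "act (Edge e) \<circ>\<^sub>m act (Vertex (tail E e)) = act (Edge e)"
      by (auto simp: map_comp_def fun_eq_iff)
    then show "rep (Vertex (tail E e)) \<otimes>\<^bsub>K.Op\<^esub> rep (Edge e) = rep (Edge e)"
      by (simp add: rep_mult) (simp add: rep_def)
    have "act (Vertex (head E e)) \<circ>\<^sub>m act (Edge e) = act (Edge e)"
      by (auto simp: map_comp_def fun_eq_iff)
    then show "rep (Edge e) \<otimes>\<^bsub>K.Op\<^esub> rep (Vertex (head E e)) = rep (Edge e)"
      by (simp add: rep_mult) (simp add: rep_def)
    have "act (Ghost e) \<circ>\<^sub>m act (Vertex (head E e)) = act (Ghost e)"
      by (auto simp: map_comp_def fun_eq_iff)
    then show "rep (Vertex (head E e)) \<otimes>\<^bsub>K.Op\<^esub> rep (Ghost e) = rep (Ghost e)"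
      by (simp add: rep_mult) (simp add: rep_def)
    have "act (Vertex (tail E e)) \<circ>\<^sub>m act (Ghost e) = act (Ghost e)"
      by (auto simp: map_comp_def fun_eq_iff)
    then show "rep (Ghost e) \<otimes>\<^bsub>K.Op\<^esub> rep (Vertex (tail E e)) = rep (Ghost e)"
      by (simp add: rep_mult) (simp add: rep_def)
  next
    fix e f assume e: "e \<in> arcs E" "f \<in> arcs E"
    have "act (Edge f) \<circ>\<^sub>m act (Ghost e) = (if e = f then act (Vertex (head E e)) else Map.empty)"
    proof (rule ext, clarify)
      fix u k i
      show "(act (Edge f) \<circ>\<^sub>m act (Ghost e)) (u, k, i)
          = (if e = f then act (Vertex (head E e)) else Map.empty) (u, k, i)"
        using e enc_inj[OF e] act_edge[of f "k + 1" i] act_edge_None[of f "tail E e" "k + 1" "enc e i"]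
        by (auto simp: map_comp_def simp del: act.simps(3))
    qed
    then show "rep (Ghost e) \<otimes>\<^bsub>K.Op\<^esub> rep (Edge f) = (if e = f then rep (Vertex (head E e)) else \<zero>\<^bsub>K.Op\<^esub>)"
      by (simp add: rep_mult K.pullback_empty) (simp add: rep_def)
  next
    fix v assume v: "v \<in> verts E" "out_arcs E v \<noteq> {}"
    have sum: "(\<Oplus>\<^bsub>K.Op\<^esub>e\<in>out_arcs E v. rep (Edge e) \<otimes>\<^bsub>K.Op\<^esub> rep (Ghost e)) \<in> carrier K.Op"
      by (intro Op.M.finsum_closed') (auto simp: rep_mult K.pullback_closed)
    show "rep (Vertex v) = (\<Oplus>\<^bsub>K.Op\<^esub>e\<in>out_arcs E v. rep (Edge e) \<otimes>\<^bsub>K.Op\<^esub> rep (Ghost e))"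
    proof (rule K.Op_eqI[OF _ sum])
      show "rep (Vertex v) \<in> carrier K.Op" by (simp add: rep_def K.pullback_closed)
      fix \<phi> :: "'v \<times> int \<times> nat \<Rightarrow> 'k" and x :: "'v \<times> int \<times> nat" assume \<phi>: "\<phi> \<in> vectors K"
      obtain u k i where x: "x = (u, k, i)" by (cases x)
      have app: "(rep (Edge e) \<otimes>\<^bsub>K.Op\<^esub> rep (Ghost e)) \<phi> x
          = (if u = tail E e \<and> (\<exists>j. enc e j = i) then \<phi> x else \<zero>)" if e: "e \<in> arcs E" for e
      proof (cases "u = tail E e \<and> (\<exists>j. enc e j = i)")
        case True
        then obtain j where j: "u = tail E e" "i = enc e j" by blast
        show ?thesis unfolding x j rep_mult K.pullback_app[OF \<phi>] map_comp_def act_edge[OF e]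
          by auto
      next
        case False
        then have "act (Edge e) (u, k, i) = None" using act_edge_None by blast
        then show ?thesis unfolding if_not_P[OF False] unfolding x rep_mult K.pullback_app[OF \<phi>] map_comp_def
          by (simp del: act.simps)
      qed
      have "(\<Oplus>e\<in>out_arcs E v. (rep (Edge e) \<otimes>\<^bsub>K.Op\<^esub> rep (Ghost e)) \<phi> x) = rep (Vertex v) \<phi> x"
      proof (cases "u = v")
        case True
        obtain e j where ej: "e \<in> out_arcs E v" "enc e j = i" using enc_surj[OF v(2)] by blast
        have "(\<Oplus>e\<in>out_arcs E v. (rep (Edge e) \<otimes>\<^bsub>K.Op\<^esub> rep (Ghost e)) \<phi> x)
            = (rep (Edge e) \<otimes>\<^bsub>K.Op\<^esub> rep (Ghost e)) \<phi> x"
        proof (rule K.finsum_only)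
          fix e' assume e': "e' \<in> out_arcs E v" "e' \<noteq> e"
          then have "\<not> (\<exists>j. enc e' j = i)" using ej enc_inj[of e' e] by auto
          then show "(rep (Edge e') \<otimes>\<^bsub>K.Op\<^esub> rep (Ghost e')) \<phi> x = \<zero>" using app e' by simp
        qed (use ej app[of e] K.vectors_app[OF \<phi>] in auto)
        also have "\<dots> = \<phi> x" using app ej True by auto
        also have "\<dots> = rep (Vertex v) \<phi> x" using True x \<phi> by (simp add: rep_def K.pullback_app)
        finally show ?thesis .
      next
        case False
        then show ?thesis using x \<phi> app
          by (subst K.finsum_neutral) (auto simp: rep_def K.pullback_app)
      qed
      moreover have "(\<Oplus>\<^bsub>K.Op\<^esub>e\<in>out_arcs E v. rep (Edge e) \<otimes>\<^bsub>K.Op\<^esub> rep (Ghost e)) \<phi> x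
          = (\<Oplus>e\<in>out_arcs E v. (rep (Edge e) \<otimes>\<^bsub>K.Op\<^esub> rep (Ghost e)) \<phi> x)"
        using \<phi> by (intro K.Op_finsum_app) (auto simp: rep_mult K.pullback_closed)
      ultimately show "rep (Vertex v) \<phi> x
          = (\<Oplus>\<^bsub>K.Op\<^esub>e\<in>out_arcs E v. rep (Edge e) \<otimes>\<^bsub>K.Op\<^esub> rep (Ghost e)) \<phi> x"
        by simp
    qed
  qed (simp add: rep_def K.pullback_closed)
qed

text \<open>The partial map that underlies the operator of a path.\<close>

primrec walk_act :: "'v \<Rightarrow> 'e list \<Rightarrow> 'v \<times> int \<times> nat \<Rightarrow> ('v \<times> int \<times> nat) option" where
  "walk_act v [] = act (Vertex v)"
| "walk_act v (e # \<mu>) = walk_act (head E e) \<mu> \<circ>\<^sub>m act (Edge e)"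

lemma walk_act_start:
  "awalk u \<mu> w \<Longrightarrow> \<exists>i. walk_act u \<mu> (u, k + int (length \<mu>), i) = Some (w, k, j)"
proof (induct \<mu> arbitrary: u)
  case (Cons e \<mu>)
  then have e: "awalk (head E e) \<mu> w" "e \<in> arcs E" "u = tail E e" by (auto simp: awalk_Cons_iff)
  obtain i where i: "walk_act (head E e) \<mu> (head E e, k + int (length \<mu>), i) = Some (w, k, j)"
    using Cons.hyps[OF e(1)] by blast
  have "walk_act u (e # \<mu>) (u, k + int (length (e # \<mu>)), enc e i) = Some (w, k, j)"
    using i act_edge[OF e(2), of "k + int (length (e # \<mu>))" i] e(3) by (simp add: map_comp_def add_ac)
  then show ?case by blast
qed (auto simp: awalk_Nil_iff)

lemma walk_act_Some:
  "\<lbrakk>set \<mu> \<subseteq> arcs E; walk_act u \<mu> (u', k, i) = Some (w, l, j); awalk u \<mu> z\<rbrakk> \<Longrightarrow> u' = u \<and> k = l + int (length \<mu>)"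
proof (induct \<mu> arbitrary: u u' k i)
  case (Cons e \<mu>)
  obtain w1 k1 i1 where 1: "act (Edge e) (u', k, i) = Some (w1, k1, i1)"
    "walk_act (head E e) \<mu> (w1, k1, i1) = Some (w, l, j)"
    using Cons.prems(2) by (auto simp: map_comp_def simp del: act.simps split: option.splits)
  moreover have "e \<in> arcs E" "set \<mu> \<subseteq> arcs E" "u = tail E e" "awalk (head E e) \<mu> z"
    using Cons.prems by (auto simp: awalk_Cons_iff)
  ultimately show ?case using Cons.hyps[of "head E e" w1 k1 i1] act_edge_Some by auto
qed (auto split: if_splits)

lemma walk_act_inj:
  "\<lbrakk>set \<mu> \<subseteq> arcs E; set \<nu> \<subseteq> arcs E; length \<mu> = length \<nu>;
    walk_act u \<mu> x = Some y; walk_act u' \<nu> x = Some y'\<rbrakk> \<Longrightarrow> \<mu> = \<nu>"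
proof (induct \<mu> arbitrary: u u' \<nu> x)
  case (Cons e \<mu>)
  then obtain f \<nu>' where \<nu>: "\<nu> = f # \<nu>'" by (cases \<nu>) auto
  obtain p k i where x: "x = (p, k, i)" by (cases x)
  obtain w1 k1 i1 where 1: "act (Edge e) (p, k, i) = Some (w1, k1, i1)"
    "walk_act (head E e) \<mu> (w1, k1, i1) = Some y"
    using Cons.prems x by (auto simp: map_comp_def simp del: act.simps split: option.splits)
  obtain w2 k2 i2 where 2: "act (Edge f) (p, k, i) = Some (w2, k2, i2)"
    "walk_act (head E f) \<nu>' (w2, k2, i2) = Some y'"
    using Cons.prems x \<nu> by (auto simp: map_comp_def simp del: act.simps split: option.splits)
  have arcs: "e \<in> arcs E" "f \<in> arcs E" using Cons.prems \<nu> by auto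
  have "p = tail E e" "i = enc e i1" "w1 = head E e" "k1 = k - 1"
    using 1(1) act_edge_Some[OF arcs(1)] by blast+
  moreover have "p = tail E f" "i = enc f i2" "w2 = head E f" "k2 = k - 1"
    using 2(1) act_edge_Some[OF arcs(2)] by blast+
  ultimately have "e = f" "(w1, k1, i1) = (w2, k2, i2)" using enc_inj[OF arcs, of i1 i2] by auto
  moreover have "\<mu> = \<nu>'"
    by (rule Cons.hyps[OF _ _ _ 1(2)]) (use Cons.prems \<nu> 2(2) calculation in auto)
  ultimately show ?case using \<nu> by simp
qed simp

text \<open>For a path \<open>\<mu>\<close> from \<open>u\<close> to \<open>w\<close>, choose a point that
  \<open>\<mu>\<close> moves to \<open>(w, 0, 0)\<close>. No other path does the same: the first
  component of the point determines where the path starts, the integer determines its length,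
  and the natural number determines its edges. Hence the value at this point of the sum applied
  to the indicator of \<open>(w, 0, 0)\<close> is the coefficient of \<open>\<mu>\<close>.\<close>

lemma Q_indep: "Q.lin_indep (\<lambda>(v, \<mu>). Q.pth v \<mu>) {(v, \<mu>). \<exists>w. awalk v \<mu> w}"
  unfolding Q.lin_indep_def
proof (intro allI impI ballI, elim conjE)
  fix T c i0
  assume T: "finite T" "T \<subseteq> {(v, \<mu>). \<exists>w. awalk v \<mu> w}" "c \<in> T \<rightarrow> carrier K" "i0 \<in> T"
    and sum: "(\<Oplus>\<^bsub>Q\<^esub>i\<in>T. c i \<odot>\<^bsub>Q\<^esub> (case i of (v, \<mu>) \<Rightarrow> Q.pth v \<mu>)) = \<zero>\<^bsub>Q\<^esub>"
  obtain \<phi> where "leavitt_hom Q K.Op K E canon rep \<phi>"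
    using universal_property[OF rep_family] by blast
  then interpret H: leavitt_hom Q K.Op K E canon rep \<phi> .
  have pth: "H.A.pth u \<mu> = pullback K (walk_act u \<mu>)" for u \<mu>
    by (induct \<mu> arbitrary: u) (auto simp: rep_def K.pullback_mult)
  have cl: "Q.pth (fst i) (snd i) \<in> carrier Q" "c i \<in> carrier K" "\<exists>w. awalk (fst i) (snd i) w" if "i \<in> T" for i
    using subsetD[OF T(2) that] Q.pth_closed funcset_mem[OF T(3) that] by auto
  have "\<phi> (\<Oplus>\<^bsub>Q\<^esub>i\<in>T. c i \<odot>\<^bsub>Q\<^esub> Q.pth (fst i) (snd i))
      = (\<Oplus>\<^bsub>K.Op\<^esub>i\<in>T. \<phi> (c i \<odot>\<^bsub>Q\<^esub> Q.pth (fst i) (snd i)))"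
    using cl T by (intro H.hom_finsum) auto
  also have "\<dots> = (\<Oplus>\<^bsub>K.Op\<^esub>i\<in>T. c i \<odot>\<^bsub>K.Op\<^esub> pullback K (walk_act (fst i) (snd i)))"
  proof (intro H.A.M.finsum_cong' refl Pi_I)
    fix i assume i: "i \<in> T"
    then obtain w where "awalk (fst i) (snd i) w" using cl by blast
    then show "\<phi> (c i \<odot>\<^bsub>Q\<^esub> Q.pth (fst i) (snd i)) = c i \<odot>\<^bsub>K.Op\<^esub> pullback K (walk_act (fst i) (snd i))"
      using cl i by (simp add: H.hom_smult H.hom_pth pth)
  qed (rule K.Op_closed(5)[OF cl(2) K.pullback_closed])
  finally have sum0: "(\<Oplus>\<^bsub>K.Op\<^esub>i\<in>T. c i \<odot>\<^bsub>K.Op\<^esub> pullback K (walk_act (fst i) (snd i))) = \<zero>\<^bsub>K.Op\<^esub>"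
    using sum H.hom_zero by (simp add: case_prod_unfold)
  obtain u \<mu> where i0: "i0 = (u, \<mu>)" by (cases i0)
  then obtain w where w: "awalk u \<mu> w" using T by auto
  let ?y = "(w, 0, 0) :: 'v \<times> int \<times> nat"
  obtain i where i: "walk_act u \<mu> (u, int (length \<mu>), i) = Some ?y"
    using walk_act_start[OF w, of 0 0] by auto
  let ?x = "(u, int (length \<mu>), i)"
  let ?\<delta> = "\<lambda>x. if x = ?y then \<one> else \<zero>"
  have \<delta>: "?\<delta> \<in> vectors K" by (auto simp: vectors_def)
  have "(\<Oplus>j\<in>T. (c j \<odot>\<^bsub>K.Op\<^esub> pullback K (walk_act (fst j) (snd j))) ?\<delta> ?x) = \<zero>"
    using K.Op_finsum_app[OF T(1) _ \<delta>, of "\<lambda>i. c i \<odot>\<^bsub>K.Op\<^esub> pullback K (walk_act (fst i) (snd i))" ?x,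
        OF K.Op_closed(5)[OF cl(2) K.pullback_closed]] sum0 \<delta> by (simp add: K.Op_sel)
  moreover have "(\<Oplus>j\<in>T. (c j \<odot>\<^bsub>K.Op\<^esub> pullback K (walk_act (fst j) (snd j))) ?\<delta> ?x)
      = (c i0 \<odot>\<^bsub>K.Op\<^esub> pullback K (walk_act (fst i0) (snd i0))) ?\<delta> ?x"
  proof (rule K.finsum_only[OF T(1,4)])
    show "(c i0 \<odot>\<^bsub>K.Op\<^esub> pullback K (walk_act (fst i0) (snd i0))) ?\<delta> ?x \<in> carrier K"
      by (rule K.Op_app[OF K.Op_closed(5)[OF cl(2)[OF T(4)] K.pullback_closed] \<delta>])
    fix j assume j: "j \<in> T" "j \<noteq> i0"
    obtain v \<nu> where v: "j = (v, \<nu>)" by (cases j)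
    obtain z where z: "awalk v \<nu> z" using cl[OF j(1)] v by auto
    have "walk_act v \<nu> ?x \<noteq> Some ?y"
    proof
      assume a: "walk_act v \<nu> ?x = Some ?y"
      then have "u = v" "length \<mu> = length \<nu>"
        using walk_act_Some[OF _ a z] z by auto
      moreover have "\<mu> = \<nu>"
        using walk_act_inj[OF _ _ _ i a] w z calculation by auto
      ultimately show False using j v i0 by simp
    qed
    then show "(c j \<odot>\<^bsub>K.Op\<^esub> pullback K (walk_act (fst j) (snd j))) ?\<delta> ?x = \<zero>"
      using v cl[OF j(1)] \<delta> by (auto simp: K.Op_sel K.pullback_app split: option.splits)
  qed
  moreover have "(c i0 \<odot>\<^bsub>K.Op\<^esub> pullback K (walk_act (fst i0) (snd i0))) ?\<delta> ?x = c i0"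
    using i i0 cl[OF T(4)] \<delta> by (simp add: K.Op_sel K.pullback_app)
  ultimately show "c i0 = \<zero>" by simp
qed

lemma canonical_system:
  assumes "verts E \<noteq> {}"
  shows "leavitt_system Q K E canon"
  using assms Q_indep Q_span by unfold_locales auto

end

section \<open>Frames\<close>

context leavitt_family begin

text \<open>A frame amounts to an isomorphism between the right ideal \<open>f A\<close> and the direct sum
  of the right ideals \<open>p\<^bsub>\<nu> k\<^esub> A\<close>, given by \<open>a \<mapsto>
  (y\<^sub>k a)\<^sub>k\<close> with inverse \<open>(b\<^sub>k)\<^sub>k \<mapsto>
  \<Sum>x\<^sub>k b\<^sub>k\<close>.\<close>

definition frame :: "'a \<Rightarrow> 'j set \<Rightarrow> ('j \<Rightarrow> 'a) \<Rightarrow> ('j \<Rightarrow> 'a) \<Rightarrow> ('j \<Rightarrow> 'v) \<Rightarrow> bool" where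
  "frame f J x y \<nu> \<longleftrightarrow> finite J
    \<and> (\<forall>k\<in>J. x k \<in> carrier A \<and> y k \<in> carrier A \<and> \<nu> k \<in> verts E
        \<and> x k \<otimes> P (\<nu> k) = x k \<and> P (\<nu> k) \<otimes> y k = y k)
    \<and> (\<forall>k\<in>J. \<forall>l\<in>J. y k \<otimes> x l = (if k = l then P (\<nu> k) else \<zero>))
    \<and> (\<Oplus>k\<in>J. x k \<otimes> y k) = f"

lemma frameD:
  assumes "frame f J x y \<nu>"
  shows "finite J" and "\<And>k. k \<in> J \<Longrightarrow> x k \<in> carrier A" and "\<And>k. k \<in> J \<Longrightarrow> y k \<in> carrier A"
    and "\<And>k. k \<in> J \<Longrightarrow> \<nu> k \<in> verts E"
    and "\<And>k. k \<in> J \<Longrightarrow> x k \<otimes> P (\<nu> k) = x k" and "\<And>k. k \<in> J \<Longrightarrow> P (\<nu> k) \<otimes> y k = y k"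
    and "\<And>k l. k \<in> J \<Longrightarrow> l \<in> J \<Longrightarrow> y k \<otimes> x l = (if k = l then P (\<nu> k) else \<zero>)"
    and "(\<Oplus>k\<in>J. x k \<otimes> y k) = f"
  using assms unfolding frame_def by blast+

lemma frame_reindex:
  assumes fr: "frame f J x y \<nu>" and h: "bij_betw h J' J"
  shows "frame f J' (x \<circ> h) (y \<circ> h) (\<nu> \<circ> h)"
proof -
  note f = frameD[OF fr]
  have J': "finite J'" using f(1) h bij_betw_finite by blast
  have hJ: "h k \<in> J" if "k \<in> J'" for k using h that by (auto simp: bij_betw_def)
  have "(\<Oplus>k\<in>J'. x (h k) \<otimes> y (h k)) = (\<Oplus>k\<in>h ` J'. x k \<otimes> y k)"
    using f hJ h by (subst M.finsum_reindex) (auto simp: bij_betw_def)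
  also have "h ` J' = J" using h by (auto simp: bij_betw_def)
  finally have sum: "(\<Oplus>k\<in>J'. x (h k) \<otimes> y (h k)) = f" using f(8) by simp
  have inj: "h k = h l \<longleftrightarrow> k = l" if "k \<in> J'" "l \<in> J'" for k l
    using h that by (auto simp: bij_betw_def inj_on_def)
  show ?thesis unfolding frame_def comp_def
    using J' sum f hJ by (simp add: inj)
qed

lemma frame_nat:
  assumes fr: "frame f J x y \<nu>"
  shows "\<exists>(J' :: nat set) x' y' \<nu>'. frame f J' x' y' \<nu>' \<and> \<nu>' ` J' = \<nu> ` J"
proof -
  obtain h where h: "bij_betw h {0..<card J} J"
    using ex_bij_betw_nat_finite[OF frameD(1)[OF fr]] by blast
  then have "(\<nu> \<circ> h) ` {0..<card J} = \<nu> ` J" by (metis bij_betw_imp_surj_on image_comp)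
  then show ?thesis using frame_reindex[OF fr h] by blast
qed

text \<open>A summand at a regular vertex may be replaced by the summands at the ends of its outgoing
  edges, by the Cuntz-Krieger relation.\<close>

lemma frame_expand:
  assumes fr: "frame f J x y \<nu>" and D: "\<And>v. v \<in> D \<Longrightarrow> out_arcs E v \<noteq> {}"
  shows "\<exists>(J' :: nat set) x' y' \<nu>'. frame f J' x' y' \<nu>'
    \<and> \<nu>' ` J' = (\<nu> ` J - D) \<union> {head E e | e. e \<in> arcs E \<and> tail E e \<in> \<nu> ` J \<inter> D}"
proof -
  note f = frameD[OF fr]
  \<comment> \<open>the index \<open>None\<close> keeps a summand, \<open>Some e\<close> is its part along \<open>e\<close>\<close>
  define B where "B k = (if \<nu> k \<in> D then Some ` out_arcs E (\<nu> k) else {None})" for k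
  define x' where "x' = (\<lambda>(k, e). case e of None \<Rightarrow> x k | Some e \<Rightarrow> x k \<otimes> S e)"
  define y' where "y' = (\<lambda>(k, e). case e of None \<Rightarrow> y k | Some e \<Rightarrow> T e \<otimes> y k)"
  define \<nu>' where "\<nu>' = (\<lambda>(k, e). case e of None \<Rightarrow> \<nu> k | Some e \<Rightarrow> head E e)"
  have Bcases: "b = None \<and> \<nu> k \<notin> D \<or> (\<exists>e. b = Some e \<and> e \<in> arcs E \<and> tail E e = \<nu> k \<and> \<nu> k \<in> D)"
    if "b \<in> B k" for b k
    using that by (auto simp: B_def split: if_splits)
  have cl: "x' p \<in> carrier A \<and> y' p \<in> carrier A \<and> \<nu>' p \<in> verts E
      \<and> x' p \<otimes> P (\<nu>' p) = x' p \<and> P (\<nu>' p) \<otimes> y' p = y' p" if "p \<in> Sigma J B" for p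
  proof -
    obtain k b where p: "p = (k, b)" "k \<in> J" "b \<in> B k" using \<open>p \<in> Sigma J B\<close> by auto
    show ?thesis
      using Bcases[OF p(3)] p f(2-6)[OF p(2)]
      by (auto simp: x'_def y'_def \<nu>'_def A.m_assoc edge_head intro!: left_absorb head_ghost)
  qed
  have orth: "y' p \<otimes> x' q = (if p = q then P (\<nu>' p) else \<zero>)" if "p \<in> Sigma J B" "q \<in> Sigma J B" for p q
  proof -
    obtain k b where p: "p = (k, b)" "k \<in> J" "b \<in> B k" using \<open>p \<in> Sigma J B\<close> by auto
    obtain l c where q: "q = (l, c)" "l \<in> J" "c \<in> B l" using \<open>q \<in> Sigma J B\<close> by auto
    show ?thesis
    proof (cases "b = None \<or> c = None")
      case True
      then show ?thesis
        using Bcases[OF p(3)] Bcases[OF q(3)] p q f(2-6)[OF p(2)] f(2-6)[OF q(2)] f(7)[OF p(2) q(2)]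
        by (auto simp: x'_def y'_def \<nu>'_def A.m_assoc A.m_assoc[symmetric, of "y k" "x l"])
    next
      case False
      then obtain e d where e: "b = Some e" "e \<in> arcs E" "tail E e = \<nu> k"
        and d: "c = Some d" "d \<in> arcs E" "tail E d = \<nu> l"
        using Bcases[OF p(3)] Bcases[OF q(3)] by auto
      have "y' p \<otimes> x' q = T e \<otimes> ((y k \<otimes> x l) \<otimes> S d)"
        using p q e d f(2,3) by (simp add: x'_def y'_def A.m_assoc)
      also have "\<dots> = (if k = l then T e \<otimes> S d else \<zero>)"
        using f(7)[OF p(2) q(2)] e d tail_edge[OF d(2)] by simp
      finally show ?thesis using p q e d by (auto simp: \<nu>'_def ghost_edge)
    qed
  qed
  have fin: "finite (B k)" for k by (auto simp: B_def)
  have "(\<Oplus>p\<in>Sigma J B. x' p \<otimes> y' p) = (\<Oplus>k\<in>J. \<Oplus>b\<in>B k. x' (k, b) \<otimes> y' (k, b))"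
    using f(1) fin cl by (intro M.finsum_Sigma) (auto simp del: split_paired_Ex)
  also have "\<dots> = (\<Oplus>k\<in>J. x k \<otimes> y k)"
  proof (rule M.finsum_cong')
    fix k assume k: "k \<in> J"
    note fk = f(2-6)[OF k]
    show "(\<Oplus>b\<in>B k. x' (k, b) \<otimes> y' (k, b)) = x k \<otimes> y k"
    proof (cases "\<nu> k \<in> D")
      case True
      have "(\<Oplus>b\<in>B k. x' (k, b) \<otimes> y' (k, b)) = (\<Oplus>e\<in>out_arcs E (\<nu> k). (x k \<otimes> S e) \<otimes> (T e \<otimes> y k))"
        unfolding B_def using True fk by (simp, subst M.finsum_reindex) (auto simp: x'_def y'_def)
      also have "\<dots> = (\<Oplus>e\<in>out_arcs E (\<nu> k). (x k \<otimes> S e) \<otimes> T e) \<otimes> y k"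
        using fk by (subst A.finsum_ldistr) (auto simp: A.m_assoc intro!: M.finsum_cong')
      also have "\<dots> = x k \<otimes> y k"
        using expand_right[OF fk(1,3) D[OF True]] fk(4) by simp
      finally show ?thesis .
    qed (use fk in \<open>simp add: B_def x'_def y'_def\<close>)
  qed (use f in auto)
  finally have "frame f (Sigma J B) x' y' \<nu>'"
    unfolding frame_def using f(1,8) fin cl orth by blast
  moreover have "\<nu>' ` Sigma J B = (\<nu> ` J - D) \<union> {head E e | e. e \<in> arcs E \<and> tail E e \<in> \<nu> ` J \<inter> D}"
  proof (intro equalityI subsetI)
    fix v assume "v \<in> \<nu>' ` Sigma J B"
    then obtain k b where "k \<in> J" "b \<in> B k" "v = \<nu>' (k, b)" by auto
    then show "v \<in> (\<nu> ` J - D) \<union> {head E e | e. e \<in> arcs E \<and> tail E e \<in> \<nu> ` J \<inter> D}"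
      using Bcases[of b k] by (auto simp: \<nu>'_def)
  next
    fix v assume "v \<in> (\<nu> ` J - D) \<union> {head E e | e. e \<in> arcs E \<and> tail E e \<in> \<nu> ` J \<inter> D}"
    then show "v \<in> \<nu>' ` Sigma J B"
    proof
      assume "v \<in> \<nu> ` J - D"
      then obtain k where "k \<in> J" "v = \<nu> k" "\<nu> k \<notin> D" by auto
      then show ?thesis by (intro image_eqI[of _ _ "(k, None)"]) (auto simp: B_def \<nu>'_def)
    next
      assume "v \<in> {head E e | e. e \<in> arcs E \<and> tail E e \<in> \<nu> ` J \<inter> D}"
      then obtain e k where "e \<in> arcs E" "v = head E e" "k \<in> J" "tail E e = \<nu> k" "\<nu> k \<in> D" by auto
      then show ?thesis by (intro image_eqI[of _ _ "(k, Some e)"]) (auto simp: B_def \<nu>'_def)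
    qed
  qed
  ultimately show ?thesis using frame_nat by metis
qed

end

section \<open>Passing to graphs whose edges are paths\<close>

context leavitt_system begin

text \<open>The edges of the new graph are nonempty paths \<open>\<beta> e\<close> of the old one. As no
  \<open>\<beta> e\<close> is an initial segment of another, they are orthogonal to each other,
  and distinct sequences of new edges compose to distinct old paths, so independence is
  inherited. The Cuntz-Krieger relation and the spanning property depend on the choice of the paths and
  remain as hypotheses.\<close>

lemma path_graph_system:
  fixes E' :: "('v1, 'e1) pre_digraph"
  assumes E': "fin_digraph E'" "verts E' \<noteq> {}"
    and \<alpha>: "inj_on \<alpha> (verts E')" "\<alpha> ` verts E' \<subseteq> verts E"
    and \<beta>: "\<And>e. e \<in> arcs E' \<Longrightarrow> awalk (\<alpha> (tail E' e)) (\<beta> e) (\<alpha> (head E' e))"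
      "\<And>e. e \<in> arcs E' \<Longrightarrow> \<beta> e \<noteq> []"
    and code: "\<And>e f. e \<in> arcs E' \<Longrightarrow> f \<in> arcs E' \<Longrightarrow> prefix (\<beta> e) (\<beta> f) \<Longrightarrow> e = f"
    and ck: "\<And>v. v \<in> verts E' \<Longrightarrow> out_arcs E' v \<noteq> {}
      \<Longrightarrow> P (\<alpha> v) = (\<Oplus>e\<in>out_arcs E' v. pth (\<alpha> v) (\<beta> e) \<otimes> gst (\<alpha> v) (\<beta> e))"
    and sp: "\<And>u w a. u \<in> verts E' \<Longrightarrow> w \<in> verts E' \<Longrightarrow> a \<in> carrier A \<Longrightarrow> P (\<alpha> u) \<otimes> a \<otimes> P (\<alpha> w)
      \<in> lin {pth (\<alpha> u) (concat (map \<beta> bs)) \<otimes> gst (\<alpha> w) (concat (map \<beta> cs)) | bs cs z.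
          pre_digraph.awalk E' u bs z \<and> pre_digraph.awalk E' w cs z}"
  defines "g' \<equiv> case_generator (\<lambda>v. P (\<alpha> v)) (\<lambda>e. pth (\<alpha> (tail E' e)) (\<beta> e)) (\<lambda>e. gst (\<alpha> (tail E' e)) (\<beta> e))"
  shows "leavitt_system A K E' g'"
proof -
  interpret E': fin_digraph E' by (rule E'(1))
  have g' [simp]: "g' (Vertex v) = P (\<alpha> v)" "g' (Edge e) = pth (\<alpha> (tail E' e)) (\<beta> e)"
    "g' (Ghost e) = gst (\<alpha> (tail E' e)) (\<beta> e)" for v e
    by (simp_all add: g'_def)
  have \<alpha>V: "\<alpha> v \<in> verts E" if "v \<in> verts E'" for v using \<alpha>(2) that by auto
  have \<alpha>eq: "\<alpha> v = \<alpha> w \<longleftrightarrow> v = w" if "v \<in> verts E'" "w \<in> verts E'" for v w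
    using \<alpha>(1) that by (auto simp: inj_on_def)
  have fam: "leavitt_family A K E' g'"
  proof unfold_locales
    fix x assume "x \<in> generators E'"
    then show "g' x \<in> carrier A"
      using \<alpha>V pth_closed[OF \<beta>(1)] gst_closed[OF \<beta>(1)] by (auto simp: generators_def)
  next
    fix v w assume "v \<in> verts E'" "w \<in> verts E'"
    then show "g' (Vertex v) \<otimes> g' (Vertex w) = (if v = w then g' (Vertex w) else \<zero>)"
      using \<alpha>V by (simp add: vertex_vertex \<alpha>eq)
  next
    fix e f assume e: "e \<in> arcs E'" "f \<in> arcs E'"
    show "g' (Ghost e) \<otimes> g' (Edge f) = (if e = f then g' (Vertex (head E' e)) else \<zero>)"
    proof (cases "e = f")
      case True
      then show ?thesis using gst_pth[OF \<beta>(1)[OF e(1)]] by simp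
    next
      case False
      then have "\<not> prefix (\<beta> e) (\<beta> f)" "\<not> prefix (\<beta> f) (\<beta> e)" using code[OF e] code[OF e(2,1)] by auto
      then show ?thesis using gst_pth_zero[OF \<beta>(1)[OF e(1)] \<beta>(1)[OF e(2)]] False by simp
    qed
  qed (auto simp: ck[simplified] intro: pth_left[OF \<beta>(1)] pth_right[OF \<beta>(1)] gst_left[OF \<beta>(1)]
      gst_right[OF \<beta>(1)], auto simp: ck intro!: M.finsum_cong' pth_closed[OF \<beta>(1)] gst_closed[OF \<beta>(1)])
  interpret F: leavitt_family A K E' g' by (rule fam)
  have walk: "awalk (\<alpha> u) (concat (map \<beta> bs)) (\<alpha> w)" if "E'.awalk u bs w" for u bs w
    using that
  proof (induct bs arbitrary: u)
    case (Cons e bs)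
    then have e: "e \<in> arcs E'" "u = tail E' e" "E'.awalk (head E' e) bs w" by (auto simp: E'.awalk_Cons_iff)
    then show ?case using awalk_appendI[OF \<beta>(1)[OF e(1)] Cons.hyps[OF e(3)]] by simp
  qed (auto simp: E'.awalk_Nil_iff awalk_Nil_iff \<alpha>V)
  have pth: "F.pth u bs = pth (\<alpha> u) (concat (map \<beta> bs))" if "E'.awalk u bs w" for u bs w
    using that
  proof (induct bs arbitrary: u)
    case (Cons e bs)
    then have e: "e \<in> arcs E'" "u = tail E' e" "E'.awalk (head E' e) bs w" by (auto simp: E'.awalk_Cons_iff)
    then show ?case using Cons.hyps[OF e(3)] pth_append[OF \<beta>(1)[OF e(1)] walk[OF e(3)]] by simp
  qed simp
  have gst: "F.gst u bs = gst (\<alpha> u) (concat (map \<beta> bs))" if "E'.awalk u bs w" for u bs w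
    using that
  proof (induct bs arbitrary: u)
    case (Cons e bs)
    then have e: "e \<in> arcs E'" "u = tail E' e" "E'.awalk (head E' e) bs w" by (auto simp: E'.awalk_Cons_iff)
    then show ?case using Cons.hyps[OF e(3)] gst_append[OF \<beta>(1)[OF e(1)] walk[OF e(3)]] by simp
  qed simp
  have decode: "bs = cs" if "set bs \<subseteq> arcs E'" "set cs \<subseteq> arcs E'" "concat (map \<beta> bs) = concat (map \<beta> cs)" for bs cs
    using that
  proof (induct bs arbitrary: cs)
    case Nil
    then show ?case using \<beta>(2) by (cases cs) auto
  next
    case (Cons e bs)
    obtain f cs' where cs: "cs = f # cs'" using Cons.prems \<beta>(2)[of e] by (cases cs) auto
    have arcs: "e \<in> arcs E'" "f \<in> arcs E'" using Cons.prems cs by auto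
    have eq: "\<beta> e @ concat (map \<beta> bs) = \<beta> f @ concat (map \<beta> cs')" using Cons.prems cs by simp
    then have "prefix (\<beta> e) (\<beta> f) \<or> prefix (\<beta> f) (\<beta> e)"
      by (metis prefixI prefix_same_cases)
    then have "e = f" using code[OF arcs] code[OF arcs(2,1)] by auto
    then show ?case using Cons cs eq by auto
  qed
  show ?thesis
  proof unfold_locales
    show "verts E' \<noteq> {}" by (rule E'(2))
    show "lin_indep (\<lambda>(v, \<mu>). F.pth v \<mu>) {(v, \<mu>). \<exists>w. E'.awalk v \<mu> w}"
      unfolding lin_indep_def
    proof (intro allI impI ballI, elim conjE)
      fix T c i0
      assume T: "finite T" "T \<subseteq> {(v, \<mu>). \<exists>w. E'.awalk v \<mu> w}" "c \<in> T \<rightarrow> carrier K" "i0 \<in> T"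
        and sum: "(\<Oplus>i\<in>T. c i \<odot> (case i of (v, \<mu>) \<Rightarrow> F.pth v \<mu>)) = \<zero>"
      let ?\<theta> = "\<lambda>i. (\<alpha> (fst i), concat (map \<beta> (snd i)))"
      have w: "\<exists>z. E'.awalk (fst i) (snd i) z" if "i \<in> T" for i using subsetD[OF T(2) that] by auto
      have pth_i: "F.pth (fst i) (snd i) = pth (fst (?\<theta> i)) (snd (?\<theta> i))
          \<and> pth (fst (?\<theta> i)) (snd (?\<theta> i)) \<in> carrier A" if "i \<in> T" for i
        using w[OF that] pth walk pth_closed by (metis fst_conv snd_conv)
      show "c i0 = \<zero>\<^bsub>K\<^esub>"
      proof (rule lin_indep_isolated[OF indep _ T(1) _ _ _ T(4)])
        show "(\<Oplus>i\<in>T. c i \<odot> (case ?\<theta> i of (v, \<mu>) \<Rightarrow> pth v \<mu>)) = \<zero>"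
          unfolding sum[symmetric] using T(3) pth_i
          by (intro M.finsum_cong' Pi_I) (auto simp: case_prod_unfold)
        show "?\<theta> i \<in> {(v, \<mu>). \<exists>w. awalk v \<mu> w}" if "i \<in> T" for i using w[OF that] walk by auto
        show "c i \<in> carrier K" if "i \<in> T" for i using T(3) that by auto
        fix i assume i: "i \<in> T" "?\<theta> i = ?\<theta> i0"
        have "fst i \<in> verts E'" "set (snd i) \<subseteq> arcs E'" "fst i0 \<in> verts E'" "set (snd i0) \<subseteq> arcs E'"
          using w[OF i(1)] w[OF T(4)] by (auto dest: E'.awalk_hd_in_verts)
        then show "i = i0" using i decode[of "snd i" "snd i0"] \<alpha>eq by (auto intro: prod_eqI)
      qed (use pth_closed in auto)
    qed
  next
    fix u w a assume u: "u \<in> verts E'" "w \<in> verts E'" "a \<in> carrier A"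
    have sub: "{pth (\<alpha> u) (concat (map \<beta> bs)) \<otimes> gst (\<alpha> w) (concat (map \<beta> cs)) | bs cs z.
          E'.awalk u bs z \<and> E'.awalk w cs z} \<subseteq> F.path_pairs {u} w"
      unfolding F.path_pairs_def using pth gst by (smt (verit, best) Collect_mono_iff singletonI)
    have "P (\<alpha> u) \<otimes> a \<otimes> P (\<alpha> w) \<in> lin (F.path_pairs {u} w)"
      by (rule lin_mono[OF subset_trans[OF sub F.path_pairs_closed] F.path_pairs_closed sp[OF u]
            lin_base[OF F.path_pairs_closed subsetD[OF sub]]])
    then show "g' (Vertex u) \<otimes> a \<otimes> g' (Vertex w) \<in> lin (F.path_pairs {u} w)" by simp
  qed
qed

end

lemma (in unital_algebra) lin_subset:
  assumes "S \<subseteq> S'" "x \<in> lin S"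
  shows "x \<in> lin S'"
  using assms(2) by induct (use assms(1) in \<open>auto intro: lin_zero lin_step\<close>)

lemma (in wf_digraph) awalk_ends: "awalk u b w \<Longrightarrow> b \<noteq> [] \<Longrightarrow> u = tail G (hd b) \<and> w = head G (last b)"
proof (induct b arbitrary: u)
  case (Cons e b)
  then show ?case by (cases "b = []") (auto simp: awalk_Cons_iff awalk_Nil_iff)
qed simp

text \<open>The vertices of the new graph are the elements \<open>p\<^sub>v\<close> with \<open>v \<in>
  V\<close> themselves, so a frame supported in \<open>V\<close> is also a frame for the new
  graph. Vertices and edges are numbered in order that an induction can run over graphs of one
  type.\<close>

definition (in leavitt_family) models_corner :: "'v set \<Rightarrow> (nat, nat) pre_digraph \<Rightarrow> ((nat, nat) generator \<Rightarrow> 'a) \<Rightarrow> (nat \<Rightarrow> 'v) \<Rightarrow> bool" where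
  "models_corner V G g' \<alpha> \<longleftrightarrow> leavitt_system A K G g' \<and> bij_betw \<alpha> (verts G) V
    \<and> (\<forall>n\<in>verts G. g' (Vertex n) = P (\<alpha> n))"

context leavitt_system begin

text \<open>The edges of the new graph are the paths in \<open>B\<close>, numbered.\<close>

lemma models_corner_of_paths:
  assumes V: "V \<subseteq> verts E" "V \<noteq> {}" and B: "finite B"
    "\<And>b. b \<in> B \<Longrightarrow> b \<noteq> [] \<and> (\<exists>u\<in>V. \<exists>w\<in>V. awalk u b w)"
    and code: "\<And>b c. b \<in> B \<Longrightarrow> c \<in> B \<Longrightarrow> prefix b c \<Longrightarrow> b = c"
    and ck: "\<And>v. v \<in> V \<Longrightarrow> {b \<in> B. \<exists>w. awalk v b w} \<noteq> {}
      \<Longrightarrow> P v = (\<Oplus>b\<in>{b \<in> B. \<exists>w. awalk v b w}. pth v b \<otimes> gst v b)"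
    and sp: "\<And>u w a. u \<in> V \<Longrightarrow> w \<in> V \<Longrightarrow> a \<in> carrier A \<Longrightarrow> P u \<otimes> a \<otimes> P w
      \<in> lin {pth u (concat bs) \<otimes> gst w (concat cs) | bs cs z.
          bs \<in> lists B \<and> cs \<in> lists B \<and> z \<in> V \<and> awalk u (concat bs) z \<and> awalk w (concat cs) z}"
  shows "\<exists>G g' \<alpha>. models_corner V G g' \<alpha>"
proof -
  have finV: "finite V" using V finite_subset finite_verts by blast
  obtain \<alpha> where \<alpha>: "bij_betw \<alpha> {0..<card V} V" using ex_bij_betw_nat_finite[OF finV] by blast
  obtain \<beta> where \<beta>: "bij_betw \<beta> {0..<card B} B" using ex_bij_betw_nat_finite[OF B(1)] by blast
  define \<alpha>' where "\<alpha>' = inv_into {0..<card V} \<alpha>"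
  have \<alpha>': "\<alpha>' v \<in> {0..<card V}" "\<alpha> (\<alpha>' v) = v" if "v \<in> V" for v
    using \<alpha> that inv_into_into[of v \<alpha> "{0..<card V}"] f_inv_into_f[of v \<alpha> "{0..<card V}"]
    unfolding \<alpha>'_def bij_betw_def by auto
  have \<alpha>'': "\<alpha>' (\<alpha> n) = n" if "n < card V" for n
    using \<alpha> that unfolding \<alpha>'_def bij_betw_def by (simp add: inv_into_f_f)
  define G where "G = \<lparr>verts = {0..<card V}, arcs = {0..<card B},
    tail = (\<lambda>n. \<alpha>' (tail E (hd (\<beta> n)))), head = (\<lambda>n. \<alpha>' (head E (last (\<beta> n))))\<rparr>"
  have G: "verts G = {0..<card V}" "arcs G = {0..<card B}"
    "tail G n = \<alpha>' (tail E (hd (\<beta> n)))" "head G n = \<alpha>' (head E (last (\<beta> n)))" for n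
    by (simp_all add: G_def)
  have \<beta>B: "\<beta> n \<in> B" if "n \<in> arcs G" for n using \<beta> that G by (auto simp: bij_betw_def)
  have B_ends: "tail E (hd b) \<in> V \<and> head E (last b) \<in> V \<and> b \<noteq> [] \<and> awalk (tail E (hd b)) b (head E (last b))"
    if "b \<in> B" for b
    using B(2)[OF that] awalk_ends by metis
  interpret G: fin_digraph G
    by unfold_locales (use B_ends \<beta>B \<alpha>' G in auto)
  have \<alpha>V: "\<alpha> n \<in> V" if "n \<in> verts G" for n using \<alpha> that G by (auto simp: bij_betw_def)
  have decode: "\<exists>ms. map \<beta> ms = bs \<and> G.awalk (\<alpha>' u) ms (\<alpha>' z)"
    if "bs \<in> lists B" "u \<in> V" "z \<in> V" "awalk u (concat bs) z" for bs u z
    using that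
  proof (induct bs arbitrary: u)
    case Nil
    then show ?case using \<alpha>'(1) by (auto simp: awalk_Nil_iff G.awalk_Nil_iff G)
  next
    case (Cons b bs)
    obtain m where m: "awalk u b m" "awalk m (concat bs) z"
      using Cons.prems by (auto simp: awalk_append_iff)
    then have ends: "u = tail E (hd b)" "m = head E (last b)" "m \<in> V"
      using awalk_ends[OF m(1)] B_ends[OF Cons.hyps(1)] by auto
    obtain ms where ms: "map \<beta> ms = bs" "G.awalk (\<alpha>' m) ms (\<alpha>' z)"
      using Cons.hyps(3)[OF ends(3) Cons.prems(2) m(2)] by blast
    obtain n where n: "n \<in> arcs G" "\<beta> n = b"
      using bij_betw_imp_surj_on[OF \<beta>] Cons.hyps(1) G(2) by (metis imageE)
    then have "G.awalk (\<alpha>' u) (n # ms) (\<alpha>' z)" using ms ends by (simp add: G.awalk_Cons_iff G)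
    then show ?case using ms n by (intro exI[of _ "n # ms"]) simp
  qed
  let ?g = "case_generator (\<lambda>v. P (\<alpha> v)) (\<lambda>e. pth (\<alpha> (tail G e)) (\<beta> e)) (\<lambda>e. gst (\<alpha> (tail G e)) (\<beta> e))"
  have "leavitt_system A K G ?g"
  proof (rule path_graph_system[of G \<alpha> \<beta>])
    show "fin_digraph G" by unfold_locales
    show "verts G \<noteq> {}" using V finV G by (simp add: card_gt_0_iff)
    show "inj_on \<alpha> (verts G)" "\<alpha> ` verts G \<subseteq> verts E" using \<alpha> V G by (auto simp: bij_betw_def)
    show "awalk (\<alpha> (tail G e)) (\<beta> e) (\<alpha> (head G e))" "\<beta> e \<noteq> []" if "e \<in> arcs G" for e
      using B_ends[OF \<beta>B[OF that]] \<alpha>' by (auto simp: G)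
    show "e = f" if "e \<in> arcs G" "f \<in> arcs G" "prefix (\<beta> e) (\<beta> f)" for e f
      using code[OF \<beta>B[OF that(1)] \<beta>B[OF that(2)] that(3)] \<beta> that G by (auto simp: bij_betw_def inj_on_def)
  next
    fix v assume v: "v \<in> verts G" "out_arcs G v \<noteq> {}"
    have eq: "{b \<in> B. \<exists>w. awalk (\<alpha> v) b w} = \<beta> ` out_arcs G v"
    proof (intro equalityI subsetI)
      fix b assume b: "b \<in> {b \<in> B. \<exists>w. awalk (\<alpha> v) b w}"
      then obtain n where n: "n \<in> arcs G" "\<beta> n = b"
        using bij_betw_imp_surj_on[OF \<beta>] G(2) by (metis (no_types, lifting) imageE mem_Collect_eq)
      obtain w where "awalk (\<alpha> v) b w" using b by blast
      then have "\<alpha> v = tail E (hd b)" using awalk_ends B_ends b by blast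
      then have "tail G n = v" using n \<alpha>'' v G by (metis atLeastLessThan_iff)
      then show "b \<in> \<beta> ` out_arcs G v" using n by auto
    next
      fix b assume "b \<in> \<beta> ` out_arcs G v"
      then obtain n where n: "n \<in> arcs G" "tail G n = v" "b = \<beta> n" by auto
      then have "\<alpha> v = tail E (hd b)" using \<alpha>'(2) B_ends[OF \<beta>B[OF n(1)]] G by metis
      then show "b \<in> {b \<in> B. \<exists>w. awalk (\<alpha> v) b w}" using B_ends[OF \<beta>B[OF n(1)]] \<beta>B[OF n(1)] n by auto
    qed
    have "P (\<alpha> v) = (\<Oplus>b\<in>\<beta> ` out_arcs G v. pth (\<alpha> v) b \<otimes> gst (\<alpha> v) b)"
      unfolding eq[symmetric] by (rule ck) (use eq v \<alpha>V in auto)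
    also have "\<dots> = (\<Oplus>e\<in>out_arcs G v. pth (\<alpha> v) (\<beta> e) \<otimes> gst (\<alpha> v) (\<beta> e))"
    proof (rule M.finsum_reindex)
      show "inj_on \<beta> (out_arcs G v)" using \<beta> G by (auto simp: bij_betw_def inj_on_def)
      have "\<exists>w. awalk (\<alpha> v) b w" if "b \<in> \<beta> ` out_arcs G v" for b using that unfolding eq[symmetric] by blast
      then show "(\<lambda>b. pth (\<alpha> v) b \<otimes> gst (\<alpha> v) b) \<in> \<beta> ` out_arcs G v \<rightarrow> carrier A"
        using pth_closed gst_closed by blast
    qed
    finally show "P (\<alpha> v) = (\<Oplus>e\<in>out_arcs G v. pth (\<alpha> v) (\<beta> e) \<otimes> gst (\<alpha> v) (\<beta> e))" .
  next
    fix u w a assume u: "u \<in> verts G" "w \<in> verts G" "a \<in> carrier A"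
    show "P (\<alpha> u) \<otimes> a \<otimes> P (\<alpha> w)
      \<in> lin {pth (\<alpha> u) (concat (map \<beta> bs)) \<otimes> gst (\<alpha> w) (concat (map \<beta> cs)) | bs cs z.
          G.awalk u bs z \<and> G.awalk w cs z}"
    proof (rule lin_subset[OF _ sp[OF \<alpha>V[OF u(1)] \<alpha>V[OF u(2)] u(3)]], rule subsetI)
      fix s assume "s \<in> {pth (\<alpha> u) (concat bs) \<otimes> gst (\<alpha> w) (concat cs) | bs cs z.
        bs \<in> lists B \<and> cs \<in> lists B \<and> z \<in> V \<and> awalk (\<alpha> u) (concat bs) z \<and> awalk (\<alpha> w) (concat cs) z}"
      then obtain bs cs z where s: "s = pth (\<alpha> u) (concat bs) \<otimes> gst (\<alpha> w) (concat cs)"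
        "bs \<in> lists B" "cs \<in> lists B" "z \<in> V" "awalk (\<alpha> u) (concat bs) z" "awalk (\<alpha> w) (concat cs) z"
        by blast
      obtain ms where ms: "map \<beta> ms = bs" "G.awalk u ms (\<alpha>' z)"
        using decode[OF s(2) \<alpha>V[OF u(1)] s(4,5)] \<alpha>'' u(1) G by auto
      obtain ns where ns: "map \<beta> ns = cs" "G.awalk w ns (\<alpha>' z)"
        using decode[OF s(3) \<alpha>V[OF u(2)] s(4,6)] \<alpha>'' u(2) G by auto
      show "s \<in> {pth (\<alpha> u) (concat (map \<beta> bs)) \<otimes> gst (\<alpha> w) (concat (map \<beta> cs)) | bs cs z.
          G.awalk u bs z \<and> G.awalk w cs z}"
        using s(1) ms ns by blast
    qed
  qed
  moreover have "bij_betw \<alpha> (verts G) V" using \<alpha> G by simp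
  ultimately have "models_corner V G ?g \<alpha>" unfolding models_corner_def by simp
  then show ?thesis by blast
qed

lemma concat_singletons: "concat (map (\<lambda>e. [e]) xs) = xs"
  by (induct xs) auto

text \<open>No edge leaves \<open>V\<close>, so all paths that start in \<open>V\<close> are paths of the
  restricted graph.\<close>

lemma models_corner_hereditary:
  assumes V: "V \<subseteq> verts E" "V \<noteq> {}" and her: "\<And>e. e \<in> arcs E \<Longrightarrow> tail E e \<in> V \<Longrightarrow> head E e \<in> V"
  shows "\<exists>G g' \<alpha>. models_corner V G g' \<alpha>"
proof -
  let ?B = "(\<lambda>e. [e]) ` {e \<in> arcs E. tail E e \<in> V}"
  have walk: "z \<in> V \<and> map (\<lambda>e. [e]) \<mu> \<in> lists ?B" if "awalk u \<mu> z" "u \<in> V" for u \<mu> z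
    using that
  proof (induct \<mu> arbitrary: u)
    case (Cons e \<mu>)
    then have e: "e \<in> arcs E" "tail E e \<in> V" "awalk (head E e) \<mu> z" by (auto simp: awalk_Cons_iff)
    then show ?case using Cons.hyps[OF e(3) her[OF e(1,2)]] by auto
  qed (auto simp: awalk_Nil_iff)
  have out: "{b \<in> ?B. \<exists>w. awalk v b w} = (\<lambda>e. [e]) ` out_arcs E v" if "v \<in> V" for v
    using that by (auto simp: awalk_Cons_iff awalk_Nil_iff)
  show ?thesis
  proof (rule models_corner_of_paths[OF V, of ?B])
    show "b \<noteq> [] \<and> (\<exists>u\<in>V. \<exists>w\<in>V. awalk u b w)" if "b \<in> ?B" for b
      using that her by (auto simp: awalk_Cons_iff awalk_Nil_iff)
  next
    fix v assume v: "v \<in> V" "{b \<in> ?B. \<exists>w. awalk v b w} \<noteq> {}"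
    then have ne: "out_arcs E v \<noteq> {}" "v \<in> verts E" using out V by auto
    have "P v = (\<Oplus>e\<in>out_arcs E v. pth v [e] \<otimes> gst v [e])"
      by (subst cuntz_krieger[OF ne(2,1)]) (auto simp: edge_head head_ghost intro!: M.finsum_cong')
    also have "\<dots> = (\<Oplus>b\<in>(\<lambda>e. [e]) ` out_arcs E v. pth v b \<otimes> gst v b)"
      by (rule M.finsum_reindex[symmetric]) (auto simp: inj_on_def)
    finally show "P v = (\<Oplus>b\<in>{b \<in> ?B. \<exists>w. awalk v b w}. pth v b \<otimes> gst v b)"
      unfolding out[OF v(1)] .
  next
    fix u w a assume u: "u \<in> V" "w \<in> V" "a \<in> carrier A"
    have "path_pairs {u} w \<subseteq> {pth u (concat bs) \<otimes> gst w (concat cs) | bs cs z.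
        bs \<in> lists ?B \<and> cs \<in> lists ?B \<and> z \<in> V \<and> awalk u (concat bs) z \<and> awalk w (concat cs) z}"
    proof
      fix s assume "s \<in> path_pairs {u} w"
      then obtain \<mu> \<nu> z where s: "s = pth u \<mu> \<otimes> gst w \<nu>" "awalk u \<mu> z" "awalk w \<nu> z"
        by (auto simp: path_pairs_def)
      then show "s \<in> {pth u (concat bs) \<otimes> gst w (concat cs) | bs cs z.
          bs \<in> lists ?B \<and> cs \<in> lists ?B \<and> z \<in> V \<and> awalk u (concat bs) z \<and> awalk w (concat cs) z}"
        using walk[OF s(2) u(1)] walk[OF s(3) u(2)]
        by (intro CollectI exI[of _ "map (\<lambda>e. [e]) \<mu>"] exI[of _ "map (\<lambda>e. [e]) \<nu>"] exI[of _ z])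
          (simp add: concat_singletons)
    qed
    then show "P u \<otimes> a \<otimes> P w \<in> lin {pth u (concat bs) \<otimes> gst w (concat cs) | bs cs z.
        bs \<in> lists ?B \<and> cs \<in> lists ?B \<and> z \<in> V \<and> awalk u (concat bs) z \<and> awalk w (concat cs) z}"
      using span[of u w a] u V lin_subset by blast
  qed auto
qed

text \<open>The new edges are the old ones that avoid \<open>v\<close> and the paths of length two through
  \<open>v\<close>. Since \<open>v\<close> has no loop, a path between other vertices is
  uniquely composed of these. Every occurrence of \<open>p\<^sub>v\<close> in the middle of a
  product is replaced by \<open>\<Sum>e e\<^sup>*\<close>; this gives the Cuntz-Krieger relation for the
  new edges and shows that products \<open>\<mu>\<nu>\<^sup>*\<close> with \<open>\<mu>\<close>
  and \<open>\<nu>\<close> ending at \<open>v\<close> are not missed.\<close>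

lemma models_corner_eliminate:
  assumes v: "v \<in> verts E" "out_arcs E v \<noteq> {}" and loopless: "\<And>e. e \<in> out_arcs E v \<Longrightarrow> head E e \<noteq> v"
    and ne: "verts E - {v} \<noteq> {}"
  shows "\<exists>G g' \<alpha>. models_corner (verts E - {v}) G g' \<alpha>"
proof -
  let ?V = "verts E - {v}"
  let ?B1 = "(\<lambda>e. [e]) ` {e \<in> arcs E. tail E e \<noteq> v \<and> head E e \<noteq> v}"
  let ?B2 = "(\<lambda>(d, e). [d, e]) ` ({d \<in> arcs E. head E d = v} \<times> out_arcs E v)"
  let ?B = "?B1 \<union> ?B2"
  have no_loop: "head E e \<noteq> v" if "e \<in> arcs E" "tail E e = v" for e using loopless that by auto
  have decomp: "\<exists>bs\<in>lists ?B. concat bs = \<mu>" if "awalk u \<mu> z" "u \<noteq> v" "z \<noteq> v" for u \<mu> z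
    using that
  proof (induct \<mu> arbitrary: u rule: length_induct)
    case (1 \<mu>)
    show ?case
    proof (cases \<mu>)
      case Nil
      then show ?thesis by (intro bexI[of _ "[]"]) auto
    next
      case (Cons e \<mu>')
      then have e: "e \<in> arcs E" "tail E e = u" "awalk (head E e) \<mu>' z"
        using 1(2) by (auto simp: awalk_Cons_iff)
      show ?thesis
      proof (cases "head E e = v")
        case False
        then obtain bs where "bs \<in> lists ?B" "concat bs = \<mu>'"
          using 1(1)[rule_format, OF _ e(3) False 1(4)] Cons by auto
        then show ?thesis using e False 1(3) Cons by (intro bexI[of _ "[e] # bs"]) auto
      next
        case True
        then obtain d \<mu>'' where d: "\<mu>' = d # \<mu>''" using e(3) 1(4) by (cases \<mu>') (auto simp: awalk_Nil_iff)
        then have d': "d \<in> arcs E" "tail E d = v" "awalk (head E d) \<mu>'' z"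
          using e(3) True by (auto simp: awalk_Cons_iff)
        then obtain bs where "bs \<in> lists ?B" "concat bs = \<mu>''"
          using 1(1)[rule_format, OF _ d'(3) no_loop[OF d'(1,2)] 1(4)] Cons d by auto
        then show ?thesis using e d d' True Cons by (intro bexI[of _ "[e, d] # bs"]) auto
      qed
    qed
  qed
  show ?thesis
  proof (rule models_corner_of_paths[OF _ ne, of ?B])
    show "?V \<subseteq> verts E" by auto
    have "finite {d \<in> arcs E. head E d = v}" by (rule finite_subset[of _ "arcs E"]) auto
    then show "finite ?B" by (intro finite_UnI finite_imageI finite_cartesian_product) auto
    show "b \<noteq> [] \<and> (\<exists>u\<in>?V. \<exists>w\<in>?V. awalk u b w)" if bB: "b \<in> ?B" for b
    proof -
      consider e where "b = [e]" "e \<in> arcs E" "tail E e \<noteq> v" "head E e \<noteq> v"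
        | d e where "b = [d, e]" "d \<in> arcs E" "head E d = v" "e \<in> arcs E" "tail E e = v"
        using bB by auto
      then show ?thesis
      proof cases
        case 1
        then show ?thesis
          by (intro conjI bexI[of _ "tail E e"] bexI[of _ "head E e"]) (auto simp: awalk_Cons_iff awalk_Nil_iff)
      next
        case 2
        then show ?thesis using no_loop[of d] no_loop[of e]
          by (intro conjI bexI[of _ "tail E d"] bexI[of _ "head E e"]) (auto simp: awalk_Cons_iff awalk_Nil_iff)
      qed
    qed
    show "b = c" if "b \<in> ?B" "c \<in> ?B" "prefix b c" for b c
    proof -
      have forms: "(\<exists>e. x = [e] \<and> head E e \<noteq> v) \<or> (\<exists>d e. x = [d, e] \<and> head E d = v)" if "x \<in> ?B" for x
        using that by (elim UnE imageE) auto
      from forms[OF that(1)] show ?thesis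
      proof (elim disjE exE conjE)
        fix e assume e: "b = [e]" "head E e \<noteq> v"
        from forms[OF that(2)] show ?thesis
        proof (elim disjE exE conjE)
          fix f assume "c = [f]"
          then show ?thesis using that(3) e(1) by (simp only: Cons_prefix_Cons)
        next
          fix d f assume "c = [d, f]" "head E d = v"
          then show ?thesis using that(3) e by (simp only: Cons_prefix_Cons) blast
        qed
      next
        fix d e assume b: "b = [d, e]"
        from forms[OF that(2)] show ?thesis
        proof (elim disjE exE conjE)
          fix f assume "c = [f]"
          then show ?thesis using that(3) b by (simp add: prefix_Nil)
        next
          fix d' f assume "c = [d', f]"
          then show ?thesis using that(3) b by (simp only: Cons_prefix_Cons)
        qed
      qed
    qed
  next
    fix u assume u: "u \<in> ?V" "{b \<in> ?B. \<exists>w. awalk u b w} \<noteq> {}"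
    let ?h = "\<lambda>b. pth u b \<otimes> gst u b"
    let ?O1 = "{e \<in> out_arcs E u. head E e \<noteq> v}" and ?O2 = "{e \<in> out_arcs E u. head E e = v}"
    have ne: "out_arcs E u \<noteq> {}" using u(2) by (fastforce simp: awalk_Cons_iff)
    have fin: "finite ?O1" "finite ?O2" by (rule finite_subset[of _ "arcs E"]; auto)+
    have fin3: "finite ((\<lambda>(d, e). [d, e]) ` (?O2 \<times> out_arcs E v))"
      using fin by (intro finite_imageI finite_cartesian_product) auto
    have h1: "?h [e] \<in> carrier A" if "e \<in> out_arcs E u" for e
      using that by auto
    have h2: "?h [d, e] \<in> carrier A" if "d \<in> ?O2" "e \<in> out_arcs E v" for d e
      using that by auto
    have B_u: "{b \<in> ?B. \<exists>w. awalk u b w} = (\<lambda>e. [e]) ` ?O1 \<union> (\<lambda>(d, e). [d, e]) ` (?O2 \<times> out_arcs E v)"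
      using u(1) by (auto simp: awalk_Cons_iff awalk_Nil_iff)
    have split: "?h [d] = (\<Oplus>e\<in>out_arcs E v. ?h [d, e])" if d: "d \<in> ?O2" for d
    proof -
      have "?h [d] = (S d \<otimes> P v) \<otimes> T d" using d head_ghost[of d] by (auto simp: A.m_assoc)
      also have "\<dots> = (\<Oplus>e\<in>out_arcs E v. (S d \<otimes> S e) \<otimes> T e) \<otimes> T d"
        using expand_right[of "S d" v] d v by simp
      also have "\<dots> = (\<Oplus>e\<in>out_arcs E v. ((S d \<otimes> S e) \<otimes> T e) \<otimes> T d)"
        using d by (intro A.finsum_ldistr) auto
      also have "\<dots> = (\<Oplus>e\<in>out_arcs E v. ?h [d, e])"
      proof (intro M.finsum_cong' refl)
        fix e assume e: "e \<in> out_arcs E v"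
        show "((S d \<otimes> S e) \<otimes> T e) \<otimes> T d = ?h [d, e]"
          using d e by (auto simp: edge_head head_ghost A.m_assoc)
      qed (use d h2 in auto)
      finally show ?thesis .
    qed
    have "P u = (\<Oplus>e\<in>out_arcs E u. ?h [e])"
      using u(1) ne by (subst cuntz_krieger) (auto simp: edge_head head_ghost intro!: M.finsum_cong')
    also have "out_arcs E u = ?O1 \<union> ?O2" by auto
    also have "(\<Oplus>e\<in>?O1 \<union> ?O2. ?h [e]) = (\<Oplus>e\<in>?O1. ?h [e]) \<oplus> (\<Oplus>e\<in>?O2. ?h [e])"
      using h1 fin by (intro M.finsum_Un_disjoint) auto
    also have "(\<Oplus>e\<in>?O1. ?h [e]) = (\<Oplus>b\<in>(\<lambda>e. [e]) ` ?O1. ?h b)"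
      using h1 by (subst M.finsum_reindex) (auto simp: inj_on_def)
    also have "(\<Oplus>d\<in>?O2. ?h [d]) = (\<Oplus>d\<in>?O2. \<Oplus>e\<in>out_arcs E v. ?h [d, e])"
      using split h2 by (intro M.finsum_cong' M.finsum_closed' Pi_I) auto
    also have "\<dots> = (\<Oplus>p\<in>?O2 \<times> out_arcs E v. ?h (case p of (d, e) \<Rightarrow> [d, e]))"
      using h2 fin by (subst M.finsum_Sigma) auto
    also have "\<dots> = (\<Oplus>b\<in>(\<lambda>(d, e). [d, e]) ` (?O2 \<times> out_arcs E v). ?h b)"
      using h2 by (subst M.finsum_reindex) (auto simp: inj_on_def)
    also have "(\<Oplus>b\<in>(\<lambda>e. [e]) ` ?O1. ?h b) \<oplus> (\<Oplus>b\<in>(\<lambda>(d, e). [d, e]) ` (?O2 \<times> out_arcs E v). ?h b)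
        = (\<Oplus>b\<in>{b \<in> ?B. \<exists>w. awalk u b w}. ?h b)"
      unfolding B_u
    proof (rule M.finsum_Un_disjoint[symmetric])
      show "(\<lambda>e. [e]) ` ?O1 \<inter> (\<lambda>(d, e). [d, e]) ` (?O2 \<times> out_arcs E v) = {}" by auto
      show "?h \<in> (\<lambda>e. [e]) ` ?O1 \<rightarrow> carrier A" using h1 by blast
      show "?h \<in> (\<lambda>(d, e). [d, e]) ` (?O2 \<times> out_arcs E v) \<rightarrow> carrier A"
        by (intro Pi_I, elim imageE SigmaE) (simp only: prod.case h2)
    qed (use fin fin3 in simp_all)
    finally show "P u = (\<Oplus>b\<in>{b \<in> ?B. \<exists>w. awalk u b w}. ?h b)" .
  next
    fix u w a assume u: "u \<in> ?V" "w \<in> ?V" "a \<in> carrier A"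
    let ?S = "{pth u (concat bs) \<otimes> gst w (concat cs) | bs cs z.
      bs \<in> lists ?B \<and> cs \<in> lists ?B \<and> z \<in> ?V \<and> awalk u (concat bs) z \<and> awalk w (concat cs) z}"
    have S_closed: "?S \<subseteq> carrier A"
    proof (intro subsetI, elim CollectE exE conjE)
      fix s bs cs z
      assume s: "s = pth u (concat bs) \<otimes> gst w (concat cs)" "awalk u (concat bs) z" "awalk w (concat cs) z"
      show "s \<in> carrier A" unfolding s(1) by (intro A.m_closed pth_closed[OF s(2)] gst_closed[OF s(3)])
    qed
    have good: "pth u \<mu> \<otimes> gst w \<nu> \<in> lin ?S" if aw: "awalk u \<mu> z" "awalk w \<nu> z" "z \<noteq> v" for \<mu> \<nu> z
    proof -
      obtain bs cs where "bs \<in> lists ?B" "concat bs = \<mu>" "cs \<in> lists ?B" "concat cs = \<nu>"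
        using decomp[OF aw(1)] decomp[OF aw(2)] u aw(3) by blast
      then have "pth u \<mu> \<otimes> gst w \<nu> \<in> ?S" using aw awalk_last_in_verts by blast
      then show ?thesis by (rule lin_base[OF S_closed])
    qed
    show "P u \<otimes> a \<otimes> P w \<in> lin ?S"
    proof (rule lin_mono[OF path_pairs_closed S_closed span])
      fix s assume "s \<in> path_pairs {u} w"
      then obtain \<mu> \<nu> z where s: "s = pth u \<mu> \<otimes> gst w \<nu>" "awalk u \<mu> z" "awalk w \<nu> z"
        by (auto simp: path_pairs_def)
      show "s \<in> lin ?S"
      proof (cases "z = v")
        case False
        then show ?thesis using good s by blast
      next
        case True
        have cl: "pth u \<mu> \<in> carrier A" "gst w \<nu> \<in> carrier A" using s pth_closed gst_closed by blast+
        have "s = (pth u \<mu> \<otimes> P v) \<otimes> gst w \<nu>" using s True pth_right by simp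
        also have "\<dots> = (\<Oplus>e\<in>out_arcs E v. (pth u \<mu> \<otimes> S e) \<otimes> T e) \<otimes> gst w \<nu>"
          using expand_right[OF cl(1) v] by simp
        also have "\<dots> = (\<Oplus>e\<in>out_arcs E v. ((pth u \<mu> \<otimes> S e) \<otimes> T e) \<otimes> gst w \<nu>)"
          using cl by (intro A.finsum_ldistr) auto
        also have "\<dots> = (\<Oplus>e\<in>out_arcs E v. pth u (\<mu> @ [e]) \<otimes> gst w (\<nu> @ [e]))"
        proof (intro M.finsum_cong' refl)
          fix e assume e: "e \<in> out_arcs E v"
          then have w: "awalk v [e] (head E e)" by (auto simp: awalk_Cons_iff awalk_Nil_iff)
          show "((pth u \<mu> \<otimes> S e) \<otimes> T e) \<otimes> gst w \<nu> = pth u (\<mu> @ [e]) \<otimes> gst w (\<nu> @ [e])"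
            using pth_append[OF s(2)[unfolded True] w] gst_append[OF s(3)[unfolded True] w] e cl
            by (simp add: edge_head head_ghost A.m_assoc)
        next
          show "(\<lambda>e. pth u (\<mu> @ [e]) \<otimes> gst w (\<nu> @ [e])) \<in> out_arcs E v \<rightarrow> carrier A"
          proof
            fix e assume "e \<in> out_arcs E v"
            then have w: "awalk v [e] (head E e)" by (auto simp: awalk_Cons_iff awalk_Nil_iff)
            show "pth u (\<mu> @ [e]) \<otimes> gst w (\<nu> @ [e]) \<in> carrier A"
              using pth_closed[OF awalk_appendI[OF s(2)[unfolded True] w]]
                gst_closed[OF awalk_appendI[OF s(3)[unfolded True] w]] by simp
          qed
        qed
        finally have eq: "s = (\<Oplus>e\<in>out_arcs E v. pth u (\<mu> @ [e]) \<otimes> gst w (\<nu> @ [e]))" .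
        show ?thesis unfolding eq
        proof (rule lin_finsum[OF S_closed])
          fix e assume e: "e \<in> out_arcs E v"
          then have w: "awalk v [e] (head E e)" by (auto simp: awalk_Cons_iff awalk_Nil_iff)
          show "pth u (\<mu> @ [e]) \<otimes> gst w (\<nu> @ [e]) \<in> lin ?S"
            by (rule good[OF awalk_appendI[OF s(2)[unfolded True] w] awalk_appendI[OF s(3)[unfolded True] w] loopless[OF e]])
        qed auto
      qed
    qed (use u in auto)
  qed
qed

end

section \<open>From a frame to a graph\<close>

context leavitt_system begin

text \<open>If \<open>j\<close> emits a single edge \<open>a\<close>, then \<open>p\<^sub>j = a
  a\<^sup>*\<close> while \<open>a\<^sup>* a\<close> is the vertex at the head of
  \<open>a\<close>. So an additional copy of a vertex is the same thing as a new vertex with one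
  edge into the old one.\<close>

lemma system_of_full_frame:
  fixes J :: "nat set"
  assumes fr: "frame f J x y \<nu>" and J: "\<nu> ` J = verts E"
  shows "\<exists>(G :: (nat, nat) pre_digraph) g'. leavitt_system A K G g' \<and> leavitt_family.unit A G g' = f"
proof -
  note fj = frameD[OF fr]
  \<comment> \<open>one index for every vertex of \<open>E\<close>; on these indices \<open>G\<close> is a copy of \<open>E\<close>, and every other index \<open>j\<close> gets the edge \<open>Inr j\<close>\<close>
  define m where "m v = (SOME j. j \<in> J \<and> \<nu> j = v)" for v
  have m: "m v \<in> J \<and> \<nu> (m v) = v" if "v \<in> verts E" for v
    unfolding m_def by (rule someI_ex) (use that J in \<open>metis imageE\<close>)
  define G where "G = \<lparr>verts = J, arcs = Inl ` arcs E \<union> Inr ` (J - m ` verts E),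
    tail = case_sum (\<lambda>e. m (tail E e)) (\<lambda>j. j), head = case_sum (\<lambda>e. m (head E e)) (\<lambda>j. m (\<nu> j))\<rparr>"
  have G: "verts G = J" "arcs G = Inl ` arcs E \<union> Inr ` (J - m ` verts E)"
    "tail G (Inl e) = m (tail E e)" "tail G (Inr j) = j" "head G (Inl e) = m (head E e)" "head G (Inr j) = m (\<nu> j)"
    for e j
    by (simp_all add: G_def)
  interpret G: fin_digraph G
    by unfold_locales (use fj(1,4) m in \<open>auto simp: G\<close>)
  \<comment> \<open>the elements \<open>W i a j\<close> multiply like matrices with the single entry \<open>a\<close> in position \<open>(i, j)\<close>\<close>
  define W where "W i a j = x i \<otimes> (a \<otimes> y j)" for i a j
  have W_closed: "W i a j \<in> carrier A" if "i \<in> J" "j \<in> J" "a \<in> carrier A" for i a j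
    using that fj by (simp add: W_def)
  have W_mult: "W i a j \<otimes> W l b k = (if j = l then W i (a \<otimes> (P (\<nu> j) \<otimes> b)) k else \<zero>)"
    if "i \<in> J" "j \<in> J" "l \<in> J" "k \<in> J" "a \<in> carrier A" "b \<in> carrier A" for i j l k a b
  proof -
    have "W i a j \<otimes> W l b k = x i \<otimes> (a \<otimes> ((y j \<otimes> x l) \<otimes> (b \<otimes> y k)))"
      using that fj(2,3) by (simp add: W_def A.m_assoc)
    then show ?thesis unfolding fj(7)[OF that(2,3)] using that fj(2-4) by (simp add: W_def A.m_assoc)
  qed
  define s where "s = case_sum S (\<lambda>j. P (\<nu> j))"
  define t where "t = case_sum T (\<lambda>j. P (\<nu> j))"
  have arc: "tail G a \<in> J" "head G a \<in> J" "\<nu> (tail G a) \<in> verts E" "\<nu> (head G a) \<in> verts E"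
    "s a \<in> carrier A" "t a \<in> carrier A"
    "P (\<nu> (tail G a)) \<otimes> s a = s a" "s a \<otimes> P (\<nu> (head G a)) = s a"
    "P (\<nu> (head G a)) \<otimes> t a = t a" "t a \<otimes> P (\<nu> (tail G a)) = t a"
    "t a \<otimes> s a = P (\<nu> (head G a))"
    if "a \<in> arcs G" for a
    using that m fj(4) by (auto simp: G s_def t_def tail_edge edge_head head_ghost ghost_tail ghost_edge)
  let ?g = "case_generator (\<lambda>j. W j (P (\<nu> j)) j) (\<lambda>a. W (tail G a) (s a) (head G a)) (\<lambda>a. W (head G a) (t a) (tail G a))"
  have fam: "leavitt_family A K G ?g"
  proof unfold_locales
    fix a b assume a: "a \<in> arcs G" "b \<in> arcs G"
    show "?g (Ghost a) \<otimes> ?g (Edge b) = (if a = b then ?g (Vertex (head G a)) else \<zero>)"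
    proof (cases "a = b")
      case True
      then show ?thesis using a arc[OF a(1)] by (simp add: W_mult)
    next
      case False
      have "t a \<otimes> s b = \<zero>" if "tail G a = tail G b"
        using that a False by (auto simp: G s_def t_def ghost_edge split: if_splits)
      then show ?thesis using False a arc[OF a(1)] arc[OF a(2)]
        by (auto simp: W_mult) (simp add: W_def fj)
    qed
  next
    fix j assume j: "j \<in> verts G" "out_arcs G j \<noteq> {}"
    have jJ: "j \<in> J" "\<nu> j \<in> verts E" using j fj G by auto
    have summand: "?g (Edge a) \<otimes> ?g (Ghost a) = W j (s a \<otimes> t a) j" if "a \<in> out_arcs G j" for a
      using that arc[of a] by (auto simp: W_mult)
    have "(\<Oplus>a\<in>out_arcs G j. ?g (Edge a) \<otimes> ?g (Ghost a)) = (\<Oplus>a\<in>out_arcs G j. W j (s a \<otimes> t a) j)"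
      using summand arc jJ by (intro M.finsum_cong' Pi_I W_closed) auto
    also have "\<dots> = W j (P (\<nu> j)) j"
    proof (cases "j \<in> m ` verts E")
      case True
      then have mj: "j = m (\<nu> j)" using m by auto
      have out: "out_arcs G j = Inl ` out_arcs E (\<nu> j)"
      proof (intro equalityI subsetI)
        fix a assume a: "a \<in> out_arcs G j"
        show "a \<in> Inl ` out_arcs E (\<nu> j)"
        proof (cases a)
          case (Inl e)
          then have "e \<in> arcs E" "m (tail E e) = j" using a by (auto simp: G)
          moreover then have "tail E e = \<nu> j" using m[of "tail E e"] by simp
          ultimately show ?thesis using Inl by simp
        next
          case (Inr i)
          then show ?thesis using a True by (auto simp: G)
        qed
      next
        fix a :: "'e + nat" assume "a \<in> Inl ` out_arcs E (\<nu> j)"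
        then obtain e where e: "a = Inl e" "e \<in> arcs E" "tail E e = \<nu> j" by auto
        have "tail G a = m (\<nu> j)" using e by (simp add: G)
        then have "tail G a = j" unfolding mj[symmetric] .
        moreover have "a \<in> arcs G" using e by (simp add: G)
        ultimately show "a \<in> out_arcs G j" by simp
      qed
      then have ne: "out_arcs E (\<nu> j) \<noteq> {}" using j by auto
      have cl: "S e \<otimes> T e \<in> carrier A" if "e \<in> out_arcs E (\<nu> j)" for e using that by auto
      have "(\<Oplus>a\<in>out_arcs G j. W j (s a \<otimes> t a) j) = (\<Oplus>e\<in>out_arcs E (\<nu> j). x j \<otimes> ((S e \<otimes> T e) \<otimes> y j))"
        unfolding out using jJ cl fj by (subst M.finsum_reindex) (auto simp: s_def t_def W_def)
      also have "\<dots> = x j \<otimes> (\<Oplus>e\<in>out_arcs E (\<nu> j). (S e \<otimes> T e) \<otimes> y j)"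
        using jJ cl fj by (intro A.finsum_rdistr[symmetric]) auto
      also have "(\<Oplus>e\<in>out_arcs E (\<nu> j). (S e \<otimes> T e) \<otimes> y j) = (\<Oplus>e\<in>out_arcs E (\<nu> j). S e \<otimes> T e) \<otimes> y j"
        using jJ cl fj by (intro A.finsum_ldistr[symmetric]) auto
      also have "(\<Oplus>e\<in>out_arcs E (\<nu> j). S e \<otimes> T e) = P (\<nu> j)"
        using cuntz_krieger[OF jJ(2) ne] by simp
      finally show ?thesis by (simp add: W_def)
    next
      case False
      then have "out_arcs G j = {Inr j}" using jJ m by (auto simp: G)
      then show ?thesis using jJ fj by (simp add: s_def t_def W_def)
    qed
    finally show "?g (Vertex j) = (\<Oplus>a\<in>out_arcs G j. ?g (Edge a) \<otimes> ?g (Ghost a))" by simp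
  next
    fix z assume "z \<in> generators G"
    then show "?g z \<in> carrier A"
      using arc fj(4) by (auto simp: generators_def G(1) intro!: W_closed)
  qed (use arc fj(4) in \<open>auto simp: W_mult G(1)\<close>)
  interpret F: leavitt_family A K G ?g by (rule fam)
  \<comment> \<open>the path of \<open>E\<close> that is left when the added edges are deleted\<close>
  define core where "core bs = concat (map (case_sum (\<lambda>e. [e]) (\<lambda>_. [])) bs)" for bs :: "('e + nat) list"
  have walk: "awalk (\<nu> j) (core bs) (\<nu> l)" if "G.awalk j bs l" for j bs l
    using that
  proof (induct bs arbitrary: j)
    case Nil
    then show ?case using fj(4) by (auto simp: G.awalk_Nil_iff awalk_Nil_iff core_def G(1))
  next
    case (Cons a bs)
    then have a: "a \<in> arcs G" "j = tail G a" "G.awalk (head G a) bs l" by (auto simp: G.awalk_Cons_iff)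
    then show ?case using Cons.hyps[OF a(3)] m fj(4)
      by (auto simp: G awalk_Cons_iff awalk_Nil_iff core_def)
  qed
  have ends: "j \<in> J" "l \<in> J" if "G.awalk j bs l" for j bs l
    using G.awalk_hd_in_verts[OF that] G.awalk_last_in_verts[OF that] by (simp_all add: G(1))
  have core_Cons: "pth (\<nu> (tail G a)) (core (a # bs)) = s a \<otimes> pth (\<nu> (head G a)) (core bs)
      \<and> gst (\<nu> (tail G a)) (core (a # bs)) = gst (\<nu> (head G a)) (core bs) \<otimes> t a"
    if a: "a \<in> arcs G" "G.awalk (head G a) bs l" for a bs l
    using a m fj(4) pth_left[OF walk[OF a(2)]] gst_right[OF walk[OF a(2)]]
    by (auto simp: G core_def s_def t_def)
  have pth: "F.pth j bs = W j (pth (\<nu> j) (core bs)) l \<and> F.gst j bs = W l (gst (\<nu> j) (core bs)) j"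
    if "G.awalk j bs l" for j bs l
    using that
  proof (induct bs arbitrary: j)
    case Nil
    then show ?case by (auto simp: G.awalk_Nil_iff core_def)
  next
    case (Cons a bs)
    then have a: "a \<in> arcs G" "j = tail G a" "G.awalk (head G a) bs l" by (auto simp: G.awalk_Cons_iff)
    note w = walk[OF a(3)]
    show ?case
      using Cons.hyps[OF a(3)] a(2) arc[OF a(1)] core_Cons[OF a(1,3)] ends[OF a(3)] pth_left[OF w] gst_right[OF w]
        pth_closed[OF w] gst_closed[OF w]
      by (simp add: W_mult)
  qed
  have shape: "bs = (if j \<in> m ` verts E then map Inl (core bs) else if l = j then [] else Inr j # map Inl (core bs))
      \<and> (bs \<noteq> [] \<longrightarrow> l \<in> m ` verts E)"
    if "G.awalk j bs l" for j bs l
    using that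
  proof (induct bs arbitrary: j)
    case (Cons a bs)
    then have a: "a \<in> arcs G" "j = tail G a" "G.awalk (head G a) bs l" by (auto simp: G.awalk_Cons_iff)
    have h: "head G a \<in> m ` verts E" using a(1) fj(4) by (auto simp: G)
    have IH: "bs = map Inl (core bs)" "bs \<noteq> [] \<longrightarrow> l \<in> m ` verts E" using Cons.hyps[OF a(3)] h by auto
    have l: "l \<in> m ` verts E" using IH(2) a(3) h by (cases bs) (auto simp: G.awalk_Nil_iff)
    show ?case
    proof (cases a)
      case (Inl e)
      then have "j \<in> m ` verts E" using a by (auto simp: G)
      then show ?thesis using Inl IH(1) l by (auto simp: core_def)
    next
      case (Inr i)
      then have "j \<notin> m ` verts E" "i = j" using a by (auto simp: G)
      then show ?thesis using Inr IH(1) l by (auto simp: core_def)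
    qed
  qed (auto simp: core_def G.awalk_Nil_iff)
  have lift: "\<exists>bs. G.awalk j bs (m z) \<and> core bs = \<mu>" if jw: "j \<in> J" "awalk (\<nu> j) \<mu> z" for j \<mu> z
  proof -
    have main: "G.awalk (m u) (map Inl \<mu>) (m z) \<and> core (map Inl \<mu>) = \<mu>" if "awalk u \<mu> z" for u
      using that
    proof (induct \<mu> arbitrary: u)
      case Nil
      then show ?case using m by (auto simp: awalk_Nil_iff G.awalk_Nil_iff core_def G(1))
    next
      case (Cons e \<mu>)
      then have "e \<in> arcs E" "u = tail E e" "awalk (head E e) \<mu> z" by (auto simp: awalk_Cons_iff)
      then show ?case using Cons.hyps[of "head E e"] by (auto simp: G.awalk_Cons_iff G core_def)
    qed
    show ?thesis
    proof (cases "j \<in> m ` verts E")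
      case True
      then have "m (\<nu> j) = j" using m by auto
      then show ?thesis using main[OF jw(2)] by auto
    next
      case False
      then have "G.awalk j (Inr j # map Inl \<mu>) (m z)"
        using main[OF jw(2)] jw(1) by (auto simp: G.awalk_Cons_iff G)
      then show ?thesis using main[OF jw(2)] by (auto simp: core_def)
    qed
  qed
  have sys: "leavitt_system A K G ?g"
  proof unfold_locales
    show "verts G \<noteq> {}" using J verts_nonempty G by auto
    show "lin_indep (\<lambda>(v, \<mu>). F.pth v \<mu>) {(v, \<mu>). \<exists>w. G.awalk v \<mu> w}"
      unfolding lin_indep_def
    proof (intro allI impI ballI, elim conjE)
      fix Y c i0
      assume Y: "finite Y" "Y \<subseteq> {(v, \<mu>). \<exists>w. G.awalk v \<mu> w}" "c \<in> Y \<rightarrow> carrier K" "i0 \<in> Y"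
        and sum: "(\<Oplus>i\<in>Y. c i \<odot> (case i of (v, \<mu>) \<Rightarrow> F.pth v \<mu>)) = \<zero>"
      have "\<exists>w. G.awalk (fst i) (snd i) w" if "i \<in> Y" for i using subsetD[OF Y(2) that] by auto
      then obtain r where r: "\<And>i. i \<in> Y \<Longrightarrow> G.awalk (fst i) (snd i) (r i)" by metis
      have cK: "c i \<in> carrier K" if "i \<in> Y" for i using Y(3) that by auto
      define j l where "j = fst i0" and "l = r i0"
      have jl: "j \<in> J" "l \<in> J" using ends[OF r[OF Y(4)]] by (simp_all add: j_def l_def)
      let ?p = "\<lambda>i. pth (\<nu> (fst i)) (core (snd i))"
      have pcl: "?p i \<in> carrier A" "F.pth (fst i) (snd i) \<in> carrier A" if "i \<in> Y" for i
        using pth_closed[OF walk[OF r[OF that]]] F.pth_closed[OF r[OF that]] by auto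
      let ?I = "{i \<in> Y. fst i = j \<and> r i = l}"
      have cut: "y j \<otimes> F.pth (fst i) (snd i) \<otimes> x l = (if i \<in> ?I then ?p i else \<zero>)" if i: "i \<in> Y" for i
      proof -
        note e = ends[OF r[OF i]] and w = walk[OF r[OF i]]
        have "y j \<otimes> F.pth (fst i) (snd i) \<otimes> x l = (y j \<otimes> x (fst i)) \<otimes> ?p i \<otimes> (y (r i) \<otimes> x l)"
          using pth[OF r[OF i]] pcl(1)[OF i] e jl fj(2,3) by (simp add: W_def A.m_assoc)
        then show ?thesis
          using fj(7)[OF jl(1) e(1)] fj(7)[OF e(2) jl(2)] i pcl[OF i] pth_left[OF w] pth_right[OF w] fj(4)[OF e(1)] fj(4)[OF e(2)]
            fj(4)[OF jl(1)] fj(4)[OF jl(2)]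
          by auto
      qed
      have ysum: "(\<Oplus>i\<in>Y. y j \<otimes> (c i \<odot> F.pth (fst i) (snd i)) \<otimes> x l) = \<zero>"
      proof -
        have "(\<Oplus>i\<in>Y. y j \<otimes> (c i \<odot> F.pth (fst i) (snd i)) \<otimes> x l)
            = (\<Oplus>i\<in>Y. y j \<otimes> (c i \<odot> F.pth (fst i) (snd i))) \<otimes> x l"
          using Y pcl cK jl fj by (intro A.finsum_ldistr[symmetric]) auto
        also have "\<dots> = (y j \<otimes> (\<Oplus>i\<in>Y. c i \<odot> F.pth (fst i) (snd i))) \<otimes> x l"
          using Y pcl cK jl fj by (subst A.finsum_rdistr) auto
        finally show ?thesis using sum jl fj by (simp add: case_prod_unfold)
      qed
      have "(\<Oplus>i\<in>?I. c i \<odot> ?p i) = (\<Oplus>i\<in>Y. y j \<otimes> (c i \<odot> F.pth (fst i) (snd i)) \<otimes> x l)"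
      proof (rule M.add.finprod_mono_neutral_cong_left[OF Y(1)])
        have eq: "y j \<otimes> (c i \<odot> F.pth (fst i) (snd i)) \<otimes> x l = (if i \<in> ?I then c i \<odot> ?p i else \<zero>)" if "i \<in> Y" for i
          using cut[OF that] cK[OF that] pcl[OF that] jl fj by (auto simp: smult_mult_left smult_mult_right)
        show "y j \<otimes> (c i \<odot> F.pth (fst i) (snd i)) \<otimes> x l = \<zero>" if "i \<in> Y - ?I" for i
          using eq[of i] that by auto
        show "c i \<odot> ?p i = y j \<otimes> (c i \<odot> F.pth (fst i) (snd i)) \<otimes> x l" if "i \<in> ?I" for i
          using eq[of i] that by auto
        show "(\<lambda>i. y j \<otimes> (c i \<odot> F.pth (fst i) (snd i)) \<otimes> x l) \<in> Y \<rightarrow> carrier A"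
          using pcl cK jl fj by auto
      qed auto
      then have sum0: "(\<Oplus>i\<in>?I. c i \<odot> ?p i) = \<zero>" using ysum by simp
      show "c i0 = \<zero>\<^bsub>K\<^esub>"
      proof (rule lin_indep_isolated[OF indep, of ?I c "\<lambda>i. (\<nu> (fst i), core (snd i))"])
        show "(\<Oplus>i\<in>?I. c i \<odot> (case (\<nu> (fst i), core (snd i)) of (v, \<mu>) \<Rightarrow> pth v \<mu>)) = \<zero>"
          using sum0 by simp
        show "(\<nu> (fst i), core (snd i)) \<in> {(v, \<mu>). \<exists>w. awalk v \<mu> w}" if "i \<in> ?I" for i
          using walk[OF r[of i]] that by auto
        show "i0 \<in> ?I" using Y(4) by (simp add: j_def l_def)
        show "i = i0" if "i \<in> ?I" "(\<nu> (fst i), core (snd i)) = (\<nu> (fst i0), core (snd i0))" for i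
        proof (rule prod_eqI)
          show eq: "fst i = fst i0" using that by (simp add: j_def)
          have "r i = r i0" "core (snd i) = core (snd i0)" using that by (simp_all add: l_def)
          then show "snd i = snd i0"
            using shape[OF r[of i]] shape[OF r[OF Y(4)]] that(1) eq by (metis (mono_tags, lifting) mem_Collect_eq)
        qed
        show "c i \<in> carrier K" if "i \<in> ?I" for i using cK that by auto
      qed (use Y pth_closed in auto)
    qed
  next
    fix j l a assume j: "j \<in> verts G" "l \<in> verts G" "a \<in> carrier A"
    then have jl: "j \<in> J" "l \<in> J" by (simp_all add: G)
    note fjl = fj(2-4)[OF jl(1)] fj(2-4)[OF jl(2)]
    let ?b = "P (\<nu> j) \<otimes> (y j \<otimes> a \<otimes> x l) \<otimes> P (\<nu> l)"
    have eq: "?g (Vertex j) \<otimes> a \<otimes> ?g (Vertex l) = x j \<otimes> ?b \<otimes> y l"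
      using fjl j(3) by (simp add: W_def A.m_assoc)
    have "x j \<otimes> ?b \<otimes> y l \<in> lin (F.path_pairs {j} l)"
    proof (rule lin_sandwich[OF path_pairs_closed F.path_pairs_closed])
      show "?b \<in> lin (path_pairs {\<nu> j} (\<nu> l))" using fjl j(3) by (intro span) auto
      fix q assume "q \<in> path_pairs {\<nu> j} (\<nu> l)"
      then obtain \<mu> \<kappa> z where q: "q = pth (\<nu> j) \<mu> \<otimes> gst (\<nu> l) \<kappa>" "awalk (\<nu> j) \<mu> z" "awalk (\<nu> l) \<kappa> z"
        by (auto simp: path_pairs_def)
      obtain bs where bs: "G.awalk j bs (m z)" "core bs = \<mu>" using lift[OF jl(1) q(2)] by blast
      obtain cs where cs: "G.awalk l cs (m z)" "core cs = \<kappa>" using lift[OF jl(2) q(3)] by blast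
      have z: "z \<in> verts E" "m z \<in> J" "\<nu> (m z) = z" using q(2) m awalk_last_in_verts by auto
      have "F.pth j bs \<otimes> F.gst l cs = W j (pth (\<nu> j) \<mu> \<otimes> (P z \<otimes> gst (\<nu> l) \<kappa>)) l"
        using pth[OF bs(1)] pth[OF cs(1)] bs(2) cs(2) z jl pth_closed[OF q(2)] gst_closed[OF q(3)]
        by (simp add: W_mult)
      also have "\<dots> = x j \<otimes> q \<otimes> y l"
        using q fjl pth_closed[OF q(2)] gst_closed[OF q(3)] gst_left[OF q(3)] by (simp add: W_def A.m_assoc)
      finally have eq: "F.pth j bs \<otimes> F.gst l cs = x j \<otimes> q \<otimes> y l" .
      have "x j \<otimes> q \<otimes> y l \<in> F.path_pairs {j} l"
        unfolding F.path_pairs_def eq[symmetric] using bs(1) cs(1) by blast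
      then show "x j \<otimes> q \<otimes> y l \<in> lin (F.path_pairs {j} l)" by (rule lin_base[OF F.path_pairs_closed])
    qed (use fjl in auto)
    then show "?g (Vertex j) \<otimes> a \<otimes> ?g (Vertex l) \<in> lin (F.path_pairs {j} l)" unfolding eq .
  qed
  \<comment> \<open>only renames the edges of \<open>G\<close>, which have a sum type, by natural numbers\<close>
  interpret G': leavitt_system A K G ?g by (rule sys)
  obtain H g' \<alpha> where H: "F.models_corner (verts G) H g' \<alpha>"
    using G'.models_corner_hereditary[of "verts G"] G'.verts_nonempty by auto
  then have sysH: "leavitt_system A K H g'" and \<alpha>: "bij_betw \<alpha> (verts H) (verts G)"
    and gH: "\<And>n. n \<in> verts H \<Longrightarrow> g' (Vertex n) = W (\<alpha> n) (P (\<nu> (\<alpha> n))) (\<alpha> n)"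
    by (auto simp: F.models_corner_def)
  interpret H: leavitt_system A K H g' by (rule sysH)
  have "H.unit = (\<Oplus>n\<in>verts H. x (\<alpha> n) \<otimes> y (\<alpha> n))"
    unfolding H.unit_def using gH \<alpha> fj by (intro M.finsum_cong') (auto simp: W_def bij_betw_def G(1))
  also have "\<dots> = (\<Oplus>j\<in>\<alpha> ` verts H. x j \<otimes> y j)"
    using \<alpha> fj by (intro M.finsum_reindex[symmetric]) (auto simp: bij_betw_def G(1))
  also have "\<dots> = f" using \<alpha> fj(8) by (simp add: bij_betw_def G(1))
  finally show ?thesis using sysH by blast
qed

lemma frame_models_corner:
  assumes "models_corner V G g' \<alpha>" and fr: "frame f J x y \<nu>" and "\<nu> ` J \<subseteq> V"
  shows "\<exists>\<nu>'. leavitt_family.frame A G g' f J x y \<nu>' \<and> \<alpha> ` (\<nu>' ` J) = \<nu> ` J \<and> \<nu>' ` J \<subseteq> verts G"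
proof -
  have sys: "leavitt_system A K G g'" and \<alpha>: "bij_betw \<alpha> (verts G) V"
    and gv: "\<And>n. n \<in> verts G \<Longrightarrow> g' (Vertex n) = P (\<alpha> n)"
    using assms(1) by (auto simp: models_corner_def)
  interpret G: leavitt_system A K G g' by (rule sys)
  let ?\<nu> = "\<lambda>k. inv_into (verts G) \<alpha> (\<nu> k)"
  have inv: "?\<nu> k \<in> verts G \<and> \<alpha> (?\<nu> k) = \<nu> k" if "k \<in> J" for k
    using that assms(3) \<alpha> inv_into_into[of "\<nu> k" \<alpha> "verts G"] f_inv_into_f[of "\<nu> k" \<alpha> "verts G"]
    by (auto simp: bij_betw_def)
  have "G.frame f J x y ?\<nu>"
    using fr inv gv unfolding frame_def G.frame_def by auto
  then show ?thesis using inv by (intro exI[of _ ?\<nu>]) (auto simp: image_image)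
qed

end

text \<open>Induction on the number of vertices. It is essential that \<open>J\<close> is nonempty: a graph
  has a vertex, so no full frame has an empty index set.\<close>

lemma reduce_to_full_frame:
  fixes E :: "(nat, nat) pre_digraph" and J :: "nat set"
  assumes "leavitt_system A K E g" and "leavitt_family.frame A E g f J x y \<nu>" and "J \<noteq> {}"
  shows "\<exists>(E' :: (nat, nat) pre_digraph) g' (J' :: nat set) x' y' \<nu>'.
    leavitt_system A K E' g' \<and> leavitt_family.frame A E' g' f J' x' y' \<nu>' \<and> \<nu>' ` J' = verts E'"
  using assms
proof (induct "card (verts E)" arbitrary: E g J x y \<nu> rule: less_induct)
  case less
  interpret leavitt_system A K E g by (rule less.prems(1))
  note fr = less.prems(2) and J = less.prems(3)
  show ?case
  proof (cases "\<exists>v\<in>verts E. out_arcs E v \<noteq> {} \<and> (\<forall>e\<in>out_arcs E v. head E e \<noteq> v)")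
    case True
    then obtain v where v: "v \<in> verts E" "out_arcs E v \<noteq> {}" "\<And>e. e \<in> out_arcs E v \<Longrightarrow> head E e \<noteq> v" by blast
    obtain J1 :: "nat set" and x1 y1 \<nu>1 where fr1: "frame f J1 x1 y1 \<nu>1"
      and im: "\<nu>1 ` J1 = (\<nu> ` J - {v}) \<union> {head E e | e. e \<in> arcs E \<and> tail E e \<in> \<nu> ` J \<inter> {v}}"
      using frame_expand[OF fr, of "{v}"] v(2) by auto
    have sub: "\<nu>1 ` J1 \<subseteq> verts E - {v}"
      using im v(3) frameD(4)[OF fr] by auto
    have J1: "J1 \<noteq> {}"
    proof -
      obtain k where k: "k \<in> J" using J by blast
      obtain e where e: "e \<in> out_arcs E v" using v(2) by blast
      have "\<nu>1 ` J1 \<noteq> {}" unfolding im using k e by (cases "\<nu> k = v") auto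
      then show ?thesis by blast
    qed
    then have ne: "verts E - {v} \<noteq> {}" using sub by blast
    obtain G g' \<alpha> where G: "models_corner (verts E - {v}) G g' \<alpha>"
      using models_corner_eliminate[OF v ne] by blast
    then have sysG: "leavitt_system A K G g'" and \<alpha>: "bij_betw \<alpha> (verts G) (verts E - {v})"
      by (auto simp: models_corner_def)
    obtain \<nu>2 where fr2: "leavitt_family.frame A G g' f J1 x1 y1 \<nu>2"
      using frame_models_corner[OF G fr1 sub] by blast
    have "card (verts G) < card (verts E)"
      using bij_betw_same_card[OF \<alpha>] card_Diff1_less[OF finite_verts v(1)] by simp
    from less.hyps[OF this sysG fr2 J1] show ?thesis .
  next
    case False
    then have loop: "\<exists>e\<in>out_arcs E v. head E e = v" if "v \<in> verts E" "out_arcs E v \<noteq> {}" for v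
      using that by blast
    \<comment> \<open>the largest number of vertices that can occur in a frame of \<open>f\<close>\<close>
    define good where "good n \<longleftrightarrow> (\<exists>(J1 :: nat set) x1 y1 \<nu>1. J1 \<noteq> {} \<and> frame f J1 x1 y1 \<nu>1 \<and> card (\<nu>1 ` J1) = n)" for n
    have "good (card (\<nu> ` J))" unfolding good_def using fr J by blast
    moreover have "n \<le> card (verts E)" if "good n" for n
      using that frameD(4) card_mono[OF finite_verts] unfolding good_def by (metis image_subsetI)
    ultimately obtain n where n: "good n" "\<And>n'. good n' \<Longrightarrow> n' \<le> n"
      using ex_has_greatest_nat[of good _ "\<lambda>n. n" "Suc (card (verts E))"]
      by (metis le_imp_less_Suc)
    then obtain J1 :: "nat set" and x1 y1 \<nu>1 where J1: "J1 \<noteq> {}" and fr1: "frame f J1 x1 y1 \<nu>1"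
      and c1: "card (\<nu>1 ` J1) = n" unfolding good_def by blast
    let ?V = "\<nu>1 ` J1"
    have V: "?V \<subseteq> verts E" using frameD(4)[OF fr1] by auto
    have "head E e \<in> ?V" if e: "e \<in> arcs E" "tail E e \<in> ?V" for e
    proof -
      \<comment> \<open>expanding at all regular vertices adds the heads of all edges and, thanks to the loops, loses nothing; by maximality it adds nothing either\<close>
      let ?D = "{v \<in> verts E. out_arcs E v \<noteq> {}}"
      obtain J2 :: "nat set" and x2 y2 \<nu>2 where fr2: "frame f J2 x2 y2 \<nu>2"
        and im: "\<nu>2 ` J2 = (?V - ?D) \<union> {head E e | e. e \<in> arcs E \<and> tail E e \<in> ?V \<inter> ?D}"
        using frame_expand[OF fr1, of ?D] by auto
      have sub: "?V \<subseteq> \<nu>2 ` J2"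
      proof
        fix v assume v: "v \<in> ?V"
        show "v \<in> \<nu>2 ` J2"
        proof (cases "v \<in> ?D")
          case True
          then obtain d where "d \<in> out_arcs E v" "head E d = v" using loop by blast
          then have "v = head E d \<and> d \<in> arcs E \<and> tail E d \<in> ?V \<inter> ?D" using v True by simp
          then show ?thesis unfolding im by blast
        qed (use v im in blast)
      qed
      have "J2 \<noteq> {}" using sub J1 by auto
      then have "good (card (\<nu>2 ` J2))" unfolding good_def using fr2 by blast
      then have "card (\<nu>2 ` J2) \<le> card ?V" using n(2) c1 by simp
      then have "?V = \<nu>2 ` J2"
        using sub frameD(1)[OF fr2] by (intro card_seteq) auto
      moreover have "head E e \<in> \<nu>2 ` J2"
      proof -
        have "tail E e \<in> ?V \<inter> ?D" using e V by auto
        then show ?thesis unfolding im using e(1) by blast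
      qed
      ultimately show ?thesis by simp
    qed
    then obtain G g' \<alpha> where G: "models_corner ?V G g' \<alpha>"
      using models_corner_hereditary[OF V] J1 by auto
    then have sysG: "leavitt_system A K G g'" and \<alpha>: "bij_betw \<alpha> (verts G) ?V"
      by (auto simp: models_corner_def)
    obtain \<nu>2 where fr2: "leavitt_family.frame A G g' f J1 x1 y1 \<nu>2"
      and im: "\<alpha> ` (\<nu>2 ` J1) = ?V" "\<nu>2 ` J1 \<subseteq> verts G"
      using frame_models_corner[OF G fr1 subset_refl] by blast
    have "\<nu>2 ` J1 = verts G"
      using im \<alpha> by (metis bij_betw_def inj_on_image_eq_iff subset_refl)
    then show ?thesis using sysG fr2 by blast
  qed
qed

section \<open>Finitely generated right ideals have frames\<close>

text \<open>The order on paths is given by an injection into the natural numbers: a path is read as a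
  numeral in a large base whose digits, all nonzero, number the start vertex and the edges.
  Appending a path multiplies the value by a power of the base and adds a constant, which is
  strictly increasing.\<close>

lemma (in fin_digraph) walk_code_exists:
  "\<exists>code :: 'a \<times> 'b list \<Rightarrow> nat. inj_on code (verts G \<times> lists (arcs G))
    \<and> (\<forall>u v \<alpha> \<beta> \<mu>. code (v, \<beta>) < code (u, \<alpha>) \<longrightarrow> code (v, \<beta> @ \<mu>) < code (u, \<alpha> @ \<mu>))"
proof -
  obtain nv n1 where nv: "nv ` verts G = {i::nat. i < n1}" "inj_on nv (verts G)"
    using finite_imp_inj_to_nat_seg[OF finite_verts] by blast
  obtain ne n2 where ne: "ne ` arcs G = {i::nat. i < n2}" "inj_on ne (arcs G)"
    using finite_imp_inj_to_nat_seg[OF finite_arcs] by blast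
  define B where "B = n1 + n2 + 2"
  define step where "step a e = a * B + (ne e + 1)" for a e
  define code where "code p = foldl step (nv (fst p) + 1) (snd p)" for p
  have mono: "foldl step x \<mu> < foldl step y \<mu>" if "x < y" for x y \<mu>
    using that
  proof (induct \<mu> arbitrary: x y)
    case (Cons e \<mu>)
    then have "x * B < y * B" by (intro mult_less_mono1) (simp_all add: B_def)
    then have "step x e < step y e" by (simp add: step_def)
    then show ?case using Cons.hyps by simp
  qed simp
  have code_snoc: "code (v, \<beta> @ [e]) = step (code (v, \<beta>)) e" for v \<beta> e by (simp add: code_def)
  have pos: "code (v, \<beta>) \<ge> 1" for v \<beta>
    by (induct \<beta> rule: rev_induct) (simp_all add: code_snoc, simp_all add: code_def step_def)
  have nvB: "nv v + 1 < B" if "v \<in> verts G" for v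
  proof -
    have "nv v < n1" using nv(1) that by blast
    then show ?thesis by (simp add: B_def)
  qed
  have neB: "ne e + 1 < B" if "e \<in> arcs G" for e
  proof -
    have "ne e < n2" using ne(1) that by blast
    then show ?thesis by (simp add: B_def)
  qed
  have big: "B < code (v, \<beta> @ [e])" for v \<beta> e
  proof -
    have "B \<le> code (v, \<beta>) * B" using mult_le_mono1[OF pos[of v \<beta>], of B] by (simp only: mult_1)
    moreover have "code (v, \<beta> @ [e]) = code (v, \<beta>) * B + (ne e + 1)" by (simp add: code_snoc step_def)
    ultimately show ?thesis by linarith
  qed
  have inj: "u = v \<and> \<alpha> = \<beta>"
    if "u \<in> verts G" "v \<in> verts G" "set \<alpha> \<subseteq> arcs G" "set \<beta> \<subseteq> arcs G" "code (u, \<alpha>) = code (v, \<beta>)" for u v \<alpha> \<beta>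
    using that
  proof (induct \<alpha> arbitrary: \<beta> rule: rev_induct)
    case Nil
    then show ?case
    proof (cases \<beta> rule: rev_cases)
      case Nil
      then show ?thesis using Nil.prems nv(2) \<open>code (u, []) = code (v, \<beta>)\<close> \<open>u \<in> verts G\<close> \<open>v \<in> verts G\<close>
        by (auto simp: code_def inj_on_def)
    next
      case (snoc \<beta>' e)
      then show ?thesis using Nil.prems nvB[of u] big[of v \<beta>' e] by (simp add: code_def)
    qed
  next
    case (snoc e \<alpha>)
    show ?case
    proof (cases \<beta> rule: rev_cases)
      case Nil
      then show ?thesis using snoc.prems nvB[of v] big[of u \<alpha> e] by (simp add: code_def)
    next
      case (snoc \<beta>' d)
      have ed: "e \<in> arcs G" "d \<in> arcs G" using snoc.prems \<open>\<beta> = \<beta>' @ [d]\<close> by auto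
      have eq: "code (u, \<alpha>) * B + (ne e + 1) = code (v, \<beta>') * B + (ne d + 1)"
        using snoc.prems(5) \<open>\<beta> = \<beta>' @ [d]\<close> by (simp add: code_snoc step_def)
      have "(code (u, \<alpha>) * B + (ne e + 1)) mod B = ne e + 1" "(code (v, \<beta>') * B + (ne d + 1)) mod B = ne d + 1"
        using neB[OF ed(1)] neB[OF ed(2)] by simp_all
      then have "ne e + 1 = ne d + 1" unfolding eq by (rule trans[OF sym])
      then have "ne e = ne d" by simp
      have "e = d" using ne(2) ed \<open>ne e = ne d\<close> by (auto simp: inj_on_def)
      have "0 < B" by (simp add: B_def)
      have "code (u, \<alpha>) * B = code (v, \<beta>') * B" using eq \<open>ne e = ne d\<close> by simp
      then have "code (u, \<alpha>) = code (v, \<beta>')" using \<open>0 < B\<close> by simp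
      then show ?thesis using snoc.hyps[of \<beta>'] snoc.prems \<open>e = d\<close> \<open>\<beta> = \<beta>' @ [d]\<close> by auto
    qed
  qed
  have "inj_on code (verts G \<times> lists (arcs G))"
  proof (rule inj_onI)
    fix p q assume pq: "p \<in> verts G \<times> lists (arcs G)" "q \<in> verts G \<times> lists (arcs G)" "code p = code q"
    then have "fst p = fst q \<and> snd p = snd q" by (intro inj) auto
    then show "p = q" by (simp add: prod_eq_iff)
  qed
  moreover have "\<forall>u v \<alpha> \<beta> \<mu>. code (v, \<beta>) < code (u, \<alpha>) \<longrightarrow> code (v, \<beta> @ \<mu>) < code (u, \<alpha> @ \<mu>)"
    using mono by (simp add: code_def)
  ultimately show ?thesis by blast
qed

context leavitt_family begin

text \<open>The coefficients of a polynomial after right multiplication by the path \<open>\<mu>\<close>.\<close>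

definition shift :: "'e list \<Rightarrow> ('v \<times> 'e list \<Rightarrow> 'k) \<Rightarrow> 'v \<times> 'e list \<Rightarrow> 'k" where
  "shift \<mu> c p = (if suffix \<mu> (snd p) then c (fst p, take (length (snd p) - length \<mu>) (snd p)) else \<zero>\<^bsub>K\<^esub>)"

lemma shift_append [simp]: "shift \<mu> c (v, \<beta> @ \<mu>) = c (v, \<beta>)"
  by (auto simp: shift_def suffix_def)

lemma shift_supp: "{p. shift \<mu> c p \<noteq> \<zero>\<^bsub>K\<^esub>} = (\<lambda>p. (fst p, snd p @ \<mu>)) ` {p. c p \<noteq> \<zero>\<^bsub>K\<^esub>}"
proof (intro equalityI subsetI)
  fix p assume p: "p \<in> {p. shift \<mu> c p \<noteq> \<zero>\<^bsub>K\<^esub>}"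
  then obtain \<beta> where "snd p = \<beta> @ \<mu>" by (auto simp: shift_def suffix_def split: if_splits)
  then have "p = (fst p, \<beta> @ \<mu>)" by (simp add: prod_eq_iff)
  then show "p \<in> (\<lambda>p. (fst p, snd p @ \<mu>)) ` {p. c p \<noteq> \<zero>\<^bsub>K\<^esub>}"
    using p shift_append[of \<mu> c "fst p" \<beta>] by (intro image_eqI[of _ _ "(fst p, \<beta>)"]) auto
qed auto

lemma shift_coeffs:
  assumes "c \<in> coeffs U w" "awalk w \<mu> z"
  shows "shift \<mu> c \<in> coeffs U z"
proof -
  have "finite {p. shift \<mu> c p \<noteq> \<zero>\<^bsub>K\<^esub>}" unfolding shift_supp using coeffs_finite[OF assms(1)] by blast
  moreover have "{p. shift \<mu> c p \<noteq> \<zero>\<^bsub>K\<^esub>} \<subseteq> {(u, \<mu>). u \<in> U \<and> awalk u \<mu> z}"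
  proof
    fix q assume "q \<in> {p. shift \<mu> c p \<noteq> \<zero>\<^bsub>K\<^esub>}"
    then obtain p where p: "q = (fst p, snd p @ \<mu>)" "c p \<noteq> \<zero>\<^bsub>K\<^esub>" unfolding shift_supp by blast
    have "fst p \<in> U" "awalk (fst p) (snd p) w" using coeffs_walk[OF assms(1) p(2)] by blast+
    then show "q \<in> {(u, \<mu>). u \<in> U \<and> awalk u \<mu> z}" using p(1) awalk_appendI[OF _ assms(2)] by blast
  qed
  moreover have "shift \<mu> c p \<in> carrier K" for p
    using coeffs_closed[OF assms(1)] by (simp add: shift_def)
  ultimately show ?thesis by (auto simp: coeffs_def)
qed

lemma pev_shift:
  assumes c: "c \<in> coeffs U w" and \<mu>: "awalk w \<mu> z"
  shows "pev (shift \<mu> c) = pev c \<otimes> pth w \<mu>"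
proof -
  let ?S = "{p. c p \<noteq> \<zero>\<^bsub>K\<^esub>}"
  have t: "pth (fst p) (snd p @ \<mu>) = pth (fst p) (snd p) \<otimes> pth w \<mu>" "pth (fst p) (snd p) \<in> carrier A"
    if "p \<in> ?S" for p
    using coeffs_walk[OF c] that pth_append[OF _ \<mu>] coeffs_term[OF c] by auto
  have cl: "c p \<in> carrier K" "pth w \<mu> \<in> carrier A" for p using coeffs_closed[OF c] pth_closed[OF \<mu>] by auto
  have "pev (shift \<mu> c) = (\<Oplus>p\<in>?S. c p \<odot> pth (fst p) (snd p @ \<mu>))"
  proof -
    let ?h = "\<lambda>p. (fst p, snd p @ \<mu>)"
    have inj: "inj_on ?h ?S" by (auto simp: inj_on_def)
    have "shift \<mu> c q \<odot> pth (fst q) (snd q) \<in> carrier A" if q: "q \<in> ?h ` ?S" for q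
    proof -
      obtain p where "p \<in> ?S" "q = ?h p" using q by blast
      then show ?thesis using t[of p] cl by simp
    qed
    then have "(\<Oplus>q\<in>?h ` ?S. shift \<mu> c q \<odot> pth (fst q) (snd q))
        = (\<Oplus>p\<in>?S. shift \<mu> c (?h p) \<odot> pth (fst (?h p)) (snd (?h p)))"
      by (intro M.finsum_reindex Pi_I inj)
    then show ?thesis unfolding pev_def shift_supp by simp
  qed
  also have "\<dots> = (\<Oplus>p\<in>?S. (c p \<odot> pth (fst p) (snd p)) \<otimes> pth w \<mu>)"
    using t cl by (intro M.finsum_cong' Pi_I) (auto simp: smult_mult_left)
  also have "\<dots> = pev c \<otimes> pth w \<mu>"
    unfolding pev_def using t cl coeffs_finite[OF c] by (intro A.finsum_ldistr[symmetric] Pi_I) auto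
  finally show ?thesis .
qed

lemma pev_mult:
  assumes c: "c \<in> coeffs U w" and d: "d \<in> coeffs {w} z"
  shows "pev c \<otimes> pev d = (\<Oplus>p\<in>{p. c p \<noteq> \<zero>\<^bsub>K\<^esub>} \<times> {q. d q \<noteq> \<zero>\<^bsub>K\<^esub>}.
    (c (fst p) \<otimes>\<^bsub>K\<^esub> d (snd p)) \<odot> pth (fst (fst p)) (snd (fst p) @ snd (snd p)))"
proof -
  let ?S = "{p. c p \<noteq> \<zero>\<^bsub>K\<^esub>}" and ?D = "{q. d q \<noteq> \<zero>\<^bsub>K\<^esub>}"
  have cc: "c p \<in> carrier K" "d q \<in> carrier K" for p q using coeffs_closed[OF c] coeffs_closed[OF d] by auto
  have cp: "pth (fst p) (snd p) \<in> carrier A" if "p \<in> ?S" for p using coeffs_term[OF c] that by auto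
  have dq: "pth (fst q) (snd q) \<in> carrier A" if "q \<in> ?D" for q using coeffs_term[OF d] that by auto
  have prod: "(c p \<odot> pth (fst p) (snd p)) \<otimes> (d q \<odot> pth (fst q) (snd q))
      = (c p \<otimes>\<^bsub>K\<^esub> d q) \<odot> pth (fst p) (snd p @ snd q) \<and> pth (fst p) (snd p @ snd q) \<in> carrier A"
    if p: "p \<in> ?S" and q: "q \<in> ?D" for p q
  proof -
    have w: "awalk (fst p) (snd p) w" "awalk w (snd q) z" "fst q = w"
      using coeffs_walk[OF c, of p] coeffs_walk[OF d, of q] p q by auto
    show ?thesis
      using cp[OF p] dq[OF q] cc pth_append[OF w(1,2)] pth_closed[OF awalk_appendI[OF w(1,2)]] w(3)
        smult_mult_left[of "c p" "pth (fst p) (snd p)" "d q \<odot> pth (fst q) (snd q)"]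
        smult_mult_right[of "d q" "pth (fst p) (snd p)" "pth (fst q) (snd q)"]
      by (simp add: smult_assoc1)
  qed
  have "pev c \<otimes> pev d = (\<Oplus>p\<in>?S. (c p \<odot> pth (fst p) (snd p)) \<otimes> pev d)"
    unfolding pev_def[of c] using cp cc coeffs_finite[OF c] pev_closed[OF d]
    by (intro A.finsum_ldistr Pi_I) auto
  also have "\<dots> = (\<Oplus>p\<in>?S. \<Oplus>q\<in>?D. (c p \<odot> pth (fst p) (snd p)) \<otimes> (d q \<odot> pth (fst q) (snd q)))"
  proof (intro M.finsum_cong' refl Pi_I)
    fix p assume p: "p \<in> ?S"
    have px: "c p \<odot> pth (fst p) (snd p) \<in> carrier A" using cp[OF p] cc by simp
    have qx: "d q \<odot> pth (fst q) (snd q) \<in> carrier A" if "q \<in> ?D" for q using dq[OF that] cc by simp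
    show "(c p \<odot> pth (fst p) (snd p)) \<otimes> pev d
        = (\<Oplus>q\<in>?D. (c p \<odot> pth (fst p) (snd p)) \<otimes> (d q \<odot> pth (fst q) (snd q)))"
      unfolding pev_def[of d] by (rule A.finsum_rdistr[OF coeffs_finite[OF d] px]) (rule Pi_I, rule qx)
    show "(\<Oplus>q\<in>?D. (c p \<odot> pth (fst p) (snd p)) \<otimes> (d q \<odot> pth (fst q) (snd q))) \<in> carrier A"
      by (intro M.finsum_closed' A.m_closed px qx)
  qed
  also have "\<dots> = (\<Oplus>p\<in>?S. \<Oplus>q\<in>?D. (c p \<otimes>\<^bsub>K\<^esub> d q) \<odot> pth (fst p) (snd p @ snd q))"
    using prod cc by (intro M.finsum_cong' refl Pi_I M.finsum_closed') simp_all
  also have "\<dots> = (\<Oplus>p\<in>?S \<times> ?D. (c (fst p) \<otimes>\<^bsub>K\<^esub> d (snd p)) \<odot> pth (fst (fst p)) (snd (fst p) @ snd (snd p)))"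
    using prod cc coeffs_finite[OF c] coeffs_finite[OF d] by (subst M.finsum_Sigma) simp_all
  finally show ?thesis .
qed

end

context leavitt_system begin

context
  fixes code :: "'v \<times> 'e list \<Rightarrow> nat"
  assumes code_inj: "inj_on code (verts E \<times> lists (arcs E))"
    and code_mono: "\<And>u v \<alpha> \<beta> \<mu>. code (v, \<beta>) < code (u, \<alpha>) \<Longrightarrow> code (v, \<beta> @ \<mu>) < code (u, \<alpha> @ \<mu>)"
begin

definition lead :: "('v \<times> 'e list \<Rightarrow> 'k) \<Rightarrow> 'v \<times> 'e list" where
  "lead c = (SOME i. c i \<noteq> \<zero>\<^bsub>K\<^esub> \<and> (\<forall>j. c j \<noteq> \<zero>\<^bsub>K\<^esub> \<longrightarrow> code j \<le> code i))"

lemma lead: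
  assumes "c \<in> coeffs U w" "\<exists>i. c i \<noteq> \<zero>\<^bsub>K\<^esub>"
  shows "c (lead c) \<noteq> \<zero>\<^bsub>K\<^esub>" "\<And>j. c j \<noteq> \<zero>\<^bsub>K\<^esub> \<Longrightarrow> code j \<le> code (lead c)"
proof -
  let ?S = "{i. c i \<noteq> \<zero>\<^bsub>K\<^esub>}"
  have S: "finite (code ` ?S)" "code ` ?S \<noteq> {}" using coeffs_finite[OF assms(1)] assms(2) by auto
  obtain i where i: "Max (code ` ?S) = code i" "i \<in> ?S" using Max_in[OF S] by (rule imageE)
  then have "c i \<noteq> \<zero>\<^bsub>K\<^esub> \<and> (\<forall>j. c j \<noteq> \<zero>\<^bsub>K\<^esub> \<longrightarrow> code j \<le> code i)"
    using Max_ge[OF S(1)] unfolding i(1) by auto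
  then have "c (lead c) \<noteq> \<zero>\<^bsub>K\<^esub> \<and> (\<forall>j. c j \<noteq> \<zero>\<^bsub>K\<^esub> \<longrightarrow> code j \<le> code (lead c))"
    unfolding lead_def by (rule someI)
  then show "c (lead c) \<noteq> \<zero>\<^bsub>K\<^esub>" "\<And>j. c j \<noteq> \<zero>\<^bsub>K\<^esub> \<Longrightarrow> code j \<le> code (lead c)" by blast+
qed

lemma supp_words: "c \<in> coeffs (verts E) w \<Longrightarrow> c i \<noteq> \<zero>\<^bsub>K\<^esub> \<Longrightarrow> i \<in> verts E \<times> lists (arcs E)"
  using coeffs_walk[of c "verts E" w i] by (cases i) auto

lemma code_append_le:
  assumes "code (v, \<beta>) \<le> code (u, \<alpha>)" "(v, \<beta>) \<in> verts E \<times> lists (arcs E)" "(u, \<alpha>) \<in> verts E \<times> lists (arcs E)"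
  shows "code (v, \<beta> @ \<mu>) \<le> code (u, \<alpha> @ \<mu>)"
proof (cases "code (v, \<beta>) = code (u, \<alpha>)")
  case True
  then have "(v, \<beta>) = (u, \<alpha>)" using code_inj assms(2,3) by (auto dest: inj_onD)
  then show ?thesis by simp
next
  case False
  then show ?thesis using assms(1) code_mono[of v \<beta> u \<alpha> \<mu>] by simp
qed

text \<open>Take the largest of all products of the leading path of some \<open>c k\<close> with a path that occurs in
  \<open>d k\<close>. A product whose first factor is not leading is smaller than the one with the leading path
  and the same second factor, hence smaller than the largest. Two products with leading first
  factors that agree have the same \<open>k\<close>, because otherwise one leading path would be an initial
  segment of another, and then also the same second factor. So the largest product occurs once
  and cannot cancel.\<close>

lemma polynomials_independent:
  fixes J :: "'i set"
  assumes J: "finite J" and c: "\<And>k. k \<in> J \<Longrightarrow> c k \<in> coeffs (verts E) (w k)"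
    and nz: "\<And>k. k \<in> J \<Longrightarrow> \<exists>i. c k i \<noteq> \<zero>\<^bsub>K\<^esub>"
    and np: "\<And>k l \<mu>. \<lbrakk>k \<in> J; l \<in> J; k \<noteq> l\<rbrakk> \<Longrightarrow> lead (c k) \<noteq> (fst (lead (c l)), snd (lead (c l)) @ \<mu>)"
    and d: "\<And>k. k \<in> J \<Longrightarrow> d k \<in> coeffs {w k} z"
    and sum: "(\<Oplus>k\<in>J. pev (c k) \<otimes> pev (d k)) = \<zero>"
    and k: "k \<in> J"
  shows "d k i = \<zero>\<^bsub>K\<^esub>"
proof (rule ccontr)
  assume di: "d k i \<noteq> \<zero>\<^bsub>K\<^esub>"
  let ?C = "\<lambda>k. {p. c k p \<noteq> \<zero>\<^bsub>K\<^esub>}" and ?D = "\<lambda>k. {q. d k q \<noteq> \<zero>\<^bsub>K\<^esub>}"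
  define top where "top p = (fst (lead (c (fst p))), snd (lead (c (fst p))) @ snd (snd p))" for p :: "'i \<times> 'v \<times> 'e list"
  have fin: "finite (?C k)" "finite (?D k)" if "k \<in> J" for k
    using coeffs_finite[OF c[OF that]] coeffs_finite[OF d[OF that]] by auto
  let ?N = "Sigma J ?D"
  have N: "finite (code ` top ` ?N)" "code ` top ` ?N \<noteq> {}" using J fin k di by auto
  obtain p0 where p0: "p0 \<in> ?N" "code (top p0) = Max (code ` top ` ?N)"
    using Max_in[OF N] by (elim imageE) simp
  obtain k0 q0 where kq: "p0 = (k0, q0)" by (cases p0)
  have k0: "k0 \<in> J" "d k0 q0 \<noteq> \<zero>\<^bsub>K\<^esub>" using p0 kq by auto
  have max: "code (top (k, q)) \<le> code (top (k0, q0))" if "k \<in> J" "d k q \<noteq> \<zero>\<^bsub>K\<^esub>" for k q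
    using Max_ge[OF N(1), of "code (top (k, q))"] that p0(2) kq by auto
  let ?I = "Sigma J (\<lambda>k. ?C k \<times> ?D k)"
  define coef where "coef t = c (fst t) (fst (snd t)) \<otimes>\<^bsub>K\<^esub> d (fst t) (snd (snd t))" for t
  define \<theta> where "\<theta> t = (fst (fst (snd t)), snd (fst (snd t)) @ snd (snd (snd t)))" for t :: "'i \<times> ('v \<times> 'e list) \<times> ('v \<times> 'e list)"
  have cl: "c k p \<in> carrier K" "d k q \<in> carrier K" if "k \<in> J" for k p q
    using coeffs_closed[OF c[OF that]] coeffs_closed[OF d[OF that]] by auto
  have walk: "awalk (fst (\<theta> t)) (snd (\<theta> t)) z" if t: "t \<in> ?I" for t
  proof -
    have tt: "fst t \<in> J" "c (fst t) (fst (snd t)) \<noteq> \<zero>\<^bsub>K\<^esub>" "d (fst t) (snd (snd t)) \<noteq> \<zero>\<^bsub>K\<^esub>" using t by auto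
    have "awalk (fst (fst (snd t))) (snd (fst (snd t))) (w (fst t))" using coeffs_walk[OF c[OF tt(1)] tt(2)] by blast
    moreover have "awalk (w (fst t)) (snd (snd (snd t))) z" using coeffs_walk[OF d[OF tt(1)] tt(3)] by auto
    ultimately show ?thesis unfolding \<theta>_def by (auto intro: awalk_appendI)
  qed
  have coefK: "coef t \<in> carrier K" if "t \<in> ?I" for t using that cl by (auto simp: coef_def)
  have tcl: "coef t \<odot> pth (fst (\<theta> t)) (snd (\<theta> t)) \<in> carrier A" if "t \<in> ?I" for t
    using coefK[OF that] pth_closed[OF walk[OF that]] by simp
  have "(\<Oplus>t\<in>?I. coef t \<odot> pth (fst (\<theta> t)) (snd (\<theta> t)))
      = (\<Oplus>k\<in>J. \<Oplus>p\<in>?C k \<times> ?D k. coef (k, p) \<odot> pth (fst (\<theta> (k, p))) (snd (\<theta> (k, p))))"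
    using J fin tcl by (intro M.finsum_Sigma) auto
  also have "\<dots> = (\<Oplus>k\<in>J. pev (c k) \<otimes> pev (d k))"
  proof (rule M.finsum_cong'[OF refl])
    show "(\<lambda>k. pev (c k) \<otimes> pev (d k)) \<in> J \<rightarrow> carrier A" using pev_closed c d by blast
    show "(\<Oplus>p\<in>?C k \<times> ?D k. coef (k, p) \<odot> pth (fst (\<theta> (k, p))) (snd (\<theta> (k, p)))) = pev (c k) \<otimes> pev (d k)"
      if "k \<in> J" for k
      unfolding pev_mult[OF c[OF that] d[OF that]] coef_def \<theta>_def by simp
  qed
  finally have sum': "(\<Oplus>t\<in>?I. coef t \<odot> pth (fst (\<theta> t)) (snd (\<theta> t))) = \<zero>" using sum by simp
  let ?t0 = "(k0, lead (c k0), q0)"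
  have t0: "?t0 \<in> ?I" using k0 lead(1)[OF c[OF k0(1)] nz[OF k0(1)]] by simp
  have "coef ?t0 = \<zero>\<^bsub>K\<^esub>"
  proof (rule lin_indep_isolated[OF indep, of ?I coef \<theta>])
    show "finite ?I" using J fin by auto
    show "(\<Oplus>t\<in>?I. coef t \<odot> (case \<theta> t of (v, \<mu>) \<Rightarrow> pth v \<mu>)) = \<zero>"
      using sum' by (simp add: case_prod_unfold)
    show "\<theta> t \<in> {(v, \<mu>). \<exists>w. awalk v \<mu> w}" if "t \<in> ?I" for t
      using walk[OF that] by (auto simp: case_prod_unfold)
    show "t = ?t0" if t: "t \<in> ?I" "\<theta> t = \<theta> ?t0" for t
    proof -
      obtain k p q where tk: "t = (k, p, q)" by (cases t) auto
      then have kJ: "k \<in> J" "c k p \<noteq> \<zero>\<^bsub>K\<^esub>" "d k q \<noteq> \<zero>\<^bsub>K\<^esub>" using t by auto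
      note ld = lead[OF c[OF kJ(1)] nz[OF kJ(1)]]
      have inW: "p \<in> verts E \<times> lists (arcs E)" "lead (c k) \<in> verts E \<times> lists (arcs E)"
        using supp_words[OF c[OF kJ(1)]] kJ(2) ld(1) by blast+
      have top0: "\<theta> ?t0 = top (k0, q0)" by (simp add: \<theta>_def top_def)
      have "p = lead (c k)"
      proof (rule ccontr)
        assume "p \<noteq> lead (c k)"
        then have "code p \<noteq> code (lead (c k))" using code_inj inW by (auto dest: inj_onD)
        then have "code (fst p, snd p) < code (fst (lead (c k)), snd (lead (c k)))" using ld(2)[OF kJ(2)] by simp
        then have "code (fst p, snd p @ snd q) < code (top (k, q))"
          unfolding top_def by (simp add: code_mono)
        also have "\<dots> \<le> code (top (k0, q0))" using max kJ by blast
        finally show False using t(2) top0 tk by (simp add: \<theta>_def)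
      qed
      then have eq: "fst (lead (c k)) = fst (lead (c k0))" "snd (lead (c k)) @ snd q = snd (lead (c k0)) @ snd q0"
        using t(2) tk by (auto simp: \<theta>_def)
      have "k = k0"
      proof (rule ccontr)
        assume "k \<noteq> k0"
        from eq(2) obtain us where "snd (lead (c k)) = snd (lead (c k0)) @ us \<or> snd (lead (c k)) @ us = snd (lead (c k0))"
          by (auto simp: append_eq_append_conv2)
        then show False
          using np[OF kJ(1) k0(1) \<open>k \<noteq> k0\<close>, of us] np[OF k0(1) kJ(1) \<open>k \<noteq> k0\<close>[symmetric], of us] eq(1)
          by (metis prod.collapse)
      qed
      moreover have "fst q = w k" "fst q0 = w k0"
        using coeffs_walk[OF d[OF kJ(1)] kJ(3)] coeffs_walk[OF d[OF k0(1)] k0(2)] by auto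
      ultimately show "t = ?t0" using eq(2) tk \<open>p = lead (c k)\<close> by (auto simp: prod_eq_iff)
    qed
  qed (use t0 coefK pth_closed in auto)
  then have "c k0 (lead (c k0)) \<otimes>\<^bsub>K\<^esub> d k0 q0 = \<zero>\<^bsub>K\<^esub>" by (simp add: coef_def)
  then show False
    using K.integral[OF _ cl(1)[OF k0(1)] cl(2)[OF k0(1)]] k0 lead(1)[OF c[OF k0(1)] nz[OF k0(1)]] by blast
qed

text \<open>Right multiplication by edges reduces the case of tame coefficients to polynomial ones.\<close>

lemma tame_independent:
  fixes J :: "'i set"
  assumes J: "finite J" and c: "\<And>k. k \<in> J \<Longrightarrow> c k \<in> coeffs (verts E) (w k)"
    and nz: "\<And>k. k \<in> J \<Longrightarrow> \<exists>i. c k i \<noteq> \<zero>\<^bsub>K\<^esub>"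
    and np: "\<And>k l \<mu>. \<lbrakk>k \<in> J; l \<in> J; k \<noteq> l\<rbrakk> \<Longrightarrow> lead (c k) \<noteq> (fst (lead (c l)), snd (lead (c l)) @ \<mu>)"
    and z: "z \<in> verts E" and a: "\<And>k. k \<in> J \<Longrightarrow> a k \<in> tame m {w k} z"
    and sum: "(\<Oplus>k\<in>J. pev (c k) \<otimes> a k) = \<zero>" and k: "k \<in> J"
  shows "a k = \<zero>"
proof -
  have poly: "a k = \<zero>" if a: "\<And>k. k \<in> J \<Longrightarrow> a k \<in> polynomials {w k} z"
    and sum: "(\<Oplus>k\<in>J. pev (c k) \<otimes> a k) = \<zero>" and k: "k \<in> J" for a z k
  proof -
    obtain d where d: "\<And>k. k \<in> J \<Longrightarrow> d k \<in> coeffs {w k} z \<and> a k = pev (d k)"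
      using polynomial_coeffs[OF a] by metis
    have "(\<Oplus>k\<in>J. pev (c k) \<otimes> pev (d k)) = (\<Oplus>k\<in>J. pev (c k) \<otimes> a k)"
      using d pev_closed c by (intro M.finsum_cong') (auto, blast)
    then have "d k i = \<zero>\<^bsub>K\<^esub>" for i
      using polynomials_independent[where J = J and c = c and w = w and d = d and z = z and k = k and i = i, OF J c nz np] d sum k
      by simp
    then show ?thesis using d[OF k] by (simp add: pev_def)
  qed
  show ?thesis using z a sum k
  proof (induct m arbitrary: a z k)
    case 0
    then show ?case using poly[of a z k] by simp
  next
    case (Suc m)
    show ?case
    proof (cases "out_arcs E z = {}")
      case True
      then show ?thesis using poly[of a z k] Suc.prems by simp
    next
      case False
      have acl: "a k \<in> carrier A" "a k \<otimes> P z = a k" if "k \<in> J" for k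
        using tame_closed[OF Suc.prems(1) Suc.prems(2)[OF that]] by auto
      have pcl: "pev (c k) \<in> carrier A" if "k \<in> J" for k using pev_closed c that by blast
      have "a k \<otimes> S e = \<zero>" if e: "e \<in> out_arcs E z" for e
      proof (rule Suc.hyps[of "head E e" "\<lambda>k. a k \<otimes> S e", OF _ _ _ Suc.prems(4)])
        show "head E e \<in> verts E" using e by auto
        show "a k \<otimes> S e \<in> tame m {w k} (head E e)" if "k \<in> J" for k
          using Suc.prems(2)[OF that] False e by auto
        have "(\<Oplus>k\<in>J. pev (c k) \<otimes> (a k \<otimes> S e)) = (\<Oplus>k\<in>J. (pev (c k) \<otimes> a k) \<otimes> S e)"
          using acl pcl e by (intro M.finsum_cong') (auto simp: A.m_assoc)
        also have "\<dots> = (\<Oplus>k\<in>J. pev (c k) \<otimes> a k) \<otimes> S e"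
          using acl pcl e J by (intro A.finsum_ldistr[symmetric]) auto
        finally show "(\<Oplus>k\<in>J. pev (c k) \<otimes> (a k \<otimes> S e)) = \<zero>" using Suc.prems(3) e by simp
      qed
      then show ?thesis
        using acl[OF Suc.prems(4)] Suc.prems(1) False by (intro cancel_edges[of "a k" z])
    qed
  qed
qed

text \<open>Zero generators are counted below all others, so that a reduction to zero is also progress.\<close>

definition msr :: "('v \<times> 'e list \<Rightarrow> 'k) \<Rightarrow> nat" where
  "msr c = (if \<exists>i. c i \<noteq> \<zero>\<^bsub>K\<^esub> then Suc (code (lead c)) else 0)"

text \<open>The elements \<open>z\<^sub>k c\<^sub>l - \<delta>\<^sub>k\<^sub>l p\<^bsub>w l\<^esub>\<close>
  are the coefficients of \<open>f c\<^sub>l - c\<^sub>l = 0\<close> with respect to the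
  independent elements \<open>c\<^sub>k\<close>, so they vanish.\<close>

lemma frame_of_independent:
  fixes J :: "nat set"
  assumes J: "finite J" and c: "\<And>k. k \<in> J \<Longrightarrow> c k \<in> coeffs (verts E) (w k)"
    and nz: "\<And>k. k \<in> J \<Longrightarrow> \<exists>i. c k i \<noteq> \<zero>\<^bsub>K\<^esub>"
    and np: "\<And>k l \<mu>. \<lbrakk>k \<in> J; l \<in> J; k \<noteq> l\<rbrakk> \<Longrightarrow> lead (c k) \<noteq> (fst (lead (c l)), snd (lead (c l)) @ \<mu>)"
    and w: "\<And>k. k \<in> J \<Longrightarrow> w k \<in> verts E"
    and z: "\<And>k. k \<in> J \<Longrightarrow> z k \<in> carrier A" "\<And>k. k \<in> J \<Longrightarrow> P (w k) \<otimes> z k = z k"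
    and f: "f \<in> carrier A" "\<And>k. k \<in> J \<Longrightarrow> f \<otimes> pev (c k) = pev (c k)"
    and sum: "(\<Oplus>k\<in>J. pev (c k) \<otimes> z k) = f"
  shows "frame f J (\<lambda>k. pev (c k)) z w"
proof -
  have pcl: "pev (c k) \<in> carrier A" if "k \<in> J" for k using pev_closed c that by blast
  have pright: "pev (c k) \<otimes> P (w k) = pev (c k)" if "k \<in> J" for k
  proof -
    have cw: "c k \<in> coeffs (verts E) (w k)" using c that .
    have "pev (c k) \<otimes> pth (w k) [] = pev (shift [] (c k))"
      using pev_shift[OF cw, of "[]" "w k"] w[OF that] by (simp add: awalk_Nil_iff)
    moreover have "shift [] (c k) = c k" by (rule ext) (simp add: shift_def)
    ultimately show ?thesis by simp
  qed
  have orth: "z k \<otimes> pev (c l) = (if k = l then P (w k) else \<zero>)" if k: "k \<in> J" and l: "l \<in> J" for k l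
  proof -
    define a where "a k = z k \<otimes> pev (c l) \<oplus> (if k = l then \<ominus> P (w l) else \<zero>)" for k
    have acl: "a k \<in> carrier A" if "k \<in> J" for k using z pcl w that l by (simp add: a_def)
    have aP: "P (w k) \<otimes> a k \<otimes> P (w l) = a k" if "k \<in> J" for k
      using z(1)[OF that] z(2)[OF that] pcl[OF l] pright[OF l] w[OF that] w[OF l]
      by (simp add: a_def A.l_distr A.r_distr A.m_assoc A.r_minus A.l_minus left_absorb)
    have "\<exists>m. a k \<in> tame m {w k} (w l)" if "k \<in> J" for k
      using span_tame'[OF w[OF that] w[OF l] acl[OF that]] aP[OF that] by simp
    then obtain m where m: "\<And>k. k \<in> J \<Longrightarrow> a k \<in> tame (m k) {w k} (w l)" by metis
    have tame: "a k \<in> tame (Max (m ` J)) {w k} (w l)" if "k \<in> J" for k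
      using tame_mono[OF w[OF l] m[OF that]] J that by simp
    have "(\<Oplus>k\<in>J. pev (c k) \<otimes> a k) = (\<Oplus>k\<in>J. (pev (c k) \<otimes> z k) \<otimes> pev (c l) \<oplus> (if k = l then \<ominus> pev (c l) else \<zero>))"
      using z pcl w l pright[OF l]
      by (intro M.finsum_cong') (auto simp: a_def A.r_distr A.m_assoc A.r_minus)
    also have "\<dots> = (\<Oplus>k\<in>J. (pev (c k) \<otimes> z k) \<otimes> pev (c l)) \<oplus> (\<Oplus>k\<in>J. if k = l then \<ominus> pev (c l) else \<zero>)"
      using z pcl l by (intro M.finsum_addf) auto
    also have "(\<Oplus>k\<in>J. (pev (c k) \<otimes> z k) \<otimes> pev (c l)) = f \<otimes> pev (c l)"
      using z pcl l J by (subst sum[symmetric]) (auto intro!: A.finsum_ldistr[symmetric])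
    also have "(\<Oplus>k\<in>J. if k = l then \<ominus> pev (c l) else \<zero>) = \<ominus> pev (c l)"
      using pcl[OF l] J l M.finsum_only[of J l "\<lambda>k. if k = l then \<ominus> pev (c l) else \<zero>"] by simp
    finally have "(\<Oplus>k\<in>J. pev (c k) \<otimes> a k) = \<zero>" using f(2)[OF l] pcl[OF l] by (simp add: M.r_neg)
    then have "a k = \<zero>"
      using tame_independent[where J = J and c = c and w = w and a = a, OF J c nz np w[OF l] tame _ k] by simp
    then have eq: "z k \<otimes> pev (c l) \<oplus> (if k = l then \<ominus> P (w l) else \<zero>) = \<zero>" by (simp add: a_def)
    show ?thesis
    proof (cases "k = l")
      case True
      then have "\<ominus> (\<ominus> P (w l)) = z k \<otimes> pev (c l)"
        using eq z(1)[OF k] pcl[OF l] w[OF l] by (intro M.minus_equality) auto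
      then show ?thesis using True w[OF l] by simp
    next
      case False
      then show ?thesis using eq z(1)[OF k] pcl[OF l] by simp
    qed
  qed
  show ?thesis unfolding frame_def using J pcl z w pright orth sum by blast
qed

text \<open>If the leading path of \<open>c\<^sub>k\<close> is that of \<open>c\<^sub>l\<close> followed by
  \<open>\<mu>\<close>, then \<open>c\<^sub>k\<close> is replaced by \<open>c\<^sub>k - r
  c\<^sub>l \<mu>\<close>, where the scalar \<open>r\<close> cancels the leading term. The
  leading path drops, the span of the right multiples stays the same, and the procedure stops
  when no two leading paths are comparable.\<close>

lemma frame_of_generators:
  fixes J :: "nat set"
  assumes "finite J" and "\<And>k. k \<in> J \<Longrightarrow> c k \<in> coeffs (verts E) (w k)"
    and "\<And>k. k \<in> J \<Longrightarrow> w k \<in> verts E"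
    and "\<And>k. k \<in> J \<Longrightarrow> z k \<in> carrier A" "\<And>k. k \<in> J \<Longrightarrow> P (w k) \<otimes> z k = z k"
    and "f \<in> carrier A" "\<And>k. k \<in> J \<Longrightarrow> f \<otimes> pev (c k) = pev (c k)"
    and "(\<Oplus>k\<in>J. pev (c k) \<otimes> z k) = f"
  shows "\<exists>(J' :: nat set) x y \<nu>. frame f J' x y \<nu>"
  using assms
proof (induct "\<Sum>k\<in>J. msr (c k)" arbitrary: c z rule: less_induct)
  case less
  note J = less.prems(1) and c = less.prems(2) and w = less.prems(3) and z = less.prems(4,5)
    and f = less.prems(6,7) and sum = less.prems(8)
  have pcl: "pev (c k) \<in> carrier A" if "k \<in> J" for k using pev_closed c that by blast
  let ?J0 = "{k \<in> J. \<exists>i. c k i \<noteq> \<zero>\<^bsub>K\<^esub>}"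
  show ?case
  proof (cases "\<exists>k\<in>?J0. \<exists>l\<in>?J0. k \<noteq> l \<and> (\<exists>\<mu>. lead (c k) = (fst (lead (c l)), snd (lead (c l)) @ \<mu>))")
    case False
    have "(\<Oplus>k\<in>?J0. pev (c k) \<otimes> z k) = (\<Oplus>k\<in>J. pev (c k) \<otimes> z k)"
    proof (rule M.add.finprod_mono_neutral_cong_left[OF J])
      fix k assume k: "k \<in> J - ?J0"
      then have "c k i = \<zero>\<^bsub>K\<^esub>" for i by blast
      then have "pev (c k) = \<zero>" by (simp add: pev_def)
      then show "pev (c k) \<otimes> z k = \<zero>" using z k by simp
    qed (use pcl z in auto)
    then have sum0: "(\<Oplus>k\<in>?J0. pev (c k) \<otimes> z k) = f" using sum by simp
    have "frame f ?J0 (\<lambda>k. pev (c k)) z w"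
    proof (rule frame_of_independent[OF _ _ _ _ _ _ _ f(1) _ sum0])
      fix k l \<mu> assume "k \<in> ?J0" "l \<in> ?J0" "k \<noteq> l"
      then show "lead (c k) \<noteq> (fst (lead (c l)), snd (lead (c l)) @ \<mu>)" using False by blast
    qed (use J c w z f in auto)
    then show ?thesis by blast
  next
    case True
    then obtain k l \<mu> where k: "k \<in> J" "\<exists>i. c k i \<noteq> \<zero>\<^bsub>K\<^esub>" and l: "l \<in> J" "\<exists>i. c l i \<noteq> \<zero>\<^bsub>K\<^esub>" and kl: "k \<noteq> l"
      and \<mu>: "lead (c k) = (fst (lead (c l)), snd (lead (c l)) @ \<mu>)" by blast
    note ldk = lead[OF c[OF k(1)] k(2)] and ldl = lead[OF c[OF l(1)] l(2)]
    have walkl: "awalk (fst (lead (c l))) (snd (lead (c l))) (w l)" using coeffs_walk[OF c[OF l(1)] ldl(1)] by blast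
    have "awalk (fst (lead (c l))) (snd (lead (c l)) @ \<mu>) (w k)"
      using coeffs_walk[OF c[OF k(1)] ldk(1)] \<mu> by simp
    then have walk: "awalk (w l) \<mu> (w k)" using walkl by (auto simp: awalk_append_iff)
    have mcl: "pth (w l) \<mu> \<in> carrier A" using pth_closed[OF walk] .
    have K: "c k i \<in> carrier K" "c l i \<in> carrier K" for i
      using coeffs_closed[OF c[OF k(1)]] coeffs_closed[OF c[OF l(1)]] by auto
    obtain r where r: "r \<in> carrier K" "r \<otimes>\<^bsub>K\<^esub> c l (lead (c l)) = c k (lead (c k))"
    proof -
      have u: "c l (lead (c l)) \<in> Units K" using K ldl(1) K.field_Units by auto
      show ?thesis
        using that[of "c k (lead (c k)) \<otimes>\<^bsub>K\<^esub> inv\<^bsub>K\<^esub> (c l (lead (c l)))"] u K by (simp add: K.m_assoc)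
    qed
    define d where "d i = c k i \<oplus>\<^bsub>K\<^esub> (\<ominus>\<^bsub>K\<^esub> r) \<otimes>\<^bsub>K\<^esub> shift \<mu> (c l) i" for i
    have sh: "shift \<mu> (c l) \<in> coeffs (verts E) (w k)" by (rule shift_coeffs[OF c[OF l(1)] walk])
    have rsh: "(\<lambda>i. (\<ominus>\<^bsub>K\<^esub> r) \<otimes>\<^bsub>K\<^esub> shift \<mu> (c l) i) \<in> coeffs (verts E) (w k)"
      using r by (intro coeffs_smult[OF sh]) auto
    have d: "d \<in> coeffs (verts E) (w k)" unfolding d_def by (rule coeffs_add[OF c[OF k(1)] rsh])
    have pd: "pev d = pev (c k) \<oplus> (\<ominus>\<^bsub>K\<^esub> r) \<odot> (pev (c l) \<otimes> pth (w l) \<mu>)"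
      unfolding d_def using r pev_add[OF c[OF k(1)] rsh] pev_smult[OF sh, of "\<ominus>\<^bsub>K\<^esub> r"] pev_shift[OF c[OF l(1)] walk]
      by simp
    have lead0: "d (lead (c k)) = \<zero>\<^bsub>K\<^esub>"
      using r K \<mu> by (simp add: d_def K.l_minus K.r_neg)
    have le: "code i \<le> code (lead (c k))" if i: "d i \<noteq> \<zero>\<^bsub>K\<^esub>" for i
    proof (cases "c k i = \<zero>\<^bsub>K\<^esub>")
      case False
      then show ?thesis using ldk(2) by blast
    next
      case True
      then have "shift \<mu> (c l) i \<noteq> \<zero>\<^bsub>K\<^esub>" using i r by (auto simp: d_def)
      then obtain p where p: "c l p \<noteq> \<zero>\<^bsub>K\<^esub>" "i = (fst p, snd p @ \<mu>)"
        using shift_supp[of \<mu> "c l"] by blast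
      have "code (fst p, snd p) \<le> code (fst (lead (c l)), snd (lead (c l)))" using ldl(2)[OF p(1)] by simp
      then show ?thesis unfolding p(2) \<mu>
        using supp_words[OF c[OF l(1)] p(1)] supp_words[OF c[OF l(1)] ldl(1)] by (intro code_append_le) auto
    qed
    have msr: "msr d < msr (c k)"
    proof (cases "\<exists>i. d i \<noteq> \<zero>\<^bsub>K\<^esub>")
      case False
      then show ?thesis using k(2) by (simp add: msr_def)
    next
      case True
      note ldd = lead[OF d True]
      have "lead d \<noteq> lead (c k)" using ldd(1) lead0 by auto
      then have "code (lead d) \<noteq> code (lead (c k))"
        using code_inj supp_words[OF d ldd(1)] supp_words[OF c[OF k(1)] ldk(1)] by (auto dest: inj_onD)
      then show ?thesis using le[OF ldd(1)] True k(2) by (simp add: msr_def)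
    qed
    define c' where "c' = c(k := d)"
    \<comment> \<open>compensates for the change of \<open>c k\<close>, so that the sum is still \<open>f\<close>\<close>
    define z' where "z' = z(l := z l \<oplus> r \<odot> (pth (w l) \<mu> \<otimes> z k))"
    have "(\<Sum>j\<in>J. msr (c' j)) < (\<Sum>j\<in>J. msr (c j))"
      using msr k(1) by (intro sum_strict_mono_ex1[OF J]) (auto simp: c'_def intro!: bexI[of _ k])
    then show ?thesis
    proof (rule less.hyps[OF _ J, of c' z'])
      show "c' j \<in> coeffs (verts E) (w j)" if "j \<in> J" for j using c d that by (simp add: c'_def)
      show "w j \<in> verts E" if "j \<in> J" for j using w that .
      show "z' j \<in> carrier A" if "j \<in> J" for j using z k(1) l(1) r mcl that by (simp add: z'_def)
      show "P (w j) \<otimes> z' j = z' j" if "j \<in> J" for j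
        using z[OF that] z(1)[OF k(1)] r mcl w[OF l(1)] pth_left[OF walk] that z(1,2)[OF l(1)]
        by (simp add: z'_def A.r_distr smult_mult_right left_absorb)
      show "f \<in> carrier A" by (rule f(1))
      show "f \<otimes> pev (c' j) = pev (c' j)" if "j \<in> J" for j
        using f(1) f(2)[OF that] f(2)[OF k(1)] f(2)[OF l(1)] pcl[OF k(1)] pcl[OF l(1)] mcl r pd
        by (simp add: c'_def A.r_distr smult_mult_right left_absorb)
      define R where "R = J - {k, l}"
      have JR: "J = insert k (insert l R)" "k \<notin> insert l R" "l \<notin> R" "finite R" "R \<subseteq> J"
        using k(1) l(1) kl J by (auto simp: R_def)
      let ?t = "\<lambda>j. pev (c j) \<otimes> z j" and ?t' = "\<lambda>j. pev (c' j) \<otimes> z' j"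
      have tcl: "?t j \<in> carrier A" if "j \<in> J" for j using pcl z that by simp
      have tR_eq: "?t' j = ?t j" "?t' j \<in> carrier A" if "j \<in> R" for j
      proof -
        have "j \<noteq> k" "j \<noteq> l" "j \<in> J" using that by (simp_all add: R_def)
        then show "?t' j = ?t j" "?t' j \<in> carrier A" using tcl by (simp_all add: c'_def z'_def)
      qed
      have R: "(\<Oplus>j\<in>R. ?t' j) = (\<Oplus>j\<in>R. ?t j)"
        by (rule M.finsum_cong'[OF refl _ tR_eq(1)]) (use tcl JR(5) in blast)+
      have Rcl: "(\<Oplus>j\<in>R. ?t j) \<in> carrier A" using tcl JR(5) by (intro M.finsum_closed') auto
      have k': "?t' k = ?t k \<oplus> (\<ominus>\<^bsub>K\<^esub> r) \<odot> (pev (c l) \<otimes> pth (w l) \<mu> \<otimes> z k)"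
        using kl pd pcl k(1) l(1) z mcl r by (simp add: c'_def z'_def A.l_distr smult_mult_left)
      have l': "?t' l = ?t l \<oplus> r \<odot> (pev (c l) \<otimes> pth (w l) \<mu> \<otimes> z k)"
        using kl pcl k(1) l(1) z mcl r by (simp add: c'_def z'_def A.r_distr smult_mult_right A.m_assoc)
      let ?s = "r \<odot> (pev (c l) \<otimes> pth (w l) \<mu> \<otimes> z k)"
      have scl: "?s \<in> carrier A" using pcl l(1) k(1) z mcl r by simp
      have k'': "?t' k = ?t k \<oplus> \<ominus> ?s"
        unfolding k' using pcl l(1) k(1) z mcl r by (simp add: smult_l_minus)
      have cl': "?t' k \<in> carrier A" "?t' l \<in> carrier A"
        unfolding k'' l' using tcl k(1) l(1) scl by auto
      have split: "(\<Oplus>j\<in>J. h j) = h k \<oplus> (h l \<oplus> (\<Oplus>j\<in>R. h j))"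
        if "\<And>j. j \<in> J \<Longrightarrow> h j \<in> carrier A" for h
      proof -
        have "h \<in> R \<rightarrow> carrier A" using that subsetD[OF JR(5)] by auto
        moreover have "h k \<in> carrier A" "h l \<in> carrier A" using that k(1) l(1) by auto
        moreover have "h \<in> insert l R \<rightarrow> carrier A" using calculation by auto
        ultimately show ?thesis using JR(2-4) by (subst JR(1)) simp
      qed
      have cancel: "(a \<oplus> \<ominus> s) \<oplus> ((b \<oplus> s) \<oplus> q) = a \<oplus> (b \<oplus> q)"
        if abc: "a \<in> carrier A" "b \<in> carrier A" "s \<in> carrier A" "q \<in> carrier A" for a b s q
      proof -
        have "(a \<oplus> \<ominus> s) \<oplus> ((b \<oplus> s) \<oplus> q) = a \<oplus> (\<ominus> s \<oplus> (s \<oplus> (b \<oplus> q)))"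
          using abc by (simp add: M.a_assoc M.a_comm[of b s] del: M.r_neg1 M.r_neg2)
        also have "\<ominus> s \<oplus> (s \<oplus> (b \<oplus> q)) = b \<oplus> q" using abc by (simp add: M.r_neg1)
        finally show ?thesis .
      qed
      have tcl': "?t' j \<in> carrier A" if "j \<in> J" for j
        using that cl' tR_eq(2)[of j] by (cases "j = k"; cases "j = l") (simp_all add: R_def)
      have "(\<Oplus>j\<in>J. ?t' j) = ?t' k \<oplus> (?t' l \<oplus> (\<Oplus>j\<in>R. ?t' j))"
        by (rule split[of ?t', OF tcl'])
      also have "\<dots> = (?t k \<oplus> \<ominus> ?s) \<oplus> ((?t l \<oplus> ?s) \<oplus> (\<Oplus>j\<in>R. ?t j))"
        unfolding k'' l' R ..
      also have "\<dots> = ?t k \<oplus> (?t l \<oplus> (\<Oplus>j\<in>R. ?t j))"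
        by (rule cancel[OF tcl[OF k(1)] tcl[OF l(1)] scl Rcl])
      also have "\<dots> = (\<Oplus>j\<in>J. ?t j)"
        by (rule split[of ?t, OF tcl, symmetric])
      finally show "(\<Oplus>j\<in>J. pev (c' j) \<otimes> z' j) = f" using sum by simp
    qed
  qed
qed

end

text \<open>Multiplying \<open>a\<close> on the right by long paths \<open>\<gamma>\<close> gives
  polynomials \<open>a \<gamma>\<close>, which are fixed by \<open>f\<close> as \<open>a\<close>
  is, and \<open>a\<close> is recovered as the sum of the products \<open>(a \<gamma>)
  \<gamma>\<^sup>*\<close>.\<close>

lemma polynomial_generators:
  assumes "a \<in> tame m (verts E) z" "z \<in> verts E" "f \<in> carrier A" "f \<otimes> a = a"
  shows "a \<in> lin {q \<otimes> r | q r w. w \<in> verts E \<and> q \<in> polynomials (verts E) w \<and> f \<otimes> q = q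
    \<and> r \<in> carrier A \<and> P w \<otimes> r = r}"
    (is "a \<in> lin ?Y")
proof -
  have Y: "?Y \<subseteq> carrier A" using polynomials_closed by auto
  have poly: "a \<in> lin ?Y" if "a \<in> polynomials (verts E) z" "z \<in> verts E" "f \<otimes> a = a" for a z
  proof (rule lin_base[OF Y])
    show "a \<in> ?Y" using that polynomials_right[OF that(1,2)]
      by (intro CollectI exI[of _ a] exI[of _ "P z"] exI[of _ z]) auto
  qed
  show ?thesis using assms(1,2,4)
  proof (induct m arbitrary: a z)
    case 0
    then show ?case using poly by simp
  next
    case (Suc m)
    show ?case
    proof (cases "out_arcs E z = {}")
      case True
      then show ?thesis using poly Suc.prems by simp
    next
      case False
      have a: "a \<in> carrier A" "a \<otimes> P z = a" using tame_closed[OF Suc.prems(2,1)] by auto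
      have e: "(a \<otimes> S e) \<otimes> T e \<in> lin ?Y" if e: "e \<in> out_arcs E z" for e
      proof (rule lin_mult_right[OF Y Y])
        show "a \<otimes> S e \<in> lin ?Y"
          using Suc.prems False e a assms(3) by (intro Suc.hyps[of "a \<otimes> S e" "head E e"]) (auto simp: A.m_assoc[symmetric])
        show "T e \<in> carrier A" using e by auto
        fix s assume "s \<in> ?Y"
        then obtain q r w where s: "s = q \<otimes> r" "w \<in> verts E" "q \<in> polynomials (verts E) w" "f \<otimes> q = q"
          "r \<in> carrier A" "P w \<otimes> r = r" by blast
        have "q \<in> carrier A" using s(3) polynomials_closed by blast
        then have "s \<otimes> T e = q \<otimes> (r \<otimes> T e)" using s e by (simp add: A.m_assoc)
        moreover have "r \<otimes> T e \<in> carrier A" "P w \<otimes> (r \<otimes> T e) = r \<otimes> T e" using s e by (auto simp: left_absorb)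
        ultimately have "s \<otimes> T e \<in> ?Y" using s by blast
        then show "s \<otimes> T e \<in> lin ?Y" by (rule lin_base[OF Y])
      qed
      have "a = (\<Oplus>e\<in>out_arcs E z. (a \<otimes> S e) \<otimes> T e)"
        using expand_right[OF a(1) Suc.prems(2) False] a(2) by simp
      moreover have "(\<Oplus>e\<in>out_arcs E z. (a \<otimes> S e) \<otimes> T e) \<in> lin ?Y"
        using e by (intro lin_finsum[OF Y]) auto
      ultimately show ?thesis by simp
    qed
  qed
qed

text \<open>The columns \<open>f p\<^sub>z\<close> are tame and are fixed by \<open>f\<close> on the left,
  so \<open>f\<close> is a sum of products \<open>q r\<close> with polynomials \<open>q = f
  q\<close>. These generate \<open>f A\<close> as a right ideal and are reduced to a frame.\<close>

theorem frame_of_idempotent: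
  assumes f: "f \<in> carrier A" "f \<otimes> f = f" and unit: "unit = \<one>"
  shows "\<exists>(J :: nat set) x y \<nu>. frame f J x y \<nu>"
proof -
  let ?Y = "{q \<otimes> r | q r w. w \<in> verts E \<and> q \<in> polynomials (verts E) w \<and> f \<otimes> q = q
    \<and> r \<in> carrier A \<and> P w \<otimes> r = r}"
  have Y: "?Y \<subseteq> carrier A" using polynomials_closed by auto
  have col: "f \<otimes> P z \<in> lin ?Y" if z: "z \<in> verts E" for z
  proof -
    have "f \<otimes> P z = (\<Oplus>u\<in>verts E. P u \<otimes> (f \<otimes> P z))"
      using f z unit by (intro corner_decomp) auto
    also have "\<dots> \<in> lin (path_pairs (verts E) z)"
    proof (rule lin_finsum[OF path_pairs_closed finite_verts])
      fix u assume u: "u \<in> verts E"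
      have "path_pairs {u} z \<subseteq> path_pairs (verts E) z" using u by (auto simp: path_pairs_def)
      then show "P u \<otimes> (f \<otimes> P z) \<in> lin (path_pairs (verts E) z)"
        using span[OF u z f(1)] lin_subset f u z by (simp add: A.m_assoc)
    qed
    finally obtain m where "f \<otimes> P z \<in> tame m (verts E) z" using span_tame z by blast
    then show ?thesis using z f by (intro polynomial_generators) (auto simp: A.m_assoc[symmetric])
  qed
  have "f = (\<Oplus>z\<in>verts E. f \<otimes> P z)" using f unit by (intro corner_decomp_right) auto
  also have "\<dots> \<in> lin ?Y" using col by (intro lin_finsum[OF Y]) auto
  finally obtain n :: nat and \<kappa> s where s: "\<And>i. i < n \<Longrightarrow> \<kappa> i \<in> carrier K \<and> s i \<in> ?Y"
    and fs: "f = (\<Oplus>i\<in>{..<n}. \<kappa> i \<odot> s i)"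
    using lin_finite_sum[OF _ Y] by blast
  have "\<exists>c r w. s i = pev c \<otimes> r \<and> w \<in> verts E \<and> c \<in> coeffs (verts E) w \<and> f \<otimes> pev c = pev c
      \<and> r \<in> carrier A \<and> P w \<otimes> r = r" if "i < n" for i
    using s[OF that] polynomial_coeffs by blast
  then obtain c r w where cr: "\<And>i. i < n \<Longrightarrow> s i = pev (c i) \<otimes> r i \<and> w i \<in> verts E
      \<and> c i \<in> coeffs (verts E) (w i) \<and> f \<otimes> pev (c i) = pev (c i) \<and> r i \<in> carrier A \<and> P (w i) \<otimes> r i = r i"
    by metis
  obtain code :: "'v \<times> 'e list \<Rightarrow> nat" where code: "inj_on code (verts E \<times> lists (arcs E))"
    "\<And>u v \<alpha> \<beta> \<mu>. code (v, \<beta>) < code (u, \<alpha>) \<Longrightarrow> code (v, \<beta> @ \<mu>) < code (u, \<alpha> @ \<mu>)"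
    using walk_code_exists by blast
  show ?thesis
  proof (rule frame_of_generators[OF code, where J = "{..<n}" and c = c and w = w and z = "\<lambda>i. \<kappa> i \<odot> r i"])
    have "pev (c i) \<otimes> (\<kappa> i \<odot> r i) = \<kappa> i \<odot> s i \<and> \<kappa> i \<odot> s i \<in> carrier A" if "i < n" for i
      using s[OF that] cr[OF that] pev_closed[of "c i"] by (auto simp: smult_mult_right)
    then show "(\<Oplus>i\<in>{..<n}. pev (c i) \<otimes> (\<kappa> i \<odot> r i)) = f"
      unfolding fs by (intro M.finsum_cong') auto
    show "P (w k) \<otimes> (\<kappa> k \<odot> r k) = \<kappa> k \<odot> r k" if "k \<in> {..<n}" for k
      using that s[of k] cr[of k] by (simp add: smult_mult_right)
  qed (use s cr f in auto)
qed

end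

section \<open>Matrix algebras\<close>

definition matrix_unit :: "('k, 'b, 'n) module_scheme \<Rightarrow> nat \<Rightarrow> nat \<Rightarrow> nat \<Rightarrow> 'b \<Rightarrow> nat \<times> nat \<Rightarrow> 'b" where
  "matrix_unit B n i j b = (\<lambda>p\<in>{..<n} \<times> {..<n}. if p = (i, j) then b else \<zero>\<^bsub>B\<^esub>)"

context unital_algebra begin

context fixes n :: nat begin

abbreviation (input) "Mat \<equiv> matrix_algebra n A"

lemma matrix_entry: "M \<in> carrier Mat \<Longrightarrow> i < n \<Longrightarrow> j < n \<Longrightarrow> M (i, j) \<in> carrier A"
  by (auto simp: matrix_algebra_def)

lemma matrix_sel:
  "i < n \<Longrightarrow> j < n \<Longrightarrow> (M \<otimes>\<^bsub>Mat\<^esub> N) (i, j) = (\<Oplus>\<^bsub>A\<^esub>k\<in>{..<n}. M (i, k) \<otimes>\<^bsub>A\<^esub> N (k, j))"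
  "i < n \<Longrightarrow> j < n \<Longrightarrow> \<one>\<^bsub>Mat\<^esub> (i, j) = (if i = j then \<one>\<^bsub>A\<^esub> else \<zero>\<^bsub>A\<^esub>)"
  "i < n \<Longrightarrow> j < n \<Longrightarrow> \<zero>\<^bsub>Mat\<^esub> (i, j) = \<zero>\<^bsub>A\<^esub>"
  "i < n \<Longrightarrow> j < n \<Longrightarrow> (M \<oplus>\<^bsub>Mat\<^esub> N) (i, j) = M (i, j) \<oplus>\<^bsub>A\<^esub> N (i, j)"
  "i < n \<Longrightarrow> j < n \<Longrightarrow> (c \<odot>\<^bsub>Mat\<^esub> M) (i, j) = c \<odot>\<^bsub>A\<^esub> M (i, j)"
  "i < n \<Longrightarrow> j < n \<Longrightarrow> matrix_unit A n p q b (i, j) = (if i = p \<and> j = q then b else \<zero>\<^bsub>A\<^esub>)"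
  by (simp_all add: matrix_algebra_def matrix_unit_def)

lemma matrixI:
  assumes "M \<in> extensional ({..<n} \<times> {..<n})" "\<And>i j. i < n \<Longrightarrow> j < n \<Longrightarrow> M (i, j) \<in> carrier A"
  shows "M \<in> carrier Mat"
  using assms by (auto simp: matrix_algebra_def PiE_def)

lemma matrix_ext:
  "M \<otimes>\<^bsub>Mat\<^esub> N \<in> extensional ({..<n} \<times> {..<n})" "\<one>\<^bsub>Mat\<^esub> \<in> extensional ({..<n} \<times> {..<n})"
  "\<zero>\<^bsub>Mat\<^esub> \<in> extensional ({..<n} \<times> {..<n})" "M \<oplus>\<^bsub>Mat\<^esub> N \<in> extensional ({..<n} \<times> {..<n})"
  "c \<odot>\<^bsub>Mat\<^esub> M \<in> extensional ({..<n} \<times> {..<n})" "matrix_unit A n p q b \<in> extensional ({..<n} \<times> {..<n})"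
  by (simp_all add: matrix_algebra_def matrix_unit_def)

lemma matrix_eqI:
  assumes "M \<in> carrier Mat" "N \<in> carrier Mat" "\<And>i j. i < n \<Longrightarrow> j < n \<Longrightarrow> M (i, j) = N (i, j)"
  shows "M = N"
proof (rule extensionalityI[of M "{..<n} \<times> {..<n}"])
  show "M \<in> extensional ({..<n} \<times> {..<n})" "N \<in> extensional ({..<n} \<times> {..<n})"
    using assms(1,2) by (auto simp: matrix_algebra_def PiE_def)
qed (use assms(3) in auto)

lemma matrix_closed:
  "M \<in> carrier Mat \<Longrightarrow> N \<in> carrier Mat \<Longrightarrow> M \<otimes>\<^bsub>Mat\<^esub> N \<in> carrier Mat"
  "\<one>\<^bsub>Mat\<^esub> \<in> carrier Mat" "\<zero>\<^bsub>Mat\<^esub> \<in> carrier Mat"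
  "M \<in> carrier Mat \<Longrightarrow> N \<in> carrier Mat \<Longrightarrow> M \<oplus>\<^bsub>Mat\<^esub> N \<in> carrier Mat"
  "c \<in> carrier K \<Longrightarrow> M \<in> carrier Mat \<Longrightarrow> c \<odot>\<^bsub>Mat\<^esub> M \<in> carrier Mat"
  "b \<in> carrier A \<Longrightarrow> matrix_unit A n p q b \<in> carrier Mat"
  by (rule matrixI; simp add: matrix_ext matrix_sel matrix_entry M.finsum_closed')+

lemma matrix_unital_algebra: "unital_algebra K Mat"
proof -
  have grp: "abelian_group Mat"
  proof (rule abelian_groupI)
    fix M assume M: "M \<in> carrier Mat"
    let ?N = "(\<ominus> \<one>) \<odot>\<^bsub>Mat\<^esub> M"
    have "?N \<oplus>\<^bsub>Mat\<^esub> M = \<zero>\<^bsub>Mat\<^esub>"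
      using M by (intro matrix_eqI)
        (simp_all add: matrix_closed matrix_sel matrix_entry smult_l_minus M.l_neg)
    then show "\<exists>N\<in>carrier Mat. N \<oplus>\<^bsub>Mat\<^esub> M = \<zero>\<^bsub>Mat\<^esub>"
      using M matrix_closed(5)[of "\<ominus> \<one>" M] by auto
  qed (simp_all add: matrix_closed, (rule matrix_eqI; simp add: matrix_closed matrix_sel matrix_entry M.a_ac)+)
  have assoc: "(L \<otimes>\<^bsub>Mat\<^esub> M) \<otimes>\<^bsub>Mat\<^esub> N = L \<otimes>\<^bsub>Mat\<^esub> (M \<otimes>\<^bsub>Mat\<^esub> N)"
    if "L \<in> carrier Mat" "M \<in> carrier Mat" "N \<in> carrier Mat" for L M N
  proof (rule matrix_eqI)
    fix i j assume ij: "i < n" "j < n"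
    have e: "L (i, k) \<in> carrier A" "M (k, l) \<in> carrier A" "N (l, j) \<in> carrier A" if "k < n" "l < n" for k l
      using \<open>L \<in> carrier Mat\<close> \<open>M \<in> carrier Mat\<close> \<open>N \<in> carrier Mat\<close> ij that by (auto intro: matrix_entry)
    have "((L \<otimes>\<^bsub>Mat\<^esub> M) \<otimes>\<^bsub>Mat\<^esub> N) (i, j)
        = (\<Oplus>\<^bsub>A\<^esub>l\<in>{..<n}. (\<Oplus>\<^bsub>A\<^esub>k\<in>{..<n}. L (i, k) \<otimes>\<^bsub>A\<^esub> M (k, l)) \<otimes>\<^bsub>A\<^esub> N (l, j))"
      using ij e by (subst matrix_sel) (auto simp: matrix_sel intro!: M.finsum_cong' M.finsum_closed')
    also have "\<dots> = (\<Oplus>\<^bsub>A\<^esub>l\<in>{..<n}. \<Oplus>\<^bsub>A\<^esub>k\<in>{..<n}. L (i, k) \<otimes>\<^bsub>A\<^esub> M (k, l) \<otimes>\<^bsub>A\<^esub> N (l, j))"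
      using e by (intro M.finsum_cong') (auto intro!: A.finsum_ldistr M.finsum_closed')
    also have "\<dots> = (\<Oplus>\<^bsub>A\<^esub>k\<in>{..<n}. \<Oplus>\<^bsub>A\<^esub>l\<in>{..<n}. L (i, k) \<otimes>\<^bsub>A\<^esub> M (k, l) \<otimes>\<^bsub>A\<^esub> N (l, j))"
      using e by (intro M.finsum_swap) auto
    also have "\<dots> = (\<Oplus>\<^bsub>A\<^esub>k\<in>{..<n}. L (i, k) \<otimes>\<^bsub>A\<^esub> (\<Oplus>\<^bsub>A\<^esub>l\<in>{..<n}. M (k, l) \<otimes>\<^bsub>A\<^esub> N (l, j)))"
      using e by (intro M.finsum_cong')
        (auto simp: A.finsum_rdistr A.m_assoc intro!: M.finsum_closed' M.finsum_cong')
    also have "\<dots> = (L \<otimes>\<^bsub>Mat\<^esub> (M \<otimes>\<^bsub>Mat\<^esub> N)) (i, j)"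
      using ij e by (subst matrix_sel) (auto simp: matrix_sel intro!: M.finsum_cong' M.finsum_closed')
    finally show "((L \<otimes>\<^bsub>Mat\<^esub> M) \<otimes>\<^bsub>Mat\<^esub> N) (i, j) = (L \<otimes>\<^bsub>Mat\<^esub> (M \<otimes>\<^bsub>Mat\<^esub> N)) (i, j)" .
  qed (use that in \<open>simp_all add: matrix_closed\<close>)
  have one_l: "\<one>\<^bsub>Mat\<^esub> \<otimes>\<^bsub>Mat\<^esub> M = M" and one_r: "M \<otimes>\<^bsub>Mat\<^esub> \<one>\<^bsub>Mat\<^esub> = M" if M: "M \<in> carrier Mat" for M
  proof -
    show "\<one>\<^bsub>Mat\<^esub> \<otimes>\<^bsub>Mat\<^esub> M = M"
    proof (rule matrix_eqI)
      fix i j assume ij: "i < n" "j < n"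
      have "(\<Oplus>\<^bsub>A\<^esub>k\<in>{..<n}. \<one>\<^bsub>Mat\<^esub> (i, k) \<otimes>\<^bsub>A\<^esub> M (k, j)) = \<one>\<^bsub>Mat\<^esub> (i, i) \<otimes>\<^bsub>A\<^esub> M (i, j)"
        using ij M by (intro M.finsum_only) (auto simp: matrix_sel matrix_entry)
      then show "(\<one>\<^bsub>Mat\<^esub> \<otimes>\<^bsub>Mat\<^esub> M) (i, j) = M (i, j)" using ij M by (simp add: matrix_sel matrix_entry)
    qed (use M in \<open>simp_all add: matrix_closed\<close>)
    show "M \<otimes>\<^bsub>Mat\<^esub> \<one>\<^bsub>Mat\<^esub> = M"
    proof (rule matrix_eqI)
      fix i j assume ij: "i < n" "j < n"
      have "(\<Oplus>\<^bsub>A\<^esub>k\<in>{..<n}. M (i, k) \<otimes>\<^bsub>A\<^esub> \<one>\<^bsub>Mat\<^esub> (k, j)) = M (i, j) \<otimes>\<^bsub>A\<^esub> \<one>\<^bsub>Mat\<^esub> (j, j)"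
        using ij M by (intro M.finsum_only) (auto simp: matrix_sel matrix_entry)
      then show "(M \<otimes>\<^bsub>Mat\<^esub> \<one>\<^bsub>Mat\<^esub>) (i, j) = M (i, j)" using ij M by (simp add: matrix_sel matrix_entry)
    qed (use M in \<open>simp_all add: matrix_closed\<close>)
  qed
  have sum_eq: "(\<Oplus>\<^bsub>A\<^esub>k\<in>{..<n}. f k) = (\<Oplus>\<^bsub>A\<^esub>k\<in>{..<n}. g k) \<oplus>\<^bsub>A\<^esub> (\<Oplus>\<^bsub>A\<^esub>k\<in>{..<n}. h k)"
    if "\<And>k. k < n \<Longrightarrow> f k = g k \<oplus>\<^bsub>A\<^esub> h k" "\<And>k. k < n \<Longrightarrow> g k \<in> carrier A" "\<And>k. k < n \<Longrightarrow> h k \<in> carrier A"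
    for f g h
  proof -
    have "(\<Oplus>\<^bsub>A\<^esub>k\<in>{..<n}. f k) = (\<Oplus>\<^bsub>A\<^esub>k\<in>{..<n}. g k \<oplus>\<^bsub>A\<^esub> h k)"
      using that by (intro M.finsum_cong' Pi_I) auto
    also have "\<dots> = (\<Oplus>\<^bsub>A\<^esub>k\<in>{..<n}. g k) \<oplus>\<^bsub>A\<^esub> (\<Oplus>\<^bsub>A\<^esub>k\<in>{..<n}. h k)"
      using that by (intro M.finsum_addf Pi_I) auto
    finally show ?thesis .
  qed
  have "ring Mat"
  proof (rule ringI[OF grp])
    show "monoid Mat" using assoc one_l one_r by (intro monoidI) (simp_all add: matrix_closed)
  next
    fix L M N assume LMN: "L \<in> carrier Mat" "M \<in> carrier Mat" "N \<in> carrier Mat"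
    show "(L \<oplus>\<^bsub>Mat\<^esub> M) \<otimes>\<^bsub>Mat\<^esub> N = L \<otimes>\<^bsub>Mat\<^esub> N \<oplus>\<^bsub>Mat\<^esub> M \<otimes>\<^bsub>Mat\<^esub> N"
      using LMN by (intro matrix_eqI)
        (simp_all add: matrix_closed matrix_sel, intro sum_eq, simp_all add: matrix_sel matrix_entry A.l_distr)
    show "N \<otimes>\<^bsub>Mat\<^esub> (L \<oplus>\<^bsub>Mat\<^esub> M) = N \<otimes>\<^bsub>Mat\<^esub> L \<oplus>\<^bsub>Mat\<^esub> N \<otimes>\<^bsub>Mat\<^esub> M"
      using LMN by (intro matrix_eqI)
        (simp_all add: matrix_closed matrix_sel, intro sum_eq, simp_all add: matrix_sel matrix_entry A.r_distr)
  qed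
  moreover have "module K Mat"
    by (intro moduleI is_cring grp)
      (simp_all add: matrix_closed, (rule matrix_eqI; simp add: matrix_closed matrix_sel matrix_entry
        smult_l_distr smult_r_distr smult_assoc1)+)
  moreover have "(c \<odot>\<^bsub>Mat\<^esub> M) \<otimes>\<^bsub>Mat\<^esub> N = c \<odot>\<^bsub>Mat\<^esub> (M \<otimes>\<^bsub>Mat\<^esub> N) \<and>
      M \<otimes>\<^bsub>Mat\<^esub> (c \<odot>\<^bsub>Mat\<^esub> N) = c \<odot>\<^bsub>Mat\<^esub> (M \<otimes>\<^bsub>Mat\<^esub> N)"
    if "c \<in> carrier K" "M \<in> carrier Mat" "N \<in> carrier Mat" for c M N
  proof (intro conjI matrix_eqI)
    fix i j assume ij: "i < n" "j < n"
    have e: "M (i, k) \<in> carrier A" "N (k, j) \<in> carrier A" if "k < n" for k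
      using \<open>M \<in> carrier Mat\<close> \<open>N \<in> carrier Mat\<close> ij that by (auto intro: matrix_entry)
    have c: "c \<odot>\<^bsub>A\<^esub> (\<Oplus>\<^bsub>A\<^esub>k\<in>{..<n}. M (i, k) \<otimes>\<^bsub>A\<^esub> N (k, j)) = (\<Oplus>\<^bsub>A\<^esub>k\<in>{..<n}. c \<odot>\<^bsub>A\<^esub> (M (i, k) \<otimes>\<^bsub>A\<^esub> N (k, j)))"
      using that e by (intro finsum_smult_ldistr) auto
    show "((c \<odot>\<^bsub>Mat\<^esub> M) \<otimes>\<^bsub>Mat\<^esub> N) (i, j) = (c \<odot>\<^bsub>Mat\<^esub> (M \<otimes>\<^bsub>Mat\<^esub> N)) (i, j)"
      using ij e that by (simp add: matrix_sel c) (intro M.finsum_cong', auto simp: matrix_sel smult_mult_left)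
    show "(M \<otimes>\<^bsub>Mat\<^esub> (c \<odot>\<^bsub>Mat\<^esub> N)) (i, j) = (c \<odot>\<^bsub>Mat\<^esub> (M \<otimes>\<^bsub>Mat\<^esub> N)) (i, j)"
      using ij e that by (simp add: matrix_sel c) (intro M.finsum_cong', auto simp: matrix_sel smult_mult_right)
  qed (use that in \<open>simp_all add: matrix_closed\<close>)
  ultimately show ?thesis
    by (intro unital_algebra.intro) (auto simp: unital_algebra_axioms_def)
qed

lemma matrix_unit_mult:
  assumes "i < n" "j < n" "k < n" "l < n" "b \<in> carrier A" "c \<in> carrier A"
  shows "matrix_unit A n i j b \<otimes>\<^bsub>Mat\<^esub> matrix_unit A n k l c
    = (if j = k then matrix_unit A n i l (b \<otimes>\<^bsub>A\<^esub> c) else \<zero>\<^bsub>Mat\<^esub>)"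
proof (rule matrix_eqI)
  fix p q assume pq: "p < n" "q < n"
  have "(\<Oplus>\<^bsub>A\<^esub>m\<in>{..<n}. matrix_unit A n i j b (p, m) \<otimes>\<^bsub>A\<^esub> matrix_unit A n k l c (m, q))
      = matrix_unit A n i j b (p, j) \<otimes>\<^bsub>A\<^esub> matrix_unit A n k l c (j, q)"
    using assms pq by (intro M.finsum_only) (auto simp: matrix_sel)
  then show "(matrix_unit A n i j b \<otimes>\<^bsub>Mat\<^esub> matrix_unit A n k l c) (p, q)
    = (if j = k then matrix_unit A n i l (b \<otimes>\<^bsub>A\<^esub> c) else \<zero>\<^bsub>Mat\<^esub>) (p, q)"
    using assms pq by (auto simp: matrix_sel)
qed (use assms in \<open>auto simp: matrix_closed\<close>)

lemma matrix_unit_add: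
  "b \<in> carrier A \<Longrightarrow> c \<in> carrier A \<Longrightarrow> matrix_unit A n i j (b \<oplus>\<^bsub>A\<^esub> c)
    = matrix_unit A n i j b \<oplus>\<^bsub>Mat\<^esub> matrix_unit A n i j c"
  by (rule matrix_eqI) (auto simp: matrix_closed matrix_sel)

lemma matrix_unit_smult:
  "b \<in> carrier A \<Longrightarrow> c \<in> carrier K \<Longrightarrow> matrix_unit A n i j (c \<odot>\<^bsub>A\<^esub> b) = c \<odot>\<^bsub>Mat\<^esub> matrix_unit A n i j b"
  by (rule matrix_eqI) (auto simp: matrix_closed matrix_sel)

lemma matrix_unit_zero: "matrix_unit A n i j \<zero>\<^bsub>A\<^esub> = \<zero>\<^bsub>Mat\<^esub>"
  by (rule matrix_eqI) (auto simp: matrix_closed matrix_sel)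

lemma matrix_unit_finsum:
  assumes "finite I" "\<And>t. t \<in> I \<Longrightarrow> b t \<in> carrier A"
  shows "matrix_unit A n i j (\<Oplus>\<^bsub>A\<^esub>t\<in>I. b t) = (\<Oplus>\<^bsub>Mat\<^esub>t\<in>I. matrix_unit A n i j (b t))"
proof -
  interpret Mat: unital_algebra K Mat by (rule matrix_unital_algebra)
  show ?thesis using assms
  proof (induct I)
    case (insert t I)
    then have "b \<in> I \<rightarrow> carrier A" "(\<lambda>t. matrix_unit A n i j (b t)) \<in> I \<rightarrow> carrier Mat"
      by (auto simp: matrix_closed)
    then show ?case using insert by (simp add: matrix_unit_add matrix_closed)
  qed (simp add: matrix_unit_zero)
qed

lemma matrix_unit_sandwich:
  assumes "0 < n" "b \<in> carrier A" "c \<in> carrier A" "M \<in> carrier Mat"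
  shows "matrix_unit A n 0 0 b \<otimes>\<^bsub>Mat\<^esub> M \<otimes>\<^bsub>Mat\<^esub> matrix_unit A n 0 0 c
    = matrix_unit A n 0 0 (b \<otimes>\<^bsub>A\<^esub> M (0, 0) \<otimes>\<^bsub>A\<^esub> c)"
proof (rule matrix_eqI)
  have bM: "matrix_unit A n 0 0 b \<otimes>\<^bsub>Mat\<^esub> M \<in> carrier Mat" using assms by (simp add: matrix_closed)
  fix p q assume pq: "p < n" "q < n"
  have "(\<Oplus>\<^bsub>A\<^esub>m\<in>{..<n}. matrix_unit A n 0 0 b (p, m) \<otimes>\<^bsub>A\<^esub> M (m, 0))
      = matrix_unit A n 0 0 b (p, 0) \<otimes>\<^bsub>A\<^esub> M (0, 0)"
    using assms pq by (intro M.finsum_only) (auto simp: matrix_sel matrix_entry)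
  then have 1: "(matrix_unit A n 0 0 b \<otimes>\<^bsub>Mat\<^esub> M) (p, 0) = matrix_unit A n 0 0 b (p, 0) \<otimes>\<^bsub>A\<^esub> M (0, 0)"
    using assms pq by (simp add: matrix_sel)
  have "(\<Oplus>\<^bsub>A\<^esub>m\<in>{..<n}. (matrix_unit A n 0 0 b \<otimes>\<^bsub>Mat\<^esub> M) (p, m) \<otimes>\<^bsub>A\<^esub> matrix_unit A n 0 0 c (m, q))
      = (matrix_unit A n 0 0 b \<otimes>\<^bsub>Mat\<^esub> M) (p, 0) \<otimes>\<^bsub>A\<^esub> matrix_unit A n 0 0 c (0, q)"
    using assms pq matrix_entry[OF bM]
    by (intro M.finsum_only) (auto simp: matrix_sel(6))
  then show "(matrix_unit A n 0 0 b \<otimes>\<^bsub>Mat\<^esub> M \<otimes>\<^bsub>Mat\<^esub> matrix_unit A n 0 0 c) (p, q)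
      = matrix_unit A n 0 0 (b \<otimes>\<^bsub>A\<^esub> M (0, 0) \<otimes>\<^bsub>A\<^esub> c) (p, q)"
    using assms pq 1 by (auto simp: matrix_sel(1,6) matrix_entry)
qed (use assms in \<open>auto simp: matrix_closed matrix_entry\<close>)

end

end

context leavitt_system begin

lemma vertex_nonzero: assumes "v \<in> verts E" shows "P v \<noteq> \<zero>"
proof
  assume "P v = \<zero>"
  moreover have "finite {(v, [] :: 'e list)} \<and> {(v, [])} \<subseteq> {(v, \<mu>). \<exists>w. awalk v \<mu> w} \<and>
      (\<lambda>_. \<one>\<^bsub>K\<^esub>) \<in> {(v, [])} \<rightarrow> carrier K"
    using assms by (auto simp: awalk_Nil_iff)
  moreover have "(\<Oplus>i\<in>{(v, [])}. \<one>\<^bsub>K\<^esub> \<odot> (case i of (v, \<mu>) \<Rightarrow> pth v \<mu>)) = \<zero>"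
    using \<open>P v = \<zero>\<close> by simp
  ultimately have "\<one>\<^bsub>K\<^esub> = \<zero>\<^bsub>K\<^esub>"
    using indep unfolding lin_indep_def by blast
  then show False by simp
qed

text \<open>Makes the sum of the vertices the identity of the algebra.\<close>

lemma corner_system: "leavitt_system (corner A unit) K E g"
proof -
  let ?C = "corner A unit"
  note cC = corner_carrier[OF unit_closed unit_idem]
  have gC: "g x \<in> carrier ?C" if "x \<in> generators E" for x
    using that gen_unit unit_gen g_closed by (simp add: cC)
  then have C: "P v \<in> carrier ?C" "S e \<in> carrier ?C" "T e \<in> carrier ?C"
    if "v \<in> verts E" "e \<in> arcs E" for v e
    using that by (auto simp: generators_def)
  have Cl: "unital_algebra K ?C" by (rule corner_unital_algebra[OF unit_closed unit_idem])
  interpret C: unital_algebra K ?C by (rule Cl)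
  note sums = corner_finsum[OF unit_closed unit_idem]
  interpret F: leavitt_family ?C K E g
  proof unfold_locales
    fix v assume v: "v \<in> verts E" "out_arcs E v \<noteq> {}"
    have "S e \<otimes> T e \<in> carrier ?C" if "e \<in> out_arcs E v" for e
      using C.A.m_closed[OF C(2)[OF v(1)] C(3)[OF v(1)], of e e] that by (auto simp: corner_sel)
    moreover have "finite (out_arcs E v)" by (rule finite_subset[OF _ finite_arcs]) auto
    ultimately show "P v = (\<Oplus>\<^bsub>?C\<^esub>e\<in>out_arcs E v. S e \<otimes>\<^bsub>?C\<^esub> T e)"
      using cuntz_krieger[OF v] sums[of "out_arcs E v" "\<lambda>e. S e \<otimes> T e"] by (auto simp: corner_sel)
  qed (simp_all add: gC corner_sel vertex_vertex tail_edge edge_head head_ghost ghost_tail ghost_edge)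
  have pth: "F.pth u \<mu> = pth u \<mu>" for u \<mu>
    by (induct \<mu> arbitrary: u) (simp_all add: corner_sel)
  have gst: "F.gst u \<mu> = gst u \<mu>" for u \<mu>
    by (induct \<mu> arbitrary: u) (simp_all add: corner_sel)
  show ?thesis
  proof unfold_locales
    show "verts E \<noteq> {}" by (rule verts_nonempty)
    show "C.lin_indep (\<lambda>(v, \<mu>). F.pth v \<mu>) {(v, \<mu>). \<exists>w. awalk v \<mu> w}"
      unfolding C.lin_indep_def
    proof (intro allI impI, elim conjE)
      fix Y c
      assume Y: "finite Y" "Y \<subseteq> {(v, \<mu>). \<exists>w. awalk v \<mu> w}" "c \<in> Y \<rightarrow> carrier K"
        and sum: "(\<Oplus>\<^bsub>?C\<^esub>i\<in>Y. c i \<odot>\<^bsub>?C\<^esub> (case i of (v, \<mu>) \<Rightarrow> F.pth v \<mu>)) = \<zero>\<^bsub>?C\<^esub>"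
      have "c i \<odot>\<^bsub>?C\<^esub> (case i of (v, \<mu>) \<Rightarrow> F.pth v \<mu>) \<in> carrier ?C" if "i \<in> Y" for i
        using that Y(3) subsetD[OF Y(2) that] F.pth_closed by (auto intro!: C.smult_closed)
      then have "(\<Oplus>i\<in>Y. c i \<odot> (case i of (v, \<mu>) \<Rightarrow> pth v \<mu>)) = \<zero>"
        using sum sums[OF Y(1)] by (simp add: corner_sel pth)
      then show "\<forall>i\<in>Y. c i = \<zero>\<^bsub>K\<^esub>" using indep Y unfolding lin_indep_def by blast
    qed
  next
    fix u w a assume u: "u \<in> verts E" "w \<in> verts E" "a \<in> carrier ?C"
    then have "P u \<otimes> a \<otimes> P w \<in> lin (path_pairs {u} w)" by (intro span) (auto simp: cC)
    moreover have "F.path_pairs {u} w = path_pairs {u} w"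
      by (simp add: F.path_pairs_def path_pairs_def pth gst corner_sel)
    ultimately show "P u \<otimes>\<^bsub>?C\<^esub> a \<otimes>\<^bsub>?C\<^esub> P w \<in> C.lin (F.path_pairs {u} w)"
      by (simp add: corner_sel corner_lin[OF unit_closed unit_idem])
  qed
qed

lemma corner_system_unit: "leavitt_family.unit (corner A unit) E g = \<one>\<^bsub>corner A unit\<^esub>"
proof -
  interpret C: leavitt_system "corner A unit" K E g by (rule corner_system)
  show ?thesis
    unfolding C.unit_def using corner_finsum[OF unit_closed unit_idem finite_verts C.P_closed]
    by (simp add: corner_sel unit_def[symmetric])
qed

text \<open>The graph is placed in the upper left corner. The frame of the identity matrix is indexed by
  pairs of a row \<open>i\<close> and a vertex \<open>v\<close>, with the matrices that have the
  single entry \<open>p\<^sub>v\<close> in position \<open>(i, 0)\<close> and in position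
  \<open>(0, i)\<close>.\<close>

lemma matrix_system:
  assumes n: "0 < n" and unit: "unit = \<one>"
  shows "\<exists>g'. leavitt_system (matrix_algebra n A) K E g'
    \<and> (\<exists>(J :: nat set) x y \<nu>. leavitt_family.frame (matrix_algebra n A) E g' \<one>\<^bsub>matrix_algebra n A\<^esub> J x y \<nu> \<and> \<nu> ` J = verts E)"
proof -
  let ?M = "matrix_algebra n A"
  let ?\<iota> = "matrix_unit A n 0 0"
  let ?g = "\<lambda>x. ?\<iota> (g x)"
  interpret Mt: unital_algebra K ?M by (rule matrix_unital_algebra)
  have mult: "?\<iota> (a \<otimes> b) = ?\<iota> a \<otimes>\<^bsub>?M\<^esub> ?\<iota> b" if "a \<in> carrier A" "b \<in> carrier A" for a b
    using n that by (simp add: matrix_unit_mult)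
  interpret F: leavitt_family ?M K E ?g
  proof unfold_locales
    fix v assume v: "v \<in> verts E" "out_arcs E v \<noteq> {}"
    have "?g (Vertex v) = (\<Oplus>\<^bsub>?M\<^esub>e\<in>out_arcs E v. ?\<iota> (S e \<otimes> T e))"
      by (subst cuntz_krieger[OF v]) (auto intro!: matrix_unit_finsum)
    also have "\<dots> = (\<Oplus>\<^bsub>?M\<^esub>e\<in>out_arcs E v. ?g (Edge e) \<otimes>\<^bsub>?M\<^esub> ?g (Ghost e))"
      by (intro Mt.M.finsum_cong' Pi_I Mt.A.m_closed matrix_closed) (auto simp: mult)
    finally show "?g (Vertex v) = (\<Oplus>\<^bsub>?M\<^esub>e\<in>out_arcs E v. ?g (Edge e) \<otimes>\<^bsub>?M\<^esub> ?g (Ghost e))" .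
  qed (auto simp: mult[symmetric] matrix_closed g_closed vertex_vertex tail_edge edge_head head_ghost
      ghost_tail ghost_edge matrix_unit_zero)
  have pth: "F.pth u \<mu> = ?\<iota> (pth u \<mu>)" if "awalk u \<mu> w" for u \<mu> w
    using that
  proof (induct \<mu> arbitrary: u)
    case (Cons e \<mu>)
    then have "e \<in> arcs E" "awalk (head E e) \<mu> w" by (auto simp: awalk_Cons_iff)
    then show ?case using Cons.hyps pth_closed by (auto simp: mult)
  qed simp
  have gst: "F.gst u \<mu> = ?\<iota> (gst u \<mu>)" if "awalk u \<mu> w" for u \<mu> w
    using that
  proof (induct \<mu> arbitrary: u)
    case (Cons e \<mu>)
    then have "e \<in> arcs E" "awalk (head E e) \<mu> w" by (auto simp: awalk_Cons_iff)
    then show ?case using Cons.hyps gst_closed by (auto simp: mult)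
  qed simp
  have sys: "leavitt_system ?M K E ?g"
  proof unfold_locales
    show "verts E \<noteq> {}" by (rule verts_nonempty)
    show "Mt.lin_indep (\<lambda>(v, \<mu>). F.pth v \<mu>) {(v, \<mu>). \<exists>w. awalk v \<mu> w}"
      unfolding Mt.lin_indep_def
    proof (intro allI impI, elim conjE)
      fix Y c
      assume Y: "finite Y" "Y \<subseteq> {(v, \<mu>). \<exists>w. awalk v \<mu> w}" "c \<in> Y \<rightarrow> carrier K"
        and sum: "(\<Oplus>\<^bsub>?M\<^esub>i\<in>Y. c i \<odot>\<^bsub>?M\<^esub> (case i of (v, \<mu>) \<Rightarrow> F.pth v \<mu>)) = \<zero>\<^bsub>?M\<^esub>"
      have cl: "c i \<in> carrier K \<and> (case i of (v, \<mu>) \<Rightarrow> pth v \<mu>) \<in> carrier A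
          \<and> (case i of (v, \<mu>) \<Rightarrow> F.pth v \<mu>) = ?\<iota> (case i of (v, \<mu>) \<Rightarrow> pth v \<mu>)" if "i \<in> Y" for i
        using that Y(3) subsetD[OF Y(2) that] pth pth_closed by auto
      have "?\<iota> (\<Oplus>i\<in>Y. c i \<odot> (case i of (v, \<mu>) \<Rightarrow> pth v \<mu>))
          = (\<Oplus>\<^bsub>?M\<^esub>i\<in>Y. ?\<iota> (c i \<odot> (case i of (v, \<mu>) \<Rightarrow> pth v \<mu>)))"
        using cl Y(1) by (intro matrix_unit_finsum smult_closed) auto
      also have "\<dots> = (\<Oplus>\<^bsub>?M\<^esub>i\<in>Y. c i \<odot>\<^bsub>?M\<^esub> (case i of (v, \<mu>) \<Rightarrow> F.pth v \<mu>))"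
        using cl by (intro Mt.M.finsum_cong' Pi_I Mt.smult_closed) (simp_all add: matrix_unit_smult matrix_closed)
      finally have "?\<iota> (\<Oplus>i\<in>Y. c i \<odot> (case i of (v, \<mu>) \<Rightarrow> pth v \<mu>)) (0, 0) = \<zero>"
        using sum n by (simp add: matrix_sel)
      then have "(\<Oplus>i\<in>Y. c i \<odot> (case i of (v, \<mu>) \<Rightarrow> pth v \<mu>)) = \<zero>" using n by (simp add: matrix_sel)
      then show "\<forall>i\<in>Y. c i = \<zero>\<^bsub>K\<^esub>" using indep Y unfolding lin_indep_def by blast
    qed
  next
    fix u w a assume u: "u \<in> verts E" "w \<in> verts E" "a \<in> carrier ?M"
    have lift: "?\<iota> x \<in> Mt.lin (F.path_pairs {u} w)" if "x \<in> lin (path_pairs {u} w)" for x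
      using that
    proof induct
      case lin_zero
      then show ?case by (simp add: matrix_unit_zero Mt.lin_zero)
    next
      case (lin_step c s x)
      then obtain \<mu> \<nu> z where s: "s = pth u \<mu> \<otimes> gst w \<nu>" "awalk u \<mu> z" "awalk w \<nu> z"
        by (auto simp: path_pairs_def)
      have cl: "pth u \<mu> \<in> carrier A" "gst w \<nu> \<in> carrier A" "x \<in> carrier A"
        using s pth_closed gst_closed lin_closed[OF path_pairs_closed lin_step(3)] by auto
      have "?\<iota> s \<in> F.path_pairs {u} w"
        unfolding F.path_pairs_def using s cl by (intro CollectI exI[of _ u] exI[of _ \<mu>] exI[of _ \<nu>] exI[of _ z])
          (simp add: mult pth[OF s(2)] gst[OF s(3)])
      then have "c \<odot>\<^bsub>?M\<^esub> ?\<iota> s \<oplus>\<^bsub>?M\<^esub> ?\<iota> x \<in> Mt.lin (F.path_pairs {u} w)"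
        using lin_step by (intro Mt.lin_step)
      then show ?case using cl s lin_step by (simp add: matrix_unit_add matrix_unit_smult)
    qed
    have "P u \<otimes> a (0, 0) \<otimes> P w \<in> lin (path_pairs {u} w)"
      using u n by (intro span) (auto simp: matrix_entry)
    then show "?g (Vertex u) \<otimes>\<^bsub>?M\<^esub> a \<otimes>\<^bsub>?M\<^esub> ?g (Vertex w) \<in> Mt.lin (F.path_pairs {u} w)"
      using lift u n by (simp add: matrix_unit_sandwich)
  qed
  let ?J = "{..<n} \<times> verts E"
  let ?x = "\<lambda>p. matrix_unit A n (fst p) 0 (P (snd p))" and ?y = "\<lambda>p. matrix_unit A n 0 (fst p) (P (snd p))"
  have "F.frame \<one>\<^bsub>?M\<^esub> ?J ?x ?y snd"
    unfolding F.frame_def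
  proof (intro conjI ballI)
    show "finite ?J" by simp
    have term_cl: "matrix_unit A n i i (P v) \<in> carrier ?M" if "v \<in> verts E" for i v
      using that by (simp add: matrix_closed)
    have "(\<Oplus>\<^bsub>?M\<^esub>p\<in>?J. ?x p \<otimes>\<^bsub>?M\<^esub> ?y p) = (\<Oplus>\<^bsub>?M\<^esub>i\<in>{..<n}. \<Oplus>\<^bsub>?M\<^esub>v\<in>verts E. ?x (i, v) \<otimes>\<^bsub>?M\<^esub> ?y (i, v))"
      by (intro Mt.M.finsum_Sigma) (auto intro!: Mt.A.m_closed matrix_closed)
    also have "\<dots> = (\<Oplus>\<^bsub>?M\<^esub>i\<in>{..<n}. matrix_unit A n i i \<one>)"
    proof (intro Mt.M.finsum_cong' refl Pi_I)
      fix i assume i: "i \<in> {..<n}"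
      have "(\<Oplus>\<^bsub>?M\<^esub>v\<in>verts E. ?x (i, v) \<otimes>\<^bsub>?M\<^esub> ?y (i, v)) = (\<Oplus>\<^bsub>?M\<^esub>v\<in>verts E. matrix_unit A n i i (P v))"
        using i n term_cl by (intro Mt.M.finsum_cong' refl Pi_I) (simp_all add: matrix_unit_mult)
      also have "\<dots> = matrix_unit A n i i unit"
        unfolding unit_def by (rule matrix_unit_finsum[symmetric]) auto
      finally show "(\<Oplus>\<^bsub>?M\<^esub>v\<in>verts E. ?x (i, v) \<otimes>\<^bsub>?M\<^esub> ?y (i, v)) = matrix_unit A n i i \<one>" by (simp add: unit)
    qed (simp add: matrix_closed)
    also have "\<dots> = \<one>\<^bsub>?M\<^esub>"
    proof (rule matrix_eqI)
      have entry: "(\<Oplus>\<^bsub>?M\<^esub>i\<in>I. matrix_unit A n i i \<one>) (p, q) = (\<Oplus>i\<in>I. matrix_unit A n i i \<one> (p, q))"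
        if "p < n" "q < n" "finite I" for p q I
        using that(3)
      proof induct
        case (insert i I)
        have "(\<lambda>i. matrix_unit A n i i \<one>) \<in> I \<rightarrow> carrier ?M" by (simp add: matrix_closed)
        moreover have "(\<lambda>i. matrix_unit A n i i \<one> (p, q)) \<in> I \<rightarrow> carrier A" using that by (simp add: matrix_sel)
        ultimately show ?case using insert that by (simp add: matrix_closed matrix_sel)
      qed (use that in \<open>simp add: matrix_sel\<close>)
      fix p q assume pq: "p < n" "q < n"
      have "(\<Oplus>i\<in>{..<n}. matrix_unit A n i i \<one> (p, q)) = matrix_unit A n p p \<one> (p, q)"
        using pq by (intro M.finsum_only[of "{..<n}" p "\<lambda>i. matrix_unit A n i i \<one> (p, q)"]) (auto simp: matrix_sel)
      then show "(\<Oplus>\<^bsub>?M\<^esub>i\<in>{..<n}. matrix_unit A n i i \<one>) (p, q) = \<one>\<^bsub>?M\<^esub> (p, q)"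
        using entry[OF pq, of "{..<n}"] pq by (auto simp: matrix_sel)
    qed (auto simp: matrix_closed intro!: Mt.M.finsum_closed')
    finally show "(\<Oplus>\<^bsub>?M\<^esub>p\<in>?J. ?x p \<otimes>\<^bsub>?M\<^esub> ?y p) = \<one>\<^bsub>?M\<^esub>" .
  qed (use n in \<open>auto simp: matrix_closed matrix_unit_mult vertex_vertex matrix_unit_zero\<close>)
  moreover have "snd ` ?J = verts E" using n by force
  ultimately show ?thesis using sys F.frame_nat[of "\<one>\<^bsub>?M\<^esub>" ?J ?x ?y snd] by metis
qed

end

section \<open>Invariance under Morita equivalence\<close>

lemma alg_iso_sym:
  assumes "unital_algebra K A" "\<phi> \<in> alg_iso K A B"
  shows "inv_into (carrier A) \<phi> \<in> alg_iso K B A"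
proof -
  interpret unital_algebra K A by (rule assms(1))
  let ?\<psi> = "inv_into (carrier A) \<phi>"
  have \<phi>: "\<phi> \<in> ring_iso A B" "\<And>a x. a \<in> carrier K \<Longrightarrow> x \<in> carrier A \<Longrightarrow> \<phi> (a \<odot>\<^bsub>A\<^esub> x) = a \<odot>\<^bsub>B\<^esub> \<phi> x"
    using assms(2) by (auto simp: alg_iso_def)
  then have bij: "bij_betw \<phi> (carrier A) (carrier B)" by (simp add: ring_iso_def)
  have "?\<psi> (a \<odot>\<^bsub>B\<^esub> z) = a \<odot>\<^bsub>A\<^esub> ?\<psi> z" if a: "a \<in> carrier K" and z: "z \<in> carrier B" for a z
  proof -
    have inv: "?\<psi> z \<in> carrier A" "\<phi> (?\<psi> z) = z"
      using bij z by (auto simp: bij_betw_def intro: inv_into_into f_inv_into_f)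
    then have "a \<odot>\<^bsub>B\<^esub> z = \<phi> (a \<odot>\<^bsub>A\<^esub> ?\<psi> z)" using \<phi>(2)[OF a inv(1)] by simp
    then show ?thesis
      using bij inv(1) a by (simp add: bij_betw_def inv_into_f_f)
  qed
  moreover have "?\<psi> \<in> ring_iso B A" using ring_iso_set_sym[OF A.ring_axioms \<phi>(1)] .
  ultimately show ?thesis by (simp add: alg_iso_def)
qed

lemma alg_iso_trans:
  assumes "\<phi> \<in> alg_iso K A B" "\<psi> \<in> alg_iso K B C"
  shows "\<psi> \<circ> \<phi> \<in> alg_iso K A C"
proof -
  have "\<psi> \<circ> \<phi> \<in> ring_iso A C"
    using assms ring_iso_set_trans[of \<phi> A B \<psi> C] by (simp add: alg_iso_def)
  moreover have "\<phi> x \<in> carrier B" if "x \<in> carrier A" for x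
    using assms(1) that by (auto simp: alg_iso_def ring_iso_def ring_hom_def)
  ultimately show ?thesis using assms by (simp add: alg_iso_def)
qed

text \<open>The idempotent gets a frame, the graph is changed until the frame has full support, and then
  once more until the vertices add up to \<open>f\<close>.\<close>

lemma corner_is_leavitt_path_algebra:
  fixes E :: "(nat, nat) pre_digraph"
  assumes sys: "leavitt_system A K E g" and unit: "leavitt_family.unit A E g = \<one>\<^bsub>A\<^esub>"
    and f: "f \<in> carrier A" "f \<otimes>\<^bsub>A\<^esub> f = f" "f \<noteq> \<zero>\<^bsub>A\<^esub>"
  shows "\<exists>G :: (nat, nat) pre_digraph. finite_graph G
    \<and> is_alg_iso K (leavitt_path_algebra K G) (corner A f)"
proof -
  interpret A: leavitt_system A K E g by (rule sys)
  obtain J :: "nat set" and x y \<nu> where fr: "A.frame f J x y \<nu>"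
    using A.frame_of_idempotent[OF f(1,2) unit] by blast
  have "J \<noteq> {}" using A.frameD(8)[OF fr] f(3) by auto
  then obtain E' :: "(nat, nat) pre_digraph" and g' J' x' y' \<nu>'
    where sys': "leavitt_system A K E' g'" and fr': "leavitt_family.frame A E' g' f (J' :: nat set) x' y' \<nu>'"
      and J': "\<nu>' ` J' = verts E'"
    using reduce_to_full_frame[OF sys fr] by blast
  obtain G :: "(nat, nat) pre_digraph" and h
    where G: "leavitt_system A K G h" "leavitt_family.unit A G h = f"
    using leavitt_system.system_of_full_frame[OF sys' fr' J'] by blast
  interpret G: leavitt_system A K G h by (rule G(1))
  interpret P: leavitt_presentation K G ..
  have "is_alg_iso K (leavitt_path_algebra K G) (corner A f)"
    using P.leavitt_system_corner_iso[OF G(1)] G(2) by (auto simp: is_alg_iso_def)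
  moreover have "finite_graph G"
    using G.verts_nonempty G.fin_digraph_axioms by (simp add: finite_graph_def)
  ultimately show ?thesis by blast
qed

theorem corollary3p16:
  fixes K :: "('k, 'r) ring_scheme"
    and A :: "('k, 'a, 'm) module_scheme"
    and E :: "('v, 'e) pre_digraph"
  assumes "field K"
    and "unital_algebra K A"
    and "finite_graph E"
    and "morita_equivalent K A (leavitt_path_algebra K E)"
  shows "\<exists>G :: (nat, nat) pre_digraph.
    finite_graph G \<and> is_alg_iso K A (leavitt_path_algebra K G)"
proof -
  let ?L = "leavitt_path_algebra K E"
  interpret E: leavitt_presentation K E
    using assms(1,3) by (simp add: leavitt_presentation_def finite_graph_def)
  have "verts E \<noteq> {}" using assms(3) by (simp add: finite_graph_def)
  then interpret Q: leavitt_system E.Q K E E.canon by (rule E.canonical_system)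
  interpret L: leavitt_system ?L K E E.canon
    unfolding E.leavitt_path_algebra_corner by (rule Q.corner_system)
  have L_unit: "L.unit = \<one>\<^bsub>?L\<^esub>"
    using Q.corner_system_unit unfolding E.leavitt_path_algebra_corner .
  obtain n f \<phi> where n: "0 < n" and full: "full_idempotent (matrix_algebra n ?L) f"
    and \<phi>: "\<phi> \<in> alg_iso K A (corner (matrix_algebra n ?L) f)"
    using assms(4) by (auto simp: morita_equivalent_def is_alg_iso_def)
  let ?M = "matrix_algebra n ?L"
  obtain g J x y \<nu> where g: "leavitt_system ?M K E g"
    and fr: "leavitt_family.frame ?M E g \<one>\<^bsub>?M\<^esub> (J :: nat set) x y \<nu>" and J: "\<nu> ` J = verts E"
    using L.matrix_system[OF n L_unit] by blast
  interpret M: leavitt_system ?M K E g by (rule g)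
  have f: "f \<in> carrier ?M" "f \<otimes>\<^bsub>?M\<^esub> f = f" using full by (auto simp: full_idempotent_def)
  have f0: "f \<noteq> \<zero>\<^bsub>?M\<^esub>"
  proof
    assume f0: "f = \<zero>\<^bsub>?M\<^esub>"
    \<comment> \<open>fullness would make the whole matrix algebra zero\<close>
    obtain v where v: "v \<in> verts E" using \<open>verts E \<noteq> {}\<close> by blast
    have "g (Vertex v) \<in> carrier ?M" using v by simp
    then obtain m p q where pq: "p \<in> {..<m::nat} \<rightarrow> carrier ?M" "q \<in> {..<m} \<rightarrow> carrier ?M"
      and sum: "g (Vertex v) = (\<Oplus>\<^bsub>?M\<^esub>i\<in>{..<m}. p i \<otimes>\<^bsub>?M\<^esub> f \<otimes>\<^bsub>?M\<^esub> q i)"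
      using full unfolding full_idempotent_def by blast
    have "(\<Oplus>\<^bsub>?M\<^esub>i\<in>{..<m}. p i \<otimes>\<^bsub>?M\<^esub> f \<otimes>\<^bsub>?M\<^esub> q i) = \<zero>\<^bsub>?M\<^esub>"
      using pq unfolding f0 by (intro M.M.finsum_neutral) (auto simp: Pi_iff)
    then show False using M.vertex_nonzero[OF v] sum by simp
  qed
  \<comment> \<open>a graph whose vertices add up to the identity matrix, in place of the copy of \<open>E\<close> in the upper left corner\<close>
  obtain G0 :: "(nat, nat) pre_digraph" and g0
    where G0: "leavitt_system ?M K G0 g0" "leavitt_family.unit ?M G0 g0 = \<one>\<^bsub>?M\<^esub>"
    using M.system_of_full_frame[OF fr J] by blast
  obtain G :: "(nat, nat) pre_digraph" and \<psi>
    where G: "finite_graph G" and \<psi>: "\<psi> \<in> alg_iso K (leavitt_path_algebra K G) (corner ?M f)"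
    using corner_is_leavitt_path_algebra[OF G0 f f0] by (auto simp: is_alg_iso_def)
  interpret G: leavitt_presentation K G
    using assms(1) G by (simp add: leavitt_presentation_def finite_graph_def)
  have "unital_algebra K (leavitt_path_algebra K G)"
    unfolding G.leavitt_path_algebra_corner
    using G.Q.corner_unital_algebra[OF G.Q.unit_closed G.Q.unit_idem] .
  then have "inv_into (carrier (leavitt_path_algebra K G)) \<psi> \<circ> \<phi> \<in> alg_iso K A (leavitt_path_algebra K G)"
    using alg_iso_trans[OF \<phi> alg_iso_sym] \<psi> by blast
  then show ?thesis using G unfolding is_alg_iso_def by blast
qed


end
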